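(* Let $\Lambda$ be a finite-dimensional algebra over a field $k$ with $E=\Lambda/\operatorname{rad}\Lambda$ separable over $k$. Then $$\dim_k\bigoplus_{n\ge1}\tau_n\Lambda<\infty\quad\Longleftrightarrow\quad \operatorname{gl.dim}\Lambda<\infty,$$ and in that case, for $n\ge1$, $\tau_n\Lambda=0$ exactly when $n>\operatorname{gl.dim}\Lambda$.
   Context: $\Lambda^{\mathrm e}=\Lambda\otimes_k\Lambda^{\mathrm{op}}$; $\Lambda$-bimodules are identified with left $\Lambda^{\mathrm e}$-modules. $\tau=\mathsf{D}\operatorname{Tr}$ (with $\mathsf{D}=\operatorname{Hom}_k(-,k)$) is the Auslander--Reiten translate of $\operatorname{mod}\Lambda^{\mathrm e}$, $\Omega$ is the syzygy over $\Lambda^{\mathrm e}$ with respect to minimal projective covers, and $\tau_n=\tau\Omega^{n-1}$ for $n\ge1$, applied to the regular bimodule $\Lambda$. *)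

theory Defs
  imports "HOL-Library.Extended_Nat" "HOL-Algebra.QuotRing" "HOL-Algebra.Module"
begin

section \<open>Left modules over a not necessarily commutative ring\<close>

text \<open>
  The library locale \<open>module\<close> requires a commutative ring of scalars; the following is the same
  notion over an arbitrary ring.  Modules are kept in the library record \<open>module\<close>, which extends
  the ring record, so a module which is not an algebra carries two meaningless fields \<open>mult\<close> and
  \<open>one\<close>; nothing below depends on them.  Submodules are given by the library locale \<open>submodule\<close>
  (which does not need commutativity), and a submodule \<open>U\<close> of \<open>M\<close> regarded as a module in its own
  right is \<open>M\<lparr>carrier := U\<rparr>\<close>.
\<close>

locale left_module = R?: ring R + M?: abelian_group M
  for R :: "('a, 'c) ring_scheme" (structure) and M :: "('a, 'b) module" (structure) +
  assumes smult_closed: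
      "\<lbrakk>a \<in> carrier R; x \<in> carrier M\<rbrakk> \<Longrightarrow> a \<odot>\<^bsub>M\<^esub> x \<in> carrier M"
    and smult_l_distr:
      "\<lbrakk>a \<in> carrier R; b \<in> carrier R; x \<in> carrier M\<rbrakk> \<Longrightarrow>
       (a \<oplus>\<^bsub>R\<^esub> b) \<odot>\<^bsub>M\<^esub> x = a \<odot>\<^bsub>M\<^esub> x \<oplus>\<^bsub>M\<^esub> b \<odot>\<^bsub>M\<^esub> x"
    and smult_r_distr:
      "\<lbrakk>a \<in> carrier R; x \<in> carrier M; y \<in> carrier M\<rbrakk> \<Longrightarrow>
       a \<odot>\<^bsub>M\<^esub> (x \<oplus>\<^bsub>M\<^esub> y) = a \<odot>\<^bsub>M\<^esub> x \<oplus>\<^bsub>M\<^esub> a \<odot>\<^bsub>M\<^esub> y"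
    and smult_assoc1:
      "\<lbrakk>a \<in> carrier R; b \<in> carrier R; x \<in> carrier M\<rbrakk> \<Longrightarrow>
       (a \<otimes>\<^bsub>R\<^esub> b) \<odot>\<^bsub>M\<^esub> x = a \<odot>\<^bsub>M\<^esub> (b \<odot>\<^bsub>M\<^esub> x)"
    and smult_one:
      "x \<in> carrier M \<Longrightarrow> \<one>\<^bsub>R\<^esub> \<odot>\<^bsub>M\<^esub> x = x"

definition mod_hom ::
  "('r, 'x) ring_scheme \<Rightarrow> ('r, 'm) module \<Rightarrow> ('r, 'n) module \<Rightarrow> ('m \<Rightarrow> 'n) set" where
  "mod_hom R M N = {f \<in> carrier M \<rightarrow> carrier N.
     (\<forall>x\<in>carrier M. \<forall>y\<in>carrier M. f (x \<oplus>\<^bsub>M\<^esub> y) = f x \<oplus>\<^bsub>N\<^esub> f y) \<and>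
     (\<forall>r\<in>carrier R. \<forall>x\<in>carrier M. f (r \<odot>\<^bsub>M\<^esub> x) = r \<odot>\<^bsub>N\<^esub> f x)}"

definition mod_span :: "('r, 'x) ring_scheme \<Rightarrow> ('r, 'm) module \<Rightarrow> 'm set \<Rightarrow> 'm set" where
  "mod_span R M S = \<Inter>{U. submodule U R M \<and> S \<subseteq> U}"

definition fin_gen :: "('r, 'x) ring_scheme \<Rightarrow> ('r, 'm) module \<Rightarrow> bool" where
  "fin_gen R M \<longleftrightarrow> (\<exists>S. finite S \<and> S \<subseteq> carrier M \<and> mod_span R M S = carrier M)"

text \<open>
  The quotient reuses the library's \<open>FactRing\<close>, adding the induced scalar multiplication.  It serves
  both for the quotient of a module by a submodule (where \<open>mult\<close> and \<open>one\<close> are irrelevant) and for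
  the quotient of an algebra by a two-sided ideal.
\<close>

definition quot_mod :: "('r, 'm) module \<Rightarrow> 'm set \<Rightarrow> ('r, 'm set) module" where
  "quot_mod M U = ring.extend (M Quot U)
     (module.fields (\<lambda>r C. \<Union>x\<in>C. U +>\<^bsub>M\<^esub> (r \<odot>\<^bsub>M\<^esub> x)))"

definition regular_module :: "('r, 'x) ring_scheme \<Rightarrow> ('r, 'r) module" where
  "regular_module R = ring.extend (ring.truncate R) (module.fields (\<lambda>r x. r \<otimes>\<^bsub>R\<^esub> x))"

definition direct_sum :: "'i set \<Rightarrow> ('i \<Rightarrow> ('r, 'm) module) \<Rightarrow> ('r, 'i \<Rightarrow> 'm) module" where
  "direct_sum I M =
     \<lparr>carrier = {x \<in> (\<Pi>\<^sub>E i\<in>I. carrier (M i)). finite {i \<in> I. x i \<noteq> \<zero>\<^bsub>M i\<^esub>}},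
      mult = undefined, one = undefined,
      zero = (\<lambda>i\<in>I. \<zero>\<^bsub>M i\<^esub>),
      add = (\<lambda>x y. \<lambda>i\<in>I. x i \<oplus>\<^bsub>M i\<^esub> y i),
      smult = (\<lambda>r x. \<lambda>i\<in>I. r \<odot>\<^bsub>M i\<^esub> x i)\<rparr>"

definition free_module :: "('r, 'x) ring_scheme \<Rightarrow> 'i set \<Rightarrow> ('r, 'i \<Rightarrow> 'r) module" where
  "free_module R X = direct_sum X (\<lambda>_. regular_module R)"

text \<open>
  \<open>P\<close> is projective if it is (isomorphic to) a direct summand of a free module.  It is no restriction
  to index the free module by a set \<open>X\<close> of the type that carries \<open>P\<close>: if \<open>P\<close> is a direct summand of
  any free module at all, then the canonical map from the free module on the set \<open>carrier P\<close> onto \<open>P\<close>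
  splits.
\<close>

definition projective :: "('r, 'x) ring_scheme \<Rightarrow> ('r, 'm) module \<Rightarrow> bool" where
  "projective R P \<longleftrightarrow> left_module R P \<and>
     (\<exists>X :: 'm set. \<exists>i \<in> mod_hom R P (free_module R X). \<exists>q \<in> mod_hom R (free_module R X) P.
        \<forall>x\<in>carrier P. q (i x) = x)"


section \<open>Projective and global dimension\<close>

text \<open>
  Every finitely generated \<open>R\<close>-module is a quotient of some \<open>R\<^sup>n\<close>, hence isomorphic to a module whose
  carrier consists of elements of type \<open>nat \<Rightarrow> 'r\<close>.  The modules with carrier in this type therefore
  represent all isomorphism classes of finitely generated \<open>R\<close>-modules, and the quantifiers over
  finitely generated modules below range over them.
\<close>

definition proj_resolution ::
  "('r, 'x) ring_scheme \<Rightarrow> ('r, 'm) module \<Rightarrow> (nat \<Rightarrow> ('r, nat \<Rightarrow> 'r) module) \<Rightarrow>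
   (nat \<Rightarrow> (nat \<Rightarrow> 'r) \<Rightarrow> (nat \<Rightarrow> 'r)) \<Rightarrow> ((nat \<Rightarrow> 'r) \<Rightarrow> 'm) \<Rightarrow> bool" where
  "proj_resolution R M P d e \<longleftrightarrow>
     (\<forall>i. projective R (P i) \<and> fin_gen R (P i)) \<and>
     (\<forall>i. d i \<in> mod_hom R (P (Suc i)) (P i)) \<and>
     e \<in> mod_hom R (P 0) M \<and>
     e ` carrier (P 0) = carrier M \<and>
     d 0 ` carrier (P 1) = a_kernel (P 0) M e \<and>
     (\<forall>i. d (Suc i) ` carrier (P (Suc (Suc i))) = a_kernel (P (Suc i)) (P i) (d i))"

definition proj_dim :: "('r, 'x) ring_scheme \<Rightarrow> ('r, 'm) module \<Rightarrow> enat" where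
  "proj_dim R M = Inf {enat n | n.
     \<exists>P d e. proj_resolution R M P d e \<and> (\<forall>i>n. carrier (P i) = {\<zero>\<^bsub>P i\<^esub>})}"

definition gl_dim :: "('r, 'x) ring_scheme \<Rightarrow> enat" where
  "gl_dim R = Sup {proj_dim R M | M :: ('r, nat \<Rightarrow> 'r) module. left_module R M \<and> fin_gen R M}"


section \<open>Syzygies and transpose\<close>

definition is_proj_cover ::
  "('r, 'x) ring_scheme \<Rightarrow> ('r, 'm) module \<Rightarrow> ('r, 'p) module \<Rightarrow> ('p \<Rightarrow> 'm) \<Rightarrow> bool" where
  "is_proj_cover R M P p \<longleftrightarrow>
     projective R P \<and> p \<in> mod_hom R P M \<and> p ` carrier P = carrier M \<and>
     (\<forall>U. submodule U R P \<and> p ` U = carrier M \<longrightarrow> U = carrier P)"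

text \<open>
  A choice of a projective cover for every module that has one; the projective cover of a finitely
  generated module is finitely generated, so the carrier type \<open>nat \<Rightarrow> 'r\<close> suffices.
\<close>

definition proj_cover ::
  "('r, 'x) ring_scheme \<Rightarrow> ('r, 'm) module \<Rightarrow> ('r, nat \<Rightarrow> 'r) module \<times> ((nat \<Rightarrow> 'r) \<Rightarrow> 'm)" where
  "proj_cover R M = (SOME (P, p). is_proj_cover R M P p)"

definition syzygy :: "('r, 'x) ring_scheme \<Rightarrow> ('r, 'm) module \<Rightarrow> ('r, nat \<Rightarrow> 'r) module" where
  "syzygy R M = (let (P, p) = proj_cover R M in P\<lparr>carrier := a_kernel P M p\<rparr>)"

definition opp :: "('k, 'r) module \<Rightarrow> ('k, 'r) module" where
  "opp R = R\<lparr>mult := (\<lambda>x y. y \<otimes>\<^bsub>R\<^esub> x)\<rparr>"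

text \<open>
  \<open>Hom\<^sub>R(M, R)\<close>; its right \<open>R\<close>-module structure \<open>(f \<cdot> r)(x) = f(x) r\<close> is a left module structure
  over \<open>opp R\<close>.
\<close>

definition ring_dual :: "('r, 'x) ring_scheme \<Rightarrow> ('r, 'm) module \<Rightarrow> ('r, 'm \<Rightarrow> 'r) module" where
  "ring_dual R M =
     \<lparr>carrier = mod_hom R M (regular_module R) \<inter> extensional (carrier M),
      mult = undefined, one = undefined,
      zero = (\<lambda>x\<in>carrier M. \<zero>\<^bsub>R\<^esub>),
      add = (\<lambda>f g. \<lambda>x\<in>carrier M. f x \<oplus>\<^bsub>R\<^esub> g x),
      smult = (\<lambda>r f. \<lambda>x\<in>carrier M. f x \<otimes>\<^bsub>R\<^esub> r)\<rparr>"

text \<open>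
  With the minimal projective presentation \<open>P1 \<rightarrow> P0 \<rightarrow> M \<rightarrow> 0\<close>, where \<open>P1\<close> is the projective cover of
  the syzygy of \<open>M\<close> inside \<open>P0\<close>, the transpose is the cokernel of
  \<open>Hom\<^sub>R(P0, R) \<rightarrow> Hom\<^sub>R(P1, R)\<close>, again a left module over \<open>opp R\<close>.
\<close>

definition transpose ::
  "('r, 'x) ring_scheme \<Rightarrow> ('r, 'm) module \<Rightarrow> ('r, ((nat \<Rightarrow> 'r) \<Rightarrow> 'r) set) module" where
  "transpose R M =
     (let (P0, p0) = proj_cover R M;
          (P1, p1) = proj_cover R (syzygy R M)
      in quot_mod (ring_dual R P1)
           ((\<lambda>f. \<lambda>x\<in>carrier P1. f (p1 x)) ` carrier (ring_dual R P0)))"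


section \<open>Algebras over a field\<close>

text \<open>
  Associative unital algebras; the library locale \<open>algebra\<close> covers commutative algebras only.
\<close>

locale assoc_algebra = module K A + A?: ring A
  for K :: "('k, 'c) ring_scheme" (structure) and A :: "('k, 'a) module" (structure) +
  assumes smult_mult_left:
      "\<lbrakk>c \<in> carrier K; x \<in> carrier A; y \<in> carrier A\<rbrakk> \<Longrightarrow>
       (c \<odot>\<^bsub>A\<^esub> x) \<otimes>\<^bsub>A\<^esub> y = c \<odot>\<^bsub>A\<^esub> (x \<otimes>\<^bsub>A\<^esub> y)"
    and smult_mult_right:
      "\<lbrakk>c \<in> carrier K; x \<in> carrier A; y \<in> carrier A\<rbrakk> \<Longrightarrow>
       x \<otimes>\<^bsub>A\<^esub> (c \<odot>\<^bsub>A\<^esub> y) = c \<odot>\<^bsub>A\<^esub> (x \<otimes>\<^bsub>A\<^esub> y)"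

definition is_basis :: "('k, 'x) ring_scheme \<Rightarrow> ('k, 'v) module \<Rightarrow> 'v set \<Rightarrow> bool" where
  "is_basis K V B \<longleftrightarrow> B \<subseteq> carrier V \<and> mod_span K V B = carrier V \<and>
     (\<forall>b\<in>B. b \<notin> mod_span K V (B - {b}))"

definition vdim :: "('k, 'x) ring_scheme \<Rightarrow> ('k, 'v) module \<Rightarrow> enat" where
  "vdim K V = (if \<exists>B. finite B \<and> is_basis K V B
               then enat (card (SOME B. finite B \<and> is_basis K V B)) else \<infinity>)"

text \<open>An \<open>A\<close>-module as a vector space over the ground field.\<close>

definition scalar_restr :: "('k, 'a) module \<Rightarrow> ('a, 'm) module \<Rightarrow> ('k, 'm) module" where
  "scalar_restr A M = ring.extend (ring.truncate M)
     (module.fields (\<lambda>c x. (c \<odot>\<^bsub>A\<^esub> \<one>\<^bsub>A\<^esub>) \<odot>\<^bsub>M\<^esub> x))"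

text \<open>The duality \<open>Hom\<^sub>K(-, K)\<close> takes left \<open>A\<close>-modules to left modules over \<open>opp A\<close>.\<close>

definition K_dual ::
  "('k, 'x) ring_scheme \<Rightarrow> ('k, 'a) module \<Rightarrow> ('a, 'm) module \<Rightarrow> ('a, 'm \<Rightarrow> 'k) module" where
  "K_dual K A M =
     \<lparr>carrier = mod_hom K (scalar_restr A M) (regular_module K) \<inter> extensional (carrier M),
      mult = undefined, one = undefined,
      zero = (\<lambda>x\<in>carrier M. \<zero>\<^bsub>K\<^esub>),
      add = (\<lambda>f g. \<lambda>x\<in>carrier M. f x \<oplus>\<^bsub>K\<^esub> g x),
      smult = (\<lambda>a f. \<lambda>x\<in>carrier M. f (a \<odot>\<^bsub>M\<^esub> x))\<rparr>"

definition jacobson_radical :: "('a, 'x) ring_scheme \<Rightarrow> 'a set" where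
  "jacobson_radical A = carrier A \<inter>
     \<Inter>{I. submodule I A (regular_module A) \<and> I \<noteq> carrier A \<and>
          (\<forall>J. submodule J A (regular_module A) \<and> I \<subseteq> J \<longrightarrow> J = I \<or> J = carrier A)}"


section \<open>Tensor products of algebras and bimodules\<close>

definition monoid_algebra ::
  "('k, 'x) ring_scheme \<Rightarrow> ('g, 'y) monoid_scheme \<Rightarrow> ('k, 'g \<Rightarrow> 'k) module" where
  "monoid_algebra K G =
     \<lparr>carrier = {f \<in> carrier G \<rightarrow>\<^sub>E carrier K. finite {g \<in> carrier G. f g \<noteq> \<zero>\<^bsub>K\<^esub>}},
      mult = (\<lambda>f h. \<lambda>g\<in>carrier G.
        \<Oplus>\<^bsub>K\<^esub>p \<in> {p \<in> carrier G \<times> carrier G. f (fst p) \<noteq> \<zero>\<^bsub>K\<^esub> \<and> h (snd p) \<noteq> \<zero>\<^bsub>K\<^esub> \<and>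
                          fst p \<otimes>\<^bsub>G\<^esub> snd p = g}.
          f (fst p) \<otimes>\<^bsub>K\<^esub> h (snd p)),
      one = (\<lambda>g\<in>carrier G. if g = \<one>\<^bsub>G\<^esub> then \<one>\<^bsub>K\<^esub> else \<zero>\<^bsub>K\<^esub>),
      zero = (\<lambda>g\<in>carrier G. \<zero>\<^bsub>K\<^esub>),
      add = (\<lambda>f h. \<lambda>g\<in>carrier G. f g \<oplus>\<^bsub>K\<^esub> h g),
      smult = (\<lambda>c f. \<lambda>g\<in>carrier G. c \<otimes>\<^bsub>K\<^esub> f g)\<rparr>"

definition basis_vec ::
  "('k, 'x) ring_scheme \<Rightarrow> ('g, 'y) monoid_scheme \<Rightarrow> 'g \<Rightarrow> ('g \<Rightarrow> 'k)" where
  "basis_vec K G g = (\<lambda>h\<in>carrier G. if h = g then \<one>\<^bsub>K\<^esub> else \<zero>\<^bsub>K\<^esub>)"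

text \<open>
  \<open>A \<otimes>\<^sub>K B\<close> is the free vector space on \<open>A \<times> B\<close>, with the multiplication
  \<open>(a, b)(a', b') = (aa', bb')\<close>, modulo the bilinearity relations.  The linear span of these
  relations is closed under multiplication by every pair \<open>(a, b)\<close> from either side, so it is
  the two-sided ideal they generate.
\<close>

definition tensor_relations ::
  "('k, 'x) ring_scheme \<Rightarrow> ('k, 'a) module \<Rightarrow> ('k, 'b) module \<Rightarrow> ('a \<times> 'b \<Rightarrow> 'k) set" where
  "tensor_relations K A B =
     (let F = monoid_algebra K (A \<times>\<times> B); t = (\<lambda>a b. basis_vec K (A \<times>\<times> B) (a, b)) in
        {t (a \<oplus>\<^bsub>A\<^esub> a') b \<ominus>\<^bsub>F\<^esub> (t a b \<oplus>\<^bsub>F\<^esub> t a' b) | a a' b.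
           a \<in> carrier A \<and> a' \<in> carrier A \<and> b \<in> carrier B} \<union>
        {t a (b \<oplus>\<^bsub>B\<^esub> b') \<ominus>\<^bsub>F\<^esub> (t a b \<oplus>\<^bsub>F\<^esub> t a b') | a b b'.
           a \<in> carrier A \<and> b \<in> carrier B \<and> b' \<in> carrier B} \<union>
        {t (c \<odot>\<^bsub>A\<^esub> a) b \<ominus>\<^bsub>F\<^esub> c \<odot>\<^bsub>F\<^esub> t a b | c a b.
           c \<in> carrier K \<and> a \<in> carrier A \<and> b \<in> carrier B} \<union>
        {t a (c \<odot>\<^bsub>B\<^esub> b) \<ominus>\<^bsub>F\<^esub> c \<odot>\<^bsub>F\<^esub> t a b | c a b.
           c \<in> carrier K \<and> a \<in> carrier A \<and> b \<in> carrier B})"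

definition tensor_algebra ::
  "('k, 'x) ring_scheme \<Rightarrow> ('k, 'a) module \<Rightarrow> ('k, 'b) module \<Rightarrow> ('k, ('a \<times> 'b \<Rightarrow> 'k) set) module"
  where
  "tensor_algebra K A B =
     (let F = monoid_algebra K (A \<times>\<times> B) in quot_mod F (Idl\<^bsub>F\<^esub> (tensor_relations K A B)))"

definition enveloping ::
  "('k, 'x) ring_scheme \<Rightarrow> ('k, 'a) module \<Rightarrow> ('k, ('a \<times> 'a \<Rightarrow> 'k) set) module" where
  "enveloping K A = tensor_algebra K A (opp A)"

text \<open>
  \<open>A\<close> as a left module over its enveloping algebra, \<open>(a \<otimes> b) x = a x b\<close>.  All representatives of a
  class act in the same way, so the image under \<open>the_elem\<close> is a singleton.
\<close>

definition regular_bimodule ::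
  "('k, 'x) ring_scheme \<Rightarrow> ('k, 'a) module \<Rightarrow> (('a \<times> 'a \<Rightarrow> 'k) set, 'a) module" where
  "regular_bimodule K A = ring.extend (ring.truncate A)
     (module.fields (\<lambda>C x. the_elem ((\<lambda>f.
        \<Oplus>\<^bsub>A\<^esub>p \<in> {p \<in> carrier A \<times> carrier A. f p \<noteq> \<zero>\<^bsub>K\<^esub>}.
          f p \<odot>\<^bsub>A\<^esub> (fst p \<otimes>\<^bsub>A\<^esub> x \<otimes>\<^bsub>A\<^esub> snd p)) ` C)))"

definition separable :: "('k, 'x) ring_scheme \<Rightarrow> ('k, 'a) module \<Rightarrow> bool" where
  "separable K A \<longleftrightarrow> projective (enveloping K A) (regular_bimodule K A)"


section \<open>Higher Auslander--Reiten translates\<close>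

text \<open>
  \<open>D Tr M\<close>: the transpose is a left module over \<open>opp A\<close>, so its dual is one over
  \<open>opp (opp A) = A\<close>.
\<close>

definition ar_translate ::
  "('k, 'x) ring_scheme \<Rightarrow> ('k, 'a) module \<Rightarrow> ('a, 'm) module \<Rightarrow>
   ('a, ((nat \<Rightarrow> 'a) \<Rightarrow> 'a) set \<Rightarrow> 'k) module" where
  "ar_translate K A M = K_dual K (opp A) (transpose A M)"

text \<open>
  The translate of the \<open>(n - 1)\<close>-st syzygy for \<open>n \<ge> 1\<close>.  The case \<open>n = 1\<close> is separate only because
  \<open>M\<close> and its syzygies have different carrier types.
\<close>

definition higher_ar_translate ::
  "('k, 'x) ring_scheme \<Rightarrow> ('k, 'a) module \<Rightarrow> nat \<Rightarrow> ('a, 'm) module \<Rightarrow>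
   ('a, ((nat \<Rightarrow> 'a) \<Rightarrow> 'a) set \<Rightarrow> 'k) module" where
  "higher_ar_translate K A n M =
     (case n of
        0 \<Rightarrow> undefined
      | Suc 0 \<Rightarrow> ar_translate K A M
      | Suc (Suc m) \<Rightarrow> ar_translate K A ((syzygy A ^^ m) (syzygy A M)))"

definition bimod_tau ::
  "('k, 'x) ring_scheme \<Rightarrow> ('k, 'a) module \<Rightarrow> nat \<Rightarrow>
   (('a \<times> 'a \<Rightarrow> 'k) set,
    ((nat \<Rightarrow> ('a \<times> 'a \<Rightarrow> 'k) set) \<Rightarrow> ('a \<times> 'a \<Rightarrow> 'k) set) set \<Rightarrow> 'k) module" where
  "bimod_tau K A n = higher_ar_translate K (enveloping K A) n (regular_bimodule K A)"

end

theory Submission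
  imports Defs
begin

text \<open>
  A translate \<open>\<tau>\<^sub>n\<close> of the bimodule \<open>A\<close> vanishes exactly if the syzygy \<open>X = \<Omega>\<^sup>m A\<close>, \<open>m = n - 1\<close>, is a
  projective bimodule, so it has to be shown that this happens exactly if \<open>gl.dim A \<le> m\<close>.

  The minimal resolution of the bimodule \<open>A\<close> splits on the right, so tensoring it with a left module
  \<open>M\<close> gives a projective resolution of \<open>M\<close>.  By Schanuel's argument \<open>X \<otimes> M\<close> and \<open>\<Omega>\<^sup>m M\<close> are then
  direct summands of each other up to projectives.  If \<open>X\<close> is projective, so is \<open>X \<otimes> M\<close>, and the
  projective dimension of \<open>M\<close> is at most \<open>m\<close>.

  Conversely, if \<open>gl.dim A \<le> m\<close>, then the choice \<open>M = A / J\<close>, with \<open>J\<close> the radical, shows that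
  \<open>X / X J\<close> is projective on the left.  Let \<open>P \<rightarrow> X\<close> be the projective cover of \<open>X\<close>, with kernel \<open>C\<close>.
  The induced map \<open>P / P J \<rightarrow> X / X J\<close> splits as a map of left modules and, by separability of
  \<open>A / J\<close>, as a map of bimodules.  Minimality of the cover forces this map to be bijective, hence
  \<open>C \<subseteq> P J\<close>.  As \<open>X\<close> is projective on the right, \<open>C\<close> is a direct summand of \<open>P\<close> on the right, which
  gives \<open>C = C J\<close>, and \<open>C = 0\<close> by Nakayama's lemma.
\<close>

section \<open>Modules\<close>

text \<open>Projective bimodules \<open>Q\<close> are handled by adjunction rather than as summands
  of free bimodules: bilinear maps from \<open>Q\<close> to \<open>Hom_K(V, B)\<close> correspond to
  left linear maps from \<open>Q\<close> tensored with \<open>V\<close> to \<open>B\<close>. Over a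
  field every finite-dimensional \<open>V\<close> is projective, so \<open>Hom_K(V, -)\<close> keeps
  surjections, and liftings over \<open>Env\<close> give splittings over \<open>A\<close>. The
  separability argument is the same device with left \<open>A\<close>-linear maps in place of
  \<open>K\<close>-linear ones.

  Carrier types shape the rest. The modules of one comparison live on different types, while
  \<open>direct_sum\<close> takes a family of one type; Schanuel's argument is therefore phrased by
  \<open>stable_retract\<close>, which writes an identity map as a sum of two composites, and only
  projectivity is transferred along it.

  All translates are finite-dimensional, so their sum is finite-dimensional exactly if almost all of
  them vanish.\<close>

lemma left_moduleI:
  assumes "ring R" "abelian_group M"
    and "\<And>a x. \<lbrakk>a \<in> carrier R; x \<in> carrier M\<rbrakk> \<Longrightarrow> a \<odot>\<^bsub>M\<^esub> x \<in> carrier M"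
    and "\<And>a b x. \<lbrakk>a \<in> carrier R; b \<in> carrier R; x \<in> carrier M\<rbrakk> \<Longrightarrow>
       (a \<oplus>\<^bsub>R\<^esub> b) \<odot>\<^bsub>M\<^esub> x = a \<odot>\<^bsub>M\<^esub> x \<oplus>\<^bsub>M\<^esub> b \<odot>\<^bsub>M\<^esub> x"
    and "\<And>a x y. \<lbrakk>a \<in> carrier R; x \<in> carrier M; y \<in> carrier M\<rbrakk> \<Longrightarrow>
       a \<odot>\<^bsub>M\<^esub> (x \<oplus>\<^bsub>M\<^esub> y) = a \<odot>\<^bsub>M\<^esub> x \<oplus>\<^bsub>M\<^esub> a \<odot>\<^bsub>M\<^esub> y"
    and "\<And>a b x. \<lbrakk>a \<in> carrier R; b \<in> carrier R; x \<in> carrier M\<rbrakk> \<Longrightarrow>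
       (a \<otimes>\<^bsub>R\<^esub> b) \<odot>\<^bsub>M\<^esub> x = a \<odot>\<^bsub>M\<^esub> (b \<odot>\<^bsub>M\<^esub> x)"
    and "\<And>x. x \<in> carrier M \<Longrightarrow> \<one>\<^bsub>R\<^esub> \<odot>\<^bsub>M\<^esub> x = x"
  shows "left_module R M"
  using assms by (intro left_module.intro left_module_axioms.intro) auto

lemma module_imp_left_module: "module R M \<Longrightarrow> left_module R M"
  by (intro left_moduleI)
    (auto simp: module_def module_axioms_def cring_def)

lemma abelian_group_cong:
  assumes "abelian_group M" "carrier N = carrier M" "add N = add M" "zero N = zero M"
  shows "abelian_group N"
  using abelian_groupE[OF assms(1)] assms(2-) by (intro abelian_groupI) auto

lemma (in abelian_group) diff_eq_zero_iff:
  "x \<in> carrier G \<Longrightarrow> y \<in> carrier G \<Longrightarrow> x \<ominus> y = \<zero> \<longleftrightarrow> x = y"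
  using minus_equality[of x "\<ominus> y"] by (auto simp: a_minus_def r_neg)

context left_module
begin

lemma smult_l_null: "x \<in> carrier M \<Longrightarrow> \<zero>\<^bsub>R\<^esub> \<odot>\<^bsub>M\<^esub> x = \<zero>\<^bsub>M\<^esub>"
  using smult_l_distr[of "\<zero>\<^bsub>R\<^esub>" "\<zero>\<^bsub>R\<^esub>" x] smult_closed[of "\<zero>\<^bsub>R\<^esub>" x]
  by (metis M.add.r_cancel_one' R.zero_closed R.l_zero)

lemma smult_r_null: "a \<in> carrier R \<Longrightarrow> a \<odot>\<^bsub>M\<^esub> \<zero>\<^bsub>M\<^esub> = \<zero>\<^bsub>M\<^esub>"
  using smult_r_distr[of a "\<zero>\<^bsub>M\<^esub>" "\<zero>\<^bsub>M\<^esub>"] smult_closed[of a "\<zero>\<^bsub>M\<^esub>"]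
  by (metis M.add.r_cancel_one' M.zero_closed M.l_zero)

lemma smult_l_minus:
  assumes "a \<in> carrier R" "x \<in> carrier M"
  shows "(\<ominus>\<^bsub>R\<^esub> a) \<odot>\<^bsub>M\<^esub> x = \<ominus>\<^bsub>M\<^esub> (a \<odot>\<^bsub>M\<^esub> x)"
proof -
  have "(\<ominus>\<^bsub>R\<^esub> a) \<odot>\<^bsub>M\<^esub> x \<oplus>\<^bsub>M\<^esub> a \<odot>\<^bsub>M\<^esub> x = \<zero>\<^bsub>M\<^esub>"
    using smult_l_distr[of "\<ominus>\<^bsub>R\<^esub> a" a x] assms smult_l_null by (simp add: R.l_neg)
  then show ?thesis using assms smult_closed by (metis M.minus_equality R.a_inv_closed)
qed

lemma smult_r_minus:
  assumes "a \<in> carrier R" "x \<in> carrier M"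
  shows "a \<odot>\<^bsub>M\<^esub> (\<ominus>\<^bsub>M\<^esub> x) = \<ominus>\<^bsub>M\<^esub> (a \<odot>\<^bsub>M\<^esub> x)"
proof -
  have "a \<odot>\<^bsub>M\<^esub> (\<ominus>\<^bsub>M\<^esub> x) \<oplus>\<^bsub>M\<^esub> a \<odot>\<^bsub>M\<^esub> x = \<zero>\<^bsub>M\<^esub>"
    using smult_r_distr[of a "\<ominus>\<^bsub>M\<^esub> x" x] assms smult_r_null by (simp add: M.l_neg)
  then show ?thesis using assms smult_closed by (metis M.minus_equality M.a_inv_closed)
qed

lemma smult_finsum:
  assumes "a \<in> carrier R" "finite S" "\<And>i. i \<in> S \<Longrightarrow> f i \<in> carrier M"
  shows "a \<odot>\<^bsub>M\<^esub> finsum M f S = (\<Oplus>\<^bsub>M\<^esub>i\<in>S. a \<odot>\<^bsub>M\<^esub> f i)"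
  using assms(2,3)
proof (induction S rule: finite_induct)
  case (insert i S)
  then show ?case using assms(1)
    by (simp add: Pi_def smult_r_distr smult_closed)
qed (use assms(1) smult_r_null in auto)

lemma submodule_iff:
  "submodule U R M \<longleftrightarrow> U \<subseteq> carrier M \<and> \<zero>\<^bsub>M\<^esub> \<in> U \<and> (\<forall>x\<in>U. \<forall>y\<in>U. x \<oplus>\<^bsub>M\<^esub> y \<in> U) \<and>
     (\<forall>a\<in>carrier R. \<forall>x\<in>U. a \<odot>\<^bsub>M\<^esub> x \<in> U)"
proof
  assume "submodule U R M"
  then interpret U: submodule U R M .
  show "U \<subseteq> carrier M \<and> \<zero>\<^bsub>M\<^esub> \<in> U \<and> (\<forall>x\<in>U. \<forall>y\<in>U. x \<oplus>\<^bsub>M\<^esub> y \<in> U) \<and>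
     (\<forall>a\<in>carrier R. \<forall>x\<in>U. a \<odot>\<^bsub>M\<^esub> x \<in> U)"
    using U.subset U.one_closed U.m_closed U.smult_closed by auto
next
  assume U: "U \<subseteq> carrier M \<and> \<zero>\<^bsub>M\<^esub> \<in> U \<and> (\<forall>x\<in>U. \<forall>y\<in>U. x \<oplus>\<^bsub>M\<^esub> y \<in> U) \<and>
     (\<forall>a\<in>carrier R. \<forall>x\<in>U. a \<odot>\<^bsub>M\<^esub> x \<in> U)"
  have "\<ominus>\<^bsub>M\<^esub> x \<in> U" if "x \<in> U" for x
  proof -
    have "(\<ominus>\<^bsub>R\<^esub> \<one>\<^bsub>R\<^esub>) \<odot>\<^bsub>M\<^esub> x = \<ominus>\<^bsub>M\<^esub> x"
      using that U smult_l_minus[of "\<one>\<^bsub>R\<^esub>" x] smult_one by auto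
    then show ?thesis using U that by (metis R.add.inv_closed R.one_closed)
  qed
  then show "submodule U R M"
    using U by (intro submodule.intro subgroup.intro submodule_axioms.intro)
      (auto simp: a_inv_def[symmetric])
qed

lemma submoduleD:
  assumes "submodule U R M"
  shows "U \<subseteq> carrier M" "\<zero>\<^bsub>M\<^esub> \<in> U"
    "\<And>x. x \<in> U \<Longrightarrow> x \<in> carrier M"
    "\<And>x y. x \<in> U \<Longrightarrow> y \<in> U \<Longrightarrow> x \<oplus>\<^bsub>M\<^esub> y \<in> U"
    "\<And>a x. a \<in> carrier R \<Longrightarrow> x \<in> U \<Longrightarrow> a \<odot>\<^bsub>M\<^esub> x \<in> U"
    "\<And>x. x \<in> U \<Longrightarrow> \<ominus>\<^bsub>M\<^esub> x \<in> U"
    "\<And>x y. x \<in> U \<Longrightarrow> y \<in> U \<Longrightarrow> x \<ominus>\<^bsub>M\<^esub> y \<in> U"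
proof -
  show *: "U \<subseteq> carrier M" "\<zero>\<^bsub>M\<^esub> \<in> U"
    "\<And>x. x \<in> U \<Longrightarrow> x \<in> carrier M"
    "\<And>x y. x \<in> U \<Longrightarrow> y \<in> U \<Longrightarrow> x \<oplus>\<^bsub>M\<^esub> y \<in> U"
    "\<And>a x. a \<in> carrier R \<Longrightarrow> x \<in> U \<Longrightarrow> a \<odot>\<^bsub>M\<^esub> x \<in> U"
    using assms submodule_iff by auto
  show **: "\<ominus>\<^bsub>M\<^esub> x \<in> U" if "x \<in> U" for x
    using subgroup.m_inv_closed[OF submodule.axioms(1)[OF assms], of x] that by (simp add: a_inv_def)
  show "\<And>x y. x \<in> U \<Longrightarrow> y \<in> U \<Longrightarrow> x \<ominus>\<^bsub>M\<^esub> y \<in> U"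
    using * ** by (simp add: a_minus_def)
qed

lemma carrier_submodule: "submodule (carrier M) R M"
  by (auto simp: submodule_iff smult_closed)

lemma zero_submodule: "submodule {\<zero>\<^bsub>M\<^esub>} R M"
  by (auto simp: submodule_iff smult_r_null)

lemma submodule_left_module:
  assumes "submodule U R M" shows "left_module R (M\<lparr>carrier := U\<rparr>)"
proof (intro left_moduleI)
  note U = submoduleD[OF assms]
  show "abelian_group (M\<lparr>carrier := U\<rparr>)"
  proof (rule abelian_groupI, goal_cases)
    case (6 x)
    then show ?case using U(3,6) M.l_neg[of x] by (auto intro!: bexI[of _ "\<ominus>\<^bsub>M\<^esub> x"])
  qed (use U in \<open>auto simp: M.a_ac\<close>)
qed (use submoduleD[OF assms] in \<open>auto simp: smult_l_distr smult_r_distr smult_assoc1 smult_one R.ring_axioms\<close>)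

lemma submodule_Int: "submodule U R M \<Longrightarrow> submodule V R M \<Longrightarrow> submodule (U \<inter> V) R M"
  by (auto simp: submodule_iff)

lemma span_submodule: "S \<subseteq> carrier M \<Longrightarrow> submodule (mod_span R M S) R M"
  using carrier_submodule unfolding mod_span_def submodule_iff by auto

lemma span_superset: "S \<subseteq> mod_span R M S"
  by (auto simp: mod_span_def)

lemma span_least: "submodule U R M \<Longrightarrow> S \<subseteq> U \<Longrightarrow> mod_span R M S \<subseteq> U"
  by (auto simp: mod_span_def)

lemma span_mono: "S \<subseteq> T \<Longrightarrow> mod_span R M S \<subseteq> mod_span R M T"
  by (auto simp: mod_span_def)

lemma span_carrier: "S \<subseteq> carrier M \<Longrightarrow> mod_span R M S \<subseteq> carrier M"
  using span_least[OF carrier_submodule] .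

end

lemma submodule_of_submodule:
  assumes "left_module R M" "submodule U R M"
  shows "submodule V R (M\<lparr>carrier := U\<rparr>) \<longleftrightarrow> submodule V R M \<and> V \<subseteq> U"
proof -
  interpret left_module R M by fact
  interpret U: left_module R "M\<lparr>carrier := U\<rparr>" using submodule_left_module[OF assms(2)] .
  show ?thesis using submoduleD[OF assms(2)] by (auto simp: submodule_iff U.submodule_iff)
qed

lemma span_restrict:
  assumes "left_module R M" "submodule U R M" "S \<subseteq> U"
  shows "mod_span R (M\<lparr>carrier := U\<rparr>) S = mod_span R M S"
proof -
  interpret left_module R M by fact
  show ?thesis
    unfolding mod_span_def submodule_of_submodule[OF assms(1,2)]
    using assms submodule_Int[OF assms(2)] by (auto simp: subset_iff) blast
qed


section \<open>Homomorphisms\<close>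

lemma mod_homI:
  assumes "\<And>x. x \<in> carrier M \<Longrightarrow> f x \<in> carrier N"
    "\<And>x y. x \<in> carrier M \<Longrightarrow> y \<in> carrier M \<Longrightarrow> f (x \<oplus>\<^bsub>M\<^esub> y) = f x \<oplus>\<^bsub>N\<^esub> f y"
    "\<And>r x. r \<in> carrier R \<Longrightarrow> x \<in> carrier M \<Longrightarrow> f (r \<odot>\<^bsub>M\<^esub> x) = r \<odot>\<^bsub>N\<^esub> f x"
  shows "f \<in> mod_hom R M N"
  using assms by (auto simp: mod_hom_def)

lemma mod_homD:
  assumes "f \<in> mod_hom R M N"
  shows "\<And>x. x \<in> carrier M \<Longrightarrow> f x \<in> carrier N"
    "\<And>x y. x \<in> carrier M \<Longrightarrow> y \<in> carrier M \<Longrightarrow> f (x \<oplus>\<^bsub>M\<^esub> y) = f x \<oplus>\<^bsub>N\<^esub> f y"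
    "\<And>r x. r \<in> carrier R \<Longrightarrow> x \<in> carrier M \<Longrightarrow> f (r \<odot>\<^bsub>M\<^esub> x) = r \<odot>\<^bsub>N\<^esub> f x"
  using assms by (auto simp: mod_hom_def)

lemma mod_hom_id: "(\<lambda>x. x) \<in> mod_hom R M M"
  by (auto simp: mod_hom_def)

lemma mod_hom_comp:
  "f \<in> mod_hom R M N \<Longrightarrow> g \<in> mod_hom R N P \<Longrightarrow> (\<lambda>x. g (f x)) \<in> mod_hom R M P"
  by (auto simp: mod_hom_def Pi_def)

lemma mod_hom_inclusion: "U \<subseteq> carrier M \<Longrightarrow> (\<lambda>x. x) \<in> mod_hom R (M\<lparr>carrier := U\<rparr>) M"
  by (auto simp: mod_hom_def)

lemma mod_hom_restrict_carrier:
  "f \<in> mod_hom R M N \<Longrightarrow> U \<subseteq> carrier M \<Longrightarrow> f \<in> mod_hom R (M\<lparr>carrier := U\<rparr>) N"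
  by (auto simp: mod_hom_def subset_iff)

lemma mod_hom_into_submodule:
  "f \<in> mod_hom R M N \<Longrightarrow> (\<And>x. x \<in> carrier M \<Longrightarrow> f x \<in> V) \<Longrightarrow> f \<in> mod_hom R M (N\<lparr>carrier := V\<rparr>)"
  by (auto simp: mod_hom_def)

lemma mod_hom_cong:
  assumes "f \<in> mod_hom R M N" "\<And>x. x \<in> carrier M \<Longrightarrow> g x = f x" "left_module R M"
  shows "g \<in> mod_hom R M N"
proof -
  interpret left_module R M by fact
  show ?thesis using assms(1,2) by (auto intro!: mod_homI simp: mod_homD smult_closed)
qed

locale module_pair = M: left_module R M + N: left_module R N
  for R :: "('r, 'x) ring_scheme" and M :: "('r, 'm) module" and N :: "('r, 'n) module"
begin

lemma hom_zero: "f \<in> mod_hom R M N \<Longrightarrow> f \<zero>\<^bsub>M\<^esub> = \<zero>\<^bsub>N\<^esub>"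
  using mod_homD(3)[of f R M N "\<zero>\<^bsub>R\<^esub>" "\<zero>\<^bsub>M\<^esub>"] M.smult_l_null[of "\<zero>\<^bsub>M\<^esub>"]
    N.smult_l_null[of "f \<zero>\<^bsub>M\<^esub>"] mod_homD(1)[of f R M N "\<zero>\<^bsub>M\<^esub>"] by simp

lemma hom_minus:
  assumes f: "f \<in> mod_hom R M N" and x: "x \<in> carrier M"
  shows "f (\<ominus>\<^bsub>M\<^esub> x) = \<ominus>\<^bsub>N\<^esub> f x"
proof -
  have "f (\<ominus>\<^bsub>M\<^esub> x) \<oplus>\<^bsub>N\<^esub> f x = \<zero>\<^bsub>N\<^esub>"
    using mod_homD(2)[OF f, of "\<ominus>\<^bsub>M\<^esub> x" x] x hom_zero[OF f] by (simp add: M.M.l_neg)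
  then show ?thesis using x mod_homD(1)[OF f] by (intro N.M.minus_equality[symmetric]) auto
qed

lemma hom_diff:
  "f \<in> mod_hom R M N \<Longrightarrow> x \<in> carrier M \<Longrightarrow> y \<in> carrier M \<Longrightarrow> f (x \<ominus>\<^bsub>M\<^esub> y) = f x \<ominus>\<^bsub>N\<^esub> f y"
  by (simp add: a_minus_def hom_minus mod_homD(2))

lemma hom_zero_fun: "(\<lambda>x. \<zero>\<^bsub>N\<^esub>) \<in> mod_hom R M N"
  by (auto intro!: mod_homI simp: N.smult_r_null)

lemma hom_add_fun:
  "f \<in> mod_hom R M N \<Longrightarrow> g \<in> mod_hom R M N \<Longrightarrow> (\<lambda>x. f x \<oplus>\<^bsub>N\<^esub> g x) \<in> mod_hom R M N"
  by (auto intro!: mod_homI simp: mod_homD N.smult_r_distr M.smult_closed N.M.a_ac)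

lemma hom_minus_fun:
  "f \<in> mod_hom R M N \<Longrightarrow> (\<lambda>x. \<ominus>\<^bsub>N\<^esub> f x) \<in> mod_hom R M N"
  by (auto intro!: mod_homI simp: mod_homD N.smult_r_minus M.smult_closed N.M.minus_add)

lemma hom_diff_fun:
  "f \<in> mod_hom R M N \<Longrightarrow> g \<in> mod_hom R M N \<Longrightarrow> (\<lambda>x. f x \<ominus>\<^bsub>N\<^esub> g x) \<in> mod_hom R M N"
  using hom_add_fun[OF _ hom_minus_fun] by (simp add: a_minus_def)

lemma kernel_submodule: "f \<in> mod_hom R M N \<Longrightarrow> submodule (a_kernel M N f) R M"
  by (auto simp: M.submodule_iff a_kernel_def' hom_zero mod_homD N.smult_r_null M.smult_closed)

lemma vimage_submodule:
  "f \<in> mod_hom R M N \<Longrightarrow> submodule V R N \<Longrightarrow> submodule {x \<in> carrier M. f x \<in> V} R M"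
  by (auto simp: M.submodule_iff N.submodule_iff hom_zero mod_homD M.smult_closed)

lemma image_submodule:
  assumes f: "f \<in> mod_hom R M N" and U: "submodule U R M"
  shows "submodule (f ` U) R N"
  unfolding N.submodule_iff
proof (intro conjI ballI)
  note UD = M.submoduleD[OF U]
  show "f ` U \<subseteq> carrier N" using UD(1) mod_homD(1)[OF f] by auto
  show "\<zero>\<^bsub>N\<^esub> \<in> f ` U" using UD(2) hom_zero[OF f] by (metis imageI)
  show "x \<oplus>\<^bsub>N\<^esub> y \<in> f ` U" if "x \<in> f ` U" "y \<in> f ` U" for x y
    using that UD(3,4) mod_homD(2)[OF f] by (smt (verit) imageE imageI)
  show "a \<odot>\<^bsub>N\<^esub> x \<in> f ` U" if "a \<in> carrier R" "x \<in> f ` U" for a x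
    using that UD(3,5) mod_homD(3)[OF f] by (smt (verit) imageE imageI)
qed

lemma hom_eq_on_span:
  assumes "f \<in> mod_hom R M N" "g \<in> mod_hom R M N" "S \<subseteq> carrier M"
    "\<And>s. s \<in> S \<Longrightarrow> f s = g s" "x \<in> mod_span R M S"
  shows "f x = g x"
proof -
  have "submodule {x \<in> carrier M. f x = g x} R M"
    using assms(1,2) by (auto simp: M.submodule_iff hom_zero mod_homD M.smult_closed)
  from M.span_least[OF this, of S] assms show ?thesis by auto
qed

lemma image_span:
  assumes f: "f \<in> mod_hom R M N" and S: "S \<subseteq> carrier M"
  shows "f ` mod_span R M S = mod_span R N (f ` S)"
proof
  have fS: "f ` S \<subseteq> carrier N" using S mod_homD(1)[OF f] by auto
  have "submodule {x \<in> carrier M. f x \<in> mod_span R N (f ` S)} R M"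
    by (rule vimage_submodule[OF f N.span_submodule[OF fS]])
  from M.span_least[OF this, of S] S N.span_superset
  show "f ` mod_span R M S \<subseteq> mod_span R N (f ` S)" by fast
  show "mod_span R N (f ` S) \<subseteq> f ` mod_span R M S"
    by (intro N.span_least image_submodule[OF f] M.span_submodule[OF S] image_mono M.span_superset)
qed

lemma inj_if_kernel_trivial:
  assumes f: "f \<in> mod_hom R M N" and "\<And>x. x \<in> carrier M \<Longrightarrow> f x = \<zero>\<^bsub>N\<^esub> \<Longrightarrow> x = \<zero>\<^bsub>M\<^esub>"
  shows "inj_on f (carrier M)"
proof (rule inj_onI)
  fix x y assume *: "x \<in> carrier M" "y \<in> carrier M" "f x = f y"
  then have "f (x \<ominus>\<^bsub>M\<^esub> y) = \<zero>\<^bsub>N\<^esub>"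
    using hom_diff[OF f] mod_homD(1)[OF f] by (simp add: a_minus_def N.M.r_neg)
  then have "x \<ominus>\<^bsub>M\<^esub> y = \<zero>\<^bsub>M\<^esub>" using assms(2) * by simp
  then show "x = y" using * M.M.diff_eq_zero_iff by simp
qed

lemma inverse_hom:
  assumes f: "f \<in> mod_hom R M N" and b: "bij_betw f (carrier M) (carrier N)"
  shows "inv_into (carrier M) f \<in> mod_hom R N M"
proof (rule mod_homI)
  let ?g = "inv_into (carrier M) f"
  note inj = bij_betw_imp_inj_on[OF b]
  show gc: "?g x \<in> carrier M" if "x \<in> carrier N" for x
    using that b by (metis bij_betw_imp_surj_on inv_into_into)
  have fg: "f (?g x) = x" if "x \<in> carrier N" for x
    using that b by (simp add: bij_betw_imp_surj_on f_inv_into_f)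
  show "?g (x \<oplus>\<^bsub>N\<^esub> y) = ?g x \<oplus>\<^bsub>M\<^esub> ?g y" if "x \<in> carrier N" "y \<in> carrier N" for x y
    using that gc fg mod_homD(2)[OF f] by (intro inv_into_f_eq[OF inj]) simp_all
  show "?g (r \<odot>\<^bsub>N\<^esub> x) = r \<odot>\<^bsub>M\<^esub> ?g x" if "r \<in> carrier R" "x \<in> carrier N" for r x
    using that gc fg mod_homD(3)[OF f] M.smult_closed by (intro inv_into_f_eq[OF inj]) simp_all
qed

end

lemma module_pairI: "left_module R M \<Longrightarrow> left_module R N \<Longrightarrow> module_pair R M N"
  by (simp add: module_pair_def)

text \<open>Exchanges the scalar action and keeps carrier, addition and zero. The one-sided
  structures of a bimodule are built this way, so that a single element belongs to all of them
  without coercion maps.\<close>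

definition with_smult :: "('m, 'x) ring_scheme \<Rightarrow> ('r \<Rightarrow> 'm \<Rightarrow> 'm) \<Rightarrow> ('r, 'm) module" where
  "with_smult M s = ring.extend (ring.truncate M) (module.fields s)"

lemma with_smult_simps [simp]:
  "carrier (with_smult M s) = carrier M" "zero (with_smult M s) = zero M"
  "add (with_smult M s) = add M" "smult (with_smult M s) = s"
  "mult (with_smult M s) = mult M" "one (with_smult M s) = one M"
  by (simp_all add: with_smult_def ring.defs module.defs)

lemma regular_module_simps [simp]:
  "carrier (regular_module R) = carrier R" "zero (regular_module R) = zero R"
  "add (regular_module R) = add R" "smult (regular_module R) = mult R"
  by (simp_all add: regular_module_def ring.defs module.defs)

lemma scalar_restr_simps [simp]:
  "carrier (scalar_restr A M) = carrier M" "zero (scalar_restr A M) = zero M"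
  "add (scalar_restr A M) = add M"
  "smult (scalar_restr A M) = (\<lambda>c x. (c \<odot>\<^bsub>A\<^esub> \<one>\<^bsub>A\<^esub>) \<odot>\<^bsub>M\<^esub> x)"
  by (simp_all add: scalar_restr_def ring.defs module.defs)

lemma regular_left_module: "ring R \<Longrightarrow> left_module R (regular_module R)"
proof -
  assume "ring R"
  then interpret ring R .
  show ?thesis
  proof (rule left_moduleI)
    show "abelian_group (regular_module R)"
      by (rule abelian_group_cong[OF is_abelian_group]) auto
  qed (auto simp: l_distr r_distr m_assoc ring_axioms)
qed

section \<open>Quotients\<close>

lemma quot_mod_simps:
  "carrier (quot_mod M U) = a_rcosets\<^bsub>M\<^esub> U" "zero (quot_mod M U) = U"
  "add (quot_mod M U) = set_add M" "mult (quot_mod M U) = rcoset_mult M U"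
  "one (quot_mod M U) = U +>\<^bsub>M\<^esub> \<one>\<^bsub>M\<^esub>"
  "smult (quot_mod M U) = (\<lambda>r C. \<Union>x\<in>C. U +>\<^bsub>M\<^esub> (r \<odot>\<^bsub>M\<^esub> x))"
  by (simp_all add: quot_mod_def FactRing_def ring.defs module.defs)

locale quotient_module = left_module R M for R :: "('r, 'x) ring_scheme" and M :: "('r, 'm) module" +
  fixes U assumes U: "submodule U R M"
begin

abbreviation "cls x \<equiv> U +>\<^bsub>M\<^esub> x"

sublocale sub: abelian_subgroup U M
proof (rule abelian_subgroupI3)
  show "additive_subgroup U M"
    using U by (simp add: additive_subgroup_def submodule_def)
  show "abelian_group M" ..
qed

lemma cls_eq_iff:
  assumes "x \<in> carrier M" "y \<in> carrier M"
  shows "cls x = cls y \<longleftrightarrow> x \<ominus>\<^bsub>M\<^esub> y \<in> U"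
proof
  assume "cls x = cls y"
  then have "x \<in> cls y" using sub.a_rcos_self[of x] assms by simp
  then show "x \<ominus>\<^bsub>M\<^esub> y \<in> U" using assms sub.a_rcos_module[of y x] by (simp add: a_minus_def)
next
  assume "x \<ominus>\<^bsub>M\<^esub> y \<in> U"
  then have "x \<in> cls y" using assms sub.a_rcos_module[of y x] by (simp add: a_minus_def)
  then show "cls x = cls y" using sub.a_repr_independence'[of x y] assms by simp
qed

lemma cls_zero: "cls \<zero>\<^bsub>M\<^esub> = U"
  using sub.a_subset by simp

lemma cls_eq_zero_iff: "x \<in> carrier M \<Longrightarrow> cls x = U \<longleftrightarrow> x \<in> U"
  using cls_eq_iff[of x "\<zero>\<^bsub>M\<^esub>"] cls_zero M.minus_equality[of "\<zero>\<^bsub>M\<^esub>" "\<zero>\<^bsub>M\<^esub>"]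
  by (simp add: a_minus_def)

lemma quot_carrier: "carrier (quot_mod M U) = cls ` carrier M"
  by (auto simp: quot_mod_simps A_RCOSETS_def')

lemma quot_carrierE:
  assumes "C \<in> carrier (quot_mod M U)"
  obtains x where "x \<in> carrier M" "C = cls x"
  using assms by (auto simp: quot_carrier)

lemma quot_zero: "zero (quot_mod M U) = U"
  by (simp add: quot_mod_simps)

lemma quot_add:
  "x \<in> carrier M \<Longrightarrow> y \<in> carrier M \<Longrightarrow> cls x \<oplus>\<^bsub>quot_mod M U\<^esub> cls y = cls (x \<oplus>\<^bsub>M\<^esub> y)"
  by (simp add: quot_mod_simps sub.a_rcos_sum)

lemma quot_smult:
  assumes "r \<in> carrier R" "x \<in> carrier M"
  shows "r \<odot>\<^bsub>quot_mod M U\<^esub> cls x = cls (r \<odot>\<^bsub>M\<^esub> x)"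
proof -
  have "cls (r \<odot>\<^bsub>M\<^esub> y) = cls (r \<odot>\<^bsub>M\<^esub> x)" if y: "y \<in> cls x" for y
  proof -
    have yc: "y \<in> carrier M" using y assms sub.a_elemrcos_carrier by blast
    have "y \<ominus>\<^bsub>M\<^esub> x \<in> U" using y assms yc sub.a_rcos_module[of x y] by (simp add: a_minus_def)
    then have "r \<odot>\<^bsub>M\<^esub> (y \<ominus>\<^bsub>M\<^esub> x) \<in> U" using submoduleD(5)[OF U] assms by blast
    moreover have "r \<odot>\<^bsub>M\<^esub> (y \<ominus>\<^bsub>M\<^esub> x) = r \<odot>\<^bsub>M\<^esub> y \<ominus>\<^bsub>M\<^esub> r \<odot>\<^bsub>M\<^esub> x"
      using assms yc by (simp add: a_minus_def smult_r_distr smult_r_minus)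
    ultimately show ?thesis using assms yc by (simp add: cls_eq_iff smult_closed)
  qed
  moreover have "x \<in> cls x" using assms sub.a_rcos_self by blast
  ultimately show ?thesis unfolding quot_mod_simps by blast
qed

lemma quot_abelian_group: "abelian_group (quot_mod M U)"
proof (rule abelian_group_cong[of "M Quot U"])
  show "abelian_group (M Quot U)"
    by (rule comm_group_abelian_groupI)
      (simp add: FactRing_def sub.a_factorgroup_is_comm_group[unfolded A_FactGroup_def'])
qed (simp_all add: quot_mod_simps FactRing_def)

lemma quot_left_module: "left_module R (quot_mod M U)"
proof (rule left_moduleI)
  show "r \<odot>\<^bsub>quot_mod M U\<^esub> C \<in> carrier (quot_mod M U)"
    if "r \<in> carrier R" "C \<in> carrier (quot_mod M U)" for r C
    using that quot_smult smult_closed by (auto simp: quot_carrier)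
  show "(a \<oplus>\<^bsub>R\<^esub> b) \<odot>\<^bsub>quot_mod M U\<^esub> C = a \<odot>\<^bsub>quot_mod M U\<^esub> C \<oplus>\<^bsub>quot_mod M U\<^esub> b \<odot>\<^bsub>quot_mod M U\<^esub> C"
    if "a \<in> carrier R" "b \<in> carrier R" "C \<in> carrier (quot_mod M U)" for a b C
    using that by (auto simp: quot_carrier quot_smult quot_add smult_closed smult_l_distr)
  show "a \<odot>\<^bsub>quot_mod M U\<^esub> (C \<oplus>\<^bsub>quot_mod M U\<^esub> D) = a \<odot>\<^bsub>quot_mod M U\<^esub> C \<oplus>\<^bsub>quot_mod M U\<^esub> a \<odot>\<^bsub>quot_mod M U\<^esub> D"
    if "a \<in> carrier R" "C \<in> carrier (quot_mod M U)" "D \<in> carrier (quot_mod M U)" for a C D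
    using that by (auto simp: quot_carrier quot_smult quot_add smult_closed smult_r_distr)
  show "(a \<otimes>\<^bsub>R\<^esub> b) \<odot>\<^bsub>quot_mod M U\<^esub> C = a \<odot>\<^bsub>quot_mod M U\<^esub> (b \<odot>\<^bsub>quot_mod M U\<^esub> C)"
    if "a \<in> carrier R" "b \<in> carrier R" "C \<in> carrier (quot_mod M U)" for a b C
    using that by (auto simp: quot_carrier quot_smult smult_closed smult_assoc1)
  show "\<one>\<^bsub>R\<^esub> \<odot>\<^bsub>quot_mod M U\<^esub> C = C" if "C \<in> carrier (quot_mod M U)" for C
    using that by (auto simp: quot_carrier quot_smult smult_one)
qed (rule R.ring_axioms quot_abelian_group)+

lemma cls_hom: "cls \<in> mod_hom R M (quot_mod M U)"
  by (auto intro!: mod_homI simp: quot_carrier quot_add quot_smult)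

lemma quot_trivial_iff: "carrier (quot_mod M U) = {zero (quot_mod M U)} \<longleftrightarrow> U = carrier M"
proof
  assume *: "carrier (quot_mod M U) = {zero (quot_mod M U)}"
  have "x \<in> U" if "x \<in> carrier M" for x
    using * that cls_eq_zero_iff[of x] by (auto simp: quot_carrier quot_zero)
  then show "U = carrier M" using submoduleD(1)[OF U] by auto
next
  assume *: "U = carrier M"
  have "cls x = U" if "x \<in> carrier M" for x using that cls_eq_zero_iff[of x] * by simp
  then show "carrier (quot_mod M U) = {zero (quot_mod M U)}"
    by (auto simp: quot_carrier quot_zero intro!: exI[of _ "\<zero>\<^bsub>M\<^esub>"] image_eqI[of _ _ "\<zero>\<^bsub>M\<^esub>"])
qed

lemma quot_lift:
  assumes h: "h \<in> mod_hom R M N" and N: "left_module R N" and "\<And>x. x \<in> U \<Longrightarrow> h x = \<zero>\<^bsub>N\<^esub>"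
  obtains h' where "h' \<in> mod_hom R (quot_mod M U) N" "\<And>x. x \<in> carrier M \<Longrightarrow> h' (cls x) = h x"
proof -
  interpret MN: module_pair R M N using N left_module_axioms by (intro module_pairI)
  have eq: "h x = h y" if "x \<in> carrier M" "y \<in> carrier M" "cls x = cls y" for x y
  proof -
    have "h (x \<ominus>\<^bsub>M\<^esub> y) = \<zero>\<^bsub>N\<^esub>" using that cls_eq_iff assms(3) by blast
    then show ?thesis
      using that MN.hom_diff[OF h] MN.N.M.diff_eq_zero_iff mod_homD(1)[OF h] by simp
  qed
  define h' where "h' C = h (SOME x. x \<in> carrier M \<and> C = cls x)" for C
  have h': "h' (cls x) = h x" if "x \<in> carrier M" for x
  proof -
    have "(SOME y. y \<in> carrier M \<and> cls x = cls y) \<in> carrier M \<and>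
      cls x = cls (SOME y. y \<in> carrier M \<and> cls x = cls y)"
      using that by (intro someI[of "\<lambda>y. y \<in> carrier M \<and> cls x = cls y" x]) simp
    then show ?thesis unfolding h'_def using that by (intro eq) auto
  qed
  moreover have "h' \<in> mod_hom R (quot_mod M U) N"
    by (rule mod_homI)
      (auto simp: quot_carrier h' quot_add quot_smult mod_homD[OF h] smult_closed)
  ultimately show ?thesis using that by blast
qed

end

lemma quotient_moduleI: "left_module R M \<Longrightarrow> submodule U R M \<Longrightarrow> quotient_module R M U"
  by (simp add: quotient_module_def quotient_module_axioms_def)

lemma quot_map:
  assumes M: "left_module R M" and N: "left_module R N"
    and U: "submodule U R M" and V: "submodule V R N"
    and h: "h \<in> mod_hom R M N" and hU: "\<And>x. x \<in> U \<Longrightarrow> h x \<in> V"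
  obtains h' where "h' \<in> mod_hom R (quot_mod M U) (quot_mod N V)"
    "\<And>x. x \<in> carrier M \<Longrightarrow> h' (U +>\<^bsub>M\<^esub> x) = V +>\<^bsub>N\<^esub> h x"
proof -
  interpret M: quotient_module R M U using M U by (rule quotient_moduleI)
  interpret N: quotient_module R N V using N V by (rule quotient_moduleI)
  have "(\<lambda>x. N.cls (h x)) \<in> mod_hom R M (quot_mod N V)"
    by (rule mod_hom_comp[OF h N.cls_hom])
  moreover have "N.cls (h x) = \<zero>\<^bsub>quot_mod N V\<^esub>" if "x \<in> U" for x
    using hU[OF that] N.cls_eq_zero_iff N.submoduleD(3)[OF V] by (simp add: N.quot_zero)
  ultimately show ?thesis
    using M.quot_lift[OF _ N.quot_left_module] that by blast
qed

section \<open>Direct sums and free modules\<close>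

lemma direct_sum_simps:
  "carrier (direct_sum I M) = {x \<in> (\<Pi>\<^sub>E i\<in>I. carrier (M i)). finite {i \<in> I. x i \<noteq> \<zero>\<^bsub>M i\<^esub>}}"
  "zero (direct_sum I M) = (\<lambda>i\<in>I. \<zero>\<^bsub>M i\<^esub>)"
  "add (direct_sum I M) = (\<lambda>x y. \<lambda>i\<in>I. x i \<oplus>\<^bsub>M i\<^esub> y i)"
  "smult (direct_sum I M) = (\<lambda>r x. \<lambda>i\<in>I. r \<odot>\<^bsub>M i\<^esub> x i)"
  by (simp_all add: direct_sum_def)

definition single :: "'i set \<Rightarrow> ('i \<Rightarrow> ('r, 'm) module) \<Rightarrow> 'i \<Rightarrow> 'm \<Rightarrow> ('i \<Rightarrow> 'm)" where
  "single I M i m = (\<lambda>j\<in>I. if j = i then m else \<zero>\<^bsub>M j\<^esub>)"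

definition unit_vec :: "('r, 'x) ring_scheme \<Rightarrow> 'i set \<Rightarrow> 'i \<Rightarrow> ('i \<Rightarrow> 'r)" where
  "unit_vec R I i = single I (\<lambda>_. regular_module R) i \<one>\<^bsub>R\<^esub>"

locale module_family = R: ring R for R :: "('r, 'x) ring_scheme" (structure) +
  fixes I :: "'i set" and M :: "'i \<Rightarrow> ('r, 'm) module"
  assumes M: "\<And>i. i \<in> I \<Longrightarrow> left_module R (M i)"
begin

abbreviation "S \<equiv> direct_sum I M"

lemma ag: "i \<in> I \<Longrightarrow> abelian_group (M i)"
  using M left_module.axioms(2) by blast

lemma carrierD: "f \<in> carrier S \<Longrightarrow> i \<in> I \<Longrightarrow> f i \<in> carrier (M i)"
  by (auto simp: direct_sum_simps)

lemma eqI: "f \<in> carrier S \<Longrightarrow> g \<in> carrier S \<Longrightarrow> (\<And>i. i \<in> I \<Longrightarrow> f i = g i) \<Longrightarrow> f = g"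
  by (auto simp: direct_sum_simps intro: PiE_ext)

lemma at_simps: "i \<in> I \<Longrightarrow> (f \<oplus>\<^bsub>S\<^esub> g) i = f i \<oplus>\<^bsub>M i\<^esub> g i"
  "i \<in> I \<Longrightarrow> (r \<odot>\<^bsub>S\<^esub> f) i = r \<odot>\<^bsub>M i\<^esub> f i" "i \<in> I \<Longrightarrow> \<zero>\<^bsub>S\<^esub> i = \<zero>\<^bsub>M i\<^esub>"
  by (simp_all add: direct_sum_simps)

lemma add_closed:
  assumes "f \<in> carrier S" "g \<in> carrier S" shows "f \<oplus>\<^bsub>S\<^esub> g \<in> carrier S"
proof -
  have "{i \<in> I. (f \<oplus>\<^bsub>S\<^esub> g) i \<noteq> \<zero>\<^bsub>M i\<^esub>} \<subseteq> {i \<in> I. f i \<noteq> \<zero>\<^bsub>M i\<^esub>} \<union> {i \<in> I. g i \<noteq> \<zero>\<^bsub>M i\<^esub>}"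
    using abelian_groupE(2,5)[OF ag] by (auto simp: at_simps)
  then have "finite {i \<in> I. (f \<oplus>\<^bsub>S\<^esub> g) i \<noteq> \<zero>\<^bsub>M i\<^esub>}"
    by (rule finite_subset) (use assms in \<open>auto simp: direct_sum_simps\<close>)
  then show ?thesis
    using assms abelian_groupE(1)[OF ag] by (auto simp: direct_sum_simps Pi_iff PiE_def)
qed

lemma smult_closed:
  assumes "r \<in> carrier R" "f \<in> carrier S" shows "r \<odot>\<^bsub>S\<^esub> f \<in> carrier S"
proof -
  have "{i \<in> I. (r \<odot>\<^bsub>S\<^esub> f) i \<noteq> \<zero>\<^bsub>M i\<^esub>} \<subseteq> {i \<in> I. f i \<noteq> \<zero>\<^bsub>M i\<^esub>}"
    using left_module.smult_r_null[OF M] assms by (auto simp: at_simps)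
  then have "finite {i \<in> I. (r \<odot>\<^bsub>S\<^esub> f) i \<noteq> \<zero>\<^bsub>M i\<^esub>}"
    by (rule finite_subset) (use assms in \<open>auto simp: direct_sum_simps\<close>)
  then show ?thesis
    using assms left_module.smult_closed[OF M] by (auto simp: direct_sum_simps Pi_iff PiE_def)
qed

lemma zero_in: "\<zero>\<^bsub>S\<^esub> \<in> carrier S"
  using abelian_groupE(2)[OF ag] by (auto simp: direct_sum_simps)

lemma abelian: "abelian_group S"
proof (rule abelian_groupI, goal_cases)
  case (3 x y z)
  then show ?case using abelian_groupE(3)[OF ag]
    by (intro eqI) (auto simp: add_closed at_simps carrierD)
next
  case (4 x y)
  then show ?case using abelian_groupE(4)[OF ag]
    by (intro eqI) (auto simp: add_closed at_simps carrierD)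
next
  case (5 x)
  then show ?case using abelian_groupE(5)[OF ag]
    by (intro eqI) (auto simp: add_closed at_simps carrierD zero_in)
next
  case (6 x)
  have "(\<ominus>\<^bsub>R\<^esub> \<one>\<^bsub>R\<^esub>) \<odot>\<^bsub>M i\<^esub> x i \<oplus>\<^bsub>M i\<^esub> x i = \<zero>\<^bsub>M i\<^esub>" if "i \<in> I" for i
  proof -
    interpret left_module R "M i" using M[OF that] .
    show ?thesis using carrierD[OF 6 that] by (simp add: smult_l_minus smult_one M.l_neg)
  qed
  then show ?case using 6
    by (intro bexI[of _ "(\<ominus>\<^bsub>R\<^esub> \<one>\<^bsub>R\<^esub>) \<odot>\<^bsub>S\<^esub> x"] eqI) (auto simp: add_closed smult_closed at_simps zero_in)
qed (auto simp: add_closed zero_in)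

lemma left_module: "left_module R S"
proof (rule left_moduleI, goal_cases)
  case (4 a b x)
  then show ?case using left_module.smult_l_distr[OF M]
    by (intro eqI) (auto simp: add_closed smult_closed at_simps carrierD)
next
  case (5 a x y)
  then show ?case using left_module.smult_r_distr[OF M]
    by (intro eqI) (auto simp: add_closed smult_closed at_simps carrierD)
next
  case (6 a b x)
  then show ?case using left_module.smult_assoc1[OF M]
    by (intro eqI) (auto simp: add_closed smult_closed at_simps carrierD)
next
  case (7 x)
  then show ?case using left_module.smult_one[OF M]
    by (intro eqI) (auto simp: add_closed smult_closed at_simps carrierD)
qed (auto simp: R.ring_axioms abelian smult_closed)

lemma single_closed: "i \<in> I \<Longrightarrow> m \<in> carrier (M i) \<Longrightarrow> single I M i m \<in> carrier S"
proof -
  assume *: "i \<in> I" "m \<in> carrier (M i)"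
  have "{j \<in> I. single I M i m j \<noteq> \<zero>\<^bsub>M j\<^esub>} \<subseteq> {i}" by (auto simp: single_def)
  then show ?thesis using * abelian_groupE(2)[OF ag]
    by (auto simp: direct_sum_simps single_def intro: finite_subset)
qed

lemma single_hom: "i \<in> I \<Longrightarrow> single I M i \<in> mod_hom R (M i) S"
proof (rule mod_homI, goal_cases)
  case (2 x y)
  then show ?case using abelian_groupE(1,2,5)[OF ag]
    by (intro eqI) (auto simp: add_closed single_closed at_simps, auto simp: single_def)
next
  case (3 r x)
  then show ?case using left_module.smult_r_null[OF M] left_module.smult_closed[OF M]
    by (intro eqI) (auto simp: smult_closed single_closed at_simps, auto simp: single_def)
qed (auto simp: single_closed)

text \<open>Induction on the support: removing one coordinate of \<open>f\<close> leaves an element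
  of smaller support, and the removed part is a \<open>single\<close>.\<close>

lemma submodule_eq_carrier:
  assumes U: "submodule U R S"
    and "\<And>i m. i \<in> I \<Longrightarrow> m \<in> carrier (M i) \<Longrightarrow> single I M i m \<in> U"
  shows "U = carrier S"
proof
  interpret S: left_module R S by (rule left_module)
  show "U \<subseteq> carrier S" using S.submoduleD(1)[OF U] .
  have "f \<in> U" if "finite F" "f \<in> carrier S" "{i \<in> I. f i \<noteq> \<zero>\<^bsub>M i\<^esub>} = F" for F f
    using that
  proof (induction F arbitrary: f rule: finite_induct)
    case empty
    then have "f = \<zero>\<^bsub>S\<^esub>" using zero_in by (intro eqI) (auto simp: at_simps)
    then show ?case using S.submoduleD(2)[OF U] by simp
  next
    case (insert i F)
    have i: "i \<in> I" and fi: "f i \<in> carrier (M i)" using insert.prems by (auto intro: carrierD)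
    define g where "g = (\<lambda>j\<in>I. if j = i then \<zero>\<^bsub>M j\<^esub> else f j)"
    have gs: "{j \<in> I. g j \<noteq> \<zero>\<^bsub>M j\<^esub>} = F" using insert by (auto simp: g_def)
    have gc: "g \<in> carrier S"
      using gs insert(1) insert.prems(1) abelian_groupE(2)[OF ag] unfolding direct_sum_simps
      by (auto simp: g_def carrierD)
    have "f = g \<oplus>\<^bsub>S\<^esub> single I M i (f i)"
      using gc insert.prems(1) i fi abelian_groupE(2,5)[OF ag] abelian_monoid.r_zero[OF abelian_group.axioms(1)[OF ag]]
      by (intro eqI) (auto simp: add_closed single_closed at_simps carrierD, auto simp: g_def single_def carrierD)
    moreover have "g \<in> U" using insert.IH gc gs by blast
    ultimately show ?case using S.submoduleD(4)[OF U] assms(2)[OF i fi] by metis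
  qed
  then show "carrier S \<subseteq> U" by (auto simp: direct_sum_simps)
qed

lemma hom_eqI:
  assumes "f \<in> mod_hom R S N" "g \<in> mod_hom R S N" "left_module R N"
    "\<And>i m. i \<in> I \<Longrightarrow> m \<in> carrier (M i) \<Longrightarrow> f (single I M i m) = g (single I M i m)"
    "x \<in> carrier S"
  shows "f x = g x"
proof -
  interpret module_pair R S N using left_module assms(3) by (rule module_pairI)
  have "submodule {x \<in> carrier S. f x = g x} R S"
    using assms(1,2) by (auto simp: M.submodule_iff hom_zero mod_homD M.smult_closed)
  then have "{x \<in> carrier S. f x = g x} = carrier S"
    by (rule submodule_eq_carrier) (auto simp: assms(4) single_closed)
  then show ?thesis using assms(5) by auto
qed

text \<open>The explicit sum in the last conclusion is carried along because the regular bimodule is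
  defined by such a sum; \<open>T_universal\<close> identifies the two.\<close>

lemma lift:
  assumes N: "left_module R N" and h: "\<And>i. i \<in> I \<Longrightarrow> h i \<in> mod_hom R (M i) N"
  obtains H where "H \<in> mod_hom R S N"
    "\<And>i m. i \<in> I \<Longrightarrow> m \<in> carrier (M i) \<Longrightarrow> H (single I M i m) = h i m"
    "\<And>f. H f = (\<Oplus>\<^bsub>N\<^esub>i\<in>{i \<in> I. f i \<noteq> \<zero>\<^bsub>M i\<^esub>}. h i (f i))"
proof -
  interpret N: left_module R N by fact
  define H where "H f = (\<Oplus>\<^bsub>N\<^esub>i\<in>{i \<in> I. f i \<noteq> \<zero>\<^bsub>M i\<^esub>}. h i (f i))" for f
  have hz: "h i \<zero>\<^bsub>M i\<^esub> = \<zero>\<^bsub>N\<^esub>" if "i \<in> I" for i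
    using module_pair.hom_zero[OF module_pairI[OF M[OF that] N] h[OF that]] .
  \<comment> \<open>The sum may run over any finite index set that contains the support. Additivity
    needs this, since \<open>x\<close>, \<open>y\<close> and their sum have different
    supports.\<close>
  have H: "H f = (\<Oplus>\<^bsub>N\<^esub>i\<in>F. h i (f i))"
    if "f \<in> carrier S" "finite F" "F \<subseteq> I" "{i \<in> I. f i \<noteq> \<zero>\<^bsub>M i\<^esub>} \<subseteq> F" for f F
    unfolding H_def using that hz mod_homD(1)[OF h] carrierD
    by (intro N.M.add.finprod_mono_neutral_cong_left) auto
  have pi: "(\<lambda>i. h i (f i)) \<in> F \<rightarrow> carrier N" if "f \<in> carrier S" "F \<subseteq> I" for f F
    using that mod_homD(1)[OF h] carrierD by blast
  have fin: "finite {i \<in> I. f i \<noteq> \<zero>\<^bsub>M i\<^esub>}" if "f \<in> carrier S" for f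
    using that by (simp add: direct_sum_simps)
  have "H \<in> mod_hom R S N"
  proof (rule mod_homI, goal_cases)
    case (1 x)
    show ?case unfolding H_def by (intro N.M.finsum_closed pi[OF 1]) auto
  next
    case (2 x y)
    let ?F = "{i \<in> I. x i \<noteq> \<zero>\<^bsub>M i\<^esub>} \<union> {i \<in> I. y i \<noteq> \<zero>\<^bsub>M i\<^esub>}"
    have F: "finite ?F" "?F \<subseteq> I" using fin 2 by auto
    have sub: "{i \<in> I. (x \<oplus>\<^bsub>S\<^esub> y) i \<noteq> \<zero>\<^bsub>M i\<^esub>} \<subseteq> ?F"
      using abelian_groupE(2,5)[OF ag] by (auto simp: at_simps)
    have "H (x \<oplus>\<^bsub>S\<^esub> y) = (\<Oplus>\<^bsub>N\<^esub>i\<in>?F. h i ((x \<oplus>\<^bsub>S\<^esub> y) i))"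
      using 2 by (intro H[OF _ F sub] add_closed)
    also have "\<dots> = (\<Oplus>\<^bsub>N\<^esub>i\<in>?F. h i (x i) \<oplus>\<^bsub>N\<^esub> h i (y i))"
      using 2 mod_homD(1,2)[OF h] carrierD
      by (intro N.M.finsum_cong') (auto simp: at_simps)
    also have "\<dots> = (\<Oplus>\<^bsub>N\<^esub>i\<in>?F. h i (x i)) \<oplus>\<^bsub>N\<^esub> (\<Oplus>\<^bsub>N\<^esub>i\<in>?F. h i (y i))"
      by (rule N.M.finsum_addf) (rule pi[OF 2(1) F(2)] pi[OF 2(2) F(2)])+
    finally show ?case using H[OF 2(1) F] H[OF 2(2) F] by auto
  next
    case (3 r x)
    let ?F = "{i \<in> I. x i \<noteq> \<zero>\<^bsub>M i\<^esub>}"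
    have F: "finite ?F" "?F \<subseteq> I" using fin 3 by auto
    have sub: "{i \<in> I. (r \<odot>\<^bsub>S\<^esub> x) i \<noteq> \<zero>\<^bsub>M i\<^esub>} \<subseteq> ?F"
      using left_module.smult_r_null[OF M] 3 by (auto simp: at_simps)
    have "H (r \<odot>\<^bsub>S\<^esub> x) = (\<Oplus>\<^bsub>N\<^esub>i\<in>?F. h i ((r \<odot>\<^bsub>S\<^esub> x) i))"
      using 3 by (intro H[OF _ F sub] smult_closed)
    also have "\<dots> = (\<Oplus>\<^bsub>N\<^esub>i\<in>?F. r \<odot>\<^bsub>N\<^esub> h i (x i))"
      using 3 mod_homD(1,3)[OF h] carrierD N.smult_closed
      by (intro N.M.finsum_cong') (auto simp: at_simps)
    also have "\<dots> = r \<odot>\<^bsub>N\<^esub> (\<Oplus>\<^bsub>N\<^esub>i\<in>?F. h i (x i))"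
      by (rule N.smult_finsum[OF 3(1) F(1), symmetric]) (use pi[OF 3(2) F(2)] in auto)
    finally show ?case using H[OF 3(2) F] by auto
  qed
  moreover have "H (single I M i m) = h i m" if "i \<in> I" "m \<in> carrier (M i)" for i m
  proof -
    have "H (single I M i m) = (\<Oplus>\<^bsub>N\<^esub>j\<in>{i}. h j (single I M i m j))"
      by (rule H) (use that single_closed in \<open>auto simp: single_def\<close>)
    also have "\<dots> = h i m" using that mod_homD(1)[OF h] by (simp add: single_def N.M.finsum_insert)
    finally show ?thesis .
  qed
  ultimately show ?thesis using that H_def by blast
qed

end

lemma module_familyI: "ring R \<Longrightarrow> (\<And>i. i \<in> I \<Longrightarrow> left_module R (M i)) \<Longrightarrow> module_family R I M"
  by (simp add: module_family_def module_family_axioms_def)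

section \<open>Projective modules\<close>

context ring
begin

lemma free_family: "module_family R X (\<lambda>_. regular_module R)"
  by (intro module_familyI regular_left_module ring_axioms)

lemma free_left_module: "left_module R (free_module R X)"
  using module_family.left_module[OF free_family] by (simp add: free_module_def)

lemma unit_vec_closed: "i \<in> X \<Longrightarrow> unit_vec R X i \<in> carrier (free_module R X)"
  using module_family.single_closed[OF free_family, of i X] by (simp add: free_module_def unit_vec_def)

lemma smult_unit_vec:
  "r \<in> carrier R \<Longrightarrow> r \<odot>\<^bsub>free_module R X\<^esub> unit_vec R X i = single X (\<lambda>_. regular_module R) i r"
  by (auto simp: free_module_def direct_sum_simps unit_vec_def single_def)

lemma free_span: "mod_span R (free_module R X) (unit_vec R X ` X) = carrier (free_module R X)"
proof -
  interpret F: left_module R "free_module R X" by (rule free_left_module)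
  have sub: "unit_vec R X ` X \<subseteq> carrier (free_module R X)" using unit_vec_closed by auto
  show ?thesis unfolding free_module_def
  proof (rule module_family.submodule_eq_carrier[OF free_family], goal_cases)
    case 1
    show ?case using F.span_submodule[OF sub] by (simp add: free_module_def)
  next
    case (2 i m)
    then have "m \<odot>\<^bsub>free_module R X\<^esub> unit_vec R X i \<in> mod_span R (free_module R X) (unit_vec R X ` X)"
      by (intro F.submoduleD(5)[OF F.span_submodule[OF sub]] subsetD[OF F.span_superset] imageI) auto
    then show ?case using 2 smult_unit_vec[of m X i] by (simp add: free_module_def)
  qed
qed

lemma free_hom_eqI:
  assumes "f \<in> mod_hom R (free_module R X) N" "g \<in> mod_hom R (free_module R X) N" "left_module R N"
    "\<And>i. i \<in> X \<Longrightarrow> f (unit_vec R X i) = g (unit_vec R X i)" "x \<in> carrier (free_module R X)"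
  shows "f x = g x"
  by (rule module_pair.hom_eq_on_span[OF module_pairI[OF free_left_module assms(3)] assms(1,2),
        of "unit_vec R X ` X"])
    (use assms(4,5) free_span unit_vec_closed in auto)

lemma free_lift:
  assumes N: "left_module R N" and \<phi>: "\<And>i. i \<in> X \<Longrightarrow> \<phi> i \<in> carrier N"
  obtains H where "H \<in> mod_hom R (free_module R X) N" "\<And>i. i \<in> X \<Longrightarrow> H (unit_vec R X i) = \<phi> i"
    "H ` carrier (free_module R X) = mod_span R N (\<phi> ` X)"
    "\<And>f. H f = (\<Oplus>\<^bsub>N\<^esub>i\<in>{i \<in> X. f i \<noteq> \<zero>}. f i \<odot>\<^bsub>N\<^esub> \<phi> i)"
proof -
  interpret N: left_module R N by fact
  have "(\<lambda>r. r \<odot>\<^bsub>N\<^esub> \<phi> i) \<in> mod_hom R (regular_module R) N" if "i \<in> X" for i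
    using \<phi>[OF that] by (auto intro!: mod_homI simp: N.smult_closed N.smult_l_distr N.smult_assoc1)
  from module_family.lift[OF free_family N this, of X "\<lambda>i. i"] obtain H
    where H: "H \<in> mod_hom R (free_module R X) N"
      "\<And>i m. i \<in> X \<Longrightarrow> m \<in> carrier R \<Longrightarrow> H (single X (\<lambda>_. regular_module R) i m) = m \<odot>\<^bsub>N\<^esub> \<phi> i"
      "\<And>f. H f = (\<Oplus>\<^bsub>N\<^esub>i\<in>{i \<in> X. f i \<noteq> \<zero>}. f i \<odot>\<^bsub>N\<^esub> \<phi> i)"
    by (auto simp: free_module_def)
  have Hu: "H (unit_vec R X i) = \<phi> i" if "i \<in> X" for i
    using H(2)[OF that, of "\<one>"] \<phi>[OF that] by (simp add: unit_vec_def N.smult_one)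
  have "H ` carrier (free_module R X) = mod_span R N (H ` unit_vec R X ` X)"
    using module_pair.image_span[OF module_pairI[OF free_left_module N] H(1), of "unit_vec R X ` X"]
    by (simp add: free_span image_subset_iff unit_vec_closed)
  also have "H ` unit_vec R X ` X = \<phi> ` X" using Hu by (auto simp: image_iff)
  finally show ?thesis using that H(1,3) Hu by blast
qed

lemma free_lifting:
  assumes A: "left_module R A" and B: "left_module R B"
    and p: "p \<in> mod_hom R A B" "p ` carrier A = carrier B"
    and h: "h \<in> mod_hom R (free_module R X) B"
  obtains g where "g \<in> mod_hom R (free_module R X) A"
    "\<And>x. x \<in> carrier (free_module R X) \<Longrightarrow> p (g x) = h x"
proof -
  have "\<exists>a. a \<in> carrier A \<and> p a = h (unit_vec R X i)" if "i \<in> X" for i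
    using mod_homD(1)[OF h unit_vec_closed[OF that]] p(2) by (metis imageE)
  then obtain \<phi> where \<phi>: "\<And>i. i \<in> X \<Longrightarrow> \<phi> i \<in> carrier A \<and> p (\<phi> i) = h (unit_vec R X i)" by metis
  obtain g where g: "g \<in> mod_hom R (free_module R X) A" "\<And>i. i \<in> X \<Longrightarrow> g (unit_vec R X i) = \<phi> i"
    by (rule free_lift[OF A, of X \<phi>]) (use \<phi> in auto)
  have "p (g x) = h x" if "x \<in> carrier (free_module R X)" for x
    by (rule free_hom_eqI[OF mod_hom_comp[OF g(1) p(1)] h B _ that]) (use g(2) \<phi> in auto)
  with g(1) show ?thesis using that by blast
qed

lemma free_cover:
  assumes "left_module R M"
  obtains \<pi> where "\<pi> \<in> mod_hom R (free_module R (carrier M)) M"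
    "\<pi> ` carrier (free_module R (carrier M)) = carrier M"
proof -
  interpret left_module R M by fact
  have "mod_span R M ((\<lambda>x. x) ` carrier M) = carrier M"
    using span_superset[of "carrier M"] span_carrier[of "carrier M"] by auto
  then show ?thesis by (rule_tac free_lift[OF assms, of "carrier M" "\<lambda>x. x"]) (use that in auto)
qed

end

lemma projective_left_module: "projective R P \<Longrightarrow> left_module R P"
  by (simp add: projective_def)

lemma left_module_ring: "left_module R M \<Longrightarrow> ring R"
  by (simp add: left_module_def)

lemma projective_lifting:
  fixes P :: "('r, 'c) module"
  assumes P: "projective R P" and A: "left_module R A" and B: "left_module R B"
    and p: "p \<in> mod_hom R A B" "p ` carrier A = carrier B"
    and h: "h \<in> mod_hom R P B"
  obtains g where "g \<in> mod_hom R P A" "\<And>x. x \<in> carrier P \<Longrightarrow> p (g x) = h x"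
proof -
  interpret ring R using A by (rule left_module_ring)
  from P obtain X :: "'c set" and i q where iq: "i \<in> mod_hom R P (free_module R X)"
    "q \<in> mod_hom R (free_module R X) P" "\<And>x. x \<in> carrier P \<Longrightarrow> q (i x) = x"
    unfolding projective_def by blast
  obtain g where g: "g \<in> mod_hom R (free_module R X) A"
    "\<And>x. x \<in> carrier (free_module R X) \<Longrightarrow> p (g x) = h (q x)"
    using free_lifting[OF A B p mod_hom_comp[OF iq(2) h]] by blast
  show ?thesis
    by (rule that[OF mod_hom_comp[OF iq(1) g(1)]]) (use g(2) iq mod_homD(1)[OF iq(1)] in auto)
qed

text \<open>The definition of \<open>projective\<close> takes the index set in the type of
  \<open>P\<close>. A retraction from the free module on a set \<open>X\<close> of another type is
  moved to the free module on \<open>carrier P\<close> by lifting \<open>b\<close> through the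
  canonical surjection.\<close>

lemma projectiveI:
  assumes P: "left_module R P" and a: "a \<in> mod_hom R P (free_module R X)"
    and b: "b \<in> mod_hom R (free_module R X) P" and ba: "\<And>x. x \<in> carrier P \<Longrightarrow> b (a x) = x"
  shows "projective R P"
proof -
  interpret ring R using P by (rule left_module_ring)
  obtain \<pi> where \<pi>: "\<pi> \<in> mod_hom R (free_module R (carrier P)) P"
    "\<pi> ` carrier (free_module R (carrier P)) = carrier P"
    using free_cover[OF P] .
  obtain g where g: "g \<in> mod_hom R (free_module R X) (free_module R (carrier P))"
    "\<And>x. x \<in> carrier (free_module R X) \<Longrightarrow> \<pi> (g x) = b x"
    using free_lifting[OF free_left_module P \<pi> b] by blast
  show ?thesis unfolding projective_def
    using P \<pi>(1) mod_hom_comp[OF a g(1)] g(2) ba mod_homD(1)[OF a]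
    by (intro conjI exI[of _ "carrier P"] bexI[of _ \<pi>] bexI[of _ "\<lambda>x. g (a x)"]) auto
qed

lemma projective_split:
  assumes P: "projective R P" and A: "left_module R A"
    and p: "p \<in> mod_hom R A P" "p ` carrier A = carrier P"
  obtains s where "s \<in> mod_hom R P A" "\<And>x. x \<in> carrier P \<Longrightarrow> p (s x) = x"
  using projective_lifting[OF P A projective_left_module[OF P] p mod_hom_id] by blast

text \<open>Only the canonical surjection from the free module on \<open>carrier P\<close> has to
  split. This is the form in which the adjunction arguments deliver projectivity.\<close>

lemma projective_if_split:
  assumes P: "left_module R P"
    and "\<And>\<pi>. \<pi> \<in> mod_hom R (free_module R (carrier P)) P \<Longrightarrow>
      \<pi> ` carrier (free_module R (carrier P)) = carrier P \<Longrightarrow>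
      \<exists>s. s \<in> mod_hom R P (free_module R (carrier P)) \<and> (\<forall>x\<in>carrier P. \<pi> (s x) = x)"
  shows "projective R P"
proof -
  obtain \<pi> where \<pi>: "\<pi> \<in> mod_hom R (free_module R (carrier P)) P"
    "\<pi> ` carrier (free_module R (carrier P)) = carrier P"
    using ring.free_cover[OF left_module_ring[OF P] P] .
  with assms(2)[OF \<pi>] show ?thesis using projectiveI[OF P _ \<pi>(1)] by blast
qed

text \<open>The identity of \<open>M\<close> is the sum of a map through \<open>N\<close> and a map
  through the projective \<open>W\<close>, i.e. \<open>M\<close> is a direct summand of the sum of
  \<open>N\<close> and \<open>W\<close>. The sum itself is avoided because \<open>N\<close> and
  \<open>W\<close> have different carrier types.\<close>

definition stable_retract ::
  "('r, 'x) ring_scheme \<Rightarrow> ('r, 'm) module \<Rightarrow> ('r, 'n) module \<Rightarrow> ('r, 'w) module \<Rightarrow> bool" where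
  "stable_retract R M N W \<longleftrightarrow> left_module R M \<and> left_module R N \<and> projective R W \<and>
     (\<exists>f\<in>mod_hom R M N. \<exists>g\<in>mod_hom R N M. \<exists>a\<in>mod_hom R M W. \<exists>b\<in>mod_hom R W M.
        \<forall>x\<in>carrier M. g (f x) \<oplus>\<^bsub>M\<^esub> b (a x) = x)"

text \<open>Lifting \<open>g\<close> and \<open>b\<close> separately through a free cover of
  \<open>M\<close> and adding the two composites gives a section of the cover.\<close>

lemma stable_retract_projective:
  assumes "stable_retract R M N W" "projective R N"
  shows "projective R M"
proof -
  from assms(1) obtain f g a b where M: "left_module R M" and W: "projective R W"
    and f: "f \<in> mod_hom R M N" and g: "g \<in> mod_hom R N M"
    and a: "a \<in> mod_hom R M W" and b: "b \<in> mod_hom R W M"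
    and eq: "\<And>x. x \<in> carrier M \<Longrightarrow> g (f x) \<oplus>\<^bsub>M\<^esub> b (a x) = x"
    unfolding stable_retract_def by blast
  interpret left_module R M by (rule M)
  let ?F = "free_module R (carrier M)"
  interpret F: left_module R ?F by (rule R.free_left_module)
  show ?thesis
  proof (rule projective_if_split[OF M])
    fix \<pi> assume \<pi>: "\<pi> \<in> mod_hom R ?F M" "\<pi> ` carrier ?F = carrier M"
    obtain g' where g': "g' \<in> mod_hom R N ?F" "\<And>x. x \<in> carrier N \<Longrightarrow> \<pi> (g' x) = g x"
      using projective_lifting[OF assms(2) F.left_module_axioms M \<pi> g] by blast
    obtain b' where b': "b' \<in> mod_hom R W ?F" "\<And>x. x \<in> carrier W \<Longrightarrow> \<pi> (b' x) = b x"
      using projective_lifting[OF W F.left_module_axioms M \<pi> b] by blast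
    have "(\<lambda>x. g' (f x) \<oplus>\<^bsub>?F\<^esub> b' (a x)) \<in> mod_hom R M ?F"
      using module_pair.hom_add_fun[OF module_pairI[OF M F.left_module_axioms]
          mod_hom_comp[OF f g'(1)] mod_hom_comp[OF a b'(1)]] .
    moreover have "\<pi> (g' (f x) \<oplus>\<^bsub>?F\<^esub> b' (a x)) = x" if "x \<in> carrier M" for x
      using that mod_homD(1)[OF f] mod_homD(1)[OF a] mod_homD(1)[OF g'(1)] mod_homD(1)[OF b'(1)]
      by (simp add: mod_homD(2)[OF \<pi>(1)] g'(2) b'(2) eq)
    ultimately show "\<exists>s. s \<in> mod_hom R M ?F \<and> (\<forall>x\<in>carrier M. \<pi> (s x) = x)" by blast
  qed
qed

lemma stable_retract_iso:
  fixes W :: "('r, 'w) module"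
  assumes "left_module R M" "left_module R N" "projective R W"
    "f \<in> mod_hom R M N" "g \<in> mod_hom R N M" "\<And>x. x \<in> carrier M \<Longrightarrow> g (f x) = x"
  shows "stable_retract R M N W"
proof -
  interpret M: left_module R M by fact
  interpret MW: module_pair R M W
    by (intro module_pairI assms projective_left_module[OF assms(3)])
  interpret WM: module_pair R W M
    by (intro module_pairI assms projective_left_module[OF assms(3)])
  show ?thesis unfolding stable_retract_def
    using assms MW.hom_zero_fun WM.hom_zero_fun
    by (intro conjI bexI[of _ f] bexI[of _ g] bexI[of _ "\<lambda>x. \<zero>\<^bsub>W\<^esub>"] bexI[of _ "\<lambda>x. \<zero>\<^bsub>M\<^esub>"]) auto
qed

lemma projective_retract:
  assumes "left_module R M" "projective R N"
    "f \<in> mod_hom R M N" "g \<in> mod_hom R N M" "\<And>x. x \<in> carrier M \<Longrightarrow> g (f x) = x"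
  shows "projective R M"
  using stable_retract_projective[OF stable_retract_iso[OF assms(1) _ assms(2) assms(3-5)] assms(2)]
    projective_left_module[OF assms(2)] by blast

section \<open>Short exact sequences and Schanuel's argument\<close>

definition short_exact ::
  "('r, 'x) ring_scheme \<Rightarrow> ('r, 'k) module \<Rightarrow> ('r, 'p) module \<Rightarrow> ('r, 'm) module \<Rightarrow>
   ('k \<Rightarrow> 'p) \<Rightarrow> ('p \<Rightarrow> 'm) \<Rightarrow> bool" where
  "short_exact R K P M i p \<longleftrightarrow> left_module R K \<and> left_module R P \<and> left_module R M \<and>
     i \<in> mod_hom R K P \<and> p \<in> mod_hom R P M \<and> inj_on i (carrier K) \<and>
     p ` carrier P = carrier M \<and> i ` carrier K = a_kernel P M p"

lemma short_exactD:
  assumes "short_exact R K P M i p"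
  shows "left_module R K" "left_module R P" "left_module R M"
    "i \<in> mod_hom R K P" "p \<in> mod_hom R P M" "inj_on i (carrier K)"
    "p ` carrier P = carrier M" "i ` carrier K = a_kernel P M p"
    "\<And>k. k \<in> carrier K \<Longrightarrow> p (i k) = \<zero>\<^bsub>M\<^esub>"
    "\<And>x. x \<in> carrier P \<Longrightarrow> p x = \<zero>\<^bsub>M\<^esub> \<Longrightarrow> \<exists>k\<in>carrier K. i k = x"
proof -
  show *: "left_module R K" "left_module R P" "left_module R M"
    "i \<in> mod_hom R K P" "p \<in> mod_hom R P M" "inj_on i (carrier K)"
    "p ` carrier P = carrier M" "i ` carrier K = a_kernel P M p"
    using assms by (auto simp: short_exact_def)
  show "p (i k) = \<zero>\<^bsub>M\<^esub>" if "k \<in> carrier K" for k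
  proof -
    have "i k \<in> a_kernel P M p" using that *(8) by blast
    then show ?thesis by (simp add: a_kernel_def')
  qed
  show "\<exists>k\<in>carrier K. i k = x" if "x \<in> carrier P" "p x = \<zero>\<^bsub>M\<^esub>" for x
  proof -
    have "x \<in> i ` carrier K" using that *(8) by (simp add: a_kernel_def')
    then show ?thesis by blast
  qed
qed

lemma short_exact_kernel:
  assumes "left_module R P" "left_module R M" "p \<in> mod_hom R P M" "p ` carrier P = carrier M"
  shows "short_exact R (P\<lparr>carrier := a_kernel P M p\<rparr>) P M (\<lambda>x. x) p"
proof -
  interpret module_pair R P M using assms(1,2) by (rule module_pairI)
  show ?thesis unfolding short_exact_def
    using assms M.submodule_left_module[OF kernel_submodule] mod_hom_inclusion[OF M.submoduleD(1)[OF kernel_submodule]]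
    by auto
qed

lemma factor_through_kernel:
  assumes ex: "short_exact R K P M i p" and X: "left_module R X"
    and h: "h \<in> mod_hom R X P" "\<And>x. x \<in> carrier X \<Longrightarrow> p (h x) = \<zero>\<^bsub>M\<^esub>"
  obtains h' where "h' \<in> mod_hom R X K" "\<And>x. x \<in> carrier X \<Longrightarrow> i (h' x) = h x"
proof -
  note e = short_exactD[OF ex]
  interpret XK: module_pair R X K using X e(1) by (rule module_pairI)
  have "\<exists>k. k \<in> carrier K \<and> i k = h x" if "x \<in> carrier X" for x
    using e(10) mod_homD(1)[OF h(1)] h(2) that by blast
  then obtain h' where h': "\<And>x. x \<in> carrier X \<Longrightarrow> h' x \<in> carrier K \<and> i (h' x) = h x" by metis
  have "h' \<in> mod_hom R X K"
  proof (rule mod_homI)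
    show "h' x \<in> carrier K" if "x \<in> carrier X" for x using h' that by blast
    show "h' (x \<oplus>\<^bsub>X\<^esub> y) = h' x \<oplus>\<^bsub>K\<^esub> h' y" if "x \<in> carrier X" "y \<in> carrier X" for x y
      using that h' by (intro inj_onD[OF e(6)]) (auto simp: mod_homD(2)[OF e(4)] mod_homD(2)[OF h(1)])
    show "h' (r \<odot>\<^bsub>X\<^esub> x) = r \<odot>\<^bsub>K\<^esub> h' x" if "r \<in> carrier R" "x \<in> carrier X" for r x
      using that h' XK.M.smult_closed XK.N.smult_closed
      by (intro inj_onD[OF e(6)]) (auto simp: mod_homD(3)[OF e(4)] mod_homD(3)[OF h(1)])
  qed
  with h' that show ?thesis by blast
qed

text \<open>Asymmetric form of Schanuel's lemma: a stable retraction of \<open>M\<close> onto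
  \<open>N\<close> passes to the kernels of projective covers or presentations, and the middle term
  \<open>P\<close> takes over the role of the complement \<open>W\<close>. Iterating it compares
  syzygies in arbitrary projective resolutions.\<close>

lemma stable_retract_kernel:
  assumes E1: "short_exact R K P M i p" and E2: "short_exact R L Q N j q"
    and P: "projective R P" and Q: "projective R Q" and st: "stable_retract R M N W"
  shows "stable_retract R K L P"
proof -
  note e = short_exactD[OF E1] and e' = short_exactD[OF E2]
  from st obtain f g a b where W: "projective R W"
    and f: "f \<in> mod_hom R M N" and g: "g \<in> mod_hom R N M"
    and a: "a \<in> mod_hom R M W" and b: "b \<in> mod_hom R W M"
    and eq: "\<And>x. x \<in> carrier M \<Longrightarrow> g (f x) \<oplus>\<^bsub>M\<^esub> b (a x) = x"
    unfolding stable_retract_def by blast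
  interpret K: left_module R K by (rule e)
  interpret P: left_module R P by (rule e)
  interpret M: left_module R M by (rule e)
  interpret L: left_module R L by (rule e')
  interpret Q: left_module R Q by (rule e')
  interpret N: left_module R N by (rule e')
  interpret W: left_module R W by (rule projective_left_module[OF W])
  obtain F where F: "F \<in> mod_hom R P Q" "\<And>x. x \<in> carrier P \<Longrightarrow> q (F x) = f (p x)"
    using projective_lifting[OF P e'(2,3,5,7) mod_hom_comp[OF e(5) f]] by blast
  obtain G where G: "G \<in> mod_hom R Q P" "\<And>x. x \<in> carrier Q \<Longrightarrow> p (G x) = g (q x)"
    using projective_lifting[OF Q e(2,3,5,7) mod_hom_comp[OF e'(5) g]] by blast
  obtain B where B: "B \<in> mod_hom R W P" "\<And>x. x \<in> carrier W \<Longrightarrow> p (B x) = b x"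
    using projective_lifting[OF W e(2,3,5,7) b] by blast
  interpret PP: module_pair R P P by unfold_locales
  interpret KP: module_pair R K P by unfold_locales
  interpret PM: module_pair R P M by unfold_locales
  interpret MN: module_pair R M N by unfold_locales
  interpret NM: module_pair R N M by unfold_locales
  interpret MW: module_pair R M W by unfold_locales
  interpret WP: module_pair R W P by unfold_locales
  note c = mod_homD(1)[OF F(1)] mod_homD(1)[OF G(1)] mod_homD(1)[OF B(1)] mod_homD(1)[OF e(5)]
    mod_homD(1)[OF e'(5)] mod_homD(1)[OF e(4)] mod_homD(1)[OF e'(4)] mod_homD(1)[OF f]
    mod_homD(1)[OF g] mod_homD(1)[OF a] mod_homD(1)[OF b]
  \<comment> \<open>The error of the lifted retraction. Its image under \<open>p\<close> is p x - (g
    f p x + b a p x) = 0, so it factors through \<open>K\<close> as \<open>h'\<close>. On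
    \<open>K\<close> the summand through \<open>W\<close> dies because p i = 0, and there the
    definition reads id = g' f' + h' i.\<close>
  define h where "h x = x \<ominus>\<^bsub>P\<^esub> (G (F x) \<oplus>\<^bsub>P\<^esub> B (a (p x)))" for x
  have h: "h \<in> mod_hom R P P" unfolding h_def
    by (intro PP.hom_diff_fun PP.hom_add_fun mod_hom_id mod_hom_comp[OF F(1) G(1)]
        mod_hom_comp[OF mod_hom_comp[OF e(5) a] B(1)])
  have ph: "p (h x) = \<zero>\<^bsub>M\<^esub>" if "x \<in> carrier P" for x
    using that c by (simp add: h_def PM.hom_diff[OF e(5)] mod_homD(2)[OF e(5)] G(2) F(2) B(2) eq
        M.M.diff_eq_zero_iff)
  obtain h' where h': "h' \<in> mod_hom R P K" "\<And>x. x \<in> carrier P \<Longrightarrow> i (h' x) = h x"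
    using factor_through_kernel[OF E1 e(2) h ph] by blast
  obtain f' where f': "f' \<in> mod_hom R K L" "\<And>x. x \<in> carrier K \<Longrightarrow> j (f' x) = F (i x)"
    by (rule factor_through_kernel[OF E2 e(1) mod_hom_comp[OF e(4) F(1)]])
      (auto simp: F(2) c e(9) MN.hom_zero[OF f])
  obtain g' where g': "g' \<in> mod_hom R L K" "\<And>x. x \<in> carrier L \<Longrightarrow> i (g' x) = G (j x)"
    by (rule factor_through_kernel[OF E1 e'(1) mod_hom_comp[OF e'(4) G(1)]])
      (auto simp: G(2) c e'(9) NM.hom_zero[OF g])
  have "g' (f' x) \<oplus>\<^bsub>K\<^esub> h' (i x) = x" if x: "x \<in> carrier K" for x
  proof (rule inj_onD[OF e(6)])
    note c' = mod_homD(1)[OF f'(1)] mod_homD(1)[OF g'(1)] mod_homD(1)[OF h'(1)]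
    have "i (g' (f' x) \<oplus>\<^bsub>K\<^esub> h' (i x)) = G (F (i x)) \<oplus>\<^bsub>P\<^esub> h (i x)"
      using x c c' by (simp add: mod_homD(2)[OF e(4)] g'(2) f'(2) h'(2))
    also have "h (i x) = i x \<ominus>\<^bsub>P\<^esub> G (F (i x))"
      using x c by (simp add: h_def e(9) MW.hom_zero[OF a] WP.hom_zero[OF B(1)])
    also have "G (F (i x)) \<oplus>\<^bsub>P\<^esub> (i x \<ominus>\<^bsub>P\<^esub> G (F (i x))) = i x"
      using x c by (simp add: a_minus_def P.M.a_lcomm[of "G (F (i x))"] P.M.r_neg)
    finally show "i (g' (f' x) \<oplus>\<^bsub>K\<^esub> h' (i x)) = i x" .
  qed (use x mod_homD(1)[OF f'(1)] mod_homD(1)[OF g'(1)] mod_homD(1)[OF h'(1)] c in auto)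
  then show ?thesis unfolding stable_retract_def
    using P e(1) e'(1) f'(1) g'(1) e(4) h'(1) by blast
qed

section \<open>Finite length\<close>

text \<open>A bounded rank function that is strictly increasing on submodules. It yields both chain
  conditions at once, and it passes to any coarser family of submodules: the rank by
  \<open>K\<close>-dimension also serves for \<open>A\<close>-submodules.\<close>

definition finite_length :: "('r, 'x) ring_scheme \<Rightarrow> ('r, 'm) module \<Rightarrow> bool" where
  "finite_length R M \<longleftrightarrow> (\<exists>(d :: 'm set \<Rightarrow> nat) N. \<forall>U. submodule U R M \<longrightarrow>
     d U \<le> N \<and> (\<forall>V. submodule V R M \<and> U \<subset> V \<longrightarrow> d U < d V))"

lemma finite_length_minimal:
  assumes "finite_length R M" "submodule U R M" "Q U"
  obtains V where "submodule V R M" "Q V" "\<And>W. submodule W R M \<Longrightarrow> Q W \<Longrightarrow> W \<subseteq> V \<Longrightarrow> W = V"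
proof -
  from assms(1) obtain d :: "'c set \<Rightarrow> nat" and N where
    d: "\<And>U V. submodule U R M \<Longrightarrow> submodule V R M \<Longrightarrow> U \<subset> V \<Longrightarrow> d U < d V"
    unfolding finite_length_def by blast
  obtain V where V: "submodule V R M \<and> Q V" "\<And>W. submodule W R M \<and> Q W \<Longrightarrow> d V \<le> d W"
    using ex_has_least_nat[of "\<lambda>V. submodule V R M \<and> Q V" U d] assms(2,3) by blast
  show ?thesis
  proof (rule that[of V])
    fix W assume W: "submodule W R M" "Q W" "W \<subseteq> V"
    show "W = V"
    proof (rule ccontr)
      assume "W \<noteq> V"
      then have "d W < d V" using W V(1) by (intro d) auto
      then show False using V(2)[of W] W by simp
    qed
  qed (use V in auto)
qed

lemma finite_length_maximal:
  assumes "finite_length R M" "submodule U R M" "Q U"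
  obtains V where "submodule V R M" "Q V" "\<And>W. submodule W R M \<Longrightarrow> Q W \<Longrightarrow> V \<subseteq> W \<Longrightarrow> W = V"
proof -
  from assms(1) obtain d :: "'c set \<Rightarrow> nat" and N where
    d: "\<And>U V. submodule U R M \<Longrightarrow> submodule V R M \<Longrightarrow> U \<subset> V \<Longrightarrow> d U < d V"
    and N: "\<And>U. submodule U R M \<Longrightarrow> d U \<le> N"
    unfolding finite_length_def by blast
  have "\<exists>V. (submodule V R M \<and> Q V) \<and> (\<forall>W. submodule W R M \<and> Q W \<longrightarrow> d W \<le> d V)"
    by (rule ex_has_greatest_nat[of _ U _ "Suc N"]) (use assms(2,3) N in \<open>auto simp: less_Suc_eq_le\<close>)
  then obtain V where V: "submodule V R M \<and> Q V" "\<And>W. submodule W R M \<and> Q W \<Longrightarrow> d W \<le> d V"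
    by auto
  show ?thesis
  proof (rule that[of V])
    fix W assume W: "submodule W R M" "Q W" "V \<subseteq> W"
    show "W = V"
    proof (rule ccontr)
      assume "W \<noteq> V"
      then have "d V < d W" using W V(1) by (intro d) auto
      then show False using V(2)[of W] W by simp
    qed
  qed (use V in auto)
qed

text \<open>A maximal finitely generated submodule of \<open>U\<close> absorbs every further element
  of \<open>U\<close>.\<close>

lemma finite_length_fin_gen:
  assumes M: "left_module R M" and fl: "finite_length R M" and U: "submodule U R M"
  obtains S where "finite S" "S \<subseteq> U" "mod_span R M S = U"
proof -
  interpret left_module R M by (rule M)
  let ?Q = "\<lambda>V. \<exists>S. finite S \<and> S \<subseteq> U \<and> mod_span R M S = V"
  have "?Q (mod_span R M {})" by blast
  then obtain V where V: "submodule V R M" "?Q V" "\<And>W. submodule W R M \<Longrightarrow> ?Q W \<Longrightarrow> V \<subseteq> W \<Longrightarrow> W = V"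
    by (rule finite_length_maximal[OF fl span_submodule[of "{}"], rotated]) (simp, blast)
  then obtain S where S: "finite S" "S \<subseteq> U" "mod_span R M S = V" by blast
  have "x \<in> V" if "x \<in> U" for x
  proof -
    have c: "insert x S \<subseteq> carrier M" using S that submoduleD(1)[OF U] by auto
    have "mod_span R M (insert x S) = V"
      using S that c span_mono[of S "insert x S"] by (intro V(3) span_submodule) (auto intro!: exI[of _ "insert x S"])
    then show ?thesis using span_superset[of "insert x S"] by auto
  qed
  moreover have "V \<subseteq> U" using span_least[OF U S(2)] S(3) by simp
  ultimately show ?thesis using that S by blast
qed

lemma finite_length_submodule:
  assumes "left_module R M" "finite_length R M" "submodule U R M"
  shows "finite_length R (M\<lparr>carrier := U\<rparr>)"
  using assms(2) unfolding finite_length_def submodule_of_submodule[OF assms(1,3)] by meson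

lemma fin_gen_submodule:
  assumes "left_module R M" "finite_length R M" "submodule U R M"
  shows "fin_gen R (M\<lparr>carrier := U\<rparr>)"
proof -
  obtain S where "finite S" "S \<subseteq> U" "mod_span R M S = U"
    using finite_length_fin_gen[OF assms] .
  then show ?thesis unfolding fin_gen_def
    using span_restrict[OF assms(1,3)] by (intro exI[of _ S]) simp
qed

text \<open>The kernels of the powers of \<open>f\<close> become stationary, say at
  \<open>n\<close>. If f x = 0 and x is written as the \<open>n\<close>-th power applied to
  \<open>y\<close>, then \<open>y\<close> lies in the kernel of the next power, hence in that of the
  \<open>n\<close>-th, and x = 0.\<close>

lemma surjective_endomorphism_inj:
  assumes M: "left_module R M" and fl: "finite_length R M"
    and f: "f \<in> mod_hom R M M" "f ` carrier M = carrier M"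
  shows "inj_on f (carrier M)"
proof -
  interpret left_module R M by (rule M)
  interpret MM: module_pair R M M by unfold_locales
  have hom: "f ^^ n \<in> mod_hom R M M" for n
  proof (induction n)
    case 0
    then show ?case using mod_hom_id[of R M] by (simp add: id_def)
  next
    case (Suc n)
    then show ?case using mod_hom_comp[OF Suc f(1)] by (simp add: o_def)
  qed
  have surj: "(f ^^ n) ` carrier M = carrier M" for n
  proof (induction n)
    case (Suc n)
    have "(f ^^ Suc n) ` carrier M = f ` (f ^^ n) ` carrier M" by (simp add: image_comp)
    then show ?case using Suc f(2) by simp
  qed simp
  let ?Q = "\<lambda>V. \<exists>n. V = a_kernel M M (f ^^ n)"
  obtain V where V: "submodule V R M" "?Q V" "\<And>W. submodule W R M \<Longrightarrow> ?Q W \<Longrightarrow> V \<subseteq> W \<Longrightarrow> W = V"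
    using finite_length_maximal[OF fl MM.kernel_submodule[OF hom[of 0]], of ?Q] by blast
  then obtain n where n: "V = a_kernel M M (f ^^ n)" by blast
  have "V \<subseteq> a_kernel M M (f ^^ Suc n)"
    using MM.hom_zero[OF f(1)] by (auto simp: n a_kernel_def')
  then have *: "a_kernel M M (f ^^ Suc n) = a_kernel M M (f ^^ n)"
    using V(3)[OF MM.kernel_submodule[OF hom[of "Suc n"]]] n by blast
  show ?thesis
  proof (rule MM.inj_if_kernel_trivial[OF f(1)])
    fix x assume x: "x \<in> carrier M" "f x = \<zero>\<^bsub>M\<^esub>"
    then obtain y where y: "y \<in> carrier M" "x = (f ^^ n) y" using surj[of n] by blast
    then have "y \<in> a_kernel M M (f ^^ Suc n)" using x by (simp add: a_kernel_def')
    then have "y \<in> a_kernel M M (f ^^ n)" using * by simp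
    then show "x = \<zero>\<^bsub>M\<^esub>" using y by (simp add: a_kernel_def')
  qed
qed

lemma span_insert:
  assumes M: "left_module R M" and T: "T \<subseteq> carrier M" "b \<in> carrier M" and x: "x \<in> mod_span R M (insert b T)"
  obtains c y where "c \<in> carrier R" "y \<in> mod_span R M T" "x = y \<oplus>\<^bsub>M\<^esub> c \<odot>\<^bsub>M\<^esub> b"
proof -
  interpret left_module R M by (rule M)
  note D = submoduleD[OF span_submodule[OF T(1)]]
  let ?U = "{y \<oplus>\<^bsub>M\<^esub> c \<odot>\<^bsub>M\<^esub> b | y c. y \<in> mod_span R M T \<and> c \<in> carrier R}"
  have "submodule ?U R M" unfolding submodule_iff
  proof (intro conjI ballI)
    show "?U \<subseteq> carrier M" using D(3) T by (auto simp: smult_closed)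
    show "\<zero>\<^bsub>M\<^esub> \<in> ?U" using D(2) T
      by (auto intro!: exI[of _ "\<zero>\<^bsub>M\<^esub>"] exI[of _ "\<zero>\<^bsub>R\<^esub>"] simp: smult_l_null)
  next
    fix u v assume "u \<in> ?U" "v \<in> ?U"
    then obtain y c y' c' where *: "u = y \<oplus>\<^bsub>M\<^esub> c \<odot>\<^bsub>M\<^esub> b" "v = y' \<oplus>\<^bsub>M\<^esub> c' \<odot>\<^bsub>M\<^esub> b"
      "y \<in> mod_span R M T" "y' \<in> mod_span R M T" "c \<in> carrier R" "c' \<in> carrier R" by blast
    have "u \<oplus>\<^bsub>M\<^esub> v = (y \<oplus>\<^bsub>M\<^esub> y') \<oplus>\<^bsub>M\<^esub> (c \<oplus>\<^bsub>R\<^esub> c') \<odot>\<^bsub>M\<^esub> b"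
      using * D(3) T(2) by (simp add: smult_l_distr smult_closed M.a_ac)
    then show "u \<oplus>\<^bsub>M\<^esub> v \<in> ?U" using * D(4) by blast
  next
    fix a u assume a: "a \<in> carrier R" and "u \<in> ?U"
    then obtain y c where *: "u = y \<oplus>\<^bsub>M\<^esub> c \<odot>\<^bsub>M\<^esub> b" "y \<in> mod_span R M T" "c \<in> carrier R" by blast
    have "a \<odot>\<^bsub>M\<^esub> u = a \<odot>\<^bsub>M\<^esub> y \<oplus>\<^bsub>M\<^esub> (a \<otimes>\<^bsub>R\<^esub> c) \<odot>\<^bsub>M\<^esub> b"
      using a * D(3) T(2) by (simp add: smult_r_distr smult_closed smult_assoc1)
    then show "a \<odot>\<^bsub>M\<^esub> u \<in> ?U" using a * D(5) by blast
  qed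
  moreover have "insert b T \<subseteq> ?U"
  proof -
    have "b = \<zero>\<^bsub>M\<^esub> \<oplus>\<^bsub>M\<^esub> \<one>\<^bsub>R\<^esub> \<odot>\<^bsub>M\<^esub> b" using T by (simp add: smult_one)
    then have "b \<in> ?U" using D(2) R.one_closed by blast
    moreover have "t \<in> ?U" if "t \<in> T" for t
    proof -
      have "t = t \<oplus>\<^bsub>M\<^esub> \<zero>\<^bsub>R\<^esub> \<odot>\<^bsub>M\<^esub> b" using T that by (auto simp: smult_l_null)
      then show ?thesis using that span_superset[of T] R.zero_closed by blast
    qed
    ultimately show ?thesis by auto
  qed
  ultimately have "mod_span R M (insert b T) \<subseteq> ?U" by (rule span_least)
  then show ?thesis using x that by blast
qed

text \<open>
  The jumps of a subspace along the flag spanned by the initial segments of a spanning sequence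
  serve as its dimension.
\<close>

lemma vector_space_finite_length:
  assumes K: "field K" and V: "left_module K V" and fg: "fin_gen K V"
  shows "finite_length K V"
proof -
  interpret K: field K by (rule K)
  interpret left_module K V by (rule V)
  from fg obtain bs where bs: "set bs \<subseteq> carrier V" "mod_span K V (set bs) = carrier V"
    unfolding fin_gen_def using finite_list by metis
  define F where "F i = mod_span K V (set (take i bs))" for i
  define J where "J W = {i. i < length bs \<and> (\<exists>w\<in>W. w \<in> F (Suc i) \<and> w \<notin> F i)}" for W
  have tc: "set (take i bs) \<subseteq> carrier V" for i using bs(1) set_take_subset[of i bs] by blast
  note FD = submoduleD[OF span_submodule[OF tc], folded F_def]
  have F_step: "\<exists>c y. c \<in> carrier K \<and> y \<in> F i \<and> x = y \<oplus>\<^bsub>V\<^esub> c \<odot>\<^bsub>V\<^esub> (bs ! i)"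
    if "i < length bs" "x \<in> F (Suc i)" for i x
  proof -
    have "set (take (Suc i) bs) = insert (bs ! i) (set (take i bs))"
      using that(1) by (simp add: take_Suc_conv_app_nth)
    then have "x \<in> mod_span K V (insert (bs ! i) (set (take i bs)))" using that(2) by (simp add: F_def)
    then show ?thesis
      using span_insert[OF V tc, of "bs ! i" x i] bs(1) that(1) nth_mem[OF that(1)] unfolding F_def by blast
  qed
  \<comment> \<open>A subspace is determined by its jumps among the subspaces that contain it. By
    induction on \<open>i\<close>, every element of \<open>W'\<close> inside \<open>F i\<close> is
    in \<open>W\<close>: at a jump of \<open>W'\<close> the subspace \<open>W\<close> jumps too, so
    a suitable multiple of an element of \<open>W\<close> reduces the problem to
    \<open>F i\<close>.\<close>
  have eq: "W = W'" if W: "submodule W K V" "submodule W' K V" "W \<subseteq> W'" "J W' \<subseteq> J W" for W W'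
  proof -
    note D = submoduleD[OF W(1)] and D' = submoduleD[OF W(2)]
    have "w \<in> W" if "i \<le> length bs" "w \<in> W'" "w \<in> F i" for i w
      using that
    proof (induction i arbitrary: w)
      case 0
      have "F 0 = {\<zero>\<^bsub>V\<^esub>}"
        using span_least[OF zero_submodule, of "{}"] FD(2)[of 0] by (auto simp: F_def)
      then show ?case using 0 D(2) by simp
    next
      case (Suc i)
      then have i: "i < length bs" by simp
      then have b: "bs ! i \<in> carrier V" using bs(1) nth_mem by blast
      show ?case
      proof (cases "w \<in> F i")
        case True
        then show ?thesis using Suc by simp
      next
        case False
        then have "i \<in> J W'" using Suc i by (auto simp: J_def)
        then obtain u where u: "u \<in> W" "u \<in> F (Suc i)" "u \<notin> F i" using W(4) by (auto simp: J_def)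
        obtain c y where cy: "c \<in> carrier K" "y \<in> F i" "u = y \<oplus>\<^bsub>V\<^esub> c \<odot>\<^bsub>V\<^esub> (bs ! i)"
          using F_step[OF i u(2)] by blast
        obtain c' y' where cy': "c' \<in> carrier K" "y' \<in> F i" "w = y' \<oplus>\<^bsub>V\<^esub> c' \<odot>\<^bsub>V\<^esub> (bs ! i)"
          using F_step[OF i Suc.prems(3)] by blast
        have "c \<noteq> \<zero>\<^bsub>K\<^esub>" using cy u(3) FD(3) b by (auto simp: smult_l_null)
        then have "c \<in> Units K" using cy(1) K.field_Units by simp
        then have ic: "inv\<^bsub>K\<^esub> c \<in> carrier K" "inv\<^bsub>K\<^esub> c \<otimes>\<^bsub>K\<^esub> c = \<one>\<^bsub>K\<^esub>" by auto
        \<comment> \<open>The quotient of the coefficients of \<open>w\<close> and \<open>u\<close>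
          at \<open>bs ! i\<close>; subtracting \<open>e\<close> times \<open>u\<close> from
          \<open>w\<close> cancels that coefficient.\<close>
        define e where "e = c' \<otimes>\<^bsub>K\<^esub> inv\<^bsub>K\<^esub> c"
        have e: "e \<in> carrier K" "e \<otimes>\<^bsub>K\<^esub> c = c'"
          using ic cy(1) cy'(1) by (simp_all add: e_def K.m_assoc)
        have eu: "e \<odot>\<^bsub>V\<^esub> u \<in> W" using D(5) e u by blast
        have yc: "y \<in> carrier V" "y' \<in> carrier V" using cy cy' FD(3) by auto
        have "w \<ominus>\<^bsub>V\<^esub> e \<odot>\<^bsub>V\<^esub> u = (y' \<ominus>\<^bsub>V\<^esub> e \<odot>\<^bsub>V\<^esub> y) \<oplus>\<^bsub>V\<^esub> (c' \<odot>\<^bsub>V\<^esub> (bs ! i) \<ominus>\<^bsub>V\<^esub> c' \<odot>\<^bsub>V\<^esub> (bs ! i))"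
          using e cy cy' yc b
          by (simp add: a_minus_def smult_r_distr smult_closed smult_assoc1[symmetric] M.minus_add M.a_ac)
        also have "\<dots> = y' \<ominus>\<^bsub>V\<^esub> e \<odot>\<^bsub>V\<^esub> y"
          using e yc cy' b by (simp add: a_minus_def smult_closed M.r_neg)
        finally have *: "w \<ominus>\<^bsub>V\<^esub> e \<odot>\<^bsub>V\<^esub> u \<in> F i" using FD(5,7) cy cy' e by simp
        have "w \<ominus>\<^bsub>V\<^esub> e \<odot>\<^bsub>V\<^esub> u \<in> W" using * eu W(3) D'(7) Suc by (intro Suc.IH) auto
        then have "(w \<ominus>\<^bsub>V\<^esub> e \<odot>\<^bsub>V\<^esub> u) \<oplus>\<^bsub>V\<^esub> e \<odot>\<^bsub>V\<^esub> u \<in> W" using eu D(4) by blast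
        moreover have "(w \<ominus>\<^bsub>V\<^esub> e \<odot>\<^bsub>V\<^esub> u) \<oplus>\<^bsub>V\<^esub> e \<odot>\<^bsub>V\<^esub> u = w"
          using eu D(3) Suc.prems(2) D'(3) by (simp add: a_minus_def M.a_assoc M.l_neg)
        ultimately show ?thesis by simp
      qed
    qed
    from this[of "length bs"] have "W' \<subseteq> W" using D'(1) bs(2) by (auto simp: F_def)
    with W(3) show ?thesis by simp
  qed
  have fin: "finite (J W)" "card (J W) \<le> length bs" for W
    using card_mono[of "{..<length bs}" "J W"] finite_subset[of "J W" "{..<length bs}"] by (auto simp: J_def)
  have "card (J W) < card (J W')" if "submodule W K V" "submodule W' K V" "W \<subset> W'" for W W'
  proof (rule psubset_card_mono[OF fin(1)])
    have "J W \<subseteq> J W'" using that by (auto simp: J_def)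
    then show "J W \<subset> J W'" using eq[of W W'] that by blast
  qed
  then show ?thesis unfolding finite_length_def using fin(2)
    by (intro exI[of _ "\<lambda>W. card (J W)"] exI[of _ "length bs"]) blast
qed

section \<open>Finitely generated modules and finite-dimensional vector spaces\<close>

lemma fin_gen_image:
  assumes "left_module R M" "left_module R N" "f \<in> mod_hom R M N" "f ` carrier M = carrier N" "fin_gen R M"
  shows "fin_gen R N"
proof -
  obtain S where S: "finite S" "S \<subseteq> carrier M" "mod_span R M S = carrier M"
    using assms(5) by (auto simp: fin_gen_def)
  have "mod_span R N (f ` S) = carrier N"
    using module_pair.image_span[OF module_pairI[OF assms(1,2)] assms(3) S(2)] S(3) assms(4) by simp
  then show ?thesis using S mod_homD(1)[OF assms(3)] unfolding fin_gen_def
    by (intro exI[of _ "f ` S"]) auto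
qed

lemma free_fin_gen:
  assumes "ring R" "finite X" shows "fin_gen R (free_module R X)"
proof -
  interpret ring R by fact
  show ?thesis unfolding fin_gen_def
    using assms(2) free_span[of X] unit_vec_closed by (intro exI[of _ "unit_vec R X ` X"]) auto
qed

lemma fin_gen_free_cover:
  assumes M: "left_module R M" and fg: "fin_gen R M"
  obtains n \<pi> where "\<pi> \<in> mod_hom R (free_module R {..<n::nat}) M"
    "\<pi> ` carrier (free_module R {..<n}) = carrier M"
proof -
  interpret left_module R M by (rule M)
  obtain bs where bs: "set bs \<subseteq> carrier M" "mod_span R M (set bs) = carrier M"
    using fg finite_list unfolding fin_gen_def by metis
  have img: "(!) bs ` {..<length bs} = set bs" by (auto simp: set_conv_nth)
  obtain H where "H \<in> mod_hom R (free_module R {..<length bs}) M"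
    "H ` carrier (free_module R {..<length bs}) = mod_span R M ((!) bs ` {..<length bs})"
    by (rule R.free_lift[OF M, of "{..<length bs}" "(!) bs"]) (use bs(1) in auto)
  with bs(2) img that show ?thesis by simp
qed

text \<open>A spanning set of least cardinality is independent: a relation with a nonzero
  coefficient at \<open>b\<close> could be solved for \<open>b\<close>, and \<open>b\<close> could
  be dropped. The free module on the set is then isomorphic to \<open>V\<close>.\<close>

lemma field_fin_gen_projective:
  assumes K: "field K" and V: "left_module K V" and fg: "fin_gen K V"
  shows "projective K V"
proof -
  interpret K: field K by (rule K)
  interpret left_module K V by (rule V)
  let ?P = "\<lambda>S. finite S \<and> S \<subseteq> carrier V \<and> mod_span K V S = carrier V"
  obtain S where "?P S" using fg by (auto simp: fin_gen_def)
  then obtain B where B: "?P B" "\<And>S. ?P S \<Longrightarrow> card B \<le> card S"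
    using ex_has_least_nat[of ?P S card] by blast
  obtain H where H: "H \<in> mod_hom K (free_module K B) V" "\<And>i. i \<in> B \<Longrightarrow> H (unit_vec K B i) = i"
    "H ` carrier (free_module K B) = mod_span K V ((\<lambda>x. x) ` B)"
    by (rule K.free_lift[OF V, of B "\<lambda>x. x"]) (use B in auto)
  let ?F = "free_module K B"
  interpret F: left_module K ?F by (rule K.free_left_module)
  interpret FV: module_pair K ?F V by unfold_locales
  have "inj_on H (carrier ?F)"
  proof (rule FV.inj_if_kernel_trivial[OF H(1)], rule ccontr)
    fix x assume x: "x \<in> carrier ?F" "H x = \<zero>\<^bsub>V\<^esub>" and nz: "x \<noteq> \<zero>\<^bsub>?F\<^esub>"
    obtain b where b: "b \<in> B" "x b \<noteq> \<zero>\<^bsub>K\<^esub>"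
      using x(1) nz module_family.eqI[OF K.free_family, of x B "\<zero>\<^bsub>?F\<^esub>"] F.M.zero_closed
      unfolding free_module_def by (auto simp: module_family.at_simps[OF K.free_family])
    have xb: "x b \<in> carrier K"
      using module_family.carrierD[OF K.free_family, of x B b] x(1) b(1) by (simp add: free_module_def)
    have Bc: "B - {b} \<subseteq> carrier V" "b \<in> carrier V" using B b by auto
    note D = submoduleD[OF span_submodule[OF Bc(1)]]
    \<comment> \<open>Deleting the coordinate at b maps the free module into the span of the other generators.\<close>
    define U where "U = {y \<in> carrier ?F. H y \<ominus>\<^bsub>V\<^esub> y b \<odot>\<^bsub>V\<^esub> b \<in> mod_span K V (B - {b})}"
    have ev: "(\<lambda>y. y b) \<in> mod_hom K ?F (regular_module K)"
      unfolding free_module_def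
      by (rule mod_homI) (use b in \<open>auto simp: module_family.at_simps[OF K.free_family]
          dest: module_family.carrierD[OF K.free_family]\<close>)
    have sm: "(\<lambda>r. r \<odot>\<^bsub>V\<^esub> b) \<in> mod_hom K (regular_module K) V"
      using Bc by (auto intro!: mod_homI simp: smult_closed smult_l_distr smult_assoc1)
    have "submodule U K ?F" unfolding U_def
      by (rule FV.vimage_submodule[OF FV.hom_diff_fun[OF H(1) mod_hom_comp[OF ev sm]] span_submodule[OF Bc(1)]])
    moreover have "unit_vec K B i \<in> U" if "i \<in> B" for i
    proof -
      have "i \<in> carrier V" using that B by auto
      moreover have "i \<in> mod_span K V (B - {b})" if "i \<noteq> b"
        using that \<open>i \<in> B\<close> span_superset[of "B - {b}"] by auto
      ultimately show ?thesis
        using that K.unit_vec_closed[OF that] H(2)[OF that] D(2) b(1) Bc(2)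
        by (auto simp: U_def unit_vec_def single_def smult_one smult_l_null a_minus_def M.r_neg
            M.minus_equality[of "\<zero>\<^bsub>V\<^esub>" "\<zero>\<^bsub>V\<^esub>"])
    qed
    ultimately have "carrier ?F \<subseteq> U"
      using F.span_least[of U "unit_vec K B ` B"] K.free_span[of B] by auto
    then have "\<zero>\<^bsub>V\<^esub> \<ominus>\<^bsub>V\<^esub> x b \<odot>\<^bsub>V\<^esub> b \<in> mod_span K V (B - {b})" using x by (auto simp: U_def)
    then have "\<ominus>\<^bsub>V\<^esub> (\<zero>\<^bsub>V\<^esub> \<ominus>\<^bsub>V\<^esub> x b \<odot>\<^bsub>V\<^esub> b) \<in> mod_span K V (B - {b})" by (rule D(6))
    then have xbb: "x b \<odot>\<^bsub>V\<^esub> b \<in> mod_span K V (B - {b})"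
      using xb Bc by (simp add: a_minus_def smult_closed)
    have u: "x b \<in> Units K" using b(2) xb K.field_Units by simp
    have "inv\<^bsub>K\<^esub> (x b) \<odot>\<^bsub>V\<^esub> (x b \<odot>\<^bsub>V\<^esub> b) \<in> mod_span K V (B - {b})"
      using u xbb D(5) by blast
    then have bs: "b \<in> mod_span K V (B - {b})"
      using u xb Bc by (simp add: smult_assoc1[symmetric] smult_one)
    have "B \<subseteq> mod_span K V (B - {b})" using bs span_superset[of "B - {b}"] by auto
    then have "carrier V \<subseteq> mod_span K V (B - {b})"
      using span_least[OF span_submodule[OF Bc(1)], of B] B by simp
    then have "?P (B - {b})" using B Bc D(1) by auto
    then have "card B \<le> card (B - {b})" by (rule B(2))
    then show False using b B card_Diff1_less[of B b] by simp
  qed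
  then have bij: "bij_betw H (carrier ?F) (carrier V)" using H(3) B(1) by (simp add: bij_betw_def)
  show ?thesis
    by (rule projectiveI[OF V FV.inverse_hom[OF H(1) bij] H(1)])
      (use bij in \<open>auto simp: bij_betw_def f_inv_into_f\<close>)
qed

text \<open>A spanning set of least cardinality is a basis in the sense of \<open>is_basis\<close>,
  so the finite case of \<open>vdim\<close> applies exactly to finitely generated spaces.\<close>

lemma vdim_finite_iff:
  assumes V: "left_module K V" shows "vdim K V < \<infinity> \<longleftrightarrow> fin_gen K V"
proof -
  interpret left_module K V by (rule V)
  have "(\<exists>B. finite B \<and> is_basis K V B) \<longleftrightarrow> fin_gen K V"
  proof
    assume "\<exists>B. finite B \<and> is_basis K V B"
    then show "fin_gen K V" by (auto simp: is_basis_def fin_gen_def)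
  next
    let ?P = "\<lambda>S. finite S \<and> S \<subseteq> carrier V \<and> mod_span K V S = carrier V"
    assume "fin_gen K V"
    then obtain S where "?P S" by (auto simp: fin_gen_def)
    then obtain B where B: "?P B" "\<And>S. ?P S \<Longrightarrow> card B \<le> card S"
      using ex_has_least_nat[of ?P S card] by blast
    have "b \<notin> mod_span K V (B - {b})" if b: "b \<in> B" for b
    proof
      assume bs: "b \<in> mod_span K V (B - {b})"
      have Bc: "B - {b} \<subseteq> carrier V" using B by auto
      have "B \<subseteq> mod_span K V (B - {b})" using bs span_superset[of "B - {b}"] by auto
      then have "carrier V \<subseteq> mod_span K V (B - {b})"
        using span_least[OF span_submodule[OF Bc], of B] B by simp
      then have "?P (B - {b})" using B Bc span_carrier[OF Bc] by auto
      then have "card B \<le> card (B - {b})" by (rule B(2))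
      then show False using b B card_Diff1_less[of B b] by simp
    qed
    then show "\<exists>B. finite B \<and> is_basis K V B" using B(1) by (auto simp: is_basis_def)
  qed
  then show ?thesis by (simp add: vdim_def)
qed

section \<open>Finite-dimensional algebras\<close>

lemma (in assoc_algebra) scalar_mult:
  assumes "c \<in> carrier K" "x \<in> carrier A"
  shows "(c \<odot>\<^bsub>A\<^esub> \<one>\<^bsub>A\<^esub>) \<otimes>\<^bsub>A\<^esub> x = c \<odot>\<^bsub>A\<^esub> x" "x \<otimes>\<^bsub>A\<^esub> (c \<odot>\<^bsub>A\<^esub> \<one>\<^bsub>A\<^esub>) = c \<odot>\<^bsub>A\<^esub> x"
  using assms by (simp_all add: smult_mult_left smult_mult_right)

lemma scalar_restr_left_module:
  assumes "assoc_algebra K A" "left_module A M"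
  shows "left_module K (scalar_restr A M)"
proof -
  interpret assoc_algebra K A by fact
  interpret M: left_module A M by fact
  have cc: "c \<odot>\<^bsub>A\<^esub> \<one>\<^bsub>A\<^esub> \<in> carrier A" if "c \<in> carrier K" for c using that by simp
  show ?thesis
  proof (rule left_moduleI)
    show "ring K" by (rule R.ring_axioms)
    show "abelian_group (scalar_restr A M)"
      by (rule abelian_group_cong[OF M.M.abelian_group_axioms]) auto
    fix a b x assume *: "a \<in> carrier K" "b \<in> carrier K" "x \<in> carrier (scalar_restr A M)"
    show "a \<otimes>\<^bsub>K\<^esub> b \<odot>\<^bsub>scalar_restr A M\<^esub> x = a \<odot>\<^bsub>scalar_restr A M\<^esub> (b \<odot>\<^bsub>scalar_restr A M\<^esub> x)"
      using * cc M.smult_assoc1[of "a \<odot>\<^bsub>A\<^esub> \<one>\<^bsub>A\<^esub>" "b \<odot>\<^bsub>A\<^esub> \<one>\<^bsub>A\<^esub>" x]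
      by (simp add: scalar_mult(1) smult_assoc1)
  qed (auto simp: M.smult_closed M.smult_l_distr M.smult_r_distr M.smult_one smult_l_distr)
qed

lemma mod_hom_scalar_restr:
  assumes "assoc_algebra K A" "f \<in> mod_hom A M N"
  shows "f \<in> mod_hom K (scalar_restr A M) (scalar_restr A N)"
proof -
  interpret assoc_algebra K A by fact
  show ?thesis by (rule mod_homI) (auto simp: mod_homD[OF assms(2)])
qed

lemma submodule_scalar_restr:
  assumes "assoc_algebra K A" "left_module A M" "submodule U A M"
  shows "submodule U K (scalar_restr A M)"
proof -
  interpret assoc_algebra K A by fact
  interpret M: left_module A M by fact
  interpret S: left_module K "scalar_restr A M" by (rule scalar_restr_left_module[OF assms(1,2)])
  show ?thesis using M.submoduleD[OF assms(3)] by (auto simp: S.submodule_iff)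
qed

locale fd_algebra =
  fixes K :: "('k, 'x) ring_scheme" and A :: "('k, 'a) module"
  assumes K: "field K" and alg: "assoc_algebra K A" and fg: "fin_gen K A"
begin

sublocale field K by (rule K)
sublocale A: assoc_algebra K A by (rule alg)

lemma A_left_module: "left_module K A"
  by (rule module_imp_left_module) unfold_locales

lemma A_ring: "ring A" ..

lemmas scalar_module = scalar_restr_left_module[OF alg]

text \<open>The products of a finite spanning set \<open>B\<close> of \<open>A\<close> with a finite
  generating set \<open>S\<close> of \<open>M\<close> span \<open>M\<close> over \<open>K\<close>.
  The point is that their \<open>K\<close>-span \<open>W\<close> is stable under
  \<open>A\<close>.\<close>

lemma fin_gen_scalar_restr:
  assumes M: "left_module A M" and fgM: "fin_gen A M"
  shows "fin_gen K (scalar_restr A M)"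
proof -
  interpret M: left_module A M by (rule M)
  interpret KM: left_module K "scalar_restr A M" by (rule scalar_module[OF M])
  interpret KA: left_module K A by (rule A_left_module)
  obtain S where S: "finite S" "S \<subseteq> carrier M" "mod_span A M S = carrier M"
    using fgM by (auto simp: fin_gen_def)
  obtain B where B: "finite B" "B \<subseteq> carrier A" "mod_span K A B = carrier A"
    using fg by (auto simp: fin_gen_def)
  let ?T = "(\<lambda>(b, s). b \<odot>\<^bsub>M\<^esub> s) ` (B \<times> S)"
  have T: "?T \<subseteq> carrier M" using B S by (auto intro!: M.smult_closed)
  define W where "W = mod_span K (scalar_restr A M) ?T"
  have W: "submodule W K (scalar_restr A M)"
    unfolding W_def using T by (intro KM.span_submodule) simp
  note WD = KM.submoduleD[OF W, simplified]
  have TW: "?T \<subseteq> W" unfolding W_def by (rule KM.span_superset)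
  \<comment> \<open>The elements of \<open>A\<close> that send \<open>x\<close> into
    \<open>W\<close> form a \<open>K\<close>-subspace, so membership is only tested on the spanning
    set \<open>B\<close>.\<close>
  have ext: "a \<odot>\<^bsub>M\<^esub> x \<in> W" if "a \<in> carrier A" "x \<in> carrier M" "\<And>b. b \<in> B \<Longrightarrow> b \<odot>\<^bsub>M\<^esub> x \<in> W" for a x
  proof -
    have "submodule {a \<in> carrier A. a \<odot>\<^bsub>M\<^esub> x \<in> W} K A"
      unfolding KA.submodule_iff
    proof (intro conjI ballI)
      fix c a assume c: "c \<in> carrier K" and a: "a \<in> {a \<in> carrier A. a \<odot>\<^bsub>M\<^esub> x \<in> W}"
      have "(c \<odot>\<^bsub>A\<^esub> a) \<odot>\<^bsub>M\<^esub> x = (c \<odot>\<^bsub>A\<^esub> \<one>\<^bsub>A\<^esub>) \<odot>\<^bsub>M\<^esub> (a \<odot>\<^bsub>M\<^esub> x)"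
        using c a that(2) M.smult_assoc1[of "c \<odot>\<^bsub>A\<^esub> \<one>\<^bsub>A\<^esub>" a x] by (simp add: A.scalar_mult)
      then show "c \<odot>\<^bsub>A\<^esub> a \<in> {a \<in> carrier A. a \<odot>\<^bsub>M\<^esub> x \<in> W}" using c a WD(5) by simp
    qed (use that(2) WD(2,4) in \<open>auto simp: M.smult_l_distr M.smult_l_null\<close>)
    from KA.span_least[OF this, of B] B that show ?thesis by auto
  qed
  have "submodule W A M" unfolding M.submodule_iff
  proof (intro conjI ballI)
    fix a x assume a: "a \<in> carrier A" and x: "x \<in> W"
    have "submodule {x \<in> carrier M. a \<odot>\<^bsub>M\<^esub> x \<in> W} K (scalar_restr A M)"
      unfolding KM.submodule_iff
    proof (intro conjI ballI)
      fix c y assume c: "c \<in> carrier K" and y: "y \<in> {x \<in> carrier M. a \<odot>\<^bsub>M\<^esub> x \<in> W}"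
      have "a \<odot>\<^bsub>M\<^esub> ((c \<odot>\<^bsub>A\<^esub> \<one>\<^bsub>A\<^esub>) \<odot>\<^bsub>M\<^esub> y) = (c \<odot>\<^bsub>A\<^esub> \<one>\<^bsub>A\<^esub>) \<odot>\<^bsub>M\<^esub> (a \<odot>\<^bsub>M\<^esub> y)"
        using a c y by (simp add: M.smult_assoc1[symmetric] A.scalar_mult)
      then show "c \<odot>\<^bsub>scalar_restr A M\<^esub> y \<in> {x \<in> carrier M. a \<odot>\<^bsub>M\<^esub> x \<in> W}"
        using c y WD(5) M.smult_closed by simp
    qed (use a WD(2,4) in \<open>auto simp: M.smult_r_distr M.smult_r_null\<close>)
    moreover have "?T \<subseteq> {x \<in> carrier M. a \<odot>\<^bsub>M\<^esub> x \<in> W}"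
    proof safe
      fix b s assume bs: "b \<in> B" "s \<in> S"
      then have c: "b \<in> carrier A" "s \<in> carrier M" using B S by auto
      then show "b \<odot>\<^bsub>M\<^esub> s \<in> carrier M" by (rule M.smult_closed)
      have "(a \<otimes>\<^bsub>A\<^esub> b) \<odot>\<^bsub>M\<^esub> s \<in> W"
        by (rule ext) (use a c bs TW in auto)
      then show "a \<odot>\<^bsub>M\<^esub> (b \<odot>\<^bsub>M\<^esub> s) \<in> W" using a c by (simp add: M.smult_assoc1)
    qed
    ultimately have "W \<subseteq> {x \<in> carrier M. a \<odot>\<^bsub>M\<^esub> x \<in> W}" unfolding W_def by (rule KM.span_least)
    then show "a \<odot>\<^bsub>M\<^esub> x \<in> W" using x by auto
  qed (use WD in auto)
  moreover have "S \<subseteq> W"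
  proof
    fix s assume s: "s \<in> S"
    have "\<one>\<^bsub>A\<^esub> \<odot>\<^bsub>M\<^esub> s \<in> W" by (rule ext) (use s S TW in auto)
    then show "s \<in> W" using s S M.smult_one by auto
  qed
  ultimately have "carrier M \<subseteq> W" using M.span_least[of W S] S(3) by simp
  then have "W = carrier M" using WD(1) by auto
  then have "mod_span K (scalar_restr A M) ?T = carrier (scalar_restr A M)" by (simp add: W_def)
  moreover have "finite ?T" using B(1) S(1) by simp
  ultimately show ?thesis unfolding fin_gen_def using T by (metis scalar_restr_simps(1))
qed

lemma finite_length:
  assumes M: "left_module A M" and fgM: "fin_gen A M"
  shows "finite_length A M"
proof -
  have "finite_length K (scalar_restr A M)"
    by (rule vector_space_finite_length[OF K scalar_module[OF M] fin_gen_scalar_restr[OF M fgM]])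
  then show ?thesis unfolding finite_length_def
    using submodule_scalar_restr[OF alg M] by meson
qed

text \<open>The cover is a submodule \<open>U\<close> of a free module of finite rank, minimal among
  those that map onto \<open>M\<close>. Working inside \<open>free_module A {..<n}\<close> places it
  on the carrier type from which \<open>proj_cover\<close> chooses.\<close>

lemma proj_cover_exists:
  assumes M: "left_module A M" and fgM: "fin_gen A M"
  shows "\<exists>(P :: ('a, nat \<Rightarrow> 'a) module) p. is_proj_cover A M P p"
proof -
  interpret M: left_module A M by (rule M)
  obtain n \<pi> where \<pi>: "\<pi> \<in> mod_hom A (free_module A {..<n::nat}) M"
    "\<pi> ` carrier (free_module A {..<n}) = carrier M"
    using fin_gen_free_cover[OF M fgM] .
  let ?F = "free_module A {..<n}"
  have F: "left_module A ?F" by (rule A.free_left_module)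
  interpret F: left_module A ?F by (rule F)
  have flF: "finite_length A ?F" by (rule finite_length[OF F free_fin_gen[OF A_ring]]) simp
  obtain U where U: "submodule U A ?F" "\<pi> ` U = carrier M"
    "\<And>V. submodule V A ?F \<Longrightarrow> \<pi> ` V = carrier M \<Longrightarrow> V \<subseteq> U \<Longrightarrow> V = U"
    by (rule finite_length_minimal[OF flF F.carrier_submodule, of "\<lambda>U. \<pi> ` U = carrier M"]) (use \<pi>(2) in auto)
  let ?U = "?F\<lparr>carrier := U\<rparr>"
  have Um: "left_module A ?U" by (rule F.submodule_left_module[OF U(1)])
  interpret U: left_module A ?U by (rule Um)
  interpret FF: module_pair A ?F ?F by unfold_locales
  interpret UU: module_pair A ?U ?U by unfold_locales
  note Uc = F.submoduleD(1)[OF U(1)]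
  have \<pi>U: "\<pi> \<in> mod_hom A ?U M" by (rule mod_hom_restrict_carrier[OF \<pi>(1) Uc])
  obtain f where f: "f \<in> mod_hom A ?F ?U" "\<And>x. x \<in> carrier ?F \<Longrightarrow> \<pi> (f x) = \<pi> x"
    using A.free_lifting[OF Um M \<pi>U _ \<pi>(1)] U(2) by auto
  \<comment> \<open>By minimality of U, the lift f maps U onto itself, hence bijectively, so U splits off.\<close>
  have fF: "f \<in> mod_hom A ?F ?F" using mod_hom_comp[OF f(1) mod_hom_inclusion[OF Uc]] .
  have fU: "f \<in> mod_hom A ?U ?U" by (rule mod_hom_restrict_carrier[OF f(1) Uc])
  have "f ` U = U"
  proof (rule U(3))
    show "submodule (f ` U) A ?F" by (rule FF.image_submodule[OF fF U(1)])
    have "\<pi> ` f ` U = \<pi> ` U" unfolding image_image using f(2) Uc by (intro image_cong) auto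
    then show "\<pi> ` f ` U = carrier M" using U(2) by simp
    show "f ` U \<subseteq> U" using mod_homD(1)[OF fU] by auto
  qed
  then have surj: "f ` carrier ?U = carrier ?U" by simp
  have inj: "inj_on f (carrier ?U)"
    by (rule surjective_endomorphism_inj[OF Um finite_length_submodule[OF F flF U(1)] fU surj])
  then have bij: "bij_betw f (carrier ?U) (carrier ?U)" using surj by (simp add: bij_betw_def)
  let ?g = "inv_into (carrier ?U) f"
  have g: "?g \<in> mod_hom A ?U ?U" by (rule UU.inverse_hom[OF fU bij])
  have "projective A ?U"
  proof (rule projectiveI[OF Um mod_hom_inclusion[OF Uc] mod_hom_comp[OF f(1) g]])
    show "?g (f x) = x" if "x \<in> carrier ?U" for x using that inj by simp
  qed
  moreover have "V = carrier ?U" if "submodule V A ?U" "\<pi> ` V = carrier M" for V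
    using that U(3)[of V] submodule_of_submodule[OF F U(1)] by simp
  ultimately have "is_proj_cover A M ?U \<pi>" unfolding is_proj_cover_def
    using \<pi>U U(2) by simp
  then show ?thesis by blast
qed

lemma proj_cover:
  assumes "left_module A M" "fin_gen A M"
  shows "is_proj_cover A M (fst (proj_cover A M)) (snd (proj_cover A M))"
proof -
  from proj_cover_exists[OF assms] obtain P :: "('a, nat \<Rightarrow> 'a) module" and p where
    "is_proj_cover A M P p" by blast
  then have "case proj_cover A M of (P, p) \<Rightarrow> is_proj_cover A M P p"
    unfolding proj_cover_def
    using someI[of "\<lambda>(P, p). is_proj_cover A M P p" "(P, p)"] by (simp only: case_prod_conv)
  then show ?thesis by (simp add: case_prod_beta)
qed

end

section \<open>Properties of projective covers\<close>

lemma proj_coverD: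
  assumes "is_proj_cover R M P p"
  shows "projective R P" "left_module R P" "p \<in> mod_hom R P M" "p ` carrier P = carrier M"
    "\<And>U. submodule U R P \<Longrightarrow> p ` U = carrier M \<Longrightarrow> U = carrier P"
  using assms projective_left_module unfolding is_proj_cover_def by auto

text \<open>Preimages of generators of \<open>M\<close> span a submodule of \<open>P\<close> that
  still maps onto \<open>M\<close>, hence all of \<open>P\<close> by minimality.\<close>

lemma proj_cover_fin_gen:
  assumes c: "is_proj_cover R M P p" and M: "left_module R M" and fg: "fin_gen R M"
  shows "fin_gen R P"
proof -
  note C = proj_coverD[OF c]
  interpret M: left_module R M by (rule M)
  interpret P: left_module R P by (rule C)
  interpret PM: module_pair R P M by unfold_locales
  obtain S where S: "finite S" "S \<subseteq> carrier M" "mod_span R M S = carrier M"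
    using fg by (auto simp: fin_gen_def)
  then obtain T where T: "T \<subseteq> carrier P" "finite T" "S = p ` T"
    using finite_subset_image[of S p "carrier P"] C(4) by auto
  have "mod_span R P T = carrier P"
    by (rule C(5)[OF P.span_submodule[OF T(1)]]) (use PM.image_span[OF C(3) T(1)] S T in simp)
  then show ?thesis using T unfolding fin_gen_def by blast
qed

text \<open>A section \<open>s\<close> of \<open>p\<close> has an image that maps onto
  \<open>M\<close>; by minimality the image is everything, so \<open>s\<close> is a two-sided
  inverse.\<close>

lemma proj_cover_of_projective_inj:
  assumes c: "is_proj_cover R M P p" and M: "projective R M"
  shows "inj_on p (carrier P)"
proof -
  note C = proj_coverD[OF c]
  obtain s where s: "s \<in> mod_hom R M P" "\<And>x. x \<in> carrier M \<Longrightarrow> p (s x) = x"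
    using projective_split[OF M C(2,3,4)] by blast
  interpret MP: module_pair R M P using projective_left_module[OF M] C(2) by (rule module_pairI)
  have "s ` carrier M = carrier P"
    by (rule C(5)[OF MP.image_submodule[OF s(1) MP.M.carrier_submodule]])
      (use s(2) in \<open>auto simp: image_image\<close>)
  then show ?thesis using s(2) by (intro inj_onI) (metis imageE)
qed

text \<open>Superfluity of the kernel of a projective cover: the hypothesis \<open>sum\<close> is
  the elementwise form of U + ker p = P.\<close>

lemma proj_cover_kernel_superfluous:
  assumes c: "is_proj_cover R M P p" and M: "left_module R M" and U: "submodule U R P"
    and sum: "\<And>x. x \<in> carrier P \<Longrightarrow> \<exists>u\<in>U. p u = p x"
  shows "U = carrier P"
proof (rule proj_coverD(5)[OF c U])
  note C = proj_coverD[OF c]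
  interpret P: left_module R P by (rule C)
  show "p ` U = carrier M"
    using sum C(4) P.submoduleD(1)[OF U] by (smt (verit) imageE image_eqI image_mono subset_antisym subset_iff)
qed

section \<open>Minimal syzygies and projective dimension\<close>

context fd_algebra
begin

abbreviation "cover M \<equiv> fst (proj_cover A M)"
abbreviation "cover_map M \<equiv> snd (proj_cover A M)"

lemma syzygy_eq: "syzygy A M = (cover M)\<lparr>carrier := a_kernel (cover M) M (cover_map M)\<rparr>"
  by (simp add: syzygy_def case_prod_beta)

lemma cover_fin_gen: "left_module A M \<Longrightarrow> fin_gen A M \<Longrightarrow> fin_gen A (cover M)"
  using proj_cover_fin_gen[OF proj_cover] by blast

lemma syzygy_short_exact:
  assumes "left_module A M" "fin_gen A M"
  shows "short_exact A (syzygy A M) (cover M) M (\<lambda>x. x) (cover_map M)"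
  unfolding syzygy_eq
  using short_exact_kernel proj_coverD[OF proj_cover[OF assms]] assms(1) by blast

lemma syzygy_module:
  assumes "left_module A M" "fin_gen A M"
  shows "left_module A (syzygy A M)" "fin_gen A (syzygy A M)"
proof -
  note C = proj_coverD[OF proj_cover[OF assms]]
  interpret module_pair A "cover M" M using C(2) assms(1) by (rule module_pairI)
  show "left_module A (syzygy A M)" using syzygy_short_exact[OF assms] by (rule short_exactD)
  show "fin_gen A (syzygy A M)" unfolding syzygy_eq
    by (rule fin_gen_submodule[OF C(2) finite_length[OF C(2) cover_fin_gen[OF assms]]
          kernel_submodule[OF C(3)]])
qed

lemma syzygy_of_projective:
  assumes "projective A M" "fin_gen A M"
  shows "carrier (syzygy A M) = {\<zero>\<^bsub>syzygy A M\<^esub>}"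
proof -
  have M: "left_module A M" using projective_left_module[OF assms(1)] .
  note C = proj_coverD[OF proj_cover[OF M assms(2)]]
  interpret PM: module_pair A "cover M" M using C(2) M by (rule module_pairI)
  have "inj_on (cover_map M) (carrier (cover M))"
    by (rule proj_cover_of_projective_inj[OF proj_cover[OF M assms(2)] assms(1)])
  then have "a_kernel (cover M) M (cover_map M) = {\<zero>\<^bsub>cover M\<^esub>}"
    using PM.hom_zero[OF C(3)] unfolding a_kernel_def'
    by (auto dest: inj_onD[of _ _ _ "\<zero>\<^bsub>cover M\<^esub>"])
  then show ?thesis by (simp add: syzygy_eq)
qed

lemma cover_of_trivial:
  assumes "left_module A M" "carrier M = {\<zero>\<^bsub>M\<^esub>}"
  shows "carrier (cover M) = {\<zero>\<^bsub>cover M\<^esub>}"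
proof -
  interpret M: left_module A M by fact
  have fgM: "fin_gen A M" unfolding fin_gen_def
    using assms(2) M.span_superset[of "{\<zero>\<^bsub>M\<^esub>}"] M.span_carrier[of "{\<zero>\<^bsub>M\<^esub>}"]
    by (intro exI[of _ "{\<zero>\<^bsub>M\<^esub>}"]) auto
  note C = proj_coverD[OF proj_cover[OF assms(1) fgM]]
  interpret PM: module_pair A "cover M" M using C(2) assms(1) by (rule module_pairI)
  show ?thesis using C(5)[OF PM.M.zero_submodule] PM.hom_zero[OF C(3)] assms(2) by simp
qed

lemma trivial_projective:
  assumes "left_module A M" "carrier M = {\<zero>\<^bsub>M\<^esub>}"
  shows "projective A M"
proof -
  let ?F = "free_module A {}"
  interpret M: left_module A M by fact
  interpret F: left_module A ?F by (rule A.free_left_module)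
  interpret MF: module_pair A M ?F by unfold_locales
  interpret FM: module_pair A ?F M by unfold_locales
  show ?thesis by (rule projectiveI[OF assms(1) MF.hom_zero_fun FM.hom_zero_fun]) (use assms(2) in auto)
qed

text \<open>\<open>N\<close> is the sequence of syzygies of an arbitrary projective resolution,
  possibly on another carrier type and far from minimal. From the first step on the complement is
  the projective cover of the previous minimal syzygy, which keeps \<open>W\<close> on one fixed
  type.\<close>

lemma nth_syzygy_stable_retract:
  fixes M :: "('a, nat \<Rightarrow> 'a) module" and N :: "nat \<Rightarrow> ('a, 'n) module" and W :: "('a, nat \<Rightarrow> 'a) module"
    and Q :: "nat \<Rightarrow> ('a, 'q) module"
  assumes M: "left_module A M" "fin_gen A M"
    and N: "\<And>i. short_exact A (N (Suc i)) (Q i) (N i) (u i) (v i)" "\<And>i. projective A (Q i)"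
    and st: "stable_retract A M (N 0) W"
  shows "\<exists>W :: ('a, nat \<Rightarrow> 'a) module. stable_retract A ((syzygy A ^^ n) M) (N n) W"
    and "left_module A ((syzygy A ^^ n) M)" "fin_gen A ((syzygy A ^^ n) M)"
proof -
  have "(\<exists>W :: ('a, nat \<Rightarrow> 'a) module. stable_retract A ((syzygy A ^^ n) M) (N n) W) \<and>
    left_module A ((syzygy A ^^ n) M) \<and> fin_gen A ((syzygy A ^^ n) M)"
  proof (induction n)
    case 0
    then show ?case using M st by auto
  next
    case (Suc n)
    let ?M = "(syzygy A ^^ n) M"
    from Suc obtain W :: "('a, nat \<Rightarrow> 'a) module" where
      W: "stable_retract A ?M (N n) W" and m: "left_module A ?M" "fin_gen A ?M" by blast
    have "stable_retract A (syzygy A ?M) (N (Suc n)) (cover ?M)"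
      by (rule stable_retract_kernel[OF syzygy_short_exact[OF m] N(1)
            proj_coverD(1)[OF proj_cover[OF m]] N(2) W])
    then show ?case using syzygy_module[OF m] by auto
  qed
  then show "\<exists>W :: ('a, nat \<Rightarrow> 'a) module. stable_retract A ((syzygy A ^^ n) M) (N n) W"
    and "left_module A ((syzygy A ^^ n) M)" "fin_gen A ((syzygy A ^^ n) M)" by auto
qed

lemma syzygy_funpow_module:
  fixes M :: "('a, nat \<Rightarrow> 'a) module"
  assumes "left_module A M" "fin_gen A M"
  shows "left_module A ((syzygy A ^^ n) M)" "fin_gen A ((syzygy A ^^ n) M)"
proof -
  have "left_module A ((syzygy A ^^ n) M) \<and> fin_gen A ((syzygy A ^^ n) M)"
    by (induction n) (use assms syzygy_module in auto)
  then show "left_module A ((syzygy A ^^ n) M)" "fin_gen A ((syzygy A ^^ n) M)" by auto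
qed

text \<open>If some resolution stops at degree \<open>n\<close> or earlier, its \<open>n\<close>-th
  syzygy is projective, and the minimal one is a stable retract of it. Conversely, once a minimal
  syzygy is projective, all later ones vanish and the minimal resolution is finite.\<close>

lemma proj_dim_le_iff:
  fixes M :: "('a, nat \<Rightarrow> 'a) module"
  assumes M: "left_module A M" "fin_gen A M"
  shows "proj_dim A M \<le> enat n \<longleftrightarrow> projective A ((syzygy A ^^ n) M)"
proof
  let ?S = "{enat n | n. \<exists>P d e. proj_resolution A M P d e \<and> (\<forall>i>n. carrier (P i) = {\<zero>\<^bsub>P i\<^esub>})}"
  assume "proj_dim A M \<le> enat n"
  then have le: "Inf ?S \<le> enat n" by (simp add: proj_dim_def)
  \<comment> \<open>The infimum of the empty set is infinite, which excludes this case; for a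
    nonempty set the infimum is attained, giving an actual finite resolution.\<close>
  have "?S \<noteq> {}"
  proof
    assume "?S = {}"
    then show False using le by (simp only:) (simp add: top_enat_def)
  qed
  then have "Inf ?S \<in> ?S" by (rule wellorder_InfI[OF ex_in_conv[THEN iffD2, THEN someI_ex]])
  then obtain m P d e where m: "Inf ?S = enat m" and res: "proj_resolution A M P d e"
    and z: "\<And>i. i > m \<Longrightarrow> carrier (P i) = {\<zero>\<^bsub>P i\<^esub>}" by blast
  have mn: "m \<le> n" using le m by simp
  have r: "\<And>i. projective A (P i)" "\<And>i. d i \<in> mod_hom A (P (Suc i)) (P i)" "e \<in> mod_hom A (P 0) M"
    "e ` carrier (P 0) = carrier M" "d 0 ` carrier (P (Suc 0)) = a_kernel (P 0) M e"
    "\<And>i. d (Suc i) ` carrier (P (Suc (Suc i))) = a_kernel (P (Suc i)) (P i) (d i)"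
    using res by (simp_all add: proj_resolution_def)
  note Pp = r(1)
  have Pm: "left_module A (P i)" for i using projective_left_module[OF Pp] .
  \<comment> \<open>\<open>N i\<close> is the \<open>i\<close>-th syzygy of the given resolution.
    Since \<open>d j\<close> starts at \<open>P (Suc j)\<close>, its kernel is the syzygy of index j
    + 2, while the kernel of \<open>e\<close> has index 1; \<open>v\<close> shifts the differentials
    accordingly.\<close>
  define N where "N i = (case i of 0 \<Rightarrow> M | Suc 0 \<Rightarrow> (P 0)\<lparr>carrier := a_kernel (P 0) M e\<rparr>
    | Suc (Suc j) \<Rightarrow> (P (Suc j))\<lparr>carrier := a_kernel (P (Suc j)) (P j) (d j)\<rparr>)" for i
  define v where "v i = (case i of 0 \<Rightarrow> e | Suc j \<Rightarrow> d j)" for i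
  have ker: "a_kernel X (Y\<lparr>carrier := Z\<rparr>) f = a_kernel X Y f" for X Y Z f
    by (simp add: a_kernel_def')
  have "left_module A (N i) \<and> short_exact A (N (Suc i)) (P i) (N i) (\<lambda>x. x) (v i)" for i
  proof -
    consider "i = 0" | "i = 1" | j where "i = Suc (Suc j)" by (metis One_nat_def not0_implies_Suc)
    then show ?thesis
    proof cases
      case 1
      then show ?thesis using short_exact_kernel[OF Pm M(1) r(3,4)] M(1) by (simp add: N_def v_def)
    next
      case 2
      interpret module_pair A "P 0" M by (intro module_pairI Pm M)
      have N1: "left_module A ((P 0)\<lparr>carrier := a_kernel (P 0) M e\<rparr>)"
        by (intro M.submodule_left_module kernel_submodule r(3))
      have "d 0 \<in> mod_hom A (P (Suc 0)) ((P 0)\<lparr>carrier := a_kernel (P 0) M e\<rparr>)"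
        using r(5) by (intro mod_hom_into_submodule r(2)) auto
      from short_exact_kernel[OF Pm N1 this] show ?thesis using 2 r(5) N1 by (simp add: N_def v_def ker)
    next
      case 3
      interpret module_pair A "P (Suc j)" "P j" by (intro module_pairI Pm)
      have N1: "left_module A ((P (Suc j))\<lparr>carrier := a_kernel (P (Suc j)) (P j) (d j)\<rparr>)"
        by (intro M.submodule_left_module kernel_submodule r(2))
      have "d (Suc j) \<in> mod_hom A (P (Suc (Suc j))) ((P (Suc j))\<lparr>carrier := a_kernel (P (Suc j)) (P j) (d j)\<rparr>)"
        using r(6)[of j] by (intro mod_hom_into_submodule r(2)) auto
      from short_exact_kernel[OF Pm N1 this] show ?thesis using 3 r(6)[of j] N1 by (simp add: N_def v_def ker)
    qed
  qed
  then have Nm: "left_module A (N i)" and ex: "short_exact A (N (Suc i)) (P i) (N i) (\<lambda>x. x) (v i)" for i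
    by auto
  have "stable_retract A M (N 0) (P 0)"
    unfolding N_def nat.case by (rule stable_retract_iso[OF M(1) M(1) Pp mod_hom_id mod_hom_id]) simp
  then obtain W :: "('a, nat \<Rightarrow> 'a) module" where W: "stable_retract A ((syzygy A ^^ n) M) (N n) W"
    using nth_syzygy_stable_retract(1)[where N = N and Q = P and u = "\<lambda>_ x. x" and v = v, OF M] ex Pp by blast
  \<comment> \<open>The module after degree \<open>n\<close> is zero, so the next syzygy is zero as
    well and \<open>v n\<close> identifies the projective \<open>P n\<close> with
    \<open>N n\<close>.\<close>
  have "carrier (P (Suc n)) = {\<zero>\<^bsub>P (Suc n)\<^esub>}" using z mn by simp
  note E = short_exactD[OF ex[of n]] and E' = short_exactD[OF ex[of "Suc n"]]
  interpret PN: module_pair A "P n" "N n" by (intro module_pairI Pm Nm)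
  interpret PN': module_pair A "P (Suc n)" "N (Suc n)" by (intro module_pairI Pm Nm)
  have "carrier (N (Suc n)) = {\<zero>\<^bsub>N (Suc n)\<^esub>}"
    using E'(7) \<open>carrier (P (Suc n)) = {\<zero>\<^bsub>P (Suc n)\<^esub>}\<close> PN'.hom_zero[OF E'(5)] by simp
  then have "inj_on (v n) (carrier (P n))"
    using E(10) module_pair.hom_zero[OF module_pairI[OF E(1) E(2)] E(4)]
    by (intro PN.inj_if_kernel_trivial[OF E(5)]) force
  then have bij: "bij_betw (v n) (carrier (P n)) (carrier (N n))" using E(7) by (simp add: bij_betw_def)
  have "projective A (N n)"
    by (rule projective_retract[OF Nm Pp PN.inverse_hom[OF E(5) bij] E(5)])
      (use bij in \<open>auto simp: bij_betw_def f_inv_into_f\<close>)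
  then show "projective A ((syzygy A ^^ n) M)" by (rule stable_retract_projective[OF W])
next
  assume pr: "projective A ((syzygy A ^^ n) M)"
  let ?M = "\<lambda>i. (syzygy A ^^ i) M"
  note m = syzygy_funpow_module[OF M]
  note C = proj_coverD[OF proj_cover[OF m]]
  note E = short_exactD[OF syzygy_short_exact[OF m]]
  have step: "d \<in> mod_hom A X (cover (?M i))" if "d \<in> mod_hom A X (?M (Suc i))" for d X i
    using mod_hom_comp[OF that, of "\<lambda>x. x" "cover (?M i)"] E(4)[of i] by simp
  have ker: "a_kernel X (syzygy A Y) f = a_kernel X (cover Y) f" for X f and Y :: "('a, nat \<Rightarrow> 'a) module"
    by (simp add: syzygy_eq a_kernel_def')
  have img: "cover_map (?M (Suc i)) ` carrier (cover (?M (Suc i))) =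
      a_kernel (cover (?M i)) (?M i) (cover_map (?M i))" for i
    using C(4)[of "Suc i"] by (simp add: syzygy_eq)
  have res: "proj_resolution A M (\<lambda>i. cover (?M i)) (\<lambda>i. cover_map (?M (Suc i))) (cover_map M)"
    unfolding proj_resolution_def
  proof (intro conjI allI)
    show "projective A (cover (?M i))" "fin_gen A (cover (?M i))" for i
      using C(1) cover_fin_gen[OF m] by blast+
    show "cover_map (?M (Suc i)) \<in> mod_hom A (cover (?M (Suc i))) (cover (?M i))" for i
      by (rule step[OF C(3)])
    show "cover_map M \<in> mod_hom A (cover (?M 0)) M" "cover_map M ` carrier (cover (?M 0)) = carrier M"
      using C(3,4)[of 0] by simp_all
    show "cover_map (?M (Suc 0)) ` carrier (cover (?M 1)) = a_kernel (cover (?M 0)) M (cover_map M)"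
      using img[of 0] by simp
    show "cover_map (?M (Suc (Suc i))) ` carrier (cover (?M (Suc (Suc i)))) =
      a_kernel (cover (?M (Suc i))) (cover (?M i)) (cover_map (?M (Suc i)))" for i
      using img[of "Suc i"] ker[of _ "?M i"] by simp
  qed
  \<comment> \<open>The \<open>n\<close>-th syzygy is projective but may be nonzero; vanishing
    starts one step later, where the cover is an isomorphism.\<close>
  have triv: "carrier (?M (Suc n + j)) = {\<zero>\<^bsub>?M (Suc n + j)\<^esub>}" for j
  proof (induction j)
    case 0
    then show ?case using syzygy_of_projective[OF pr m(2)] by simp
  next
    case (Suc j)
    from syzygy_of_projective[OF trivial_projective[OF m(1) this] m(2)] show ?case by simp
  qed
  have "carrier (cover (?M i)) = {\<zero>\<^bsub>cover (?M i)\<^esub>}" if "i > n" for i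
    using triv[of "i - Suc n"] that cover_of_trivial[OF m(1)[of i]] by simp
  with res show "proj_dim A M \<le> enat n" unfolding proj_dim_def by (intro Inf_lower) blast
qed

lemma gl_dim_le_iff:
  "gl_dim A \<le> enat n \<longleftrightarrow>
    (\<forall>M :: ('a, nat \<Rightarrow> 'a) module. left_module A M \<and> fin_gen A M \<longrightarrow> projective A ((syzygy A ^^ n) M))"
  unfolding gl_dim_def Sup_le_iff using proj_dim_le_iff by auto

end

section \<open>Modules of homomorphisms\<close>

lemma projectiveE:
  fixes P :: "('r, 'm) module"
  assumes "projective R P"
  obtains X :: "'m set" and i q where "i \<in> mod_hom R P (free_module R X)"
    "q \<in> mod_hom R (free_module R X) P" "\<And>x. x \<in> carrier P \<Longrightarrow> q (i x) = x"
proof -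
  from assms obtain X :: "'m set" and i q where "i \<in> mod_hom R P (free_module R X)"
    "q \<in> mod_hom R (free_module R X) P" "\<forall>x\<in>carrier P. q (i x) = x"
    unfolding projective_def by blast
  then show ?thesis using that by simp
qed

text \<open>The additive group is common to \<open>ring_dual\<close>, \<open>K_dual\<close> and the
  Hom bimodules used later; these differ only in the ring that acts and in the action
  \<open>s\<close>.\<close>

definition hom_module ::
  "('r, 'x) ring_scheme \<Rightarrow> ('r, 'm) module \<Rightarrow> ('r, 'n) module \<Rightarrow> ('s \<Rightarrow> ('m \<Rightarrow> 'n) \<Rightarrow> ('m \<Rightarrow> 'n)) \<Rightarrow>
   ('s, 'm \<Rightarrow> 'n) module" where
  "hom_module R M N s =
     \<lparr>carrier = mod_hom R M N \<inter> extensional (carrier M),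
      mult = undefined, one = undefined,
      zero = (\<lambda>x\<in>carrier M. \<zero>\<^bsub>N\<^esub>),
      add = (\<lambda>f g. \<lambda>x\<in>carrier M. f x \<oplus>\<^bsub>N\<^esub> g x),
      smult = s\<rparr>"

lemma hom_module_simps:
  "carrier (hom_module R M N s) = mod_hom R M N \<inter> extensional (carrier M)"
  "zero (hom_module R M N s) = (\<lambda>x\<in>carrier M. \<zero>\<^bsub>N\<^esub>)"
  "add (hom_module R M N s) = (\<lambda>f g. \<lambda>x\<in>carrier M. f x \<oplus>\<^bsub>N\<^esub> g x)"
  "smult (hom_module R M N s) = s"
  by (simp_all add: hom_module_def)

lemma restrict_mod_hom:
  "left_module R M \<Longrightarrow> f \<in> mod_hom R M N \<Longrightarrow> (\<lambda>x\<in>carrier M. f x) \<in> mod_hom R M N \<inter> extensional (carrier M)"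
  using mod_hom_cong[of f R M N "\<lambda>x\<in>carrier M. f x"] by auto

context module_pair
begin

lemma hom_module_abelian_group: "abelian_group (hom_module R M N s)"
proof (rule abelian_groupI, unfold hom_module_simps, goal_cases)
  case (1 f g)
  then show ?case using restrict_mod_hom[OF M.left_module_axioms hom_add_fun] by auto
next
  case 2
  show ?case using restrict_mod_hom[OF M.left_module_axioms hom_zero_fun] by auto
next
  case (3 f g h)
  then show ?case by (intro restrict_ext) (auto simp: mod_homD N.M.a_assoc)
next
  case (4 f g)
  then show ?case by (intro restrict_ext) (auto simp: mod_homD N.M.a_comm)
next
  case (5 f)
  then show ?case by (intro extensionalityI[of _ "carrier M"]) (auto simp: mod_homD)
next
  case (6 f)
  then show ?case using restrict_mod_hom[OF M.left_module_axioms hom_minus_fun, of f]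
    by (intro bexI[of _ "\<lambda>x\<in>carrier M. \<ominus>\<^bsub>N\<^esub> f x"]) (auto simp: mod_homD N.M.l_neg intro!: restrict_ext)
qed

text \<open>Action on the values. \<open>N'\<close> is a second module structure on the group of
  \<open>N\<close>; commuting with \<open>R\<close> is what keeps the result
  \<open>R\<close>-linear.\<close>

lemma hom_module_post:
  assumes N': "left_module S N'" and eq: "carrier N' = carrier N" "add N' = add N" "zero N' = zero N"
    and comm: "\<And>s r y. s \<in> carrier S \<Longrightarrow> r \<in> carrier R \<Longrightarrow> y \<in> carrier N \<Longrightarrow>
      s \<odot>\<^bsub>N'\<^esub> (r \<odot>\<^bsub>N\<^esub> y) = r \<odot>\<^bsub>N\<^esub> (s \<odot>\<^bsub>N'\<^esub> y)"
  shows "left_module S (hom_module R M N (\<lambda>s f. \<lambda>x\<in>carrier M. s \<odot>\<^bsub>N'\<^esub> f x))"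
proof -
  interpret N': left_module S N' by (rule N')
  have hom: "(\<lambda>y. s \<odot>\<^bsub>N'\<^esub> y) \<in> mod_hom R N N" if "s \<in> carrier S" for s
    using that N'.smult_closed N'.smult_r_distr comm eq by (auto intro!: mod_homI)
  show ?thesis
  proof (rule left_moduleI[OF N'.R.ring_axioms hom_module_abelian_group], unfold hom_module_simps, goal_cases)
    case (1 s f)
    then show ?case
      using restrict_mod_hom[OF M.left_module_axioms mod_hom_comp[OF _ hom[OF 1(1)]], of f] by auto
  next
    case (2 a b f)
    then show ?case using N'.smult_l_distr eq by (intro restrict_ext) (auto simp: mod_homD)
  next
    case (3 a f g)
    then show ?case using N'.smult_r_distr eq by (intro restrict_ext) (auto simp: mod_homD)
  next
    case (4 a b f)
    then show ?case using N'.smult_assoc1 eq by (intro restrict_ext) (auto simp: mod_homD)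
  next
    case (5 f)
    then show ?case using N'.smult_one eq by (intro extensionalityI[of _ "carrier M"]) (auto simp: mod_homD)
  qed
qed

text \<open>Action on the arguments. Composition reverses the order of scalars, so a module over
  \<open>S'\<close> on the source gives a module over its opposite \<open>S\<close>.\<close>

lemma hom_module_pre:
  assumes S: "ring S" and M': "left_module S' M'"
    and eq: "carrier M' = carrier M" "add M' = add M" "zero M' = zero M"
    and opp: "carrier S' = carrier S" "add S' = add S" "one S' = one S"
      "\<And>a b. a \<otimes>\<^bsub>S\<^esub> b = b \<otimes>\<^bsub>S'\<^esub> a"
    and comm: "\<And>s r y. s \<in> carrier S \<Longrightarrow> r \<in> carrier R \<Longrightarrow> y \<in> carrier M \<Longrightarrow>
      s \<odot>\<^bsub>M'\<^esub> (r \<odot>\<^bsub>M\<^esub> y) = r \<odot>\<^bsub>M\<^esub> (s \<odot>\<^bsub>M'\<^esub> y)"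
  shows "left_module S (hom_module R M N (\<lambda>s f. \<lambda>x\<in>carrier M. f (s \<odot>\<^bsub>M'\<^esub> x)))"
proof -
  interpret M': left_module S' M' by (rule M')
  have c: "s \<odot>\<^bsub>M'\<^esub> x \<in> carrier M" if "s \<in> carrier S" "x \<in> carrier M" for s x
    using that M'.smult_closed eq opp by auto
  have hom: "(\<lambda>y. s \<odot>\<^bsub>M'\<^esub> y) \<in> mod_hom R M M" if "s \<in> carrier S" for s
    using that c M'.smult_r_distr comm eq opp by (auto intro!: mod_homI)
  show ?thesis
  proof (rule left_moduleI[OF S hom_module_abelian_group], unfold hom_module_simps, goal_cases)
    case (1 s f)
    then show ?case
      using restrict_mod_hom[OF M.left_module_axioms mod_hom_comp[OF hom[OF 1(1)]], of f] by auto
  next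
    case (2 a b f)
    then show ?case using M'.smult_l_distr eq opp c by (intro restrict_ext) (auto simp: mod_homD)
  next
    case (3 a f g)
    then show ?case using c by (intro restrict_ext) auto
  next
    case (4 a b f)
    then show ?case using M'.smult_assoc1 eq opp c by (intro restrict_ext) auto
  next
    case (5 f)
    then show ?case using M'.smult_one eq opp by (intro extensionalityI[of _ "carrier M"]) auto
  qed
qed

end

text \<open>The image of \<open>f\<close> is a subspace of a space of finite length, hence finitely
  generated; preimages of its generators generate \<open>V\<close> by injectivity.\<close>

lemma fin_gen_embedding:
  assumes K: "field K" and V: "left_module K V" and W: "left_module K W"
    and f: "f \<in> mod_hom K V W" and inj: "inj_on f (carrier V)" and fg: "fin_gen K W"
  shows "fin_gen K V"
proof -
  interpret module_pair K V W using V W by (rule module_pairI)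
  obtain S where S: "finite S" "S \<subseteq> f ` carrier V" "mod_span K W S = f ` carrier V"
    using finite_length_fin_gen[OF W vector_space_finite_length[OF K W fg] image_submodule[OF f M.carrier_submodule]] .
  then obtain T where T: "T \<subseteq> carrier V" "finite T" "S = f ` T"
    using finite_subset_image[of S f "carrier V"] by auto
  have "f ` mod_span K V T = f ` carrier V" using image_span[OF f T(1)] S T by simp
  then have "mod_span K V T = carrier V"
    using inj_on_image_eq_iff[OF inj M.span_carrier[OF T(1)] order_refl] by simp
  then show ?thesis using T unfolding fin_gen_def by blast
qed

text \<open>Finitely many generators have a finite joint support \<open>E\<close>, and everything
  they span is supported in \<open>E\<close>; a summand outside \<open>E\<close> therefore
  vanishes.\<close>

lemma direct_sum_fin_gen_iff:
  assumes K: "ring K" and V: "\<And>i. i \<in> I \<Longrightarrow> left_module K (V i)" "\<And>i. i \<in> I \<Longrightarrow> fin_gen K (V i)"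
  shows "fin_gen K (direct_sum I V) \<longleftrightarrow> finite {i \<in> I. carrier (V i) \<noteq> {\<zero>\<^bsub>V i\<^esub>}}"
proof -
  interpret F: module_family K I V using K V(1) by (rule module_familyI)
  interpret D: left_module K "direct_sum I V" by (rule F.left_module)
  show ?thesis
  proof
    assume "fin_gen K (direct_sum I V)"
    then obtain S where S: "finite S" "S \<subseteq> carrier (direct_sum I V)"
      "mod_span K (direct_sum I V) S = carrier (direct_sum I V)" by (auto simp: fin_gen_def)
    define E where "E = (\<Union>s\<in>S. {i \<in> I. s i \<noteq> \<zero>\<^bsub>V i\<^esub>})"
    have E: "finite E" unfolding E_def using S(1,2) by (intro finite_UN_I) (auto simp: direct_sum_simps)
    define U where "U = {f \<in> carrier (direct_sum I V). \<forall>i\<in>I - E. f i = \<zero>\<^bsub>V i\<^esub>}"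
    have "submodule U K (direct_sum I V)"
      unfolding D.submodule_iff U_def
      using left_module.smult_r_null[OF V(1)] abelian_groupE(2,5)[OF F.ag]
      by (auto simp: F.add_closed F.smult_closed F.zero_in F.at_simps)
    then have "carrier (direct_sum I V) \<subseteq> U"
      using D.span_least[of U S] S by (auto simp: U_def E_def)
    then have "m = \<zero>\<^bsub>V i\<^esub>" if "i \<in> I - E" "m \<in> carrier (V i)" for i m
    proof -
      have "single I V i m \<in> U" using \<open>carrier (direct_sum I V) \<subseteq> U\<close> F.single_closed[of i m] that by blast
      then have "single I V i m i = \<zero>\<^bsub>V i\<^esub>" using that by (simp add: U_def)
      then show ?thesis using that by (simp add: single_def)
    qed
    then have "{i \<in> I. carrier (V i) \<noteq> {\<zero>\<^bsub>V i\<^esub>}} \<subseteq> E"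
      using abelian_groupE(2)[OF F.ag] by blast
    then show "finite {i \<in> I. carrier (V i) \<noteq> {\<zero>\<^bsub>V i\<^esub>}}" using E finite_subset by blast
  next
    let ?E = "{i \<in> I. carrier (V i) \<noteq> {\<zero>\<^bsub>V i\<^esub>}}"
    assume E: "finite ?E"
    have "\<exists>G. finite G \<and> G \<subseteq> carrier (V i) \<and> mod_span K (V i) G = carrier (V i)" if "i \<in> I" for i
      using V(2)[OF that] by (auto simp: fin_gen_def)
    then obtain G where G: "\<And>i. i \<in> I \<Longrightarrow> finite (G i) \<and> G i \<subseteq> carrier (V i) \<and> mod_span K (V i) (G i) = carrier (V i)"
      by metis
    define T where "T = (\<Union>i\<in>?E. single I V i ` G i)"
    have T: "finite T" "T \<subseteq> carrier (direct_sum I V)"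
      unfolding T_def using E G by (auto simp: image_subset_iff intro!: F.single_closed)
    have "mod_span K (direct_sum I V) T = carrier (direct_sum I V)"
    proof (rule F.submodule_eq_carrier[OF D.span_submodule[OF T(2)]])
      fix i m assume im: "i \<in> I" "m \<in> carrier (V i)"
      interpret P: module_pair K "V i" "direct_sum I V"
        by (intro module_pairI V(1)[OF im(1)] F.left_module)
      show "single I V i m \<in> mod_span K (direct_sum I V) T"
      proof (cases "i \<in> ?E")
        case True
        have "single I V i m \<in> single I V i ` mod_span K (V i) (G i)" using im G by auto
        also have "\<dots> = mod_span K (direct_sum I V) (single I V i ` G i)"
          using P.image_span[OF F.single_hom[OF im(1)], of "G i"] G[OF im(1)] by blast
        also have "\<dots> \<subseteq> mod_span K (direct_sum I V) T"
          using True by (intro D.span_mono) (auto simp: T_def)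
        finally show ?thesis .
      next
        case False
        then have "m = \<zero>\<^bsub>V i\<^esub>" using im by auto
        then show ?thesis
          using P.hom_zero[OF F.single_hom[OF im(1)]] D.submoduleD(2)[OF D.span_submodule[OF T(2)]] by simp
      qed
    qed
    then show "fin_gen K (direct_sum I V)" using T unfolding fin_gen_def by blast
  qed
qed

text \<open>A homomorphism is determined by its values on a finite generating set, which embeds
  \<open>V\<close> into a finite power of \<open>N'\<close>. \<open>N'\<close> carries the
  \<open>K\<close>-structure on the group of \<open>N\<close>.\<close>

lemma hom_space_fin_gen:
  assumes K: "field K" and V: "left_module K V" and carr: "carrier V = mod_hom R M N \<inter> extensional (carrier M)"
    and M: "left_module R M" "fin_gen R M" and N: "left_module R N"
    and N': "left_module K N'" "fin_gen K N'" "carrier N' = carrier N"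
    and add: "\<And>f g x. f \<in> carrier V \<Longrightarrow> g \<in> carrier V \<Longrightarrow> x \<in> carrier M \<Longrightarrow> (f \<oplus>\<^bsub>V\<^esub> g) x = f x \<oplus>\<^bsub>N'\<^esub> g x"
    and smult: "\<And>c f x. c \<in> carrier K \<Longrightarrow> f \<in> carrier V \<Longrightarrow> x \<in> carrier M \<Longrightarrow> (c \<odot>\<^bsub>V\<^esub> f) x = c \<odot>\<^bsub>N'\<^esub> f x"
  shows "fin_gen K V"
proof -
  obtain S where S: "finite S" "S \<subseteq> carrier M" "mod_span R M S = carrier M"
    using M(2) by (auto simp: fin_gen_def)
  interpret K: field K by (rule K)
  interpret F: module_family K S "\<lambda>_. N'" by (intro module_familyI K.ring_axioms N'(1))
  have fg: "fin_gen K (direct_sum S (\<lambda>_. N'))"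
    using direct_sum_fin_gen_iff[of K S "\<lambda>_. N'"] K.ring_axioms N' S(1) by simp
  have carrV: "f \<in> carrier V \<Longrightarrow> x \<in> carrier M \<Longrightarrow> f x \<in> carrier N'" for f x
    using mod_homD(1)[of f R M N x] carr N'(3) by simp
  have "(\<lambda>f. \<lambda>x\<in>S. f x) \<in> mod_hom K V (direct_sum S (\<lambda>_. N'))"
    using S(1,2) carrV by (intro mod_homI) (auto simp: direct_sum_simps subset_iff add smult intro!: restrict_ext)
  moreover have "inj_on (\<lambda>f. \<lambda>x\<in>S. f x) (carrier V)"
  proof (rule inj_onI)
    fix f g assume fg: "f \<in> carrier V" "g \<in> carrier V" "(\<lambda>x\<in>S. f x) = (\<lambda>x\<in>S. g x)"
    then have f: "f \<in> mod_hom R M N" "g \<in> mod_hom R M N" "f \<in> extensional (carrier M)" "g \<in> extensional (carrier M)"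
      using carr by auto
    have "f x = g x" if "x \<in> S" for x using fun_cong[OF fg(3), of x] that by simp
    then have "f x = g x" if "x \<in> carrier M" for x
      using module_pair.hom_eq_on_span[OF module_pairI[OF M(1) N] f(1,2) S(2)] S(3) that by simp
    then show "f = g" using f(3,4) by (intro extensionalityI)
  qed
  ultimately show ?thesis by (rule fin_gen_embedding[OF K V F.left_module _ _ fg])
qed

section \<open>Transpose and Auslander--Reiten translate\<close>

lemma opp_simps [simp]:
  "carrier (opp R) = carrier R" "add (opp R) = add R" "zero (opp R) = zero R" "one (opp R) = one R"
  "smult (opp R) = smult R" "mult (opp R) = (\<lambda>x y. y \<otimes>\<^bsub>R\<^esub> x)" "opp (opp R) = R"
  by (simp_all add: opp_def)

lemma opp_ring: assumes "ring R" shows "ring (opp R)"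
proof -
  interpret ring R by fact
  show ?thesis
  proof (rule ringI)
    show "abelian_group (opp R)" by (rule abelian_group_cong[OF is_abelian_group]) auto
    show "monoid (opp R)" by (rule monoidI) (auto simp: m_assoc)
  qed (auto simp: l_distr r_distr)
qed

lemma assoc_algebraI:
  assumes "cring K" "left_module K A" "ring A"
    "\<And>c x y. c \<in> carrier K \<Longrightarrow> x \<in> carrier A \<Longrightarrow> y \<in> carrier A \<Longrightarrow> (c \<odot>\<^bsub>A\<^esub> x) \<otimes>\<^bsub>A\<^esub> y = c \<odot>\<^bsub>A\<^esub> (x \<otimes>\<^bsub>A\<^esub> y)"
    "\<And>c x y. c \<in> carrier K \<Longrightarrow> x \<in> carrier A \<Longrightarrow> y \<in> carrier A \<Longrightarrow> x \<otimes>\<^bsub>A\<^esub> (c \<odot>\<^bsub>A\<^esub> y) = c \<odot>\<^bsub>A\<^esub> (x \<otimes>\<^bsub>A\<^esub> y)"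
  shows "assoc_algebra K A"
proof -
  interpret left_module K A by fact
  have "module K A"
    by (rule moduleI)
      (auto simp: assms(1) smult_closed smult_l_distr smult_r_distr smult_assoc1 smult_one M.abelian_group_axioms)
  then show ?thesis using assms by (intro assoc_algebra.intro assoc_algebra_axioms.intro) auto
qed

lemma assoc_algebra_left_module: "assoc_algebra K A \<Longrightarrow> left_module K A"
  by (simp add: assoc_algebra_def module_imp_left_module)

lemma left_module_cong:
  assumes "left_module R M" "carrier N = carrier M" "add N = add M" "zero N = zero M"
    "\<And>r x. r \<in> carrier R \<Longrightarrow> x \<in> carrier M \<Longrightarrow> r \<odot>\<^bsub>N\<^esub> x = r \<odot>\<^bsub>M\<^esub> x"
  shows "left_module R N"
proof -
  interpret left_module R M by fact
  have "abelian_group N" by (rule abelian_group_cong[OF M.abelian_group_axioms assms(2-4)])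
  then show ?thesis
    using assms(2-5) by (intro left_moduleI)
      (auto simp: smult_closed smult_l_distr smult_r_distr smult_assoc1 smult_one R.ring_axioms)
qed

lemma submodule_cong:
  fixes M N :: "('r, 'm) module"
  assumes "left_module R M" "carrier N = carrier M" "add N = add M" "zero N = zero M"
    "\<And>r x. r \<in> carrier R \<Longrightarrow> x \<in> carrier M \<Longrightarrow> r \<odot>\<^bsub>N\<^esub> x = r \<odot>\<^bsub>M\<^esub> x"
  shows "submodule U R N \<longleftrightarrow> submodule U R M"
proof -
  have "U \<subseteq> carrier M \<Longrightarrow> (\<forall>a\<in>carrier R. \<forall>x\<in>U. a \<odot>\<^bsub>N\<^esub> x \<in> U) = (\<forall>a\<in>carrier R. \<forall>x\<in>U. a \<odot>\<^bsub>M\<^esub> x \<in> U)"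
    using assms(5) by (auto simp: subset_iff)
  moreover have "left_module R N" by (rule left_module_cong[OF assms(1-4)]) (rule assms(5))
  ultimately show ?thesis
    unfolding left_module.submodule_iff[OF \<open>left_module R N\<close>] left_module.submodule_iff[OF assms(1)] assms(2-4)
    by blast
qed

lemma fin_gen_cong:
  fixes M N :: "('r, 'm) module"
  assumes "left_module R M" "carrier N = carrier M" "add N = add M" "zero N = zero M"
    "\<And>r x. r \<in> carrier R \<Longrightarrow> x \<in> carrier M \<Longrightarrow> r \<odot>\<^bsub>N\<^esub> x = r \<odot>\<^bsub>M\<^esub> x"
  shows "fin_gen R N \<longleftrightarrow> fin_gen R M"
proof -
  have "submodule U R N \<longleftrightarrow> submodule U R M" for U
    by (rule submodule_cong[OF assms(1-4)]) (rule assms(5))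
  then show ?thesis unfolding fin_gen_def mod_span_def assms(2) by simp
qed

lemma opp_algebra: assumes "assoc_algebra K A" shows "assoc_algebra K (opp A)"
proof -
  interpret assoc_algebra K A by fact
  show ?thesis
    by (intro assoc_algebraI left_module_cong[OF assoc_algebra_left_module[OF assms]] opp_ring)
      (auto simp: smult_mult_left smult_mult_right R.cring_axioms A.ring_axioms)
qed

lemma fd_algebra_opp: assumes "fd_algebra K A" shows "fd_algebra K (opp A)"
proof -
  interpret fd_algebra K A by fact
  have "fin_gen K (opp A)" using fg fin_gen_cong[OF A_left_module, of "opp A"] by simp
  then show ?thesis by (intro fd_algebra.intro K opp_algebra[OF alg])
qed

lemma ring_dual_eq:
  "ring_dual A P = hom_module A P (regular_module A) (\<lambda>s f. \<lambda>x\<in>carrier P. s \<odot>\<^bsub>regular_module (opp A)\<^esub> f x)"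
  by (simp add: ring_dual_def hom_module_def)

lemma K_dual_eq:
  "K_dual K A M = hom_module K (scalar_restr A M) (regular_module K) (\<lambda>s f. \<lambda>x\<in>carrier M. f (s \<odot>\<^bsub>M\<^esub> x))"
  by (simp add: K_dual_def hom_module_def)

lemma fst_snd_Let: "(let (P, p) = x in f P p) = f (fst x) (snd x)"
  by (simp add: case_prod_beta)

context fd_algebra
begin

lemma ring_dual_module:
  assumes "left_module A P" shows "left_module (opp A) (ring_dual A P)"
proof -
  interpret module_pair A P "regular_module A"
    by (intro module_pairI assms regular_left_module A_ring)
  show ?thesis unfolding ring_dual_eq
    by (rule hom_module_post[OF regular_left_module[OF opp_ring[OF A_ring]]]) (auto simp: A.m_assoc)
qed

lemma ring_dual_fin_gen:
  assumes P: "left_module A P" "fin_gen A P"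
  shows "fin_gen K (scalar_restr (opp A) (ring_dual A P))"
proof (rule hom_space_fin_gen[OF K scalar_restr_left_module[OF opp_algebra[OF alg] ring_dual_module[OF P(1)]] _
      P regular_left_module[OF A_ring] A_left_module fg])
  show "carrier (scalar_restr (opp A) (ring_dual A P)) = mod_hom A P (regular_module A) \<inter> extensional (carrier P)"
    by (simp add: ring_dual_def)
qed (auto simp: ring_dual_def A.scalar_mult mod_homD(1)[where N = "regular_module A", simplified])

text \<open>The second term of the minimal projective presentation, seen as mapping into
  \<open>cover M\<close>. The cokernel of \<open>dual_map M\<close> is the transpose.\<close>

definition "cover1 M = cover (syzygy A M)"
definition "cover1_map M = cover_map (syzygy A M)"
definition "dual_map M f = (\<lambda>x\<in>carrier (cover1 M). f (cover1_map M x))"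

lemma transpose_eq:
  "transpose A M = quot_mod (ring_dual A (cover1 M)) (dual_map M ` carrier (ring_dual A (cover M)))"
  unfolding transpose_def fst_snd_Let dual_map_def cover1_def cover1_map_def ..

lemma presentation:
  assumes M: "left_module A M" "fin_gen A M"
  shows "left_module A (cover1 M)" "projective A (cover1 M)" "fin_gen A (cover1 M)"
    "left_module A (cover M)" "cover1_map M \<in> mod_hom A (cover1 M) (cover M)"
    "\<And>x. x \<in> carrier (cover1 M) \<Longrightarrow> cover_map M (cover1_map M x) = \<zero>\<^bsub>M\<^esub>"
    "cover1_map M ` carrier (cover1 M) = a_kernel (cover M) M (cover_map M)"
proof -
  note S = syzygy_module[OF M] and E = short_exactD[OF syzygy_short_exact[OF M]]
  note C = proj_coverD[OF proj_cover[OF S], folded cover1_def cover1_map_def]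
  show "left_module A (cover1 M)" "projective A (cover1 M)" by (rule C)+
  show "fin_gen A (cover1 M)" unfolding cover1_def by (rule cover_fin_gen[OF S])
  show "left_module A (cover M)" by (rule E)
  show "cover1_map M \<in> mod_hom A (cover1 M) (cover M)" using mod_hom_comp[OF C(3) E(4)] .
  show "cover_map M (cover1_map M x) = \<zero>\<^bsub>M\<^esub>" if "x \<in> carrier (cover1 M)" for x
    using E(9) mod_homD(1)[OF C(3) that] by simp
  show "cover1_map M ` carrier (cover1 M) = a_kernel (cover M) M (cover_map M)"
    using C(4) by (simp add: syzygy_eq)
qed

lemma dual_map_hom:
  assumes M: "left_module A M" "fin_gen A M"
  shows "dual_map M \<in> mod_hom (opp A) (ring_dual A (cover M)) (ring_dual A (cover1 M))"
proof (rule mod_homI, goal_cases)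
  note p = presentation[OF M]
  case (1 f)
  then show ?case unfolding dual_map_def
    using restrict_mod_hom[OF p(1) mod_hom_comp[OF p(5)], of f] by (auto simp: ring_dual_def)
next
  note p = presentation[OF M]
  case (2 f g)
  then show ?case by (auto simp: ring_dual_def dual_map_def mod_homD(1)[OF p(5)] intro!: restrict_ext)
next
  note p = presentation[OF M]
  case (3 r f)
  then show ?case by (auto simp: ring_dual_def dual_map_def mod_homD(1)[OF p(5)] intro!: restrict_ext)
qed

lemma transpose_quotient:
  assumes M: "left_module A M" "fin_gen A M"
  shows "quotient_module (opp A) (ring_dual A (cover1 M)) (dual_map M ` carrier (ring_dual A (cover M)))"
proof -
  note p = presentation[OF M]
  interpret module_pair "opp A" "ring_dual A (cover M)" "ring_dual A (cover1 M)"
    by (intro module_pairI ring_dual_module p)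
  show ?thesis
    by (intro quotient_moduleI N.left_module_axioms image_submodule[OF dual_map_hom[OF M]] M.carrier_submodule)
qed

lemma transpose_module:
  assumes M: "left_module A M" "fin_gen A M"
  shows "left_module (opp A) (transpose A M)" "fin_gen K (scalar_restr (opp A) (transpose A M))"
proof -
  interpret Q: quotient_module "opp A" "ring_dual A (cover1 M)" "dual_map M ` carrier (ring_dual A (cover M))"
    by (rule transpose_quotient[OF M])
  note oa = opp_algebra[OF alg]
  show *: "left_module (opp A) (transpose A M)" unfolding transpose_eq by (rule Q.quot_left_module)
  show "fin_gen K (scalar_restr (opp A) (transpose A M))"
    unfolding transpose_eq
    by (rule fin_gen_image[OF scalar_restr_left_module[OF oa Q.left_module_axioms]
          scalar_restr_left_module[OF oa Q.quot_left_module] mod_hom_scalar_restr[OF oa Q.cls_hom]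
          _ ring_dual_fin_gen[OF presentation(1,3)[OF M]]]) (simp add: Q.quot_carrier)
qed

text \<open>If \<open>M\<close> is projective, its minimal presentation has \<open>cover1 M\<close>
  zero and nothing is left to dualise. If the dual map is onto, coordinate functions of
  \<open>cover1 M\<close> extend to \<open>cover M\<close> and assemble to a retraction r of
  \<open>cover1_map M\<close>; superfluity of the kernel of the cover then forces r = 0 and
  \<open>cover1 M\<close> to be zero, so the cover is an isomorphism.\<close>

lemma transpose_trivial_iff:
  assumes M: "left_module A M" "fin_gen A M"
  shows "carrier (transpose A M) = {\<zero>\<^bsub>transpose A M\<^esub>} \<longleftrightarrow> projective A M"
proof -
  interpret Q: quotient_module "opp A" "ring_dual A (cover1 M)" "dual_map M ` carrier (ring_dual A (cover M))"
    by (rule transpose_quotient[OF M])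
  note p = presentation[OF M] and c = proj_cover[OF M] and C = proj_coverD[OF proj_cover[OF M]]
  interpret PM: module_pair A "cover M" M by (intro module_pairI p M)
  interpret P: module_pair A "cover1 M" "cover M" by (intro module_pairI p)
  interpret P': module_pair A "cover M" "cover1 M" by (intro module_pairI p)
  have "dual_map M ` carrier (ring_dual A (cover M)) = carrier (ring_dual A (cover1 M)) \<longleftrightarrow> projective A M"
  proof
    assume pr: "projective A M"
    have "carrier (cover1 M) = {\<zero>\<^bsub>cover1 M\<^esub>}"
      unfolding cover1_def by (rule cover_of_trivial[OF syzygy_module(1)[OF M] syzygy_of_projective[OF pr M(2)]])
    then have "f = \<zero>\<^bsub>ring_dual A (cover1 M)\<^esub>" if "f \<in> carrier (ring_dual A (cover1 M))" for f
      using that module_pair.hom_zero[OF module_pairI[OF p(1) regular_left_module[OF A_ring]], of f]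
      by (intro extensionalityI[of _ "carrier (cover1 M)"]) (auto simp: ring_dual_def)
    then show "dual_map M ` carrier (ring_dual A (cover M)) = carrier (ring_dual A (cover1 M))"
      using Q.submoduleD(1,2)[OF Q.U] by blast
  next
    assume surj: "dual_map M ` carrier (ring_dual A (cover M)) = carrier (ring_dual A (cover1 M))"
    obtain n \<pi> where \<pi>: "\<pi> \<in> mod_hom A (free_module A {..<n::nat}) (cover1 M)"
      "\<pi> ` carrier (free_module A {..<n}) = carrier (cover1 M)"
      using fin_gen_free_cover[OF p(1,3)] .
    let ?F = "free_module A {..<n}"
    have fam: "module_family A {..<n} (\<lambda>_. regular_module A)" by (rule A.free_family)
    obtain s where s: "s \<in> mod_hom A (cover1 M) ?F" "\<And>x. x \<in> carrier (cover1 M) \<Longrightarrow> \<pi> (s x) = x"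
      using projective_split[OF p(2) A.free_left_module \<pi>] by blast
    \<comment> \<open>Each coordinate of s extends along the presentation map, which is therefore a split mono.\<close>
    have "\<exists>g\<in>carrier (ring_dual A (cover M)). \<forall>x\<in>carrier (cover1 M). g (cover1_map M x) = s x j" if j: "j < n" for j
    proof -
      have "(\<lambda>f. f j) \<in> mod_hom A ?F (regular_module A)" unfolding free_module_def
        by (rule mod_homI) (use j in \<open>auto simp: module_family.at_simps[OF fam] dest: module_family.carrierD[OF fam]\<close>)
      from restrict_mod_hom[OF p(1) mod_hom_comp[OF s(1) this]]
      have "(\<lambda>x\<in>carrier (cover1 M). s x j) \<in> carrier (ring_dual A (cover1 M))" by (simp add: ring_dual_def)
      then obtain g where "g \<in> carrier (ring_dual A (cover M))" "(\<lambda>x\<in>carrier (cover1 M). s x j) = dual_map M g"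
        using surj by (metis (no_types, lifting) imageE)
      then show ?thesis by (intro bexI[of _ g]) (auto simp: dual_map_def fun_eq_iff, metis)
    qed
    then obtain g where g: "\<And>j. j < n \<Longrightarrow> g j \<in> carrier (ring_dual A (cover M))"
      "\<And>j x. j < n \<Longrightarrow> x \<in> carrier (cover1 M) \<Longrightarrow> g j (cover1_map M x) = s x j" by metis
    have gh: "g j \<in> mod_hom A (cover M) (regular_module A)" if "j < n" for j
      using g(1)[OF that] by (simp add: ring_dual_def)
    define G where "G y = (\<lambda>j\<in>{..<n}. g j y)" for y
    have G: "G \<in> mod_hom A (cover M) ?F" unfolding free_module_def
    proof (rule mod_homI)
      show "G y \<in> carrier (direct_sum {..<n} (\<lambda>_. regular_module A))" if "y \<in> carrier (cover M)" for y
        using mod_homD(1)[OF gh that] by (auto simp: direct_sum_simps G_def)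
    qed (use mod_homD(2,3)[OF gh] in \<open>auto simp: direct_sum_simps G_def intro!: restrict_ext\<close>)
    have "G (cover1_map M x) = s x" if "x \<in> carrier (cover1 M)" for x
      using mod_homD(1)[OF s(1) that] mod_homD(1)[OF G mod_homD(1)[OF p(5) that]] g(2) that unfolding free_module_def
      by (intro module_family.eqI[OF fam]) (auto simp: G_def)
    then have r: "\<pi> (G (cover1_map M x)) = x" if "x \<in> carrier (cover1 M)" for x
      using s(2) that by simp
    have rh: "(\<lambda>y. \<pi> (G y)) \<in> mod_hom A (cover M) (cover1 M)" by (rule mod_hom_comp[OF G \<pi>(1)])
    have "a_kernel (cover M) (cover1 M) (\<lambda>y. \<pi> (G y)) = carrier (cover M)"
    proof (rule proj_cover_kernel_superfluous[OF c M(1) P'.kernel_submodule[OF rh]])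
      fix y assume y: "y \<in> carrier (cover M)"
      let ?z = "cover1_map M (\<pi> (G y))"
      have ry: "\<pi> (G y) \<in> carrier (cover1 M)" by (rule mod_homD(1)[OF rh y])
      have z: "?z \<in> carrier (cover M)" by (rule mod_homD(1)[OF p(5) ry])
      have "\<pi> (G (y \<ominus>\<^bsub>cover M\<^esub> ?z)) = \<zero>\<^bsub>cover1 M\<^esub>"
        using P'.hom_diff[OF rh y z] r[OF ry] ry by (simp add: a_minus_def P.M.M.r_neg)
      moreover have "cover_map M (y \<ominus>\<^bsub>cover M\<^esub> ?z) = cover_map M y"
        using PM.hom_diff[OF C(3) y z] p(6)[OF ry] mod_homD(1)[OF C(3) y]
          PM.N.M.minus_equality[of "\<zero>\<^bsub>M\<^esub>" "\<zero>\<^bsub>M\<^esub>"] by (simp add: a_minus_def)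
      ultimately show "\<exists>u\<in>a_kernel (cover M) (cover1 M) (\<lambda>y. \<pi> (G y)). cover_map M u = cover_map M y"
        using y z by (intro bexI[of _ "y \<ominus>\<^bsub>cover M\<^esub> ?z"]) (auto simp: a_kernel_def')
    qed
    then have r0: "\<pi> (G y) = \<zero>\<^bsub>cover1 M\<^esub>" if "y \<in> carrier (cover M)" for y
      using that by (auto simp: a_kernel_def' set_eq_iff)
    have "x = \<zero>\<^bsub>cover1 M\<^esub>" if "x \<in> carrier (cover1 M)" for x
      using trans[OF r[OF that, symmetric] r0[OF mod_homD(1)[OF p(5) that]]] .
    then have c1: "carrier (cover1 M) = {\<zero>\<^bsub>cover1 M\<^esub>}" using P.M.M.zero_closed by blast
    have "a_kernel (cover M) M (cover_map M) = {\<zero>\<^bsub>cover M\<^esub>}"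
      unfolding p(7)[symmetric] c1 using P.hom_zero[OF p(5)] by simp
    then have "inj_on (cover_map M) (carrier (cover M))"
      by (intro PM.inj_if_kernel_trivial[OF C(3)]) (auto simp: a_kernel_def')
    then have bij: "bij_betw (cover_map M) (carrier (cover M)) (carrier M)" using C(4) by (simp add: bij_betw_def)
    show "projective A M"
      by (rule projective_retract[OF M(1) C(1) PM.inverse_hom[OF C(3) bij] C(3)])
        (use bij in \<open>auto simp: bij_betw_def f_inv_into_f\<close>)
  qed
  then show ?thesis unfolding transpose_eq Q.quot_trivial_iff .
qed

text \<open>The dual of a finite-dimensional space is finite-dimensional, and it vanishes only with
  the space, so the criterion for the transpose carries over to D Tr. Finite dimension is recorded
  for the direct sum of all translates.\<close>

lemma ar_translate_module:
  assumes M: "left_module A M" "fin_gen A M"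
  shows "left_module A (ar_translate K A M)" "fin_gen K (scalar_restr A (ar_translate K A M))"
    "carrier (ar_translate K A M) = {\<zero>\<^bsub>ar_translate K A M\<^esub>} \<longleftrightarrow> projective A M"
proof -
  note oa = opp_algebra[OF alg]
  let ?T = "transpose A M"
  let ?V = "scalar_restr (opp A) ?T"
  note T = transpose_module[OF M]
  interpret T: left_module "opp A" ?T by (rule T)
  have V: "left_module K ?V" by (rule scalar_restr_left_module[OF oa T(1)])
  interpret VK: module_pair K ?V "regular_module K" by (intro module_pairI V regular_left_module ring_axioms)
  have scal: "(c \<odot>\<^bsub>A\<^esub> \<one>\<^bsub>A\<^esub>) \<odot>\<^bsub>?T\<^esub> (s \<odot>\<^bsub>?T\<^esub> y) = s \<odot>\<^bsub>?T\<^esub> ((c \<odot>\<^bsub>A\<^esub> \<one>\<^bsub>A\<^esub>) \<odot>\<^bsub>?T\<^esub> y)"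
    if "c \<in> carrier K" "s \<in> carrier A" "y \<in> carrier ?T" for c s y
    using that T.smult_assoc1[of "c \<odot>\<^bsub>A\<^esub> \<one>\<^bsub>A\<^esub>" s y] T.smult_assoc1[of s "c \<odot>\<^bsub>A\<^esub> \<one>\<^bsub>A\<^esub>" y]
    by (simp add: A.scalar_mult)
  have eq: "ar_translate K A M = K_dual K (opp A) ?T" by (simp add: ar_translate_def)
  show D: "left_module A (ar_translate K A M)"
  proof -
    have "left_module A (hom_module K ?V (regular_module K) (\<lambda>s f. \<lambda>x\<in>carrier ?V. f (s \<odot>\<^bsub>?T\<^esub> x)))"
      by (rule VK.hom_module_pre[OF A_ring T(1)]) (auto simp: scal)
    then show ?thesis by (simp add: eq K_dual_eq)
  qed
  have regK: "left_module K (regular_module K)" "fin_gen K (regular_module K)"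
  proof -
    show "left_module K (regular_module K)" by (rule regular_left_module[OF ring_axioms])
    have "x \<in> mod_span K (regular_module K) {\<one>\<^bsub>K\<^esub>}" if "x \<in> carrier K" for x
      using VK.N.submoduleD(5)[OF VK.N.span_submodule[of "{\<one>\<^bsub>K\<^esub>}"], of x "\<one>\<^bsub>K\<^esub>"]
        VK.N.span_superset[of "{\<one>\<^bsub>K\<^esub>}"] that by simp
    then show "fin_gen K (regular_module K)"
      unfolding fin_gen_def using VK.N.span_carrier[of "{\<one>\<^bsub>K\<^esub>}"] by (intro exI[of _ "{\<one>\<^bsub>K\<^esub>}"]) auto
  qed
  show "fin_gen K (scalar_restr A (ar_translate K A M))"
  proof (rule hom_space_fin_gen[OF K scalar_module[OF D] _ V T(2) regK(1) regK])
    show "carrier (scalar_restr A (ar_translate K A M)) = mod_hom K ?V (regular_module K) \<inter> extensional (carrier ?V)"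
      by (simp add: eq K_dual_def)
    fix c f x assume "c \<in> carrier K" "f \<in> carrier (scalar_restr A (ar_translate K A M))" "x \<in> carrier ?V"
    then show "(c \<odot>\<^bsub>scalar_restr A (ar_translate K A M)\<^esub> f) x = c \<odot>\<^bsub>regular_module K\<^esub> f x"
      using mod_homD(3)[of f K ?V "regular_module K" c x] by (simp add: eq K_dual_def)
  qed (auto simp: eq K_dual_def)
  have "carrier (ar_translate K A M) = {\<zero>\<^bsub>ar_translate K A M\<^esub>} \<longleftrightarrow> carrier ?T = {\<zero>\<^bsub>?T\<^esub>}"
  proof
    assume triv: "carrier ?T = {\<zero>\<^bsub>?T\<^esub>}"
    have "f = \<zero>\<^bsub>ar_translate K A M\<^esub>" if "f \<in> carrier (ar_translate K A M)" for f
      using that VK.hom_zero[of f] triv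
      by (intro extensionalityI[of _ "carrier ?T"]) (auto simp: eq K_dual_def)
    moreover interpret left_module A "ar_translate K A M" by (rule D)
    have "\<zero>\<^bsub>ar_translate K A M\<^esub> \<in> carrier (ar_translate K A M)" by simp
    ultimately show "carrier (ar_translate K A M) = {\<zero>\<^bsub>ar_translate K A M\<^esub>}" by blast
  next
    assume triv: "carrier (ar_translate K A M) = {\<zero>\<^bsub>ar_translate K A M\<^esub>}"
    \<comment> \<open>A splitting of \<open>?V\<close> into a free \<open>K\<close>-module supplies
      enough functionals: its coordinates. They all vanish when the dual is zero, so the splitting,
      and with it \<open>?V\<close>, is zero.\<close>
    have "projective K ?V" by (rule field_fin_gen_projective[OF K V T(2)])
    then obtain X :: "((nat \<Rightarrow> 'a) \<Rightarrow> 'a) set set" and i q where i: "i \<in> mod_hom K ?V (free_module K X)"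
      and q: "q \<in> mod_hom K (free_module K X) ?V" "\<And>x. x \<in> carrier ?V \<Longrightarrow> q (i x) = x"
      by (rule projectiveE) blast
    have fam: "module_family K X (\<lambda>_. regular_module K)" by (rule free_family)
    have z: "i x j = \<zero>\<^bsub>K\<^esub>" if x: "x \<in> carrier ?V" and j: "j \<in> X" for x j
    proof -
      have "(\<lambda>f. f j) \<in> mod_hom K (free_module K X) (regular_module K)" unfolding free_module_def
        by (rule mod_homI) (use j in \<open>auto simp: module_family.at_simps[OF fam] dest: module_family.carrierD[OF fam]\<close>)
      from restrict_mod_hom[OF V mod_hom_comp[OF i this]]
      have "(\<lambda>x\<in>carrier ?V. i x j) \<in> carrier (ar_translate K A M)" by (simp add: eq K_dual_def)
      then have "(\<lambda>x\<in>carrier ?V. i x j) = (\<lambda>x\<in>carrier ?V. \<zero>\<^bsub>K\<^esub>)"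
        unfolding triv by (simp add: eq K_dual_def)
      from fun_cong[OF this, of x] x show ?thesis by simp
    qed
    interpret FV: module_pair K "free_module K X" ?V by (intro module_pairI free_left_module V)
    have "x = \<zero>\<^bsub>?V\<^esub>" if "x \<in> carrier ?V" for x
    proof -
      have "i x = \<zero>\<^bsub>free_module K X\<^esub>"
        using mod_homD(1)[OF i that] FV.M.M.zero_closed z[OF that] unfolding free_module_def
        by (intro module_family.eqI[OF fam]) (auto simp: module_family.at_simps[OF fam])
      then show ?thesis using q(2)[OF that] FV.hom_zero[OF q(1)] by simp
    qed
    then show "carrier ?T = {\<zero>\<^bsub>?T\<^esub>}" using T.M.zero_closed by auto
  qed
  then show "carrier (ar_translate K A M) = {\<zero>\<^bsub>ar_translate K A M\<^esub>} \<longleftrightarrow> projective A M"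
    using transpose_trivial_iff[OF M] by simp
qed

lemma scalar_restr_direct_sum:
  "scalar_restr A (direct_sum I T) = direct_sum I (\<lambda>i. scalar_restr A (T i))"
  by (simp add: scalar_restr_def direct_sum_def ring.defs module.defs)

text \<open>\<open>X m\<close> is the syzygy of order m + 1, because the first syzygy already
  changes the carrier type and is taken separately. The syzygy of order n - 1 that belongs to the
  \<open>n\<close>-th translate is thus \<open>X (n - 2)\<close>.\<close>

lemma higher_ar_translate_module:
  fixes M :: "('a, 'm) module" and n :: nat
  defines "X \<equiv> (\<lambda>m. (syzygy A ^^ m) (syzygy A M))"
  assumes M: "left_module A M" "fin_gen A M" and n: "n \<ge> 1"
  shows "left_module A (higher_ar_translate K A n M)"
    "fin_gen K (scalar_restr A (higher_ar_translate K A n M))"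
    "carrier (higher_ar_translate K A n M) = {\<zero>\<^bsub>higher_ar_translate K A n M\<^esub>} \<longleftrightarrow>
      (if n = 1 then projective A M else projective A (X (n - 2)))"
proof -
  consider "n = 1" | m where "n = Suc (Suc m)" using n by (cases n; cases "n - 1") auto
  then have "left_module A (higher_ar_translate K A n M) \<and>
    fin_gen K (scalar_restr A (higher_ar_translate K A n M)) \<and>
    (carrier (higher_ar_translate K A n M) = {\<zero>\<^bsub>higher_ar_translate K A n M\<^esub>} \<longleftrightarrow>
      (if n = 1 then projective A M else projective A (X (n - 2))))"
  proof cases
    case 1
    then show ?thesis using ar_translate_module[OF M] by (simp add: higher_ar_translate_def)
  next
    case 2
    then show ?thesis using ar_translate_module[OF syzygy_funpow_module[OF syzygy_module[OF M], of m]]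
      by (simp add: higher_ar_translate_def X_def)
  qed
  then show "left_module A (higher_ar_translate K A n M)"
    "fin_gen K (scalar_restr A (higher_ar_translate K A n M))"
    "carrier (higher_ar_translate K A n M) = {\<zero>\<^bsub>higher_ar_translate K A n M\<^esub>} \<longleftrightarrow>
      (if n = 1 then projective A M else projective A (X (n - 2)))" by auto
qed

end

section \<open>Monoid algebras and quotient algebras\<close>

lemma ring_cong:
  assumes "ring R" "carrier S = carrier R" "add S = add R" "zero S = zero R" "mult S = mult R" "one S = one R"
  shows "ring S"
proof -
  interpret ring R by fact
  show ?thesis
  proof (rule ringI)
    show "abelian_group S" by (rule abelian_group_cong[OF is_abelian_group assms(2-4)])
    show "monoid S" by (rule monoidI) (auto simp: assms m_assoc)
  qed (auto simp: assms l_distr r_distr)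
qed

lemma mod_hom_cong_source:
  "carrier M' = carrier M \<Longrightarrow> add M' = add M \<Longrightarrow> smult M' = smult M \<Longrightarrow> mod_hom R M' N = mod_hom R M N"
  by (simp add: mod_hom_def)

locale monoid_alg = K: field K + G: monoid G
  for K :: "('k, 'x) ring_scheme" and G :: "('g, 'y) monoid_scheme"
begin

abbreviation "F \<equiv> monoid_algebra K G"
abbreviation "FM \<equiv> free_module K (carrier G)"
abbreviation "t \<equiv> basis_vec K G"
abbreviation supp where "supp f \<equiv> {g \<in> carrier G. f g \<noteq> \<zero>\<^bsub>K\<^esub>}"

text \<open>Monoid algebra and free module differ only in the ring fields, so the universal property
  of the free module gives linear extension from basis vectors on the algebra.\<close>

lemma F_simps: "carrier F = carrier FM" "add F = add FM" "zero F = zero FM" "smult F = smult FM"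
  by (simp_all add: monoid_algebra_def free_module_def direct_sum_simps)

lemma t_eq: "t g = unit_vec K (carrier G) g"
  by (auto simp: basis_vec_def unit_vec_def single_def)

lemma F_left_module: "left_module K F"
  by (rule left_module_cong[OF K.free_left_module]) (simp_all add: F_simps)

sublocale F: left_module K F by (rule F_left_module)

lemma t_closed: "g \<in> carrier G \<Longrightarrow> t g \<in> carrier F"
  by (simp add: F_simps t_eq K.unit_vec_closed)

lemma F_D: "f \<in> carrier F \<Longrightarrow> g \<in> carrier G \<Longrightarrow> f g \<in> carrier K" "f \<in> carrier F \<Longrightarrow> finite (supp f)"
  by (auto simp: monoid_algebra_def)

lemma F_at: "g \<in> carrier G \<Longrightarrow> (f \<oplus>\<^bsub>F\<^esub> h) g = f g \<oplus>\<^bsub>K\<^esub> h g"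
  "g \<in> carrier G \<Longrightarrow> (c \<odot>\<^bsub>F\<^esub> f) g = c \<otimes>\<^bsub>K\<^esub> f g"
  by (simp_all add: monoid_algebra_def)

lemma F_eqI: "f \<in> carrier F \<Longrightarrow> h \<in> carrier F \<Longrightarrow> (\<And>g. g \<in> carrier G \<Longrightarrow> f g = h g) \<Longrightarrow> f = h"
  by (auto simp: monoid_algebra_def intro: PiE_ext)

lemma F_hom_eqI:
  assumes "u \<in> mod_hom K F N" "v \<in> mod_hom K F N" "left_module K N"
    "\<And>g. g \<in> carrier G \<Longrightarrow> u (t g) = v (t g)" "x \<in> carrier F"
  shows "u x = v x"
  by (rule K.free_hom_eqI[of u "carrier G" N v])
    (use assms in \<open>simp_all add: mod_hom_cong_source[of FM F, OF F_simps(1,2,4)[symmetric]] F_simps t_eq\<close>)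

lemma F_generated:
  assumes U: "submodule U K F" "\<And>g. g \<in> carrier G \<Longrightarrow> t g \<in> U"
  shows "carrier F \<subseteq> U"
proof -
  interpret FM: left_module K FM by (rule K.free_left_module)
  have "submodule U K FM"
    using U(1) submodule_cong[OF K.free_left_module, of F "carrier G" U] by (simp add: F_simps)
  then have "mod_span K FM (unit_vec K (carrier G) ` carrier G) \<subseteq> U"
    by (rule FM.span_least) (use U(2) t_eq in auto)
  then show ?thesis by (simp add: K.free_span F_simps)
qed

text \<open>The sum that defines the product runs over a set depending on both factors. Padding it
  with zeros to any finite \<open>P\<close> that contains the product of the supports lets several
  products be compared over one index set.\<close>

lemma mult_at:
  assumes f: "f \<in> carrier F" and h: "h \<in> carrier F" and k: "k \<in> carrier G"
    and P: "finite P" "P \<subseteq> carrier G \<times> carrier G" "supp f \<times> supp h \<subseteq> P"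
  shows "(f \<otimes>\<^bsub>F\<^esub> h) k = (\<Oplus>\<^bsub>K\<^esub>p\<in>P. if fst p \<otimes>\<^bsub>G\<^esub> snd p = k then f (fst p) \<otimes>\<^bsub>K\<^esub> h (snd p) else \<zero>\<^bsub>K\<^esub>)"
proof -
  have "(f \<otimes>\<^bsub>F\<^esub> h) k = (\<Oplus>\<^bsub>K\<^esub>p\<in>{p \<in> carrier G \<times> carrier G. f (fst p) \<noteq> \<zero>\<^bsub>K\<^esub> \<and> h (snd p) \<noteq> \<zero>\<^bsub>K\<^esub> \<and>
      fst p \<otimes>\<^bsub>G\<^esub> snd p = k}. f (fst p) \<otimes>\<^bsub>K\<^esub> h (snd p))"
    using k by (simp add: monoid_algebra_def)
  also have "\<dots> = (\<Oplus>\<^bsub>K\<^esub>p\<in>P. if fst p \<otimes>\<^bsub>G\<^esub> snd p = k then f (fst p) \<otimes>\<^bsub>K\<^esub> h (snd p) else \<zero>\<^bsub>K\<^esub>)"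
  proof (rule K.add.finprod_mono_neutral_cong_left[OF P(1)])
    have PD: "fst p \<in> carrier G" "snd p \<in> carrier G" if "p \<in> P" for p using that P(2) by auto
    show "{p \<in> carrier G \<times> carrier G. f (fst p) \<noteq> \<zero>\<^bsub>K\<^esub> \<and> h (snd p) \<noteq> \<zero>\<^bsub>K\<^esub> \<and> fst p \<otimes>\<^bsub>G\<^esub> snd p = k} \<subseteq> P"
      using P(3) by auto
    show "(if fst p \<otimes>\<^bsub>G\<^esub> snd p = k then f (fst p) \<otimes>\<^bsub>K\<^esub> h (snd p) else \<zero>\<^bsub>K\<^esub>) = \<zero>\<^bsub>K\<^esub>"
      if "p \<in> P - {p \<in> carrier G \<times> carrier G. f (fst p) \<noteq> \<zero>\<^bsub>K\<^esub> \<and> h (snd p) \<noteq> \<zero>\<^bsub>K\<^esub> \<and> fst p \<otimes>\<^bsub>G\<^esub> snd p = k}" for p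
    proof -
      have "f (fst p) = \<zero>\<^bsub>K\<^esub> \<or> h (snd p) = \<zero>\<^bsub>K\<^esub> \<or> fst p \<otimes>\<^bsub>G\<^esub> snd p \<noteq> k"
        using that PD[of p] by (auto simp: mem_Times_iff)
      then show ?thesis using that PD[of p] F_D(1)[OF f] F_D(1)[OF h] by auto
    qed
    show "(\<lambda>p. if fst p \<otimes>\<^bsub>G\<^esub> snd p = k then f (fst p) \<otimes>\<^bsub>K\<^esub> h (snd p) else \<zero>\<^bsub>K\<^esub>) \<in> P \<rightarrow> carrier K"
      using PD F_D(1)[OF f] F_D(1)[OF h] by auto
  qed auto
  finally show ?thesis .
qed

lemma mult_closed:
  assumes f: "f \<in> carrier F" and h: "h \<in> carrier F" shows "f \<otimes>\<^bsub>F\<^esub> h \<in> carrier F"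
proof -
  let ?P = "supp f \<times> supp h"
  have P: "finite ?P" "?P \<subseteq> carrier G \<times> carrier G" using F_D(2) f h by auto
  note m = mult_at[OF f h _ P order_refl]
  have "(f \<otimes>\<^bsub>F\<^esub> h) k \<in> carrier K" if "k \<in> carrier G" for k
    unfolding m[OF that] using F_D(1) f h by (intro K.finsum_closed) auto
  moreover have z: "(f \<otimes>\<^bsub>F\<^esub> h) k = \<zero>\<^bsub>K\<^esub>" if "k \<in> carrier G" "k \<notin> (\<lambda>p. fst p \<otimes>\<^bsub>G\<^esub> snd p) ` ?P" for k
    unfolding m[OF that(1)] using that(2) by (intro K.add.finprod_one_eqI) auto
  have "supp (f \<otimes>\<^bsub>F\<^esub> h) \<subseteq> (\<lambda>p. fst p \<otimes>\<^bsub>G\<^esub> snd p) ` ?P"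
    by (rule subsetI, rule ccontr) (use z in blast)
  then have "finite (supp (f \<otimes>\<^bsub>F\<^esub> h))" by (rule finite_subset[OF _ finite_imageI[OF P(1)]])
  moreover have "f \<otimes>\<^bsub>F\<^esub> h \<in> extensional (carrier G)" by (simp add: monoid_algebra_def)
  ultimately show ?thesis by (simp add: monoid_algebra_def[of K G] PiE_def Pi_def)
qed

lemma mult_left_hom:
  assumes h: "h \<in> carrier F" shows "(\<lambda>f. f \<otimes>\<^bsub>F\<^esub> h) \<in> mod_hom K F F"
proof (rule mod_homI)
  show "f \<otimes>\<^bsub>F\<^esub> h \<in> carrier F" if "f \<in> carrier F" for f using mult_closed that h by blast
next
  fix f f' assume ff: "f \<in> carrier F" "f' \<in> carrier F"
  show "(f \<oplus>\<^bsub>F\<^esub> f') \<otimes>\<^bsub>F\<^esub> h = f \<otimes>\<^bsub>F\<^esub> h \<oplus>\<^bsub>F\<^esub> f' \<otimes>\<^bsub>F\<^esub> h"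
  proof (rule F_eqI)
    fix k assume k: "k \<in> carrier G"
    let ?P = "(supp f \<union> supp f') \<times> supp h"
    have P: "finite ?P" "?P \<subseteq> carrier G \<times> carrier G" using F_D(2) ff h by auto
    have "supp (f \<oplus>\<^bsub>F\<^esub> f') \<times> supp h \<subseteq> ?P" by (auto simp: F_at)
    then have "((f \<oplus>\<^bsub>F\<^esub> f') \<otimes>\<^bsub>F\<^esub> h) k =
      (\<Oplus>\<^bsub>K\<^esub>p\<in>?P. if fst p \<otimes>\<^bsub>G\<^esub> snd p = k then (f \<oplus>\<^bsub>F\<^esub> f') (fst p) \<otimes>\<^bsub>K\<^esub> h (snd p) else \<zero>\<^bsub>K\<^esub>)"
      using ff h k P by (intro mult_at) auto
    also have "\<dots> = (\<Oplus>\<^bsub>K\<^esub>p\<in>?P. (if fst p \<otimes>\<^bsub>G\<^esub> snd p = k then f (fst p) \<otimes>\<^bsub>K\<^esub> h (snd p) else \<zero>\<^bsub>K\<^esub>)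
        \<oplus>\<^bsub>K\<^esub> (if fst p \<otimes>\<^bsub>G\<^esub> snd p = k then f' (fst p) \<otimes>\<^bsub>K\<^esub> h (snd p) else \<zero>\<^bsub>K\<^esub>))"
      using F_D(1) ff h by (intro K.finsum_cong') (auto simp: F_at K.l_distr)
    also have "\<dots> = (f \<otimes>\<^bsub>F\<^esub> h) k \<oplus>\<^bsub>K\<^esub> (f' \<otimes>\<^bsub>F\<^esub> h) k"
    proof -
      have sub: "supp f \<times> supp h \<subseteq> ?P" "supp f' \<times> supp h \<subseteq> ?P" by auto
      show ?thesis unfolding mult_at[OF ff(1) h k P sub(1)] mult_at[OF ff(2) h k P sub(2)]
        using F_D(1) ff h by (intro K.finsum_addf) auto
    qed
    finally show "((f \<oplus>\<^bsub>F\<^esub> f') \<otimes>\<^bsub>F\<^esub> h) k = (f \<otimes>\<^bsub>F\<^esub> h \<oplus>\<^bsub>F\<^esub> f' \<otimes>\<^bsub>F\<^esub> h) k"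
      using k by (simp add: F_at)
  qed (use ff h mult_closed in auto)
next
  fix c f assume c: "c \<in> carrier K" and f: "f \<in> carrier F"
  show "(c \<odot>\<^bsub>F\<^esub> f) \<otimes>\<^bsub>F\<^esub> h = c \<odot>\<^bsub>F\<^esub> (f \<otimes>\<^bsub>F\<^esub> h)"
  proof (rule F_eqI)
    fix k assume k: "k \<in> carrier G"
    let ?P = "supp f \<times> supp h"
    have P: "finite ?P" "?P \<subseteq> carrier G \<times> carrier G" using F_D(2) f h by auto
    have "supp (c \<odot>\<^bsub>F\<^esub> f) \<times> supp h \<subseteq> ?P" using c by (auto simp: F_at)
    then have "((c \<odot>\<^bsub>F\<^esub> f) \<otimes>\<^bsub>F\<^esub> h) k =
      (\<Oplus>\<^bsub>K\<^esub>p\<in>?P. if fst p \<otimes>\<^bsub>G\<^esub> snd p = k then (c \<odot>\<^bsub>F\<^esub> f) (fst p) \<otimes>\<^bsub>K\<^esub> h (snd p) else \<zero>\<^bsub>K\<^esub>)"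
      using c f h k P F.smult_closed by (intro mult_at) auto
    also have "\<dots> = (\<Oplus>\<^bsub>K\<^esub>p\<in>?P. c \<otimes>\<^bsub>K\<^esub> (if fst p \<otimes>\<^bsub>G\<^esub> snd p = k then f (fst p) \<otimes>\<^bsub>K\<^esub> h (snd p) else \<zero>\<^bsub>K\<^esub>))"
      using c F_D(1) f h by (intro K.finsum_cong') (auto simp: F_at K.m_assoc)
    also have "\<dots> = c \<otimes>\<^bsub>K\<^esub> (f \<otimes>\<^bsub>F\<^esub> h) k"
      unfolding mult_at[OF f h k P order_refl]
      using c F_D(1) f h P(1) by (intro K.finsum_rdistr[symmetric]) auto
    finally show "((c \<odot>\<^bsub>F\<^esub> f) \<otimes>\<^bsub>F\<^esub> h) k = (c \<odot>\<^bsub>F\<^esub> (f \<otimes>\<^bsub>F\<^esub> h)) k"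
      using k by (simp add: F_at)
  qed (use c f h mult_closed F.smult_closed in auto)
qed

lemma mult_right_hom:
  assumes f: "f \<in> carrier F" shows "(\<lambda>h. f \<otimes>\<^bsub>F\<^esub> h) \<in> mod_hom K F F"
proof (rule mod_homI)
  show "f \<otimes>\<^bsub>F\<^esub> h \<in> carrier F" if "h \<in> carrier F" for h using mult_closed that f by blast
next
  fix h h' assume hh: "h \<in> carrier F" "h' \<in> carrier F"
  show "f \<otimes>\<^bsub>F\<^esub> (h \<oplus>\<^bsub>F\<^esub> h') = f \<otimes>\<^bsub>F\<^esub> h \<oplus>\<^bsub>F\<^esub> f \<otimes>\<^bsub>F\<^esub> h'"
  proof (rule F_eqI)
    fix k assume k: "k \<in> carrier G"
    let ?P = "supp f \<times> (supp h \<union> supp h')"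
    have P: "finite ?P" "?P \<subseteq> carrier G \<times> carrier G" using F_D(2) f hh by auto
    have "supp f \<times> supp (h \<oplus>\<^bsub>F\<^esub> h') \<subseteq> ?P" by (auto simp: F_at)
    then have "(f \<otimes>\<^bsub>F\<^esub> (h \<oplus>\<^bsub>F\<^esub> h')) k =
      (\<Oplus>\<^bsub>K\<^esub>p\<in>?P. if fst p \<otimes>\<^bsub>G\<^esub> snd p = k then f (fst p) \<otimes>\<^bsub>K\<^esub> (h \<oplus>\<^bsub>F\<^esub> h') (snd p) else \<zero>\<^bsub>K\<^esub>)"
      using f hh k P by (intro mult_at) auto
    also have "\<dots> = (\<Oplus>\<^bsub>K\<^esub>p\<in>?P. (if fst p \<otimes>\<^bsub>G\<^esub> snd p = k then f (fst p) \<otimes>\<^bsub>K\<^esub> h (snd p) else \<zero>\<^bsub>K\<^esub>)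
        \<oplus>\<^bsub>K\<^esub> (if fst p \<otimes>\<^bsub>G\<^esub> snd p = k then f (fst p) \<otimes>\<^bsub>K\<^esub> h' (snd p) else \<zero>\<^bsub>K\<^esub>))"
      using F_D(1) f hh by (intro K.finsum_cong') (auto simp: F_at K.r_distr)
    also have "\<dots> = (f \<otimes>\<^bsub>F\<^esub> h) k \<oplus>\<^bsub>K\<^esub> (f \<otimes>\<^bsub>F\<^esub> h') k"
    proof -
      have sub: "supp f \<times> supp h \<subseteq> ?P" "supp f \<times> supp h' \<subseteq> ?P" by auto
      show ?thesis unfolding mult_at[OF f hh(1) k P sub(1)] mult_at[OF f hh(2) k P sub(2)]
        using F_D(1) f hh by (intro K.finsum_addf) auto
    qed
    finally show "(f \<otimes>\<^bsub>F\<^esub> (h \<oplus>\<^bsub>F\<^esub> h')) k = (f \<otimes>\<^bsub>F\<^esub> h \<oplus>\<^bsub>F\<^esub> f \<otimes>\<^bsub>F\<^esub> h') k"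
      using k by (simp add: F_at)
  qed (use f hh mult_closed in auto)
next
  fix c h assume c: "c \<in> carrier K" and h: "h \<in> carrier F"
  show "f \<otimes>\<^bsub>F\<^esub> (c \<odot>\<^bsub>F\<^esub> h) = c \<odot>\<^bsub>F\<^esub> (f \<otimes>\<^bsub>F\<^esub> h)"
  proof (rule F_eqI)
    fix k assume k: "k \<in> carrier G"
    let ?P = "supp f \<times> supp h"
    have P: "finite ?P" "?P \<subseteq> carrier G \<times> carrier G" using F_D(2) f h by auto
    have "supp f \<times> supp (c \<odot>\<^bsub>F\<^esub> h) \<subseteq> ?P" using c by (auto simp: F_at)
    then have "(f \<otimes>\<^bsub>F\<^esub> (c \<odot>\<^bsub>F\<^esub> h)) k =
      (\<Oplus>\<^bsub>K\<^esub>p\<in>?P. if fst p \<otimes>\<^bsub>G\<^esub> snd p = k then f (fst p) \<otimes>\<^bsub>K\<^esub> (c \<odot>\<^bsub>F\<^esub> h) (snd p) else \<zero>\<^bsub>K\<^esub>)"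
      using c f h k P F.smult_closed by (intro mult_at) auto
    also have "\<dots> = (\<Oplus>\<^bsub>K\<^esub>p\<in>?P. c \<otimes>\<^bsub>K\<^esub> (if fst p \<otimes>\<^bsub>G\<^esub> snd p = k then f (fst p) \<otimes>\<^bsub>K\<^esub> h (snd p) else \<zero>\<^bsub>K\<^esub>))"
      using c F_D(1) f h by (intro K.finsum_cong') (auto simp: F_at K.m_lcomm)
    also have "\<dots> = c \<otimes>\<^bsub>K\<^esub> (f \<otimes>\<^bsub>F\<^esub> h) k"
      unfolding mult_at[OF f h k P order_refl]
      using c F_D(1) f h P(1) by (intro K.finsum_rdistr[symmetric]) auto
    finally show "(f \<otimes>\<^bsub>F\<^esub> (c \<odot>\<^bsub>F\<^esub> h)) k = (c \<odot>\<^bsub>F\<^esub> (f \<otimes>\<^bsub>F\<^esub> h)) k"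
      using k by (simp add: F_at)
  qed (use c f h mult_closed F.smult_closed in auto)
qed

lemma t_mult:
  assumes "g \<in> carrier G" "h \<in> carrier G" shows "t g \<otimes>\<^bsub>F\<^esub> t h = t (g \<otimes>\<^bsub>G\<^esub> h)"
proof (rule F_eqI)
  fix k assume k: "k \<in> carrier G"
  have "(t g \<otimes>\<^bsub>F\<^esub> t h) k = (\<Oplus>\<^bsub>K\<^esub>p\<in>{(g, h)}. if fst p \<otimes>\<^bsub>G\<^esub> snd p = k then t g (fst p) \<otimes>\<^bsub>K\<^esub> t h (snd p) else \<zero>\<^bsub>K\<^esub>)"
    using assms t_closed k by (intro mult_at) (auto simp: basis_vec_def split: if_splits)
  also have "\<dots> = t (g \<otimes>\<^bsub>G\<^esub> h) k" using assms k by (simp add: basis_vec_def)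
  finally show "(t g \<otimes>\<^bsub>F\<^esub> t h) k = t (g \<otimes>\<^bsub>G\<^esub> h) k" .
qed (use assms t_closed mult_closed in auto)

text \<open>Both sides are linear in each argument, so the identity is extended from basis vectors
  one argument at a time, from the last to the first.\<close>

lemma mult_assoc:
  assumes x: "x \<in> carrier F" and y: "y \<in> carrier F" and z: "z \<in> carrier F"
  shows "x \<otimes>\<^bsub>F\<^esub> y \<otimes>\<^bsub>F\<^esub> z = x \<otimes>\<^bsub>F\<^esub> (y \<otimes>\<^bsub>F\<^esub> z)"
proof -
  have 1: "t g \<otimes>\<^bsub>F\<^esub> t h \<otimes>\<^bsub>F\<^esub> z = t g \<otimes>\<^bsub>F\<^esub> (t h \<otimes>\<^bsub>F\<^esub> z)"
    if "g \<in> carrier G" "h \<in> carrier G" "z \<in> carrier F" for g h z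
    by (rule F_hom_eqI[OF _ _ F_left_module _ that(3)])
      (use that in \<open>auto intro!: mult_right_hom mod_hom_comp[OF mult_right_hom mult_right_hom] mult_closed t_closed
        simp: t_mult G.m_assoc\<close>)
  have 2: "t g \<otimes>\<^bsub>F\<^esub> y \<otimes>\<^bsub>F\<^esub> z = t g \<otimes>\<^bsub>F\<^esub> (y \<otimes>\<^bsub>F\<^esub> z)" if "g \<in> carrier G" for g
    by (rule F_hom_eqI[OF mod_hom_comp[OF mult_right_hom mult_left_hom] mod_hom_comp[OF mult_left_hom mult_right_hom]
          F_left_module _ y]) (use 1 that z t_closed in auto)
  show ?thesis
    by (rule F_hom_eqI[OF mod_hom_comp[OF mult_left_hom mult_left_hom] mult_left_hom F_left_module _ x])
      (use 2 y z mult_closed in auto)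
qed

lemma one_eq: "\<one>\<^bsub>F\<^esub> = t \<one>\<^bsub>G\<^esub>"
  by (simp add: monoid_algebra_def basis_vec_def)

lemma F_algebra: "assoc_algebra K F"
proof (rule assoc_algebraI[OF K.cring_axioms F_left_module])
  have lone: "t \<one>\<^bsub>G\<^esub> \<otimes>\<^bsub>F\<^esub> x = x" "x \<otimes>\<^bsub>F\<^esub> t \<one>\<^bsub>G\<^esub> = x" if "x \<in> carrier F" for x
    by (rule F_hom_eqI[OF mult_right_hom mod_hom_id F_left_module _ that]
        F_hom_eqI[OF mult_left_hom mod_hom_id F_left_module _ that];
        use t_closed t_mult in auto)+
  show "ring F"
  proof (rule ringI)
    show "abelian_group F" by (rule F.M.abelian_group_axioms)
    show "monoid F" by (rule monoidI) (auto simp: mult_closed mult_assoc one_eq t_closed lone)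
  qed (auto simp: mod_homD(2)[OF mult_left_hom] mod_homD(2)[OF mult_right_hom])
qed (auto simp: mod_homD(3)[OF mult_left_hom] mod_homD(3)[OF mult_right_hom])

end

lemma ideal_submodule:
  assumes "assoc_algebra K A" "ideal I A" shows "submodule I K A"
proof -
  interpret assoc_algebra K A by fact
  interpret I: ideal I A by fact
  interpret L: left_module K A by (rule assoc_algebra_left_module[OF assms(1)])
  have "c \<odot>\<^bsub>A\<^esub> x \<in> I" if "c \<in> carrier K" "x \<in> I" for c x
  proof -
    have "(c \<odot>\<^bsub>A\<^esub> \<one>\<^bsub>A\<^esub>) \<otimes>\<^bsub>A\<^esub> x \<in> I" using that by (intro I.I_l_closed) auto
    then show ?thesis using that scalar_mult(1)[of c x] I.Icarr by simp
  qed
  then show ?thesis unfolding L.submodule_iff using I.a_subset by auto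
qed

lemma quotient_algebra_mult:
  assumes "ideal I A" "x \<in> carrier A" "y \<in> carrier A"
  shows "(I +>\<^bsub>A\<^esub> x) \<otimes>\<^bsub>quot_mod A I\<^esub> (I +>\<^bsub>A\<^esub> y) = I +>\<^bsub>A\<^esub> (x \<otimes>\<^bsub>A\<^esub> y)"
  using ideal.rcoset_mult_add[OF assms] by (simp add: quot_mod_simps)

lemma quotient_algebra:
  assumes A: "assoc_algebra K A" and I: "ideal I A" shows "assoc_algebra K (quot_mod A I)"
proof -
  interpret assoc_algebra K A by fact
  interpret I: ideal I A by fact
  interpret Q: quotient_module K A I
    by (rule quotient_moduleI[OF assoc_algebra_left_module[OF A] ideal_submodule[OF A I]])
  have rg: "ring (quot_mod A I)"
    by (rule ring_cong[OF I.quotient_is_ring]) (simp_all add: quot_mod_simps FactRing_def)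
  show ?thesis
    by (rule assoc_algebraI[OF R.cring_axioms Q.quot_left_module rg])
      (auto simp: Q.quot_carrier Q.quot_smult quotient_algebra_mult[OF I] smult_mult_left smult_mult_right)
qed

section \<open>Tensor products of algebras\<close>

locale tensor_alg = field K + A: assoc_algebra K A + B: assoc_algebra K B
  for K :: "('k, 'x) ring_scheme" and A :: "('k, 'a) module" and B :: "('k, 'b) module"
begin

abbreviation "G \<equiv> A \<times>\<times> B"

lemma G_simps [simp]: "(a, b) \<otimes>\<^bsub>G\<^esub> (a', b') = (a \<otimes>\<^bsub>A\<^esub> a', b \<otimes>\<^bsub>B\<^esub> b')" "\<one>\<^bsub>G\<^esub> = (\<one>\<^bsub>A\<^esub>, \<one>\<^bsub>B\<^esub>)"
  by (simp_all add: DirProd_def)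

sublocale F: monoid_alg K G
proof -
  have "monoid G" using DirProd_monoid[of A B] A.A.monoid_axioms B.A.monoid_axioms by simp
  then show "monoid_alg K G" by (simp add: monoid_alg_def field_axioms)
qed

sublocale FA: assoc_algebra K F.F by (rule F.F_algebra)

abbreviation "T \<equiv> tensor_algebra K A B"
definition "I = Idl\<^bsub>F.F\<^esub> (tensor_relations K A B)"
definition "tens a b = I +>\<^bsub>F.F\<^esub> F.t (a, b)"

lemma relations_closed: "tensor_relations K A B \<subseteq> carrier F.F"
  unfolding tensor_relations_def Let_def using F.t_closed F.F.smult_closed by auto

lemma I_ideal: "ideal I F.F"
  unfolding I_def by (rule FA.genideal_ideal[OF relations_closed])

lemma T_eq: "T = quot_mod F.F I" by (simp add: tensor_algebra_def I_def Let_def)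

lemma T_algebra: "assoc_algebra K T"
  unfolding T_eq by (rule quotient_algebra[OF F.F_algebra I_ideal])

sublocale T: assoc_algebra K T by (rule T_algebra)

sublocale Q: quotient_module K F.F I
  by (rule quotient_moduleI[OF F.F_left_module ideal_submodule[OF F.F_algebra I_ideal]])

lemma relation_in_I: "r \<in> tensor_relations K A B \<Longrightarrow> r \<in> I"
  unfolding I_def using FA.genideal_self[OF relations_closed] by blast

lemma tens_closed: "a \<in> carrier A \<Longrightarrow> b \<in> carrier B \<Longrightarrow> tens a b \<in> carrier T"
  by (auto simp: T_eq tens_def Q.quot_carrier intro!: F.t_closed)

lemma tens_add_left:
  assumes "a \<in> carrier A" "a' \<in> carrier A" "b \<in> carrier B"
  shows "tens (a \<oplus>\<^bsub>A\<^esub> a') b = tens a b \<oplus>\<^bsub>T\<^esub> tens a' b"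
proof -
  have "F.t (a \<oplus>\<^bsub>A\<^esub> a', b) \<ominus>\<^bsub>F.F\<^esub> (F.t (a, b) \<oplus>\<^bsub>F.F\<^esub> F.t (a', b)) \<in> I"
    using assms by (intro relation_in_I) (auto simp: tensor_relations_def Let_def)
  then show ?thesis
    using assms F.t_closed by (simp add: T_eq tens_def Q.quot_add Q.cls_eq_iff)
qed

lemma tens_add_right:
  assumes "a \<in> carrier A" "b \<in> carrier B" "b' \<in> carrier B"
  shows "tens a (b \<oplus>\<^bsub>B\<^esub> b') = tens a b \<oplus>\<^bsub>T\<^esub> tens a b'"
proof -
  have "F.t (a, b \<oplus>\<^bsub>B\<^esub> b') \<ominus>\<^bsub>F.F\<^esub> (F.t (a, b) \<oplus>\<^bsub>F.F\<^esub> F.t (a, b')) \<in> I"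
    using assms by (intro relation_in_I) (auto simp: tensor_relations_def Let_def)
  then show ?thesis
    using assms F.t_closed by (simp add: T_eq tens_def Q.quot_add Q.cls_eq_iff)
qed

lemma tens_smult_left:
  assumes "c \<in> carrier K" "a \<in> carrier A" "b \<in> carrier B"
  shows "tens (c \<odot>\<^bsub>A\<^esub> a) b = c \<odot>\<^bsub>T\<^esub> tens a b"
proof -
  have "F.t (c \<odot>\<^bsub>A\<^esub> a, b) \<ominus>\<^bsub>F.F\<^esub> c \<odot>\<^bsub>F.F\<^esub> F.t (a, b) \<in> I"
    using assms by (intro relation_in_I) (auto simp: tensor_relations_def Let_def)
  then show ?thesis
    using assms F.t_closed F.F.smult_closed by (simp add: T_eq tens_def Q.quot_smult Q.cls_eq_iff)
qed

lemma tens_smult_right: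
  assumes "c \<in> carrier K" "a \<in> carrier A" "b \<in> carrier B"
  shows "tens a (c \<odot>\<^bsub>B\<^esub> b) = c \<odot>\<^bsub>T\<^esub> tens a b"
proof -
  have "F.t (a, c \<odot>\<^bsub>B\<^esub> b) \<ominus>\<^bsub>F.F\<^esub> c \<odot>\<^bsub>F.F\<^esub> F.t (a, b) \<in> I"
    using assms by (intro relation_in_I) (auto simp: tensor_relations_def Let_def)
  then show ?thesis
    using assms F.t_closed F.F.smult_closed by (simp add: T_eq tens_def Q.quot_smult Q.cls_eq_iff)
qed

lemma tens_mult:
  assumes "a \<in> carrier A" "a' \<in> carrier A" "b \<in> carrier B" "b' \<in> carrier B"
  shows "tens a b \<otimes>\<^bsub>T\<^esub> tens a' b' = tens (a \<otimes>\<^bsub>A\<^esub> a') (b \<otimes>\<^bsub>B\<^esub> b')"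
  using assms by (simp add: T_eq tens_def quotient_algebra_mult[OF I_ideal] F.t_closed F.t_mult)

lemma tens_one: "\<one>\<^bsub>T\<^esub> = tens \<one>\<^bsub>A\<^esub> \<one>\<^bsub>B\<^esub>"
  by (simp add: T_eq tens_def quot_mod_simps F.one_eq)

text \<open>Scalar multiples need no case of their own, as a scalar is absorbed by a pure tensor. In
  the proof this is why \<open>U\<close> asks for \<open>P\<close> at all scalar multiples of the
  class: that makes \<open>U\<close> a subspace although \<open>P\<close> is only assumed
  additive.\<close>

lemma T_induct [consumes 1, case_names zero tens add]:
  assumes r: "r \<in> carrier T" and zero: "P \<zero>\<^bsub>T\<^esub>"
    and tens: "\<And>a b. a \<in> carrier A \<Longrightarrow> b \<in> carrier B \<Longrightarrow> P (tens a b)"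
    and add: "\<And>x y. x \<in> carrier T \<Longrightarrow> y \<in> carrier T \<Longrightarrow> P x \<Longrightarrow> P y \<Longrightarrow> P (x \<oplus>\<^bsub>T\<^esub> y)"
  shows "P r"
proof -
  define U where "U = {f \<in> carrier F.F. \<forall>c\<in>carrier K. P (Q.cls (c \<odot>\<^bsub>F.F\<^esub> f))}"
  have "submodule U K F.F" unfolding F.F.submodule_iff U_def
  proof (intro conjI ballI)
    show "\<zero>\<^bsub>F.F\<^esub> \<in> {f \<in> carrier F.F. \<forall>c\<in>carrier K. P (Q.cls (c \<odot>\<^bsub>F.F\<^esub> f))}"
      using zero by (simp add: F.F.smult_r_null T_eq Q.quot_zero Q.cls_zero)
    fix f h assume fh: "f \<in> {f \<in> carrier F.F. \<forall>c\<in>carrier K. P (Q.cls (c \<odot>\<^bsub>F.F\<^esub> f))}"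
      "h \<in> {f \<in> carrier F.F. \<forall>c\<in>carrier K. P (Q.cls (c \<odot>\<^bsub>F.F\<^esub> f))}"
    have "P (Q.cls (c \<odot>\<^bsub>F.F\<^esub> (f \<oplus>\<^bsub>F.F\<^esub> h)))" if "c \<in> carrier K" for c
      using fh that add[of "Q.cls (c \<odot>\<^bsub>F.F\<^esub> f)" "Q.cls (c \<odot>\<^bsub>F.F\<^esub> h)"]
      by (simp add: T_eq Q.quot_carrier F.F.smult_r_distr F.F.smult_closed Q.quot_add)
    then show "f \<oplus>\<^bsub>F.F\<^esub> h \<in> {f \<in> carrier F.F. \<forall>c\<in>carrier K. P (Q.cls (c \<odot>\<^bsub>F.F\<^esub> f))}" using fh by simp
  next
    fix c f assume "c \<in> carrier K" "f \<in> {f \<in> carrier F.F. \<forall>c\<in>carrier K. P (Q.cls (c \<odot>\<^bsub>F.F\<^esub> f))}"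
    then show "c \<odot>\<^bsub>F.F\<^esub> f \<in> {f \<in> carrier F.F. \<forall>c\<in>carrier K. P (Q.cls (c \<odot>\<^bsub>F.F\<^esub> f))}"
      by (simp add: F.F.smult_closed F.F.smult_assoc1[symmetric])
  qed auto
  moreover have "F.t g \<in> U" if g: "g \<in> carrier G" for g
  proof -
    obtain a b where ab: "g = (a, b)" "a \<in> carrier A" "b \<in> carrier B" using g by auto
    have "Q.cls (c \<odot>\<^bsub>F.F\<^esub> F.t g) = tens (c \<odot>\<^bsub>A\<^esub> a) b" if "c \<in> carrier K" for c
      using that ab tens_smult_left[of c a b] F.t_closed[OF g]
      by (simp add: T_eq tens_def Q.quot_smult)
    then show ?thesis unfolding U_def using ab tens F.t_closed[OF g] by auto
  qed
  ultimately have "carrier F.F \<subseteq> U"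
    by (rule F.F_generated)
  moreover obtain f where "f \<in> carrier F.F" "r = Q.cls f" using r by (auto simp: T_eq Q.quot_carrier)
  ultimately have "\<forall>c\<in>carrier K. P (Q.cls (c \<odot>\<^bsub>F.F\<^esub> f))" and f: "f \<in> carrier F.F" "r = Q.cls f"
    by (simp_all add: U_def subset_iff)
  from bspec[OF this(1) one_closed] show ?thesis using F.F.smult_one[OF f(1)] f(2) by simp
qed

text \<open>The formula for the induced map is the one in the definition of the regular bimodule.\<close>

lemma T_universal:
  assumes N: "left_module K N"
    and cl: "\<And>a b. a \<in> carrier A \<Longrightarrow> b \<in> carrier B \<Longrightarrow> \<beta> a b \<in> carrier N"
    and add1: "\<And>a a' b. a \<in> carrier A \<Longrightarrow> a' \<in> carrier A \<Longrightarrow> b \<in> carrier B \<Longrightarrow> \<beta> (a \<oplus>\<^bsub>A\<^esub> a') b = \<beta> a b \<oplus>\<^bsub>N\<^esub> \<beta> a' b"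
    and add2: "\<And>a b b'. a \<in> carrier A \<Longrightarrow> b \<in> carrier B \<Longrightarrow> b' \<in> carrier B \<Longrightarrow> \<beta> a (b \<oplus>\<^bsub>B\<^esub> b') = \<beta> a b \<oplus>\<^bsub>N\<^esub> \<beta> a b'"
    and sm1: "\<And>c a b. c \<in> carrier K \<Longrightarrow> a \<in> carrier A \<Longrightarrow> b \<in> carrier B \<Longrightarrow> \<beta> (c \<odot>\<^bsub>A\<^esub> a) b = c \<odot>\<^bsub>N\<^esub> \<beta> a b"
    and sm2: "\<And>c a b. c \<in> carrier K \<Longrightarrow> a \<in> carrier A \<Longrightarrow> b \<in> carrier B \<Longrightarrow> \<beta> a (c \<odot>\<^bsub>B\<^esub> b) = c \<odot>\<^bsub>N\<^esub> \<beta> a b"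
  defines "h \<equiv> \<lambda>C. the_elem ((\<lambda>f. \<Oplus>\<^bsub>N\<^esub>p\<in>{p \<in> carrier A \<times> carrier B. f p \<noteq> \<zero>\<^bsub>K\<^esub>}. f p \<odot>\<^bsub>N\<^esub> \<beta> (fst p) (snd p)) ` C)"
  shows "h \<in> mod_hom K T N" "\<And>a b. a \<in> carrier A \<Longrightarrow> b \<in> carrier B \<Longrightarrow> h (tens a b) = \<beta> a b"
proof -
  interpret N: left_module K N by (rule N)
  interpret FN: module_pair K F.F N by unfold_locales
  obtain H0 where H0: "H0 \<in> mod_hom K F.FM N"
    "\<And>g. g \<in> carrier G \<Longrightarrow> H0 (unit_vec K (carrier G) g) = \<beta> (fst g) (snd g)"
    "\<And>f. H0 f = (\<Oplus>\<^bsub>N\<^esub>p\<in>{p \<in> carrier G. f p \<noteq> \<zero>\<^bsub>K\<^esub>}. f p \<odot>\<^bsub>N\<^esub> \<beta> (fst p) (snd p))"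
    by (rule free_lift[OF N, of "carrier G" "\<lambda>p. \<beta> (fst p) (snd p)"]) (use cl in auto)
  define H where "H f = (\<Oplus>\<^bsub>N\<^esub>p\<in>{p \<in> carrier A \<times> carrier B. f p \<noteq> \<zero>\<^bsub>K\<^esub>}. f p \<odot>\<^bsub>N\<^esub> \<beta> (fst p) (snd p))" for f
  have HH0: "H = H0" by (rule ext) (simp add: H_def H0(3))
  have H: "H \<in> mod_hom K F.F N"
    using H0(1) unfolding HH0 mod_hom_cong_source[of F.F F.FM, OF F.F_simps(1,2,4)] .
  have Ht: "H (F.t (a, b)) = \<beta> a b" if "a \<in> carrier A" "b \<in> carrier B" for a b
    using H0(2)[of "(a, b)"] that by (simp add: HH0 F.t_eq)
  \<comment> \<open>\<open>H\<close> is merely linear, so its kernel is not an ideal.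
    \<open>Z\<close> is the largest two-sided ideal inside the kernel; it contains the relations
    because multiplying a relation by basis vectors on both sides gives a relation of the same
    kind.\<close>
  define Z where "Z = {f \<in> carrier F.F. \<forall>u\<in>carrier F.F. \<forall>v\<in>carrier F.F. H (u \<otimes>\<^bsub>F.F\<^esub> f \<otimes>\<^bsub>F.F\<^esub> v) = \<zero>\<^bsub>N\<^esub>}"
  have lr: "(\<lambda>x. H (u \<otimes>\<^bsub>F.F\<^esub> x \<otimes>\<^bsub>F.F\<^esub> v)) \<in> mod_hom K F.F N" if "u \<in> carrier F.F" "v \<in> carrier F.F" for u v
    by (rule mod_hom_comp[OF mod_hom_comp[OF F.mult_right_hom F.mult_left_hom] H]) (use that in auto)
  have Zi: "ideal Z F.F"
  proof (rule idealI)
    show "ring F.F" by (rule FA.A.ring_axioms)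
    have "Z = (\<Inter>u\<in>carrier F.F. \<Inter>v\<in>carrier F.F. {x \<in> carrier F.F. H (u \<otimes>\<^bsub>F.F\<^esub> x \<otimes>\<^bsub>F.F\<^esub> v) \<in> {\<zero>\<^bsub>N\<^esub>}})"
      unfolding Z_def using FA.A.one_closed by auto
    have "submodule Z K F.F" unfolding F.F.submodule_iff Z_def
      using FN.hom_zero[OF lr] mod_homD(2,3)[OF lr] F.F.smult_closed N.smult_r_null by auto
    then show "subgroup Z (add_monoid F.F)" by (rule submodule.axioms(1))
    show "x \<otimes>\<^bsub>F.F\<^esub> f \<in> Z" if "f \<in> Z" "x \<in> carrier F.F" for f x
      using that by (auto simp: Z_def FA.A.m_assoc[symmetric])
    show "f \<otimes>\<^bsub>F.F\<^esub> x \<in> Z" if "f \<in> Z" "x \<in> carrier F.F" for f x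
    proof -
      have "u \<otimes>\<^bsub>F.F\<^esub> (f \<otimes>\<^bsub>F.F\<^esub> x) \<otimes>\<^bsub>F.F\<^esub> v = u \<otimes>\<^bsub>F.F\<^esub> f \<otimes>\<^bsub>F.F\<^esub> (x \<otimes>\<^bsub>F.F\<^esub> v)"
        if "u \<in> carrier F.F" "v \<in> carrier F.F" for u v
        using that \<open>f \<in> Z\<close> \<open>x \<in> carrier F.F\<close> by (simp add: Z_def FA.A.m_assoc)
      then show ?thesis using that by (simp add: Z_def)
    qed
  qed
  have zero_hom: "(\<lambda>x. \<zero>\<^bsub>N\<^esub>) \<in> mod_hom K F.F N" by (rule FN.hom_zero_fun)
  have ZI: "f \<in> Z" if f: "f \<in> carrier F.F"
    and z: "\<And>g k. g \<in> carrier G \<Longrightarrow> k \<in> carrier G \<Longrightarrow> H (F.t g \<otimes>\<^bsub>F.F\<^esub> f \<otimes>\<^bsub>F.F\<^esub> F.t k) = \<zero>\<^bsub>N\<^esub>" for f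
  proof -
    have 1: "H (F.t g \<otimes>\<^bsub>F.F\<^esub> f \<otimes>\<^bsub>F.F\<^esub> v) = \<zero>\<^bsub>N\<^esub>" if "g \<in> carrier G" "v \<in> carrier F.F" for g v
      by (rule F.F_hom_eqI[OF mod_hom_comp[OF F.mult_right_hom H] zero_hom N _ that(2)])
        (use z f that F.t_closed F.mult_closed in auto)
    have "H (u \<otimes>\<^bsub>F.F\<^esub> f \<otimes>\<^bsub>F.F\<^esub> v) = \<zero>\<^bsub>N\<^esub>" if "u \<in> carrier F.F" "v \<in> carrier F.F" for u v
      by (rule F.F_hom_eqI[OF mod_hom_comp[OF mod_hom_comp[OF F.mult_left_hom F.mult_left_hom] H] zero_hom N _ that(1)])
        (use 1 f that in auto)
    then show ?thesis using f by (simp add: Z_def)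
  qed
  have Hxy: "H (F.t (x, y) \<otimes>\<^bsub>F.F\<^esub> F.t (a, b) \<otimes>\<^bsub>F.F\<^esub> F.t (x', y')) =
      \<beta> (x \<otimes>\<^bsub>A\<^esub> a \<otimes>\<^bsub>A\<^esub> x') (y \<otimes>\<^bsub>B\<^esub> b \<otimes>\<^bsub>B\<^esub> y')"
    if "x \<in> carrier A" "y \<in> carrier B" "x' \<in> carrier A" "y' \<in> carrier B" "a \<in> carrier A" "b \<in> carrier B"
    for x y x' y' a b
    using that by (simp add: F.t_mult Ht)
  have rel: "tensor_relations K A B \<subseteq> Z"
  proof
    fix r assume r: "r \<in> tensor_relations K A B"
    show "r \<in> Z"
    proof (rule ZI)
      show "r \<in> carrier F.F" using r relations_closed by blast
      fix g k assume gk: "g \<in> carrier G" "k \<in> carrier G"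
      note L = lr[OF F.t_closed[OF gk(1)] F.t_closed[OF gk(2)]]
      obtain x y x' y' where gk': "g = (x, y)" "k = (x', y')" "x \<in> carrier A" "y \<in> carrier B"
        "x' \<in> carrier A" "y' \<in> carrier B" using gk by auto
      note L' = L[unfolded gk']
      have tc: "F.t (a, b) \<in> carrier F.F" if "a \<in> carrier A" "b \<in> carrier B" for a b
        using F.t_closed[of "(a, b)"] that by simp
      show "H (F.t g \<otimes>\<^bsub>F.F\<^esub> r \<otimes>\<^bsub>F.F\<^esub> F.t k) = \<zero>\<^bsub>N\<^esub>"
        using r unfolding tensor_relations_def Let_def gk'(1,2)
        by (auto simp: FN.hom_diff[OF L'] mod_homD(2,3)[OF L'] tc F.F.smult_closed Hxy gk'(3-6)
            A.A.l_distr A.A.r_distr B.A.l_distr B.A.r_distr A.smult_mult_left A.smult_mult_right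
            B.smult_mult_left B.smult_mult_right add1 add2 sm1 sm2 cl N.smult_closed N.M.diff_eq_zero_iff)
    qed
  qed
  have IZ: "H f = \<zero>\<^bsub>N\<^esub>" if "f \<in> I" for f
  proof -
    have "f \<in> Z" using that FA.genideal_minimal[OF Zi rel] by (auto simp: I_def)
    then have "\<forall>u\<in>carrier F.F. \<forall>v\<in>carrier F.F. H (u \<otimes>\<^bsub>F.F\<^esub> f \<otimes>\<^bsub>F.F\<^esub> v) = \<zero>\<^bsub>N\<^esub>"
      and f: "f \<in> carrier F.F" by (simp_all add: Z_def)
    from bspec[OF bspec[OF this(1) FA.A.one_closed] FA.A.one_closed] show ?thesis using f by simp
  qed
  \<comment> \<open>Representatives of one class differ by elements of \<open>I\<close>, on which
    \<open>H\<close> vanishes; the image under the sum is a singleton and \<open>the_elem\<close> is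
    meaningful.\<close>
  have hcls: "h (Q.cls f) = H f" if f: "f \<in> carrier F.F" for f
  proof -
    have "H f' = H f" if f': "f' \<in> Q.cls f" for f'
    proof -
      have f'c: "f' \<in> carrier F.F" using Q.sub.a_elemrcos_carrier[OF f f'] .
      have "f' \<ominus>\<^bsub>F.F\<^esub> f \<in> I" using Q.sub.a_rcos_module[OF f f'c] f' by (simp add: a_minus_def)
      then have "H f' \<ominus>\<^bsub>N\<^esub> H f = \<zero>\<^bsub>N\<^esub>" using trans[OF FN.hom_diff[OF H f'c f, symmetric] IZ] by blast
      then show ?thesis
        using N.M.diff_eq_zero_iff[OF mod_homD(1)[OF H f'c] mod_homD(1)[OF H f]] by blast
    qed
    then have "H ` Q.cls f = {H f}" using Q.sub.a_rcos_self[OF f] by blast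
    then show ?thesis unfolding h_def H_def[symmetric] by simp
  qed
  show "h \<in> mod_hom K T N"
    by (rule mod_homI)
      (auto simp: T_eq Q.quot_carrier Q.quot_add Q.quot_smult hcls mod_homD[OF H] F.F.smult_closed)
  show "h (tens a b) = \<beta> a b" if "a \<in> carrier A" "b \<in> carrier B" for a b
    unfolding tens_def using that F.t_closed[of "(a, b)"] by (simp add: hcls Ht)
qed

lemma T_fin_gen:
  assumes "fin_gen K A" "fin_gen K B" shows "fin_gen K T"
proof -
  interpret KA: left_module K A by (rule assoc_algebra_left_module) unfold_locales
  interpret KB: left_module K B by (rule assoc_algebra_left_module) unfold_locales
  interpret KT: left_module K T by (rule assoc_algebra_left_module) unfold_locales
  obtain S where S: "finite S" "S \<subseteq> carrier A" "mod_span K A S = carrier A" using assms by (auto simp: fin_gen_def)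
  obtain S' where S': "finite S'" "S' \<subseteq> carrier B" "mod_span K B S' = carrier B" using assms by (auto simp: fin_gen_def)
  let ?W = "(\<lambda>(a, b). tens a b) ` (S \<times> S')"
  have Wc: "?W \<subseteq> carrier T" using S S' by (auto intro!: tens_closed)
  note D = KT.submoduleD[OF KT.span_submodule[OF Wc]]
  have hom1: "(\<lambda>b. tens a b) \<in> mod_hom K B T" if "a \<in> carrier A" for a
    using that by (intro mod_homI) (auto simp: tens_closed tens_add_right tens_smult_right)
  have hom2: "(\<lambda>a. tens a b) \<in> mod_hom K A T" if "b \<in> carrier B" for b
    using that by (intro mod_homI) (auto simp: tens_closed tens_add_left tens_smult_left)
  have 1: "tens a b \<in> mod_span K T ?W" if "a \<in> S" "b \<in> carrier B" for a b
  proof -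
    have a: "a \<in> carrier A" using that S by auto
    have "(\<lambda>b. tens a b) ` mod_span K B S' = mod_span K T ((\<lambda>b. tens a b) ` S')"
      by (rule module_pair.image_span[OF module_pairI[OF KB.left_module_axioms KT.left_module_axioms] hom1[OF a] S'(2)])
    moreover have "mod_span K T ((\<lambda>b. tens a b) ` S') \<subseteq> mod_span K T ?W"
      using that by (intro KT.span_mono) auto
    ultimately show ?thesis using that S'(3) by blast
  qed
  have 2: "tens a b \<in> mod_span K T ?W" if "a \<in> carrier A" "b \<in> carrier B" for a b
  proof -
    have "(\<lambda>a. tens a b) ` mod_span K A S = mod_span K T ((\<lambda>a. tens a b) ` S)"
      by (rule module_pair.image_span[OF module_pairI[OF KA.left_module_axioms KT.left_module_axioms] hom2[OF that(2)] S(2)])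
    moreover have "mod_span K T ((\<lambda>a. tens a b) ` S) \<subseteq> mod_span K T ?W"
      using that 1 by (intro KT.span_least KT.span_submodule[OF Wc]) auto
    ultimately show ?thesis using that S(3) by blast
  qed
  have "r \<in> mod_span K T ?W" if "r \<in> carrier T" for r
    using that by (induction r rule: T_induct) (use D(2,4) 2 in auto)
  then have "mod_span K T ?W = carrier T" using KT.span_carrier[OF Wc] by blast
  then show ?thesis unfolding fin_gen_def using S(1) S'(1) Wc by (intro exI[of _ ?W]) auto
qed

end

lemma (in abelian_group) diff_zero: "x \<in> carrier G \<Longrightarrow> x \<ominus> \<zero> = x"
  using minus_equality[of \<zero> \<zero>] by (simp add: a_minus_def)

section \<open>Modules over the enveloping algebra\<close>

sublocale fd_algebra \<subseteq> E: tensor_alg K A "opp A"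
  by (intro tensor_alg.intro K alg opp_algebra)

text \<open>Copies the shape of \<open>regular_bimodule\<close> for an arbitrary pair action, with
  \<open>act a b x\<close> in the place of a x b, so that the regular bimodule is an instance by
  unfolding.\<close>

definition env_module ::
  "('k, 'x) ring_scheme \<Rightarrow> ('k, 'a) module \<Rightarrow> ('k, 'n) module \<Rightarrow> ('a \<Rightarrow> 'a \<Rightarrow> 'n \<Rightarrow> 'n) \<Rightarrow>
   (('a \<times> 'a \<Rightarrow> 'k) set, 'n) module" where
  "env_module K A N act = with_smult N (\<lambda>C x. the_elem ((\<lambda>f.
        \<Oplus>\<^bsub>N\<^esub>p \<in> {p \<in> carrier A \<times> carrier A. f p \<noteq> \<zero>\<^bsub>K\<^esub>}.
          f p \<odot>\<^bsub>N\<^esub> act (fst p) (snd p) x) ` C))"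

lemma env_module_simps [simp]:
  "carrier (env_module K A N act) = carrier N" "add (env_module K A N act) = add N"
  "zero (env_module K A N act) = zero N"
  by (simp_all add: env_module_def)

section \<open>The enveloping algebra and the one-sided structures of a bimodule\<close>

context fd_algebra
begin

abbreviation "Env \<equiv> enveloping K A"
abbreviation "tens \<equiv> E.tens"

lemmas tens_closed = E.tens_closed[unfolded opp_simps, folded enveloping_def]
lemmas tens_add_left = E.tens_add_left[unfolded opp_simps, folded enveloping_def]
lemmas tens_add_right = E.tens_add_right[unfolded opp_simps, folded enveloping_def]
lemmas tens_smult_left = E.tens_smult_left[unfolded opp_simps, folded enveloping_def]
lemmas tens_smult_right = E.tens_smult_right[unfolded opp_simps, folded enveloping_def]
lemmas tens_mult = E.tens_mult[unfolded opp_simps, folded enveloping_def]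
lemmas tens_one = E.tens_one[unfolded opp_simps, folded enveloping_def]
lemmas Env_induct = E.T_induct[unfolded opp_simps, folded enveloping_def, consumes 1, case_names zero tens add]
lemmas Env_algebra = E.T_algebra[folded enveloping_def]

lemma Env_fd_algebra: "fd_algebra K Env"
proof -
  have "fin_gen K Env" unfolding enveloping_def
    using E.T_fin_gen fg fd_algebra.fg[OF fd_algebra_opp[OF fd_algebra_axioms]] by blast
  then show ?thesis by (intro fd_algebra.intro K Env_algebra)
qed

lemma Env_ring: "ring Env"
  using Env_algebra by (simp add: assoc_algebra_def)

lemma tens_scalar:
  assumes "c \<in> carrier K"
  shows "c \<odot>\<^bsub>Env\<^esub> \<one>\<^bsub>Env\<^esub> = tens (c \<odot>\<^bsub>A\<^esub> \<one>\<^bsub>A\<^esub>) \<one>\<^bsub>A\<^esub>"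
    "c \<odot>\<^bsub>Env\<^esub> \<one>\<^bsub>Env\<^esub> = tens \<one>\<^bsub>A\<^esub> (c \<odot>\<^bsub>A\<^esub> \<one>\<^bsub>A\<^esub>)"
  using assms by (simp_all add: tens_one tens_smult_left tens_smult_right)

text \<open>Both sides of linearity are additive in the scalar, so \<open>Env_induct\<close> reduces
  it to pure tensors.\<close>

lemma Env_homI:
  assumes X: "left_module Env X" and Y: "left_module Env Y"
    and cl: "\<And>x. x \<in> carrier X \<Longrightarrow> g x \<in> carrier Y"
    and add: "\<And>x y. x \<in> carrier X \<Longrightarrow> y \<in> carrier X \<Longrightarrow> g (x \<oplus>\<^bsub>X\<^esub> y) = g x \<oplus>\<^bsub>Y\<^esub> g y"
    and tens: "\<And>a b x. a \<in> carrier A \<Longrightarrow> b \<in> carrier A \<Longrightarrow> x \<in> carrier X \<Longrightarrow>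
      g (tens a b \<odot>\<^bsub>X\<^esub> x) = tens a b \<odot>\<^bsub>Y\<^esub> g x"
  shows "g \<in> mod_hom Env X Y"
proof (rule mod_homI[OF cl add])
  interpret X: left_module Env X by (rule X)
  interpret Y: left_module Env Y by (rule Y)
  have g0: "g \<zero>\<^bsub>X\<^esub> = \<zero>\<^bsub>Y\<^esub>"
    using add[of "\<zero>\<^bsub>X\<^esub>" "\<zero>\<^bsub>X\<^esub>"] cl[of "\<zero>\<^bsub>X\<^esub>"] Y.M.add.l_cancel_one'[of "g \<zero>\<^bsub>X\<^esub>" "g \<zero>\<^bsub>X\<^esub>"] by simp
  show "g (r \<odot>\<^bsub>X\<^esub> x) = r \<odot>\<^bsub>Y\<^esub> g x" if "r \<in> carrier Env" "x \<in> carrier X" for r x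
    using that(1)
  proof (induction r rule: Env_induct)
    case zero
    then show ?case using that(2) cl g0 by (simp add: X.smult_l_null Y.smult_l_null)
  next
    case (tens a b)
    then show ?case using assms(5) that(2) by blast
  next
    case (add r s)
    then show ?case using that(2) cl assms(4) by (simp add: X.smult_l_distr Y.smult_l_distr X.smult_closed)
  qed
qed

lemma tens_split:
  assumes X: "left_module Env X" and "a \<in> carrier A" "b \<in> carrier A" "x \<in> carrier X"
  shows "tens a b \<odot>\<^bsub>X\<^esub> x = tens a \<one>\<^bsub>A\<^esub> \<odot>\<^bsub>X\<^esub> (tens \<one>\<^bsub>A\<^esub> b \<odot>\<^bsub>X\<^esub> x)"
    "tens a b \<odot>\<^bsub>X\<^esub> x = tens \<one>\<^bsub>A\<^esub> b \<odot>\<^bsub>X\<^esub> (tens a \<one>\<^bsub>A\<^esub> \<odot>\<^bsub>X\<^esub> x)"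
proof -
  interpret X: left_module Env X by (rule X)
  show "tens a b \<odot>\<^bsub>X\<^esub> x = tens a \<one>\<^bsub>A\<^esub> \<odot>\<^bsub>X\<^esub> (tens \<one>\<^bsub>A\<^esub> b \<odot>\<^bsub>X\<^esub> x)"
    "tens a b \<odot>\<^bsub>X\<^esub> x = tens \<one>\<^bsub>A\<^esub> b \<odot>\<^bsub>X\<^esub> (tens a \<one>\<^bsub>A\<^esub> \<odot>\<^bsub>X\<^esub> x)"
    using assms(2-) by (simp_all add: X.smult_assoc1[symmetric] tens_closed tens_mult)
qed

lemma Env_submoduleI:
  assumes X: "left_module Env X" and U: "U \<subseteq> carrier X" "\<zero>\<^bsub>X\<^esub> \<in> U"
    "\<And>x y. x \<in> U \<Longrightarrow> y \<in> U \<Longrightarrow> x \<oplus>\<^bsub>X\<^esub> y \<in> U"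
    "\<And>a x. a \<in> carrier A \<Longrightarrow> x \<in> U \<Longrightarrow> tens a \<one>\<^bsub>A\<^esub> \<odot>\<^bsub>X\<^esub> x \<in> U"
    "\<And>b x. b \<in> carrier A \<Longrightarrow> x \<in> U \<Longrightarrow> tens \<one>\<^bsub>A\<^esub> b \<odot>\<^bsub>X\<^esub> x \<in> U"
  shows "submodule U Env X"
proof -
  interpret X: left_module Env X by (rule X)
  have "r \<odot>\<^bsub>X\<^esub> x \<in> U" if "r \<in> carrier Env" "x \<in> U" for r x
    using that(1)
  proof (induction r rule: Env_induct)
    case zero
    then show ?case using that(2) U by (auto simp: X.smult_l_null)
  next
    case (tens a b)
    then show ?case using tens_split(1)[OF X, of a b x] U that(2) by auto
  next
    case (add r s)
    then show ?case using that(2) U by (auto simp: X.smult_l_distr subset_iff)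
  qed
  then show ?thesis using U by (simp add: X.submodule_iff)
qed

text \<open>Restriction of scalars along the two embeddings of \<open>A\<close> and its opposite
  into \<open>Env\<close>. A right module is kept as a left module over
  \<open>opp A\<close>.\<close>

definition "lmod X = with_smult X (\<lambda>a x. tens a \<one>\<^bsub>A\<^esub> \<odot>\<^bsub>X\<^esub> x)"
definition "rmod X = with_smult X (\<lambda>b x. tens \<one>\<^bsub>A\<^esub> b \<odot>\<^bsub>X\<^esub> x)"

lemma lmod_simps [simp]: "carrier (lmod X) = carrier X" "add (lmod X) = add X" "zero (lmod X) = zero X"
  "smult (lmod X) = (\<lambda>a x. tens a \<one>\<^bsub>A\<^esub> \<odot>\<^bsub>X\<^esub> x)"
  by (simp_all add: lmod_def)

lemma rmod_simps [simp]: "carrier (rmod X) = carrier X" "add (rmod X) = add X" "zero (rmod X) = zero X"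
  "smult (rmod X) = (\<lambda>b x. tens \<one>\<^bsub>A\<^esub> b \<odot>\<^bsub>X\<^esub> x)"
  by (simp_all add: rmod_def)

lemma lmod_left_module:
  assumes X: "left_module Env X" shows "left_module A (lmod X)"
proof -
  interpret X: left_module Env X by (rule X)
  show ?thesis
  proof (rule left_moduleI[OF A_ring])
    show "abelian_group (lmod X)" by (rule abelian_group_cong[OF X.M.abelian_group_axioms]) auto
  qed (auto simp: X.smult_closed X.smult_l_distr X.smult_r_distr X.smult_one tens_closed tens_add_left
      X.smult_assoc1[symmetric] tens_mult tens_one[symmetric])
qed

lemma rmod_left_module:
  assumes X: "left_module Env X" shows "left_module (opp A) (rmod X)"
proof -
  interpret X: left_module Env X by (rule X)
  show ?thesis
  proof (rule left_moduleI[OF opp_ring[OF A_ring]])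
    show "abelian_group (rmod X)" by (rule abelian_group_cong[OF X.M.abelian_group_axioms]) auto
  qed (auto simp: X.smult_closed X.smult_l_distr X.smult_r_distr X.smult_one tens_closed tens_add_right
      X.smult_assoc1[symmetric] tens_mult tens_one[symmetric])
qed

lemma lmod_hom: "f \<in> mod_hom Env X Y \<Longrightarrow> f \<in> mod_hom A (lmod X) (lmod Y)"
  by (auto simp: mod_hom_def tens_closed)

lemma rmod_hom: "f \<in> mod_hom Env X Y \<Longrightarrow> f \<in> mod_hom (opp A) (rmod X) (rmod Y)"
  by (auto simp: mod_hom_def tens_closed)

end

text \<open>The bimodule axioms in terms of pairs, with a common action of \<open>K\<close> on both
  sides. In \<open>act_mult\<close> the second factors appear in reversed order because the second
  variable acts from the right.\<close>

locale env_action = fd_algebra K A + N: left_module K N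
  for K :: "('k, 'x) ring_scheme" and A :: "('k, 'a) module" and N :: "('k, 'n) module" +
  fixes act :: "'a \<Rightarrow> 'a \<Rightarrow> 'n \<Rightarrow> 'n"
  assumes act_closed: "\<lbrakk>a \<in> carrier A; b \<in> carrier A; x \<in> carrier N\<rbrakk> \<Longrightarrow> act a b x \<in> carrier N"
    and act_add1: "\<lbrakk>a \<in> carrier A; a' \<in> carrier A; b \<in> carrier A; x \<in> carrier N\<rbrakk> \<Longrightarrow>
      act (a \<oplus>\<^bsub>A\<^esub> a') b x = act a b x \<oplus>\<^bsub>N\<^esub> act a' b x"
    and act_add2: "\<lbrakk>a \<in> carrier A; b \<in> carrier A; b' \<in> carrier A; x \<in> carrier N\<rbrakk> \<Longrightarrow>
      act a (b \<oplus>\<^bsub>A\<^esub> b') x = act a b x \<oplus>\<^bsub>N\<^esub> act a b' x"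
    and act_smult1: "\<lbrakk>c \<in> carrier K; a \<in> carrier A; b \<in> carrier A; x \<in> carrier N\<rbrakk> \<Longrightarrow>
      act (c \<odot>\<^bsub>A\<^esub> a) b x = c \<odot>\<^bsub>N\<^esub> act a b x"
    and act_smult2: "\<lbrakk>c \<in> carrier K; a \<in> carrier A; b \<in> carrier A; x \<in> carrier N\<rbrakk> \<Longrightarrow>
      act a (c \<odot>\<^bsub>A\<^esub> b) x = c \<odot>\<^bsub>N\<^esub> act a b x"
    and act_add3: "\<lbrakk>a \<in> carrier A; b \<in> carrier A; x \<in> carrier N; y \<in> carrier N\<rbrakk> \<Longrightarrow>
      act a b (x \<oplus>\<^bsub>N\<^esub> y) = act a b x \<oplus>\<^bsub>N\<^esub> act a b y"
    and act_one: "x \<in> carrier N \<Longrightarrow> act \<one>\<^bsub>A\<^esub> \<one>\<^bsub>A\<^esub> x = x"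
    and act_mult: "\<lbrakk>a \<in> carrier A; b \<in> carrier A; a' \<in> carrier A; b' \<in> carrier A; x \<in> carrier N\<rbrakk> \<Longrightarrow>
      act a b (act a' b' x) = act (a \<otimes>\<^bsub>A\<^esub> a') (b' \<otimes>\<^bsub>A\<^esub> b) x"
begin

abbreviation "EM \<equiv> env_module K A N act"

lemma smult_hom:
  assumes x: "x \<in> carrier N"
  shows "(\<lambda>r. r \<odot>\<^bsub>EM\<^esub> x) \<in> mod_hom K Env N"
    "\<And>a b. a \<in> carrier A \<Longrightarrow> b \<in> carrier A \<Longrightarrow> tens a b \<odot>\<^bsub>EM\<^esub> x = act a b x"
proof -
  note univ = E.T_universal[OF N.left_module_axioms, of "\<lambda>a b. act a b x", unfolded opp_simps]
  have *: "r \<odot>\<^bsub>EM\<^esub> x = the_elem ((\<lambda>f. \<Oplus>\<^bsub>N\<^esub>p\<in>{p \<in> carrier A \<times> carrier A. f p \<noteq> \<zero>\<^bsub>K\<^esub>}.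
      f p \<odot>\<^bsub>N\<^esub> act (fst p) (snd p) x) ` r)" for r
    by (simp add: env_module_def)
  show "(\<lambda>r. r \<odot>\<^bsub>EM\<^esub> x) \<in> mod_hom K Env N"
    unfolding * enveloping_def
    by (rule univ(1)) (use x in \<open>simp_all add: act_closed act_add1 act_add2 act_smult1 act_smult2\<close>)
  show "tens a b \<odot>\<^bsub>EM\<^esub> x = act a b x" if "a \<in> carrier A" "b \<in> carrier A" for a b
    unfolding * using that x by (intro univ(2)) (simp_all add: act_closed act_add1 act_add2 act_smult1 act_smult2)
qed

lemma EM_left_module: "left_module Env EM"
proof (rule left_moduleI[OF Env_ring])
  have Envm: "left_module K Env" by (rule assoc_algebra_left_module[OF Env_algebra])
  interpret Env: ring Env by (rule Env_ring)
  have z: "\<zero>\<^bsub>Env\<^esub> \<odot>\<^bsub>EM\<^esub> x = \<zero>\<^bsub>N\<^esub>" if "x \<in> carrier N" for x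
    using module_pair.hom_zero[OF module_pairI[OF Envm N.left_module_axioms] smult_hom(1)[OF that]] .
  note cl = mod_homD(1)[OF smult_hom(1)] and distr = mod_homD(2)[OF smult_hom(1)]
  show "abelian_group EM" by (rule abelian_group_cong[OF N.M.abelian_group_axioms]) auto
  show "r \<odot>\<^bsub>EM\<^esub> x \<in> carrier EM" if "r \<in> carrier Env" "x \<in> carrier EM" for r x
    using cl that by simp
  show "(r \<oplus>\<^bsub>Env\<^esub> s) \<odot>\<^bsub>EM\<^esub> x = r \<odot>\<^bsub>EM\<^esub> x \<oplus>\<^bsub>EM\<^esub> s \<odot>\<^bsub>EM\<^esub> x"
    if "r \<in> carrier Env" "s \<in> carrier Env" "x \<in> carrier EM" for r s x
    using distr that by simp
  show add: "r \<odot>\<^bsub>EM\<^esub> (x \<oplus>\<^bsub>EM\<^esub> y) = r \<odot>\<^bsub>EM\<^esub> x \<oplus>\<^bsub>EM\<^esub> r \<odot>\<^bsub>EM\<^esub> y"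
    if "r \<in> carrier Env" "x \<in> carrier EM" "y \<in> carrier EM" for r x y
    using that(1)
  proof (induction r rule: Env_induct)
    case zero
    then show ?case using that by (simp add: z)
  next
    case (tens a b)
    then show ?case using that by (simp add: smult_hom(2) act_add3)
  next
    case (add r s)
    then show ?case using that by (simp add: distr cl N.M.a_ac)
  qed
  show "(r \<otimes>\<^bsub>Env\<^esub> s) \<odot>\<^bsub>EM\<^esub> x = r \<odot>\<^bsub>EM\<^esub> (s \<odot>\<^bsub>EM\<^esub> x)"
    if "r \<in> carrier Env" "s \<in> carrier Env" "x \<in> carrier EM" for r s x
    using that(1)
  proof (induction r rule: Env_induct)
    case zero
    then show ?case using that by (simp add: z cl)
  next
    case (tens a b)
    \<comment> \<open>A second induction, on \<open>s\<close>, for a fixed pure tensor in the first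
      factor; \<open>act_mult\<close> settles the case of two pure tensors.\<close>
    show ?case using that(2)
    proof (induction s rule: Env_induct)
      case zero
      have "tens a b \<odot>\<^bsub>EM\<^esub> \<zero>\<^bsub>N\<^esub> = \<zero>\<^bsub>N\<^esub>"
        using add[OF tens_closed[OF tens], of "\<zero>\<^bsub>N\<^esub>" "\<zero>\<^bsub>N\<^esub>"] cl[OF _ tens_closed[OF tens], of "\<zero>\<^bsub>N\<^esub>"]
          N.M.add.l_cancel_one'[of "tens a b \<odot>\<^bsub>EM\<^esub> \<zero>\<^bsub>N\<^esub>" "tens a b \<odot>\<^bsub>EM\<^esub> \<zero>\<^bsub>N\<^esub>"] by simp
      then show ?case using that tens by (simp add: z tens_closed)
    next
      case (tens a' b')
      then show ?case using that \<open>a \<in> carrier A\<close> \<open>b \<in> carrier A\<close>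
        by (simp add: tens_mult smult_hom(2) act_closed act_mult)
    next
      case (add s s')
      have "(tens a b \<otimes>\<^bsub>Env\<^esub> (s \<oplus>\<^bsub>Env\<^esub> s')) \<odot>\<^bsub>EM\<^esub> x =
        (tens a b \<otimes>\<^bsub>Env\<^esub> s) \<odot>\<^bsub>EM\<^esub> x \<oplus>\<^bsub>N\<^esub> (tens a b \<otimes>\<^bsub>Env\<^esub> s') \<odot>\<^bsub>EM\<^esub> x"
        using add(1,2) that tens_closed[OF tens] by (simp add: Env.r_distr distr)
      also have "\<dots> = tens a b \<odot>\<^bsub>EM\<^esub> ((s \<oplus>\<^bsub>Env\<^esub> s') \<odot>\<^bsub>EM\<^esub> x)"
        using add that tens_closed[OF tens] \<open>\<And>r x y. \<lbrakk>r \<in> carrier Env; x \<in> carrier EM; y \<in> carrier EM\<rbrakk> \<Longrightarrow>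
          r \<odot>\<^bsub>EM\<^esub> (x \<oplus>\<^bsub>EM\<^esub> y) = r \<odot>\<^bsub>EM\<^esub> x \<oplus>\<^bsub>EM\<^esub> r \<odot>\<^bsub>EM\<^esub> y\<close>[of "tens a b" "s \<odot>\<^bsub>EM\<^esub> x" "s' \<odot>\<^bsub>EM\<^esub> x"]
        by (simp add: distr cl)
      finally show ?case .
    qed
  next
    case (add r r')
    then show ?case using that by (simp add: Env.l_distr distr cl)
  qed
  show "\<one>\<^bsub>Env\<^esub> \<odot>\<^bsub>EM\<^esub> x = x" if "x \<in> carrier EM" for x
    using that by (simp add: tens_one smult_hom(2) act_one)
qed

end

text \<open>The lifting property of a projective bimodule, restated for targets given by pair
  actions. It allows spaces of homomorphisms to be used as targets without mentioning the tensor
  product again.\<close>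

lemma (in fd_algebra) env_hom_lifting:
  assumes B: "env_action K A NB actB" and C: "env_action K A NC actC"
    and Q: "projective Env Q"
    and P: "\<And>f. f \<in> carrier NB \<Longrightarrow> P f \<in> carrier NC"
      "\<And>f g. f \<in> carrier NB \<Longrightarrow> g \<in> carrier NB \<Longrightarrow> P (f \<oplus>\<^bsub>NB\<^esub> g) = P f \<oplus>\<^bsub>NC\<^esub> P g"
      "\<And>a b f. a \<in> carrier A \<Longrightarrow> b \<in> carrier A \<Longrightarrow> f \<in> carrier NB \<Longrightarrow> P (actB a b f) = actC a b (P f)"
      "\<And>h. h \<in> carrier NC \<Longrightarrow> \<exists>f\<in>carrier NB. P f = h"
    and \<phi>: "\<And>q. q \<in> carrier Q \<Longrightarrow> \<phi> q \<in> carrier NC"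
      "\<And>q q'. q \<in> carrier Q \<Longrightarrow> q' \<in> carrier Q \<Longrightarrow> \<phi> (q \<oplus>\<^bsub>Q\<^esub> q') = \<phi> q \<oplus>\<^bsub>NC\<^esub> \<phi> q'"
      "\<And>a b q. a \<in> carrier A \<Longrightarrow> b \<in> carrier A \<Longrightarrow> q \<in> carrier Q \<Longrightarrow> \<phi> (tens a b \<odot>\<^bsub>Q\<^esub> q) = actC a b (\<phi> q)"
  shows "\<exists>\<psi>. (\<forall>q\<in>carrier Q. \<psi> q \<in> carrier NB) \<and>
    (\<forall>q\<in>carrier Q. \<forall>q'\<in>carrier Q. \<psi> (q \<oplus>\<^bsub>Q\<^esub> q') = \<psi> q \<oplus>\<^bsub>NB\<^esub> \<psi> q') \<and>
    (\<forall>a\<in>carrier A. \<forall>b\<in>carrier A. \<forall>q\<in>carrier Q. \<psi> (tens a b \<odot>\<^bsub>Q\<^esub> q) = actB a b (\<psi> q)) \<and>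
    (\<forall>q\<in>carrier Q. P (\<psi> q) = \<phi> q)"
proof -
  interpret B: env_action K A NB actB by (rule B)
  interpret C: env_action K A NC actC by (rule C)
  interpret Q: left_module Env Q by (rule projective_left_module[OF Q])
  have Ph: "P \<in> mod_hom Env B.EM C.EM"
    by (rule Env_homI[OF B.EM_left_module C.EM_left_module])
      (use P in \<open>auto simp: B.smult_hom(2) C.smult_hom(2)\<close>)
  have Ps: "P ` carrier B.EM = carrier C.EM" using P(1,4) by force
  have \<phi>h: "\<phi> \<in> mod_hom Env Q C.EM"
    by (rule Env_homI[OF Q.left_module_axioms C.EM_left_module]) (use \<phi> in \<open>auto simp: C.smult_hom(2)\<close>)
  obtain \<psi> where \<psi>: "\<psi> \<in> mod_hom Env Q B.EM" "\<And>q. q \<in> carrier Q \<Longrightarrow> P (\<psi> q) = \<phi> q"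
    using projective_lifting[OF Q B.EM_left_module C.EM_left_module Ph Ps \<phi>h] by blast
  show ?thesis
    by (rule exI[of _ \<psi>]) (use mod_homD[OF \<psi>(1)] \<psi>(2) in \<open>auto simp: tens_closed B.smult_hom(2)\<close>)
qed

text \<open>
  For modules \<open>V\<close> and \<open>B\<close> over an algebra \<open>S\<close>, \<open>S\<close> acts on maps \<open>V \<rightarrow> B\<close> before and after.
  The copies \<open>V0\<close> and \<open>B0\<close> of \<open>V\<close> and \<open>B\<close> carry a commuting action of \<open>R0\<close>.
\<close>

definition hom_act ::
  "('s, 'v) module \<Rightarrow> ('s, 'b) module \<Rightarrow> 's \<Rightarrow> 's \<Rightarrow> ('v \<Rightarrow> 'b) \<Rightarrow> ('v \<Rightarrow> 'b)" where
  "hom_act V B s t f = (\<lambda>v\<in>carrier V. s \<odot>\<^bsub>B\<^esub> f (t \<odot>\<^bsub>V\<^esub> v))"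

locale hom_action = S: assoc_algebra K S + V: left_module S V + B: left_module S B +
    VB: module_pair R0 V0 B0
  for K :: "('k, 'x) ring_scheme" and S :: "('k, 's) module"
    and R0 :: "('r, 'y) ring_scheme" and V :: "('s, 'v) module" and B :: "('s, 'b) module"
    and V0 :: "('r, 'v) module" and B0 :: "('r, 'b) module" +
  assumes V0: "carrier V0 = carrier V" "add V0 = add V" "zero V0 = zero V"
    and B0: "carrier B0 = carrier B" "add B0 = add B" "zero B0 = zero B"
    and V_comm: "\<lbrakk>s \<in> carrier S; r \<in> carrier R0; v \<in> carrier V\<rbrakk> \<Longrightarrow> s \<odot>\<^bsub>V\<^esub> (r \<odot>\<^bsub>V0\<^esub> v) = r \<odot>\<^bsub>V0\<^esub> (s \<odot>\<^bsub>V\<^esub> v)"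
    and B_comm: "\<lbrakk>s \<in> carrier S; r \<in> carrier R0; b \<in> carrier B\<rbrakk> \<Longrightarrow> s \<odot>\<^bsub>B\<^esub> (r \<odot>\<^bsub>B0\<^esub> b) = r \<odot>\<^bsub>B0\<^esub> (s \<odot>\<^bsub>B\<^esub> b)"
    and K_linear: "\<lbrakk>f \<in> mod_hom R0 V0 B0; c \<in> carrier K; v \<in> carrier V\<rbrakk> \<Longrightarrow>
      f ((c \<odot>\<^bsub>S\<^esub> \<one>\<^bsub>S\<^esub>) \<odot>\<^bsub>V\<^esub> v) = (c \<odot>\<^bsub>S\<^esub> \<one>\<^bsub>S\<^esub>) \<odot>\<^bsub>B\<^esub> f v"
begin

definition "HM = hom_module R0 V0 B0 (\<lambda>c f. \<lambda>v\<in>carrier V0. c \<odot>\<^bsub>scalar_restr S B\<^esub> f v)"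

lemma HM_simps: "carrier HM = mod_hom R0 V0 B0 \<inter> extensional (carrier V)"
  "\<zero>\<^bsub>HM\<^esub> = (\<lambda>v\<in>carrier V. \<zero>\<^bsub>B\<^esub>)" "f \<oplus>\<^bsub>HM\<^esub> g = (\<lambda>v\<in>carrier V. f v \<oplus>\<^bsub>B\<^esub> g v)"
  "c \<odot>\<^bsub>HM\<^esub> f = (\<lambda>v\<in>carrier V. (c \<odot>\<^bsub>S\<^esub> \<one>\<^bsub>S\<^esub>) \<odot>\<^bsub>B\<^esub> f v)"
  by (simp_all add: HM_def hom_module_simps V0 B0)

lemma HM_left_module: "left_module K HM"
  unfolding HM_def
  by (rule VB.hom_module_post[OF scalar_restr_left_module])
    (auto simp: B0 B_comm S.assoc_algebra_axioms B.left_module_axioms)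

lemma HM_D:
  assumes "f \<in> carrier HM"
  shows "\<And>v. v \<in> carrier V \<Longrightarrow> f v \<in> carrier B"
    "\<And>v w. v \<in> carrier V \<Longrightarrow> w \<in> carrier V \<Longrightarrow> f (v \<oplus>\<^bsub>V\<^esub> w) = f v \<oplus>\<^bsub>B\<^esub> f w"
    "f \<in> mod_hom R0 V0 B0"
  using assms mod_homD[of f R0 V0 B0] by (auto simp: HM_simps V0 B0)

lemma act_closed:
  assumes "s \<in> carrier S" "t \<in> carrier S" "f \<in> carrier HM"
  shows "hom_act V B s t f \<in> carrier HM"
proof -
  have t: "(\<lambda>v. t \<odot>\<^bsub>V\<^esub> v) \<in> mod_hom R0 V0 V0"
    using assms(2) by (intro mod_homI) (auto simp: V0 V.smult_closed V.smult_r_distr V_comm)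
  have s: "(\<lambda>v. s \<odot>\<^bsub>B\<^esub> v) \<in> mod_hom R0 B0 B0"
    using assms(1) by (intro mod_homI) (auto simp: B0 B.smult_closed B.smult_r_distr B_comm)
  from restrict_mod_hom[OF VB.M.left_module_axioms mod_hom_comp[OF mod_hom_comp[OF t HM_D(3)[OF assms(3)]] s]]
  show ?thesis by (simp add: HM_simps hom_act_def V0)
qed

lemma act_props:
  assumes "s \<in> carrier S" "t \<in> carrier S" "s' \<in> carrier S" "t' \<in> carrier S"
    "f \<in> carrier HM" "g \<in> carrier HM" "c \<in> carrier K"
  shows "hom_act V B (s \<oplus>\<^bsub>S\<^esub> s') t f = hom_act V B s t f \<oplus>\<^bsub>HM\<^esub> hom_act V B s' t f"
    "hom_act V B s (t \<oplus>\<^bsub>S\<^esub> t') f = hom_act V B s t f \<oplus>\<^bsub>HM\<^esub> hom_act V B s t' f"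
    "hom_act V B s t (f \<oplus>\<^bsub>HM\<^esub> g) = hom_act V B s t f \<oplus>\<^bsub>HM\<^esub> hom_act V B s t g"
    "hom_act V B (c \<odot>\<^bsub>S\<^esub> s) t f = c \<odot>\<^bsub>HM\<^esub> hom_act V B s t f"
    "hom_act V B s (c \<odot>\<^bsub>S\<^esub> t) f = c \<odot>\<^bsub>HM\<^esub> hom_act V B s t f"
    "hom_act V B \<one>\<^bsub>S\<^esub> \<one>\<^bsub>S\<^esub> f = f"
    "hom_act V B s t (hom_act V B s' t' f) = hom_act V B (s \<otimes>\<^bsub>S\<^esub> s') (t' \<otimes>\<^bsub>S\<^esub> t) f"
proof -
  note D = HM_D(1,2)[OF assms(5)] HM_D(1,2)[OF assms(6)]
  note * = assms(1-4,7) D V.smult_closed B.smult_closed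
  show "hom_act V B (s \<oplus>\<^bsub>S\<^esub> s') t f = hom_act V B s t f \<oplus>\<^bsub>HM\<^esub> hom_act V B s' t f"
    using * by (auto simp: hom_act_def HM_simps B.smult_l_distr intro!: restrict_ext)
  show "hom_act V B s (t \<oplus>\<^bsub>S\<^esub> t') f = hom_act V B s t f \<oplus>\<^bsub>HM\<^esub> hom_act V B s t' f"
    using * by (auto simp: hom_act_def HM_simps V.smult_l_distr B.smult_r_distr intro!: restrict_ext)
  show "hom_act V B s t (f \<oplus>\<^bsub>HM\<^esub> g) = hom_act V B s t f \<oplus>\<^bsub>HM\<^esub> hom_act V B s t g"
    using * by (auto simp: hom_act_def HM_simps B.smult_r_distr intro!: restrict_ext)
  have cs: "c \<odot>\<^bsub>S\<^esub> u = (c \<odot>\<^bsub>S\<^esub> \<one>\<^bsub>S\<^esub>) \<otimes>\<^bsub>S\<^esub> u" "c \<odot>\<^bsub>S\<^esub> u = u \<otimes>\<^bsub>S\<^esub> (c \<odot>\<^bsub>S\<^esub> \<one>\<^bsub>S\<^esub>)" if "u \<in> carrier S" for u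
    using that assms(7) by (simp_all add: S.scalar_mult)
  have c1: "c \<odot>\<^bsub>S\<^esub> \<one>\<^bsub>S\<^esub> \<in> carrier S" using assms(7) by simp
  show "hom_act V B (c \<odot>\<^bsub>S\<^esub> s) t f = c \<odot>\<^bsub>HM\<^esub> hom_act V B s t f"
    unfolding cs(1)[OF assms(1)] using * c1
    by (auto simp: hom_act_def HM_simps B.smult_assoc1 intro!: restrict_ext)
  have "s \<odot>\<^bsub>B\<^esub> f ((c \<odot>\<^bsub>S\<^esub> t) \<odot>\<^bsub>V\<^esub> v) = (c \<odot>\<^bsub>S\<^esub> \<one>\<^bsub>S\<^esub>) \<odot>\<^bsub>B\<^esub> (s \<odot>\<^bsub>B\<^esub> f (t \<odot>\<^bsub>V\<^esub> v))" if v: "v \<in> carrier V" for v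
  proof -
    have "f ((c \<odot>\<^bsub>S\<^esub> t) \<odot>\<^bsub>V\<^esub> v) = (c \<odot>\<^bsub>S\<^esub> \<one>\<^bsub>S\<^esub>) \<odot>\<^bsub>B\<^esub> f (t \<odot>\<^bsub>V\<^esub> v)"
      unfolding cs(1)[OF assms(2)] using * c1 v K_linear[OF HM_D(3)[OF assms(5)]] by (simp add: V.smult_assoc1)
    then have "s \<odot>\<^bsub>B\<^esub> f ((c \<odot>\<^bsub>S\<^esub> t) \<odot>\<^bsub>V\<^esub> v) = (s \<otimes>\<^bsub>S\<^esub> (c \<odot>\<^bsub>S\<^esub> \<one>\<^bsub>S\<^esub>)) \<odot>\<^bsub>B\<^esub> f (t \<odot>\<^bsub>V\<^esub> v)"
      using * c1 v by (simp add: B.smult_assoc1)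
    also have "s \<otimes>\<^bsub>S\<^esub> (c \<odot>\<^bsub>S\<^esub> \<one>\<^bsub>S\<^esub>) = (c \<odot>\<^bsub>S\<^esub> \<one>\<^bsub>S\<^esub>) \<otimes>\<^bsub>S\<^esub> s" using cs[OF assms(1)] by simp
    also have "((c \<odot>\<^bsub>S\<^esub> \<one>\<^bsub>S\<^esub>) \<otimes>\<^bsub>S\<^esub> s) \<odot>\<^bsub>B\<^esub> f (t \<odot>\<^bsub>V\<^esub> v) = (c \<odot>\<^bsub>S\<^esub> \<one>\<^bsub>S\<^esub>) \<odot>\<^bsub>B\<^esub> (s \<odot>\<^bsub>B\<^esub> f (t \<odot>\<^bsub>V\<^esub> v))"
      by (rule B.smult_assoc1) (use * c1 v in auto)
    finally show ?thesis .
  qed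
  then show "hom_act V B s (c \<odot>\<^bsub>S\<^esub> t) f = c \<odot>\<^bsub>HM\<^esub> hom_act V B s t f"
    by (auto simp: hom_act_def HM_simps intro!: restrict_ext)
  show "hom_act V B \<one>\<^bsub>S\<^esub> \<one>\<^bsub>S\<^esub> f = f"
    using assms(5) * by (intro extensionalityI[of _ "carrier V"])
      (auto simp: hom_act_def HM_simps V.smult_one B.smult_one)
  show "hom_act V B s t (hom_act V B s' t' f) = hom_act V B (s \<otimes>\<^bsub>S\<^esub> s') (t' \<otimes>\<^bsub>S\<^esub> t) f"
    using * by (auto simp: hom_act_def V.smult_assoc1 B.smult_assoc1 intro!: restrict_ext)
qed

text \<open>Multiplying values is the left action on a Hom space and multiplying arguments is the
  right action, because composition on arguments reverses the order.\<close>

lemma env_action_left: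
  assumes "fd_algebra K S" shows "env_action K S HM (hom_act V B)"
proof (intro env_action.intro assms HM_left_module env_action_axioms.intro, goal_cases)
  have c0: "\<zero>\<^bsub>K\<^esub> \<in> carrier K" and s1: "\<one>\<^bsub>S\<^esub> \<in> carrier S" by simp_all
  {
    case (1 a b x) show ?case by (rule act_closed[OF 1])
  next
    case (2 a a' b x) show ?case by (rule act_props(1)[OF 2(1) 2(3) 2(2) 2(3) 2(4) 2(4) c0])
  next
    case (3 a b b' x) show ?case by (rule act_props(2)[OF 3(1) 3(2) 3(1) 3(3) 3(4) 3(4) c0])
  next
    case (4 c a b x) show ?case by (rule act_props(4)[OF 4(2) 4(3) 4(2) 4(3) 4(4) 4(4) 4(1)])
  next
    case (5 c a b x) show ?case by (rule act_props(5)[OF 5(2) 5(3) 5(2) 5(3) 5(4) 5(4) 5(1)])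
  next
    case (6 a b x y) show ?case by (rule act_props(3)[OF 6(1) 6(2) 6(1) 6(2) 6(3) 6(4) c0])
  next
    case (7 x) show ?case by (rule act_props(6)[OF s1 s1 s1 s1 7 7 c0])
  next
    case (8 a b a' b' x) show ?case by (rule act_props(7)[OF 8(1) 8(2) 8(3) 8(4) 8(5) 8(5) c0])
  }
qed

text \<open>Over \<open>S = opp A\<close>, where modules are right \<open>A\<close>-modules, the two
  roles are interchanged: the left scalar acts on arguments and the right scalar on values.\<close>

lemma env_action_right:
  assumes "fd_algebra K A" "S = opp A" shows "env_action K A HM (\<lambda>a b. hom_act V B b a)"
proof (intro env_action.intro assms(1) HM_left_module env_action_axioms.intro, goal_cases)
  have eq: "carrier A = carrier S" "add A = add S" "one A = one S" "smult A = smult S" "\<And>a b. a \<otimes>\<^bsub>A\<^esub> b = b \<otimes>\<^bsub>S\<^esub> a"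
    using assms(2) by auto
  have c0: "\<zero>\<^bsub>K\<^esub> \<in> carrier K" and s1: "\<one>\<^bsub>S\<^esub> \<in> carrier S" by simp_all
  {
    case (1 a b x) note * = 1[unfolded eq]
    show ?case by (rule act_closed[OF *(2,1,3)])
  next
    case (2 a a' b x) note * = 2[unfolded eq]
    show ?case unfolding eq by (rule act_props(2)[OF *(3) *(1) *(3) *(2) *(4) *(4) c0])
  next
    case (3 a b b' x) note * = 3[unfolded eq]
    show ?case unfolding eq by (rule act_props(1)[OF *(2) *(1) *(3) *(1) *(4) *(4) c0])
  next
    case (4 c a b x) note * = 4[unfolded eq]
    show ?case unfolding eq by (rule act_props(5)[OF *(3) *(2) *(3) *(2) *(4) *(4) *(1)])
  next
    case (5 c a b x) note * = 5[unfolded eq]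
    show ?case unfolding eq by (rule act_props(4)[OF *(3) *(2) *(3) *(2) *(4) *(4) *(1)])
  next
    case (6 a b x y) note * = 6[unfolded eq]
    show ?case by (rule act_props(3)[OF *(2) *(1) *(2) *(1) *(3) *(4) c0])
  next
    case (7 x)
    show ?case unfolding eq by (rule act_props(6)[OF s1 s1 s1 s1 7 7 c0])
  next
    case (8 a b a' b' x) note * = 8[unfolded eq]
    show ?case unfolding eq by (rule act_props(7)[OF *(2) *(1) *(4) *(3) *(5) *(5) c0])
  }
qed

end

text \<open>Composition with a surjection B -> C is a bilinear map of Hom spaces, and it is onto
  because the source is projective over \<open>R0\<close>. The four conclusions are the hypotheses
  on \<open>P\<close> in \<open>env_hom_lifting\<close>.\<close>

lemma hom_action_post:
  assumes B: "hom_action K S R0 V B V0 B0" and C: "hom_action K S R0 V C V0 C0"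
    and p: "p \<in> mod_hom S B C" "p \<in> mod_hom R0 B0 C0" and ps: "p ` carrier B0 = carrier C0"
    and pr: "projective R0 V0"
  defines "NB \<equiv> hom_action.HM S R0 B V0 B0" and "NC \<equiv> hom_action.HM S R0 C V0 C0"
    and "P \<equiv> \<lambda>f. \<lambda>v\<in>carrier V. p (f v)"
  shows "\<And>f. f \<in> carrier NB \<Longrightarrow> P f \<in> carrier NC"
    "\<And>f g. f \<in> carrier NB \<Longrightarrow> g \<in> carrier NB \<Longrightarrow> P (f \<oplus>\<^bsub>NB\<^esub> g) = P f \<oplus>\<^bsub>NC\<^esub> P g"
    "\<And>s t f. s \<in> carrier S \<Longrightarrow> t \<in> carrier S \<Longrightarrow> f \<in> carrier NB \<Longrightarrow>
      P (hom_act V B s t f) = hom_act V C s t (P f)"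
    "\<And>h. h \<in> carrier NC \<Longrightarrow> \<exists>f\<in>carrier NB. P f = h"
proof -
  interpret B: hom_action K S R0 V B V0 B0 by (rule B)
  interpret C: hom_action K S R0 V C V0 C0 by (rule C)
  show "P f \<in> carrier NC" if "f \<in> carrier NB" for f
  proof -
    have "f \<in> mod_hom R0 V0 B0" using that by (simp add: NB_def B.HM_simps)
    from restrict_mod_hom[OF B.VB.M.left_module_axioms mod_hom_comp[OF this p(2)]] show ?thesis
      by (simp add: NC_def P_def C.HM_simps B.V0)
  qed
  show "P (f \<oplus>\<^bsub>NB\<^esub> g) = P f \<oplus>\<^bsub>NC\<^esub> P g" if "f \<in> carrier NB" "g \<in> carrier NB" for f g
    using B.HM_D(1) that mod_homD(2)[OF p(1)]
    by (auto simp: NB_def NC_def P_def B.HM_simps(3) C.HM_simps(3) intro!: restrict_ext)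
  show "P (hom_act V B s t f) = hom_act V C s t (P f)" if "s \<in> carrier S" "t \<in> carrier S" "f \<in> carrier NB" for s t f
    using B.HM_D(1) that mod_homD(3)[OF p(1)] B.V.smult_closed
    by (auto simp: NB_def P_def hom_act_def intro!: restrict_ext)
  show "\<exists>f\<in>carrier NB. P f = h" if h: "h \<in> carrier NC" for h
  proof -
    have hh: "h \<in> mod_hom R0 V0 C0" "h \<in> extensional (carrier V)" using h by (auto simp: NC_def C.HM_simps)
    obtain f where f: "f \<in> mod_hom R0 V0 B0" "\<And>v. v \<in> carrier V0 \<Longrightarrow> p (f v) = h v"
      using projective_lifting[OF pr B.VB.N.left_module_axioms C.VB.N.left_module_axioms p(2) ps hh(1)] by blast
    have "(\<lambda>v\<in>carrier V. f v) \<in> carrier NB"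
      using restrict_mod_hom[OF B.VB.M.left_module_axioms f(1)] by (simp add: NB_def B.HM_simps B.V0)
    moreover have "P (\<lambda>v\<in>carrier V. f v) = h"
      using f(2) hh(2) by (intro extensionalityI[of _ "carrier V"]) (auto simp: P_def B.V0)
    ultimately show ?thesis by blast
  qed
qed

lemma hom_action_scalar:
  assumes S: "assoc_algebra K S" and V: "left_module S V" and B: "left_module S B"
  shows "hom_action K S K V B (scalar_restr S V) (scalar_restr S B)"
proof -
  interpret S: assoc_algebra K S by (rule S)
  interpret V: left_module S V by (rule V)
  interpret B: left_module S B by (rule B)
  have comm: "s \<otimes>\<^bsub>S\<^esub> (c \<odot>\<^bsub>S\<^esub> \<one>\<^bsub>S\<^esub>) = (c \<odot>\<^bsub>S\<^esub> \<one>\<^bsub>S\<^esub>) \<otimes>\<^bsub>S\<^esub> s" if "s \<in> carrier S" "c \<in> carrier K" for s c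
    using that by (simp add: S.scalar_mult)
  have VB: "module_pair K (scalar_restr S V) (scalar_restr S B)"
    by (intro module_pairI scalar_restr_left_module S V B)
  show ?thesis
  proof (intro hom_action.intro S V B VB hom_action_axioms.intro)
    fix s r v assume *: "s \<in> carrier S" "r \<in> carrier K" "v \<in> carrier V"
    show "s \<odot>\<^bsub>V\<^esub> (r \<odot>\<^bsub>scalar_restr S V\<^esub> v) = r \<odot>\<^bsub>scalar_restr S V\<^esub> (s \<odot>\<^bsub>V\<^esub> v)"
      using * V.smult_assoc1[of s "r \<odot>\<^bsub>S\<^esub> \<one>\<^bsub>S\<^esub>" v] V.smult_assoc1[of "r \<odot>\<^bsub>S\<^esub> \<one>\<^bsub>S\<^esub>" s v] comm by simp
  next
    fix s r v assume *: "s \<in> carrier S" "r \<in> carrier K" "v \<in> carrier B"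
    show "s \<odot>\<^bsub>B\<^esub> (r \<odot>\<^bsub>scalar_restr S B\<^esub> v) = r \<odot>\<^bsub>scalar_restr S B\<^esub> (s \<odot>\<^bsub>B\<^esub> v)"
      using * B.smult_assoc1[of s "r \<odot>\<^bsub>S\<^esub> \<one>\<^bsub>S\<^esub>" v] B.smult_assoc1[of "r \<odot>\<^bsub>S\<^esub> \<one>\<^bsub>S\<^esub>" s v] comm by simp
  next
    fix f c v assume "f \<in> mod_hom K (scalar_restr S V) (scalar_restr S B)" "c \<in> carrier K" "v \<in> carrier V"
    then show "f ((c \<odot>\<^bsub>S\<^esub> \<one>\<^bsub>S\<^esub>) \<odot>\<^bsub>V\<^esub> v) = (c \<odot>\<^bsub>S\<^esub> \<one>\<^bsub>S\<^esub>) \<odot>\<^bsub>B\<^esub> f v"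
      using mod_homD(3)[of f K "scalar_restr S V" "scalar_restr S B" c v] by simp
  qed simp_all
qed

section \<open>Projective bimodules are projective on the right\<close>

context fd_algebra
begin

text \<open>Right linear maps Q -> B correspond to bilinear maps from \<open>Q\<close> into
  \<open>Hom_K(A, B)\<close>. As \<open>A\<close> is finite-dimensional, \<open>Hom_K(A, -)\<close>
  keeps the surjection \<open>\<pi>\<close> onto \<open>Q\<close>; lifting the map that belongs to
  the identity of \<open>Q\<close> splits \<open>\<pi>\<close>.\<close>

lemma rmod_projective:
  assumes Q: "projective Env Q" shows "projective (opp A) (rmod Q)"
proof -
  have Qm: "left_module Env Q" by (rule projective_left_module[OF Q])
  interpret Q: left_module Env Q by (rule Qm)
  note oa = opp_algebra[OF alg]
  have C: "left_module (opp A) (rmod Q)" by (rule rmod_left_module[OF Qm])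
  let ?V = "regular_module (opp A)"
  have V: "left_module (opp A) ?V" by (rule regular_left_module[OF opp_ring[OF A_ring]])
  have Vp: "projective K (scalar_restr (opp A) ?V)"
  proof (rule field_fin_gen_projective[OF K scalar_restr_left_module[OF oa V]])
    show "fin_gen K (scalar_restr (opp A) ?V)"
      using fg fin_gen_cong[OF A_left_module, of "scalar_restr (opp A) ?V"] by (simp add: A.scalar_mult)
  qed
  show ?thesis
  proof (rule projective_if_split[OF C])
    fix \<pi> assume \<pi>: "\<pi> \<in> mod_hom (opp A) (free_module (opp A) (carrier (rmod Q))) (rmod Q)"
      "\<pi> ` carrier (free_module (opp A) (carrier (rmod Q))) = carrier (rmod Q)"
    let ?B = "free_module (opp A) (carrier (rmod Q))"
    have B: "left_module (opp A) ?B" by (rule ring.free_left_module[OF opp_ring[OF A_ring]])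
    interpret HB: hom_action K "opp A" K ?V ?B "scalar_restr (opp A) ?V" "scalar_restr (opp A) ?B"
      by (rule hom_action_scalar[OF oa V B])
    interpret HC: hom_action K "opp A" K ?V "rmod Q" "scalar_restr (opp A) ?V" "scalar_restr (opp A) (rmod Q)"
      by (rule hom_action_scalar[OF oa V C])
    have \<pi>s: "\<pi> ` carrier (scalar_restr (opp A) ?B) = carrier (scalar_restr (opp A) (rmod Q))"
      using \<pi>(2) by simp
    note post = hom_action_post[OF HB.hom_action_axioms HC.hom_action_axioms \<pi>(1)
        mod_hom_scalar_restr[OF oa \<pi>(1)] \<pi>s Vp, unfolded regular_module_simps(1) opp_simps(1)]
    \<comment> \<open>The adjoint of the identity: \<open>q\<close> is sent to the function x -> x
      q.\<close>
    define \<phi> where "\<phi> q = (\<lambda>x\<in>carrier A. tens x \<one>\<^bsub>A\<^esub> \<odot>\<^bsub>Q\<^esub> q)" for q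
    have \<phi>c: "\<phi> q \<in> carrier HC.HM" if q: "q \<in> carrier Q" for q
    proof -
      have "(\<lambda>x. tens x \<one>\<^bsub>A\<^esub> \<odot>\<^bsub>Q\<^esub> q) \<in> mod_hom K (scalar_restr (opp A) ?V) (scalar_restr (opp A) (rmod Q))"
      proof (rule mod_homI, unfold scalar_restr_simps regular_module_simps opp_simps rmod_simps)
        fix c x assume c: "c \<in> carrier K" and x: "x \<in> carrier A"
        have "tens (x \<otimes>\<^bsub>A\<^esub> (c \<odot>\<^bsub>A\<^esub> \<one>\<^bsub>A\<^esub>)) \<one>\<^bsub>A\<^esub> = tens \<one>\<^bsub>A\<^esub> (c \<odot>\<^bsub>A\<^esub> \<one>\<^bsub>A\<^esub>) \<otimes>\<^bsub>Env\<^esub> tens x \<one>\<^bsub>A\<^esub>"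
        proof -
          have "tens \<one>\<^bsub>A\<^esub> (c \<odot>\<^bsub>A\<^esub> \<one>\<^bsub>A\<^esub>) \<otimes>\<^bsub>Env\<^esub> tens x \<one>\<^bsub>A\<^esub> = tens x (c \<odot>\<^bsub>A\<^esub> \<one>\<^bsub>A\<^esub>)"
            using c x by (simp add: tens_mult)
          then show ?thesis using c x by (simp add: A.scalar_mult tens_smult_left tens_smult_right)
        qed
        then show "tens (x \<otimes>\<^bsub>A\<^esub> (c \<odot>\<^bsub>A\<^esub> \<one>\<^bsub>A\<^esub>)) \<one>\<^bsub>A\<^esub> \<odot>\<^bsub>Q\<^esub> q = tens \<one>\<^bsub>A\<^esub> (c \<odot>\<^bsub>A\<^esub> \<one>\<^bsub>A\<^esub>) \<odot>\<^bsub>Q\<^esub> (tens x \<one>\<^bsub>A\<^esub> \<odot>\<^bsub>Q\<^esub> q)"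
          using c x q by (simp add: Q.smult_assoc1 tens_closed)
      qed (use q in \<open>auto simp: Q.smult_closed tens_closed tens_add_left Q.smult_l_distr\<close>)
      from restrict_mod_hom[OF HB.VB.M.left_module_axioms this] show ?thesis by (simp add: \<phi>_def HC.HM_simps)
    qed
    have "\<exists>\<psi>. (\<forall>q\<in>carrier Q. \<psi> q \<in> carrier HB.HM) \<and>
      (\<forall>q\<in>carrier Q. \<forall>q'\<in>carrier Q. \<psi> (q \<oplus>\<^bsub>Q\<^esub> q') = \<psi> q \<oplus>\<^bsub>HB.HM\<^esub> \<psi> q') \<and>
      (\<forall>a\<in>carrier A. \<forall>b\<in>carrier A. \<forall>q\<in>carrier Q. \<psi> (tens a b \<odot>\<^bsub>Q\<^esub> q) = hom_act ?V ?B b a (\<psi> q)) \<and>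
      (\<forall>q\<in>carrier Q. (\<lambda>v\<in>carrier A. \<pi> (\<psi> q v)) = \<phi> q)"
    proof (rule env_hom_lifting[OF HB.env_action_right[OF fd_algebra_axioms refl]
          HC.env_action_right[OF fd_algebra_axioms refl] Q post(1,2) _ post(4) \<phi>c])
      show "(\<lambda>v\<in>carrier A. \<pi> (hom_act ?V ?B b a f v)) = hom_act ?V (rmod Q) b a (\<lambda>v\<in>carrier A. \<pi> (f v))"
        if "a \<in> carrier A" "b \<in> carrier A" "f \<in> carrier HB.HM" for a b f
        using post(3) that by blast
      show "\<phi> (q \<oplus>\<^bsub>Q\<^esub> q') = \<phi> q \<oplus>\<^bsub>HC.HM\<^esub> \<phi> q'" if "q \<in> carrier Q" "q' \<in> carrier Q" for q q'
        using that by (auto simp: \<phi>_def HC.HM_simps Q.smult_r_distr tens_closed intro!: restrict_ext)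
      show "\<phi> (tens a b \<odot>\<^bsub>Q\<^esub> q) = hom_act ?V (rmod Q) b a (\<phi> q)" if "a \<in> carrier A" "b \<in> carrier A" "q \<in> carrier Q" for a b q
        using that by (auto simp: \<phi>_def hom_act_def Q.smult_assoc1[symmetric] tens_closed tens_mult intro!: restrict_ext)
    qed
    then obtain \<psi> where "\<forall>q\<in>carrier Q. \<psi> q \<in> carrier HB.HM"
      "\<forall>q\<in>carrier Q. \<forall>q'\<in>carrier Q. \<psi> (q \<oplus>\<^bsub>Q\<^esub> q') = \<psi> q \<oplus>\<^bsub>HB.HM\<^esub> \<psi> q'"
      "\<forall>a\<in>carrier A. \<forall>b\<in>carrier A. \<forall>q\<in>carrier Q. \<psi> (tens a b \<odot>\<^bsub>Q\<^esub> q) = hom_act ?V ?B b a (\<psi> q)"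
      "\<forall>q\<in>carrier Q. (\<lambda>v\<in>carrier A. \<pi> (\<psi> q v)) = \<phi> q"
      by (elim exE conjE)
    note \<psi> = this[rule_format]
    \<comment> \<open>Evaluation at one is the inverse of the adjunction and gives back a right
      linear map.\<close>
    define s where "s q = \<psi> q \<one>\<^bsub>A\<^esub>" for q
    have "s \<in> mod_hom (opp A) (rmod Q) ?B"
    proof (rule mod_homI)
      show "s q \<in> carrier ?B" if "q \<in> carrier (rmod Q)" for q
        using HB.HM_D(1)[OF \<psi>(1)] that by (simp add: s_def)
      show "s (q \<oplus>\<^bsub>rmod Q\<^esub> q') = s q \<oplus>\<^bsub>?B\<^esub> s q'" if "q \<in> carrier (rmod Q)" "q' \<in> carrier (rmod Q)" for q q'
      proof -
        have q: "q \<in> carrier Q" "q' \<in> carrier Q" using that by simp_all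
        show ?thesis unfolding s_def rmod_simps(2) \<psi>(2)[OF q] HB.HM_simps(3) by simp
      qed
      show "s (b \<odot>\<^bsub>rmod Q\<^esub> q) = b \<odot>\<^bsub>?B\<^esub> s q" if "b \<in> carrier (opp A)" "q \<in> carrier (rmod Q)" for b q
        using \<psi>(3)[of "\<one>\<^bsub>A\<^esub>" b q] that by (simp add: s_def hom_act_def)
    qed
    moreover have "\<pi> (s q) = q" if "q \<in> carrier Q" for q
      using fun_cong[OF \<psi>(4)[OF that], of "\<one>\<^bsub>A\<^esub>"] that
      by (simp add: s_def \<phi>_def tens_one[symmetric] Q.smult_one)
    ultimately show "\<exists>s. s \<in> mod_hom (opp A) (rmod Q) ?B \<and> (\<forall>x\<in>carrier (rmod Q). \<pi> (s x) = x)" by auto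
  qed
qed

text \<open>Right projectivity of \<open>Y\<close> splits the surjection, and q - s (p q) lands in
  the image of \<open>X\<close>. That \<open>X\<close> becomes right projective in turn keeps the
  induction along the bimodule syzygies going.\<close>

lemma rmod_split:
  assumes ex: "short_exact Env X Q Y i p" and Q: "projective Env Q" and Y: "projective (opp A) (rmod Y)"
  obtains \<rho> where "\<rho> \<in> mod_hom (opp A) (rmod Q) (rmod X)" "\<And>x. x \<in> carrier X \<Longrightarrow> \<rho> (i x) = x"
    "projective (opp A) (rmod X)"
proof -
  note e = short_exactD[OF ex]
  note X' = rmod_left_module[OF e(1)] and Q' = rmod_left_module[OF e(2)] and Y' = rmod_left_module[OF e(3)]
  note i = rmod_hom[OF e(4)] and p = rmod_hom[OF e(5)]
  have ex': "short_exact (opp A) (rmod X) (rmod Q) (rmod Y) i p"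
    unfolding short_exact_def using X' Q' Y' i p e by (simp add: a_kernel_def')
  obtain s where s: "s \<in> mod_hom (opp A) (rmod Y) (rmod Q)" "\<And>x. x \<in> carrier (rmod Y) \<Longrightarrow> p (s x) = x"
    using projective_split[OF Y Q' p] e(7) by auto
  interpret QY: module_pair "opp A" "rmod Q" "rmod Y" using Q' Y' by (rule module_pairI)
  interpret QQ: module_pair "opp A" "rmod Q" "rmod Q" using Q' Q' by (rule module_pairI)
  interpret YQ: module_pair "opp A" "rmod Y" "rmod Q" using Y' Q' by (rule module_pairI)
  have h: "(\<lambda>q. q \<ominus>\<^bsub>rmod Q\<^esub> s (p q)) \<in> mod_hom (opp A) (rmod Q) (rmod Q)"
    by (intro QQ.hom_diff_fun mod_hom_id mod_hom_comp[OF p s(1)])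
  have ph: "p (q \<ominus>\<^bsub>rmod Q\<^esub> s (p q)) = \<zero>\<^bsub>rmod Y\<^esub>" if q: "q \<in> carrier (rmod Q)" for q
  proof -
    have pq: "p q \<in> carrier (rmod Y)" by (rule mod_homD(1)[OF p q])
    show ?thesis
      unfolding QY.hom_diff[OF p q mod_homD(1)[OF s(1) pq]] s(2)[OF pq] using pq QY.N.M.diff_eq_zero_iff by blast
  qed
  obtain \<rho> where \<rho>: "\<rho> \<in> mod_hom (opp A) (rmod Q) (rmod X)" "\<And>q. q \<in> carrier (rmod Q) \<Longrightarrow> i (\<rho> q) = q \<ominus>\<^bsub>rmod Q\<^esub> s (p q)"
    using factor_through_kernel[OF ex' Q' h ph] by blast
  have \<rho>i: "\<rho> (i x) = x" if x: "x \<in> carrier X" for x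
  proof (rule inj_onD[OF e(6)])
    have ix: "i x \<in> carrier (rmod Q)" using mod_homD(1)[OF e(4) x] by simp
    have "s (p (i x)) = \<zero>\<^bsub>rmod Q\<^esub>" using e(9)[OF x] YQ.hom_zero[OF s(1)] by simp
    then show "i (\<rho> (i x)) = i x"
      using \<rho>(2)[OF ix] QY.M.M.diff_zero[OF ix] by (simp only:)
    show "\<rho> (i x) \<in> carrier X" using mod_homD(1)[OF \<rho>(1) ix] by simp
  qed (rule x)
  have "projective (opp A) (rmod X)"
    by (rule projective_retract[OF X' rmod_projective[OF Q] i \<rho>(1)]) (use \<rho>i in simp)
  with \<rho>(1) \<rho>i that show ?thesis by blast
qed

end

section \<open>The regular bimodule\<close>

lemma regular_projective: assumes "ring R" shows "projective R (regular_module R)"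
proof -
  interpret ring R by fact
  have fam: "module_family R {0::nat} (\<lambda>_. regular_module R)" by (rule free_family)
  have b: "(\<lambda>f. f 0) \<in> mod_hom R (free_module R {0::nat}) (regular_module R)" unfolding free_module_def
    by (rule mod_homI) (auto simp: module_family.at_simps[OF fam] dest: module_family.carrierD[OF fam])
  show ?thesis
    by (rule projectiveI[OF regular_left_module[OF assms] _ b, of "single {0} (\<lambda>_. regular_module R) 0"])
      (use module_family.single_hom[OF fam, of 0] in \<open>auto simp: free_module_def single_def\<close>)
qed

lemma projective_cong:
  fixes M N :: "('r, 'm) module"
  assumes "projective R M" "carrier N = carrier M" "add N = add M" "zero N = zero M"
    "\<And>r x. r \<in> carrier R \<Longrightarrow> x \<in> carrier M \<Longrightarrow> r \<odot>\<^bsub>N\<^esub> x = r \<odot>\<^bsub>M\<^esub> x"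
  shows "projective R N"
proof -
  have M: "left_module R M" by (rule projective_left_module[OF assms(1)])
  have N: "left_module R N" by (rule left_module_cong[OF M assms(2-4)]) (rule assms(5))
  show ?thesis
    by (rule projective_retract[OF N assms(1), of "\<lambda>x. x" "\<lambda>x. x"])
      (use assms(2-5) left_module.smult_closed[OF M] in \<open>auto simp: mod_hom_def\<close>)
qed

context fd_algebra
begin

abbreviation "Reg \<equiv> regular_bimodule K A"

lemma Reg_eq: "Reg = env_module K A A (\<lambda>a b x. a \<otimes>\<^bsub>A\<^esub> x \<otimes>\<^bsub>A\<^esub> b)"
  by (simp add: regular_bimodule_def env_module_def with_smult_def)

lemma Reg_action: "env_action K A A (\<lambda>a b x. a \<otimes>\<^bsub>A\<^esub> x \<otimes>\<^bsub>A\<^esub> b)"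
  by (intro env_action.intro fd_algebra_axioms A_left_module env_action_axioms.intro)
    (auto simp: A.A.l_distr A.A.r_distr A.smult_mult_left A.smult_mult_right A.A.m_assoc)

lemma Reg_simps [simp]: "carrier Reg = carrier A" "add Reg = add A" "zero Reg = zero A"
  by (simp_all add: Reg_eq)

lemma Reg_left_module: "left_module Env Reg"
  unfolding Reg_eq by (rule env_action.EM_left_module[OF Reg_action])

lemma Reg_smult: "\<lbrakk>a \<in> carrier A; b \<in> carrier A; x \<in> carrier A\<rbrakk> \<Longrightarrow> tens a b \<odot>\<^bsub>Reg\<^esub> x = a \<otimes>\<^bsub>A\<^esub> x \<otimes>\<^bsub>A\<^esub> b"
  unfolding Reg_eq by (rule env_action.smult_hom(2)[OF Reg_action])

lemma Reg_fin_gen: "fin_gen Env Reg"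
proof -
  interpret left_module Env Reg by (rule Reg_left_module)
  have "x \<in> mod_span Env Reg {\<one>\<^bsub>A\<^esub>}" if "x \<in> carrier A" for x
  proof -
    have "tens x \<one>\<^bsub>A\<^esub> \<odot>\<^bsub>Reg\<^esub> \<one>\<^bsub>A\<^esub> \<in> mod_span Env Reg {\<one>\<^bsub>A\<^esub>}"
      using that span_superset[of "{\<one>\<^bsub>A\<^esub>}"] tens_closed
      by (intro submoduleD(5)[OF span_submodule]) auto
    then show ?thesis using that by (simp add: Reg_smult)
  qed
  then show ?thesis unfolding fin_gen_def using span_carrier[of "{\<one>\<^bsub>A\<^esub>}"]
    by (intro exI[of _ "{\<one>\<^bsub>A\<^esub>}"]) auto
qed

lemma rmod_Reg_projective: "projective (opp A) (rmod Reg)"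
  by (rule projective_cong[OF regular_projective[OF opp_ring[OF A_ring]]]) (auto simp: Reg_smult)

end

section \<open>Tensoring bimodules with a left module\<close>

text \<open>
  \<open>T X\<close> is the tensor product of the bimodule \<open>X\<close> with the left module \<open>A\<^sup>I / U\<close>, presented as
  \<open>X\<^sup>I / XU\<close>.
\<close>

locale tensor_functor = fd_algebra K A
  for K :: "('k, 'x) ring_scheme" and A :: "('k, 'a) module" +
  fixes I :: "'i set" and U :: "('i \<Rightarrow> 'a) set"
  assumes I: "finite I" and U: "submodule U A (free_module A I)"
begin

abbreviation "Fr \<equiv> free_module A I"
definition "D X = direct_sum I (\<lambda>_. lmod X)"
text \<open>The pure tensor of \<open>x\<close> with the row \<open>u\<close>, as the tuple of the
  products x u_i. Right multiplication of \<open>x\<close> by \<open>b\<close> has the same effect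
  as left multiplication of \<open>u\<close> by \<open>b\<close>.\<close>

definition "tp X x u = (\<lambda>i\<in>I. tens \<one>\<^bsub>A\<^esub> (u i) \<odot>\<^bsub>X\<^esub> x)"
definition "XU X = mod_span A (D X) {tp X x u | x u. x \<in> carrier X \<and> u \<in> U}"
definition "TT X = quot_mod (D X) (XU X)"

sublocale Fr: left_module A Fr by (rule A.free_left_module)

lemma D_simps: "carrier (D X) = (\<Pi>\<^sub>E i\<in>I. carrier X)" "\<zero>\<^bsub>D X\<^esub> = (\<lambda>i\<in>I. \<zero>\<^bsub>X\<^esub>)"
  "f \<oplus>\<^bsub>D X\<^esub> g = (\<lambda>i\<in>I. f i \<oplus>\<^bsub>X\<^esub> g i)" "a \<odot>\<^bsub>D X\<^esub> f = (\<lambda>i\<in>I. tens a \<one>\<^bsub>A\<^esub> \<odot>\<^bsub>X\<^esub> f i)"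
  using I by (auto simp: D_def direct_sum_simps)

lemma Fr_simps: "carrier Fr = (\<Pi>\<^sub>E i\<in>I. carrier A)" "\<zero>\<^bsub>Fr\<^esub> = (\<lambda>i\<in>I. \<zero>\<^bsub>A\<^esub>)"
  "f \<oplus>\<^bsub>Fr\<^esub> g = (\<lambda>i\<in>I. f i \<oplus>\<^bsub>A\<^esub> g i)" "a \<odot>\<^bsub>Fr\<^esub> f = (\<lambda>i\<in>I. a \<otimes>\<^bsub>A\<^esub> f i)"
  using I by (auto simp: free_module_def direct_sum_simps)

lemma family: "left_module Env X \<Longrightarrow> module_family A I (\<lambda>_. lmod X)"
  by (intro module_familyI A_ring lmod_left_module)

lemma D_left_module: "left_module Env X \<Longrightarrow> left_module A (D X)"
  unfolding D_def by (rule module_family.left_module[OF family])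

lemma U_closed: "u \<in> U \<Longrightarrow> u \<in> carrier Fr"
  using Fr.submoduleD(3)[OF U] .

lemma Fr_at: "u \<in> carrier Fr \<Longrightarrow> i \<in> I \<Longrightarrow> u i \<in> carrier A"
  by (auto simp: Fr_simps)

lemma tp_closed: "left_module Env X \<Longrightarrow> x \<in> carrier X \<Longrightarrow> u \<in> carrier Fr \<Longrightarrow> tp X x u \<in> carrier (D X)"
  by (auto simp: tp_def D_simps left_module.smult_closed tens_closed Fr_at)

lemma tp_smult_left:
  assumes X: "left_module Env X" and "a \<in> carrier A" "x \<in> carrier X" "u \<in> carrier Fr"
  shows "a \<odot>\<^bsub>D X\<^esub> tp X x u = tp X (tens a \<one>\<^bsub>A\<^esub> \<odot>\<^bsub>X\<^esub> x) u"
proof -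
  have "tens a \<one>\<^bsub>A\<^esub> \<odot>\<^bsub>X\<^esub> (tens \<one>\<^bsub>A\<^esub> (u i) \<odot>\<^bsub>X\<^esub> x) = tens \<one>\<^bsub>A\<^esub> (u i) \<odot>\<^bsub>X\<^esub> (tens a \<one>\<^bsub>A\<^esub> \<odot>\<^bsub>X\<^esub> x)" if "i \<in> I" for i
    using trans[OF tens_split(1)[OF X, symmetric] tens_split(2)[OF X]] assms(2,3) Fr_at[OF assms(4) that] by blast
  then show ?thesis by (auto simp: tp_def D_simps intro!: restrict_ext)
qed

lemma tp_smult_right:
  assumes X: "left_module Env X" and "b \<in> carrier A" "x \<in> carrier X" "u \<in> carrier Fr"
  shows "tp X (tens \<one>\<^bsub>A\<^esub> b \<odot>\<^bsub>X\<^esub> x) u = tp X x (b \<odot>\<^bsub>Fr\<^esub> u)"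
proof -
  interpret X: left_module Env X by (rule X)
  show ?thesis using assms(2-)
    by (auto simp: tp_def Fr_simps(4) Fr_at X.smult_assoc1[symmetric] tens_closed tens_mult intro!: restrict_ext)
qed

lemma tp_add:
  assumes X: "left_module Env X" and "x \<in> carrier X" "u \<in> carrier Fr"
  shows "y \<in> carrier X \<Longrightarrow> tp X (x \<oplus>\<^bsub>X\<^esub> y) u = tp X x u \<oplus>\<^bsub>D X\<^esub> tp X y u"
    "v \<in> carrier Fr \<Longrightarrow> tp X x (u \<oplus>\<^bsub>Fr\<^esub> v) = tp X x u \<oplus>\<^bsub>D X\<^esub> tp X x v"
proof -
  interpret X: left_module Env X by (rule X)
  show "y \<in> carrier X \<Longrightarrow> tp X (x \<oplus>\<^bsub>X\<^esub> y) u = tp X x u \<oplus>\<^bsub>D X\<^esub> tp X y u"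
    using assms(2-) by (auto simp: tp_def D_simps Fr_at X.smult_r_distr tens_closed intro!: restrict_ext)
  show "v \<in> carrier Fr \<Longrightarrow> tp X x (u \<oplus>\<^bsub>Fr\<^esub> v) = tp X x u \<oplus>\<^bsub>D X\<^esub> tp X x v"
    using assms(2-) by (auto simp: tp_def D_simps Fr_simps(3) Fr_at X.smult_l_distr[symmetric] tens_closed
        tens_add_right intro!: restrict_ext)
qed

lemma XU_gens: "left_module Env X \<Longrightarrow> {tp X x u | x u. x \<in> carrier X \<and> u \<in> U} \<subseteq> carrier (D X)"
  by (auto intro!: tp_closed U_closed)

lemma XU_submodule: "left_module Env X \<Longrightarrow> submodule (XU X) A (D X)"
  unfolding XU_def by (rule left_module.span_submodule[OF D_left_module XU_gens])

lemma tp_in_XU: "left_module Env X \<Longrightarrow> x \<in> carrier X \<Longrightarrow> u \<in> U \<Longrightarrow> tp X x u \<in> XU X"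
  unfolding XU_def by (rule subsetD[OF left_module.span_superset[OF D_left_module]]) auto

lemma XU_least:
  assumes "left_module Env X" "submodule W A (D X)" "\<And>x u. x \<in> carrier X \<Longrightarrow> u \<in> U \<Longrightarrow> tp X x u \<in> W"
  shows "XU X \<subseteq> W"
  unfolding XU_def using assms(3) by (intro left_module.span_least[OF D_left_module[OF assms(1)] assms(2)]) auto

lemma quotient: "left_module Env X \<Longrightarrow> quotient_module A (D X) (XU X)"
  by (intro quotient_moduleI D_left_module XU_submodule)

lemma TT_left_module: "left_module Env X \<Longrightarrow> left_module A (TT X)"
  unfolding TT_def by (rule quotient_module.quot_left_module[OF quotient])

lemma (in -) cls_add_left:
  assumes "quotient_module R M W" "w \<in> W" "y \<in> carrier M"
  shows "W +>\<^bsub>M\<^esub> (w \<oplus>\<^bsub>M\<^esub> y) = W +>\<^bsub>M\<^esub> y"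
proof -
  interpret quotient_module R M W by fact
  have w: "w \<in> carrier M" using submoduleD(3)[OF quotient_module.U[OF assms(1)]] assms(2) .
  have "w \<oplus>\<^bsub>M\<^esub> y \<ominus>\<^bsub>M\<^esub> y = w" using w assms(3) by (simp add: a_minus_def M.a_assoc M.r_neg)
  then show ?thesis using w assms by (simp add: cls_eq_iff)
qed

abbreviation "TV \<equiv> quot_mod Fr U"

sublocale V: quotient_module A Fr U by (rule quotient_moduleI[OF Fr.left_module_axioms U])

lemma TV_fin_gen_K: "fin_gen K (scalar_restr A TV)"
proof (rule fin_gen_scalar_restr[OF V.quot_left_module])
  show "fin_gen A TV"
    by (rule fin_gen_image[OF Fr.left_module_axioms V.quot_left_module V.cls_hom _ free_fin_gen[OF A_ring I]])
      (simp add: V.quot_carrier)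
qed

lemma tp_unit_vec:
  assumes X: "left_module Env X" and "i \<in> I" "x \<in> carrier X"
  shows "tp X x (unit_vec A I i) = single I (\<lambda>_. lmod X) i x"
proof -
  interpret X: left_module Env X by (rule X)
  have z: "tens \<one>\<^bsub>A\<^esub> \<zero>\<^bsub>A\<^esub> \<odot>\<^bsub>X\<^esub> x = \<zero>\<^bsub>X\<^esub>"
    using left_module.smult_l_null[OF rmod_left_module[OF X], of x] assms(3) by simp
  show ?thesis using assms(2,3)
    by (auto simp: tp_def unit_vec_def single_def z tens_one[symmetric] X.smult_one intro!: restrict_ext)
qed

text \<open>Adjunction again, now for \<open>V\<close>, the quotient \<open>TV\<close> of the free
  module by \<open>U\<close>: left linear maps from \<open>Q\<close> tensored with \<open>V\<close>
  to \<open>B\<close> are bilinear maps from \<open>Q\<close> to \<open>Hom_K(V, B)\<close>. Finite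
  dimension of \<open>V\<close> makes \<open>Hom_K(V, -)\<close> keep the free cover of
  \<open>TT Q\<close>, and the lifted map is translated back into a section of that cover.\<close>

lemma TT_projective:
  assumes Q: "projective Env Q" shows "projective A (TT Q)"
proof -
  have Qm: "left_module Env Q" by (rule projective_left_module[OF Q])
  interpret Q: left_module Env Q by (rule Qm)
  interpret DQ: quotient_module A "D Q" "XU Q" by (rule quotient[OF Qm])
  note T = TT_left_module[OF Qm]
  interpret T: left_module A "TT Q" by (rule T)
  have Vp: "projective K (scalar_restr A TV)"
    by (rule field_fin_gen_projective[OF K scalar_module[OF V.quot_left_module] TV_fin_gen_K])
  \<comment> \<open>The class of the pure tensor of \<open>q\<close> and \<open>u\<close>. It
    depends only on the class of \<open>u\<close> in \<open>TV\<close>, since tensors with elements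
    of \<open>U\<close> are divided out; so \<open>\<phi> q\<close> below is a function on
    \<open>TV\<close>.\<close>
  define \<tau> where "\<tau> q u = DQ.cls (tp Q q u)" for q u
  have \<tau>_cong: "\<tau> q u = \<tau> q u'" if "q \<in> carrier Q" "u \<in> carrier Fr" "u' \<in> carrier Fr" "V.cls u = V.cls u'" for q u u'
  proof -
    let ?w = "u \<ominus>\<^bsub>Fr\<^esub> u'"
    have w: "?w \<in> U" using that V.cls_eq_iff by simp
    have "u = ?w \<oplus>\<^bsub>Fr\<^esub> u'" using that by (simp add: a_minus_def Fr.M.a_assoc Fr.M.l_neg)
    then have "tp Q q u = tp Q q ?w \<oplus>\<^bsub>D Q\<^esub> tp Q q u'"
      using tp_add(2)[OF Qm that(1) U_closed[OF w] that(3)] by simp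
    then show ?thesis unfolding \<tau>_def
      using cls_add_left[OF DQ.quotient_module_axioms tp_in_XU[OF Qm that(1) w] tp_closed[OF Qm that(1,3)]] by simp
  qed
  have \<tau>_add1: "\<tau> (q \<oplus>\<^bsub>Q\<^esub> q') u = \<tau> q u \<oplus>\<^bsub>TT Q\<^esub> \<tau> q' u"
    if "q \<in> carrier Q" "q' \<in> carrier Q" "u \<in> carrier Fr" for q q' u
    using that by (simp add: \<tau>_def TT_def DQ.quot_add tp_add[OF Qm] tp_closed[OF Qm])
  have \<tau>_add2: "\<tau> q (u \<oplus>\<^bsub>Fr\<^esub> u') = \<tau> q u \<oplus>\<^bsub>TT Q\<^esub> \<tau> q u'"
    if "q \<in> carrier Q" "u \<in> carrier Fr" "u' \<in> carrier Fr" for q u u'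
    using that by (simp add: \<tau>_def TT_def DQ.quot_add tp_add[OF Qm] tp_closed[OF Qm])
  have \<tau>_left: "a \<odot>\<^bsub>TT Q\<^esub> \<tau> q u = \<tau> (tens a \<one>\<^bsub>A\<^esub> \<odot>\<^bsub>Q\<^esub> q) u" if "a \<in> carrier A" "q \<in> carrier Q" "u \<in> carrier Fr" for a q u
    using that by (simp add: \<tau>_def TT_def DQ.quot_smult tp_smult_left[OF Qm] tp_closed[OF Qm])
  have \<tau>_right: "\<tau> (tens \<one>\<^bsub>A\<^esub> b \<odot>\<^bsub>Q\<^esub> q) u = \<tau> q (b \<odot>\<^bsub>Fr\<^esub> u)" if "b \<in> carrier A" "q \<in> carrier Q" "u \<in> carrier Fr" for b q u
    using that by (simp add: \<tau>_def tp_smult_right[OF Qm])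
  have \<tau>_closed: "\<tau> q u \<in> carrier (TT Q)" if "q \<in> carrier Q" "u \<in> carrier Fr" for q u
    using that tp_closed[OF Qm] by (simp add: \<tau>_def TT_def DQ.quot_carrier)
  have qc: "tens a b \<odot>\<^bsub>Q\<^esub> q \<in> carrier Q" if "a \<in> carrier A" "b \<in> carrier A" "q \<in> carrier Q" for a b q
    using that by (intro Q.smult_closed tens_closed)
  define rep where "rep v = (SOME u. u \<in> carrier Fr \<and> v = V.cls u)" for v
  have rep: "rep v \<in> carrier Fr" "V.cls (rep v) = v" if v: "v \<in> carrier TV" for v
  proof -
    obtain u where "u \<in> carrier Fr" "v = V.cls u" using v by (rule V.quot_carrierE)
    then have "u \<in> carrier Fr \<and> v = V.cls u" by simp
    then have "rep v \<in> carrier Fr \<and> v = V.cls (rep v)" unfolding rep_def by (rule someI[of "\<lambda>u. u \<in> carrier Fr \<and> v = V.cls u"])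
    then show "rep v \<in> carrier Fr" "V.cls (rep v) = v" by auto
  qed
  define \<phi> where "\<phi> q = (\<lambda>v\<in>carrier TV. \<tau> q (rep v))" for q
  have \<phi>: "\<phi> q (V.cls u) = \<tau> q u" if "q \<in> carrier Q" "u \<in> carrier Fr" for q u
  proof -
    have c: "V.cls u \<in> carrier TV" using that by (simp add: V.quot_carrier)
    have "\<tau> q (rep (V.cls u)) = \<tau> q u" by (rule \<tau>_cong[OF that(1) rep(1)[OF c] that(2) rep(2)[OF c]])
    then show ?thesis unfolding \<phi>_def using c by simp
  qed
  show ?thesis
  proof (rule projective_if_split[OF T])
    let ?B = "free_module A (carrier (TT Q))"
    fix \<pi> assume \<pi>: "\<pi> \<in> mod_hom A ?B (TT Q)" "\<pi> ` carrier ?B = carrier (TT Q)"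
    have B: "left_module A ?B" by (rule A.free_left_module)
    interpret HB: hom_action K A K TV ?B "scalar_restr A TV" "scalar_restr A ?B"
      by (rule hom_action_scalar[OF alg V.quot_left_module B])
    interpret HC: hom_action K A K TV "TT Q" "scalar_restr A TV" "scalar_restr A (TT Q)"
      by (rule hom_action_scalar[OF alg V.quot_left_module T])
    have \<pi>s: "\<pi> ` carrier (scalar_restr A ?B) = carrier (scalar_restr A (TT Q))" using \<pi>(2) by simp
    note post = hom_action_post[OF HB.hom_action_axioms HC.hom_action_axioms \<pi>(1)
        mod_hom_scalar_restr[OF alg \<pi>(1)] \<pi>s Vp]
    have \<phi>c: "\<phi> q \<in> carrier HC.HM" if q: "q \<in> carrier Q" for q
    proof -
      have "\<phi> q \<in> mod_hom K (scalar_restr A TV) (scalar_restr A (TT Q))"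
      proof (rule mod_homI)
        show "\<phi> q v \<in> carrier (scalar_restr A (TT Q))" if "v \<in> carrier (scalar_restr A TV)" for v
          using that q rep \<tau>_closed by (simp add: \<phi>_def)
        show "\<phi> q (v \<oplus>\<^bsub>scalar_restr A TV\<^esub> w) = \<phi> q v \<oplus>\<^bsub>scalar_restr A (TT Q)\<^esub> \<phi> q w"
          if "v \<in> carrier (scalar_restr A TV)" "w \<in> carrier (scalar_restr A TV)" for v w
          using that q by (auto simp: V.quot_carrier V.quot_add \<phi> \<tau>_add2)
        show "\<phi> q (c \<odot>\<^bsub>scalar_restr A TV\<^esub> v) = c \<odot>\<^bsub>scalar_restr A (TT Q)\<^esub> \<phi> q v"
          if "c \<in> carrier K" "v \<in> carrier (scalar_restr A TV)" for c v
        proof -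
          obtain u where u: "u \<in> carrier Fr" "v = V.cls u" using \<open>v \<in> _\<close> by (auto simp: V.quot_carrier)
          have c1: "c \<odot>\<^bsub>A\<^esub> \<one>\<^bsub>A\<^esub> \<in> carrier A" using that by simp
          show ?thesis
            using u q c1 tens_scalar[OF that(1)]
            by (simp add: V.quot_smult \<phi> Fr.smult_closed \<tau>_left \<tau>_right[symmetric])
        qed
      qed
      then show ?thesis by (simp add: HC.HM_simps \<phi>_def)
    qed
    have "\<exists>\<psi>. (\<forall>q\<in>carrier Q. \<psi> q \<in> carrier HB.HM) \<and>
      (\<forall>q\<in>carrier Q. \<forall>q'\<in>carrier Q. \<psi> (q \<oplus>\<^bsub>Q\<^esub> q') = \<psi> q \<oplus>\<^bsub>HB.HM\<^esub> \<psi> q') \<and>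
      (\<forall>a\<in>carrier A. \<forall>b\<in>carrier A. \<forall>q\<in>carrier Q. \<psi> (tens a b \<odot>\<^bsub>Q\<^esub> q) = hom_act TV ?B a b (\<psi> q)) \<and>
      (\<forall>q\<in>carrier Q. (\<lambda>v\<in>carrier TV. \<pi> (\<psi> q v)) = \<phi> q)"
    proof (rule env_hom_lifting[OF HB.env_action_left[OF fd_algebra_axioms]
          HC.env_action_left[OF fd_algebra_axioms] Q post(1,2) _ post(4) \<phi>c])
      show "(\<lambda>v\<in>carrier TV. \<pi> (hom_act TV ?B a b f v)) = hom_act TV (TT Q) a b (\<lambda>v\<in>carrier TV. \<pi> (f v))"
        if "a \<in> carrier A" "b \<in> carrier A" "f \<in> carrier HB.HM" for a b f
        using post(3) that by blast
      show "\<phi> (q \<oplus>\<^bsub>Q\<^esub> q') = \<phi> q \<oplus>\<^bsub>HC.HM\<^esub> \<phi> q'" if "q \<in> carrier Q" "q' \<in> carrier Q" for q q'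
        unfolding \<phi>_def HC.HM_simps(3) by (rule restrict_ext) (simp add: \<tau>_add1[OF that rep(1)])
      show "\<phi> (tens a b \<odot>\<^bsub>Q\<^esub> q) = hom_act TV (TT Q) a b (\<phi> q)" if "a \<in> carrier A" "b \<in> carrier A" "q \<in> carrier Q" for a b q
      proof (rule extensionalityI[of _ "carrier TV"])
        fix v assume v: "v \<in> carrier TV"
        then obtain u where u: "u \<in> carrier Fr" "v = V.cls u" by (auto simp: V.quot_carrier)
        have "\<phi> (tens a b \<odot>\<^bsub>Q\<^esub> q) v = a \<odot>\<^bsub>TT Q\<^esub> \<tau> q (b \<odot>\<^bsub>Fr\<^esub> u)"
          using that u tens_split(1)[OF Qm that] qc
          by (simp add: \<phi> \<tau>_left[symmetric] \<tau>_right)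
        then show "\<phi> (tens a b \<odot>\<^bsub>Q\<^esub> q) v = hom_act TV (TT Q) a b (\<phi> q) v"
          using that u v by (simp add: hom_act_def V.quot_smult \<phi> Fr.smult_closed)
      qed (simp_all add: \<phi>_def hom_act_def)
    qed
    then obtain \<psi> where "\<forall>q\<in>carrier Q. \<psi> q \<in> carrier HB.HM"
      "\<forall>q\<in>carrier Q. \<forall>q'\<in>carrier Q. \<psi> (q \<oplus>\<^bsub>Q\<^esub> q') = \<psi> q \<oplus>\<^bsub>HB.HM\<^esub> \<psi> q'"
      "\<forall>a\<in>carrier A. \<forall>b\<in>carrier A. \<forall>q\<in>carrier Q. \<psi> (tens a b \<odot>\<^bsub>Q\<^esub> q) = hom_act TV ?B a b (\<psi> q)"
      "\<forall>q\<in>carrier Q. (\<lambda>v\<in>carrier TV. \<pi> (\<psi> q v)) = \<phi> q"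
      by (elim exE conjE)
    note \<psi> = this[rule_format]
    have Vone: "\<one>\<^bsub>A\<^esub> \<odot>\<^bsub>TV\<^esub> v = v" if "v \<in> carrier TV" for v
      using left_module.smult_one[OF V.quot_left_module that] .
    have e: "unit_vec A I i \<in> carrier Fr" "V.cls (unit_vec A I i) \<in> carrier TV" if "i \<in> I" for i
      using A.unit_vec_closed[OF that] by (simp_all add: V.quot_carrier)
    have \<psi>_add: "\<psi> (q \<oplus>\<^bsub>Q\<^esub> q') v = \<psi> q v \<oplus>\<^bsub>?B\<^esub> \<psi> q' v" if "q \<in> carrier Q" "q' \<in> carrier Q" "v \<in> carrier TV" for q q' v
      unfolding \<psi>(2)[OF that(1,2)] HB.HM_simps(3) using that(3) by simp
    have \<psi>_left: "\<psi> (tens a \<one>\<^bsub>A\<^esub> \<odot>\<^bsub>Q\<^esub> q) v = a \<odot>\<^bsub>?B\<^esub> \<psi> q v" if "a \<in> carrier A" "q \<in> carrier Q" "v \<in> carrier TV" for a q v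
      unfolding \<psi>(3)[OF that(1) A.A.one_closed that(2)] hom_act_def using that by (simp add: Vone)
    have \<psi>_right: "\<psi> (tens \<one>\<^bsub>A\<^esub> b \<odot>\<^bsub>Q\<^esub> q) v = \<psi> q (b \<odot>\<^bsub>TV\<^esub> v)" if "b \<in> carrier A" "q \<in> carrier Q" "v \<in> carrier TV" for b q v
      unfolding \<psi>(3)[OF A.A.one_closed that(1,2)] hom_act_def
      using that HB.HM_D(1)[OF \<psi>(1)[OF that(2)] left_module.smult_closed[OF V.quot_left_module that(1,3)]]
      by (simp add: left_module.smult_one[OF B])
    note \<psi>c = HB.HM_D(1)[OF \<psi>(1)]
    have hi: "(\<lambda>q. \<psi> q (V.cls (unit_vec A I i))) \<in> mod_hom A (lmod Q) ?B" if "i \<in> I" for i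
      by (rule mod_homI) (use e[OF that] \<psi>c \<psi>_add \<psi>_left in \<open>simp_all only: lmod_simps\<close>)
    \<comment> \<open>The map is prescribed on the coordinates of \<open>D Q\<close>, that is on
      tensors with unit vectors. Agreement on all other pure tensors is a consequence of
      balancedness, \<open>\<psi>_right\<close>.\<close>
    have "\<exists>h\<in>mod_hom A (D Q) ?B. \<forall>i\<in>I. \<forall>q\<in>carrier Q.
        h (single I (\<lambda>_. lmod Q) i q) = \<psi> q (V.cls (unit_vec A I i))"
      unfolding D_def
    proof (rule module_family.lift[OF family[OF Qm] B, of "\<lambda>i q. \<psi> q (V.cls (unit_vec A I i))"])
      fix H assume H: "H \<in> mod_hom A (direct_sum I (\<lambda>_. lmod Q)) ?B"
        "\<And>i m. i \<in> I \<Longrightarrow> m \<in> carrier (lmod Q) \<Longrightarrow> H (single I (\<lambda>_. lmod Q) i m) = \<psi> m (V.cls (unit_vec A I i))"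
      show "\<exists>h\<in>mod_hom A (direct_sum I (\<lambda>_. lmod Q)) ?B. \<forall>i\<in>I. \<forall>q\<in>carrier Q.
        h (single I (\<lambda>_. lmod Q) i q) = \<psi> q (V.cls (unit_vec A I i))"
        by (rule bexI[OF _ H(1)]) (simp add: H(2))
    qed (rule hi)
    then obtain h where h: "h \<in> mod_hom A (D Q) ?B"
      "\<And>i q. i \<in> I \<Longrightarrow> q \<in> carrier Q \<Longrightarrow> h (single I (\<lambda>_. lmod Q) i q) = \<psi> q (V.cls (unit_vec A I i))"
      by blast
    interpret DB: module_pair A "D Q" ?B by unfold_locales
    \<comment> \<open>The map defined on the coordinates agrees with \<open>\<psi>\<close> on every product \<open>q u\<close>.\<close>
    define W where "W = {u \<in> carrier Fr. \<forall>q\<in>carrier Q. h (tp Q q u) = \<psi> q (V.cls u)}"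
    have "submodule W A Fr" unfolding Fr.submodule_iff
    proof (intro conjI ballI)
      show "W \<subseteq> carrier Fr" by (auto simp: W_def)
      have "h (tp Q q \<zero>\<^bsub>Fr\<^esub>) = \<psi> q (V.cls \<zero>\<^bsub>Fr\<^esub>)" if q: "q \<in> carrier Q" for q
      proof -
        have 1: "tp Q q \<zero>\<^bsub>Fr\<^esub> = tp Q \<zero>\<^bsub>Q\<^esub> \<zero>\<^bsub>Fr\<^esub>" "tp Q \<zero>\<^bsub>Q\<^esub> \<zero>\<^bsub>Fr\<^esub> = \<zero>\<^bsub>D Q\<^esub>"
          using q left_module.smult_l_null[OF rmod_left_module[OF Qm], of q]
            left_module.smult_l_null[OF rmod_left_module[OF Qm], of "\<zero>\<^bsub>Q\<^esub>"]
          by (auto simp: tp_def Fr_simps(2) D_simps(2) intro!: restrict_ext)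
        have "\<psi> q (V.cls \<zero>\<^bsub>Fr\<^esub>) = \<zero>\<^bsub>?B\<^esub>"
          using module_pair.hom_zero[OF HB.VB.module_pair_axioms HB.HM_D(3)[OF \<psi>(1)[OF q]]]
          by (simp only: scalar_restr_simps V.quot_zero V.cls_zero)
        then show ?thesis using 1 DB.hom_zero[OF h(1)] by simp
      qed
      then show "\<zero>\<^bsub>Fr\<^esub> \<in> W" by (simp add: W_def)
      show "u \<oplus>\<^bsub>Fr\<^esub> v \<in> W" if "u \<in> W" "v \<in> W" for u v
      proof -
        have uv: "u \<in> carrier Fr" "v \<in> carrier Fr" using that by (auto simp: W_def)
        have "h (tp Q q (u \<oplus>\<^bsub>Fr\<^esub> v)) = \<psi> q (V.cls (u \<oplus>\<^bsub>Fr\<^esub> v))" if q: "q \<in> carrier Q" for q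
        proof -
          have "h (tp Q q (u \<oplus>\<^bsub>Fr\<^esub> v)) = h (tp Q q u) \<oplus>\<^bsub>?B\<^esub> h (tp Q q v)"
            unfolding tp_add(2)[OF Qm q uv] by (rule mod_homD(2)[OF h(1) tp_closed[OF Qm q uv(1)] tp_closed[OF Qm q uv(2)]])
          also have "\<dots> = \<psi> q (V.cls u) \<oplus>\<^bsub>?B\<^esub> \<psi> q (V.cls v)"
            using \<open>u \<in> W\<close> \<open>v \<in> W\<close> q by (simp add: W_def)
          also have "\<dots> = \<psi> q (V.cls u \<oplus>\<^bsub>TV\<^esub> V.cls v)"
            by (rule HB.HM_D(2)[OF \<psi>(1)[OF q], symmetric]) (use uv in \<open>simp_all add: V.quot_carrier\<close>)
          finally show ?thesis unfolding V.quot_add[OF uv] .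
        qed
        then show ?thesis using uv by (simp add: W_def)
      qed
      show "b \<odot>\<^bsub>Fr\<^esub> u \<in> W" if b: "b \<in> carrier A" and "u \<in> W" for b u
      proof -
        have u: "u \<in> carrier Fr" "V.cls u \<in> carrier TV" using that by (auto simp: W_def V.quot_carrier)
        have "h (tp Q q (b \<odot>\<^bsub>Fr\<^esub> u)) = \<psi> q (V.cls (b \<odot>\<^bsub>Fr\<^esub> u))" if q: "q \<in> carrier Q" for q
        proof -
          have "h (tp Q q (b \<odot>\<^bsub>Fr\<^esub> u)) = h (tp Q (tens \<one>\<^bsub>A\<^esub> b \<odot>\<^bsub>Q\<^esub> q) u)"
            unfolding tp_smult_right[OF Qm b q u(1)] ..
          also have "\<dots> = \<psi> (tens \<one>\<^bsub>A\<^esub> b \<odot>\<^bsub>Q\<^esub> q) (V.cls u)"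
            using \<open>u \<in> W\<close> qc[OF A.A.one_closed b q] by (simp add: W_def)
          finally show ?thesis unfolding \<psi>_right[OF b q u(2)] V.quot_smult[OF b u(1)] .
        qed
        then show ?thesis using u b by (simp add: W_def Fr.smult_closed)
      qed
    qed
    moreover have "unit_vec A I i \<in> W" if "i \<in> I" for i
      using that e h(2) by (simp add: W_def tp_unit_vec[OF Qm])
    ultimately have WF: "carrier Fr \<subseteq> W"
      using Fr.span_least[of W "unit_vec A I ` I"] A.free_span[of I] by auto
    \<comment> \<open>An element of \<open>U\<close> has class zero in \<open>TV\<close>, so
      \<open>h\<close> kills the generators of \<open>XU Q\<close> and descends to the
      quotient.\<close>
    have hU: "h f = \<zero>\<^bsub>?B\<^esub>" if "f \<in> XU Q" for f
    proof -
      have "XU Q \<subseteq> a_kernel (D Q) ?B h"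
      proof (rule XU_least[OF Qm DB.kernel_submodule[OF h(1)]])
        fix q u assume q: "q \<in> carrier Q" and u: "u \<in> U"
        have "h (tp Q q u) = \<psi> q (V.cls u)" using WF U_closed[OF u] q by (auto simp: W_def)
        also have "V.cls u = V.cls \<zero>\<^bsub>Fr\<^esub>" using V.cls_eq_zero_iff[OF U_closed[OF u]] u V.cls_zero by simp
        also have "\<psi> q (V.cls \<zero>\<^bsub>Fr\<^esub>) = \<zero>\<^bsub>?B\<^esub>"
          using module_pair.hom_zero[OF HB.VB.module_pair_axioms HB.HM_D(3)[OF \<psi>(1)[OF q]]]
          by (simp only: scalar_restr_simps V.quot_zero V.cls_zero)
        finally show "tp Q q u \<in> a_kernel (D Q) ?B h"
          using tp_closed[OF Qm q U_closed[OF u]] by (simp add: a_kernel_def')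
      qed
      then show ?thesis using that by (auto simp: a_kernel_def')
    qed
    obtain s where s: "s \<in> mod_hom A (quot_mod (D Q) (XU Q)) ?B" "\<And>f. f \<in> carrier (D Q) \<Longrightarrow> s (DQ.cls f) = h f"
      using DQ.quot_lift[OF h(1) B hU] by blast
    have "\<pi> (h f) = DQ.cls f" if f: "f \<in> carrier (D Q)" for f
    proof (rule module_family.hom_eqI[OF family[OF Qm], folded D_def, OF mod_hom_comp[OF h(1) \<pi>(1)] _ T _ f])
      show "DQ.cls \<in> mod_hom A (D Q) (TT Q)" unfolding TT_def by (rule DQ.cls_hom)
      fix i q assume i: "i \<in> I" and "q \<in> carrier (lmod Q)"
      then have q: "q \<in> carrier Q" by simp
      have "\<pi> (h (single I (\<lambda>_. lmod Q) i q)) = \<pi> (\<psi> q (V.cls (unit_vec A I i)))" using h(2) i q by simp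
      also have "\<dots> = \<phi> q (V.cls (unit_vec A I i))"
        using fun_cong[OF \<psi>(4)[OF q], of "V.cls (unit_vec A I i)"] e(2)[OF i] by simp
      also have "\<dots> = DQ.cls (single I (\<lambda>_. lmod Q) i q)"
        unfolding \<phi>[OF q e(1)[OF i]] \<tau>_def tp_unit_vec[OF Qm i q] ..
      finally show "\<pi> (h (single I (\<lambda>_. lmod Q) i q)) = DQ.cls (single I (\<lambda>_. lmod Q) i q)" .
    qed
    then have "\<pi> (s C) = C" if "C \<in> carrier (TT Q)" for C
      using that s(2) by (auto simp: TT_def DQ.quot_carrier)
    then show "\<exists>s. s \<in> mod_hom A (TT Q) ?B \<and> (\<forall>x\<in>carrier (TT Q). \<pi> (s x) = x)"
      using s(1) by (auto simp: TT_def[symmetric])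
  qed
qed

definition "dmap \<phi> f = (\<lambda>i\<in>I. \<phi> (f i))"

lemma dmap_hom:
  assumes "\<phi> \<in> mod_hom Env X Y" shows "dmap \<phi> \<in> mod_hom A (D X) (D Y)"
  by (rule mod_homI)
    (use mod_homD[OF assms] tens_closed in \<open>auto simp: dmap_def D_simps PiE_def Pi_def intro!: restrict_ext\<close>)

lemma dmap_tp:
  assumes "\<phi> \<in> mod_hom Env X Y" "x \<in> carrier X" "u \<in> carrier Fr"
  shows "dmap \<phi> (tp X x u) = tp Y (\<phi> x) u"
  using mod_homD(3)[OF assms(1)] assms(2,3) tens_closed Fr_at
  by (auto simp: dmap_def tp_def intro!: restrict_ext)

text \<open>Right exactness needs only the surjection. Injectivity on the left comes from the right
  linear retraction \<open>\<rho>\<close>: applied coordinatewise it sends the tensor of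
  \<open>q\<close> and \<open>u\<close> to that of \<open>\<rho> q\<close> and \<open>u\<close>, so
  the relations of \<open>Q\<close> that lie in \<open>X\<close> are relations of
  \<open>X\<close>.\<close>

lemma TT_exact:
  assumes ex: "short_exact Env X Q Y i p"
    and \<rho>: "\<rho> \<in> mod_hom (opp A) (rmod Q) (rmod X)" "\<And>x. x \<in> carrier X \<Longrightarrow> \<rho> (i x) = x"
  shows "\<exists>i' p'. short_exact A (TT X) (TT Q) (TT Y) i' p'"
proof -
  note e = short_exactD[OF ex]
  interpret X: left_module Env X by (rule e)
  interpret Q: left_module Env Q by (rule e)
  interpret Y: left_module Env Y by (rule e)
  interpret DX: quotient_module A "D X" "XU X" by (rule quotient[OF e(1)])
  interpret DQ: quotient_module A "D Q" "XU Q" by (rule quotient[OF e(2)])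
  interpret DY: quotient_module A "D Y" "XU Y" by (rule quotient[OF e(3)])
  interpret DXQ: module_pair A "D X" "D Q" by unfold_locales
  interpret DQY: module_pair A "D Q" "D Y" by unfold_locales
  interpret rho: module_pair "opp A" "rmod Q" "rmod X" by (intro module_pairI rmod_left_module e)
  interpret YX: module_pair Env Q Y by unfold_locales
  note hi = dmap_hom[OF e(4)] and hp = dmap_hom[OF e(5)]
  have iU: "dmap i f \<in> XU Q" if "f \<in> XU X" for f
  proof -
    have "XU X \<subseteq> {f \<in> carrier (D X). dmap i f \<in> XU Q}"
      by (rule XU_least[OF e(1) DXQ.vimage_submodule[OF hi DQ.U]])
        (use dmap_tp[OF e(4)] tp_closed[OF e(1)] tp_in_XU[OF e(2)] mod_homD(1)[OF e(4)] U_closed in simp)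
    then show ?thesis using that by auto
  qed
  have pU: "dmap p f \<in> XU Y" if "f \<in> XU Q" for f
  proof -
    have "XU Q \<subseteq> {f \<in> carrier (D Q). dmap p f \<in> XU Y}"
      by (rule XU_least[OF e(2) DQY.vimage_submodule[OF hp DY.U]])
        (use dmap_tp[OF e(5)] tp_closed[OF e(2)] tp_in_XU[OF e(3)] mod_homD(1)[OF e(5)] U_closed in simp)
    then show ?thesis using that by auto
  qed
  \<comment> \<open>Relations of \<open>Y\<close> lift to relations of \<open>Q\<close>. Exactness
    in the middle uses this to change a representative before taking coordinatewise
    preimages.\<close>
  have UY: "\<exists>g\<in>XU Q. dmap p g = f" if "f \<in> XU Y" for f
  proof -
    have "XU Y \<subseteq> dmap p ` XU Q"
    proof (rule XU_least[OF e(3) DQY.image_submodule[OF hp DQ.U]])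
      fix y u assume y: "y \<in> carrier Y" and u: "u \<in> U"
      then obtain q where q: "q \<in> carrier Q" "p q = y" using e(7) by (metis imageE)
      have "dmap p (tp Q q u) = tp Y y u" using dmap_tp[OF e(5) q(1) U_closed[OF u]] q(2) by simp
      then show "tp Y y u \<in> dmap p ` XU Q" using tp_in_XU[OF e(2) q(1) u] by (metis imageI)
    qed
    then show ?thesis using that by blast
  qed
  have \<rho>U: "dmap \<rho> f \<in> XU X" if f: "f \<in> XU Q" for f
  proof -
    \<comment> \<open>\<open>\<rho>\<close> is linear only on the right, so the plain preimage of
      \<open>XU X\<close> need not be a left submodule. Testing after every left multiplication by
      \<open>a\<close> makes it one; \<open>a = 1\<close> recovers the claim.\<close>
    define W where "W = {f \<in> carrier (D Q). \<forall>a\<in>carrier A. dmap \<rho> (a \<odot>\<^bsub>D Q\<^esub> f) \<in> XU X}"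
    have \<rho>add: "dmap \<rho> (f \<oplus>\<^bsub>D Q\<^esub> g) = dmap \<rho> f \<oplus>\<^bsub>D X\<^esub> dmap \<rho> g" if "f \<in> carrier (D Q)" "g \<in> carrier (D Q)" for f g
      using that mod_homD(2)[OF \<rho>(1)] by (auto simp: dmap_def D_simps PiE_def Pi_def intro!: restrict_ext)
    have \<rho>0: "dmap \<rho> \<zero>\<^bsub>D Q\<^esub> = \<zero>\<^bsub>D X\<^esub>"
      using rho.hom_zero[OF \<rho>(1)] by (auto simp: dmap_def D_simps intro!: restrict_ext)
    have "submodule W A (D Q)" unfolding DQ.submodule_iff
    proof (intro conjI ballI)
      show "W \<subseteq> carrier (D Q)" by (auto simp: W_def)
      show "\<zero>\<^bsub>D Q\<^esub> \<in> W" using DX.submoduleD(2)[OF DX.U] by (simp add: W_def DQ.smult_r_null \<rho>0)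
      show "f \<oplus>\<^bsub>D Q\<^esub> g \<in> W" if "f \<in> W" "g \<in> W" for f g
        using that DX.submoduleD(4)[OF DX.U] by (auto simp: W_def DQ.smult_r_distr DQ.smult_closed \<rho>add)
      show "b \<odot>\<^bsub>D Q\<^esub> f \<in> W" if "b \<in> carrier A" "f \<in> W" for b f
        using that by (auto simp: W_def DQ.smult_closed DQ.smult_assoc1[symmetric])
    qed
    moreover have "tp Q q u \<in> W" if q: "q \<in> carrier Q" and u: "u \<in> U" for q u
    proof -
      have "dmap \<rho> (a \<odot>\<^bsub>D Q\<^esub> tp Q q u) \<in> XU X" if a: "a \<in> carrier A" for a
      proof -
        let ?q = "tens a \<one>\<^bsub>A\<^esub> \<odot>\<^bsub>Q\<^esub> q"
        have qc: "?q \<in> carrier Q" using a q by (intro Q.smult_closed tens_closed) auto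
        have "dmap \<rho> (a \<odot>\<^bsub>D Q\<^esub> tp Q q u) = tp X (\<rho> ?q) u"
          unfolding tp_smult_left[OF e(2) a q U_closed[OF u]]
          using mod_homD(3)[OF \<rho>(1)] qc Fr_at[OF U_closed[OF u]]
          by (auto simp: dmap_def tp_def intro!: restrict_ext)
        moreover have "\<rho> ?q \<in> carrier X" using mod_homD(1)[OF \<rho>(1)] qc by simp
        ultimately show ?thesis using tp_in_XU[OF e(1) _ u] by simp
      qed
      then show ?thesis using tp_closed[OF e(2) q U_closed[OF u]] by (simp add: W_def)
    qed
    ultimately have "XU Q \<subseteq> W" by (rule XU_least[OF e(2)])
    then have *: "\<forall>a\<in>carrier A. dmap \<rho> (a \<odot>\<^bsub>D Q\<^esub> f) \<in> XU X" "f \<in> carrier (D Q)" using f by (auto simp: W_def)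
    from bspec[OF *(1) A.A.one_closed] show ?thesis by (simp add: DQ.smult_one[OF *(2)])
  qed
  have \<rho>i: "dmap \<rho> (dmap i f) = f" if "f \<in> carrier (D X)" for f
    using that \<rho>(2) by (intro extensionalityI[of _ I]) (auto simp: dmap_def D_simps PiE_def)
  obtain i' where i': "i' \<in> mod_hom A (TT X) (TT Q)" "\<And>f. f \<in> carrier (D X) \<Longrightarrow> i' (DX.cls f) = DQ.cls (dmap i f)"
    unfolding TT_def using quot_map[OF DX.left_module_axioms DQ.left_module_axioms DX.U DQ.U hi iU] by blast
  obtain p' where p': "p' \<in> mod_hom A (TT Q) (TT Y)" "\<And>f. f \<in> carrier (D Q) \<Longrightarrow> p' (DQ.cls f) = DY.cls (dmap p f)"
    unfolding TT_def using quot_map[OF DQ.left_module_axioms DY.left_module_axioms DQ.U DY.U hp pU] by blast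
  interpret TXQ: module_pair A "TT X" "TT Q" by (intro module_pairI TT_left_module e)
  have "inj_on i' (carrier (TT X))"
  proof (rule TXQ.inj_if_kernel_trivial[OF i'(1)])
    fix C assume "C \<in> carrier (TT X)" and z: "i' C = \<zero>\<^bsub>TT Q\<^esub>"
    then obtain f where f: "f \<in> carrier (D X)" "C = DX.cls f" by (auto simp: TT_def DX.quot_carrier)
    have "dmap i f \<in> XU Q"
      using z f i'(2) mod_homD(1)[OF hi] DQ.cls_eq_zero_iff by (simp add: TT_def DQ.quot_zero)
    then have "f \<in> XU X" using \<rho>U \<rho>i[OF f(1)] by metis
    then show "C = \<zero>\<^bsub>TT X\<^esub>" using f DX.cls_eq_zero_iff by (simp add: TT_def DX.quot_zero)
  qed
  moreover have "p' ` carrier (TT Q) = carrier (TT Y)"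
  proof
    show "p' ` carrier (TT Q) \<subseteq> carrier (TT Y)" using mod_homD(1)[OF p'(1)] by auto
    show "carrier (TT Y) \<subseteq> p' ` carrier (TT Q)"
    proof
      fix C assume "C \<in> carrier (TT Y)"
      then obtain g where g: "g \<in> carrier (D Y)" "C = DY.cls g" by (auto simp: TT_def DY.quot_carrier)
      have "\<exists>q. q \<in> carrier Q \<and> p q = g j" if "j \<in> I" for j
        using g(1) that e(7) by (auto simp: D_simps) (metis PiE_mem imageE)
      then obtain f where f: "\<And>j. j \<in> I \<Longrightarrow> f j \<in> carrier Q \<and> p (f j) = g j" by metis
      have "(\<lambda>j\<in>I. f j) \<in> carrier (D Q)" using f by (auto simp: D_simps)
      moreover have "dmap p (\<lambda>j\<in>I. f j) = g"
        using f g(1) by (intro extensionalityI[of _ I]) (auto simp: dmap_def D_simps PiE_def)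
      ultimately show "C \<in> p' ` carrier (TT Q)"
        using p'(2) g(2) by (intro image_eqI[of _ _ "DQ.cls (\<lambda>j\<in>I. f j)"]) (auto simp: TT_def DQ.quot_carrier)
    qed
  qed
  moreover have "i' ` carrier (TT X) = a_kernel (TT Q) (TT Y) p'"
  proof
    show "i' ` carrier (TT X) \<subseteq> a_kernel (TT Q) (TT Y) p'"
    proof
      fix C assume "C \<in> i' ` carrier (TT X)"
      then obtain f where f: "f \<in> carrier (D X)" "C = DQ.cls (dmap i f)"
        using i'(2) by (auto simp: TT_def DX.quot_carrier)
      have c: "dmap i f \<in> carrier (D Q)" by (rule mod_homD(1)[OF hi f(1)])
      have "dmap p (dmap i f) = \<zero>\<^bsub>D Y\<^esub>" using f(1) e(9) by (auto simp: dmap_def D_simps PiE_def Pi_def intro!: restrict_ext)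
      then have "p' C = \<zero>\<^bsub>TT Y\<^esub>" using c f(2) p'(2) by (simp add: DY.cls_zero TT_def DY.quot_zero)
      then show "C \<in> a_kernel (TT Q) (TT Y) p'" using c f(2) by (simp add: a_kernel_def' TT_def DQ.quot_carrier)
    qed
    show "a_kernel (TT Q) (TT Y) p' \<subseteq> i' ` carrier (TT X)"
    proof
      fix C assume C: "C \<in> a_kernel (TT Q) (TT Y) p'"
      then obtain f where f: "f \<in> carrier (D Q)" "C = DQ.cls f" by (auto simp: a_kernel_def' TT_def DQ.quot_carrier)
      have "dmap p f \<in> XU Y"
        using C f p'(2) mod_homD(1)[OF hp] DY.cls_eq_zero_iff by (simp add: a_kernel_def' TT_def DY.quot_zero)
      \<comment> \<open>The image of \<open>f\<close> is only a relation of \<open>Y\<close>, not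
        zero. Subtracting the relation \<open>g\<close> of \<open>Q\<close> with the same image
        gives a tuple that vanishes in \<open>Y\<close> in every coordinate without changing the
        class of \<open>f\<close>.\<close>
      then obtain g where g: "g \<in> XU Q" "dmap p g = dmap p f" using UY by blast
      have gc: "g \<in> carrier (D Q)" using DQ.submoduleD(3)[OF DQ.U g(1)] .
      have diff: "dmap p (f \<ominus>\<^bsub>D Q\<^esub> g) = \<zero>\<^bsub>D Y\<^esub>"
        unfolding DQY.hom_diff[OF hp f(1) gc] g(2) using DY.M.diff_eq_zero_iff mod_homD(1)[OF hp f(1)] by blast
      have fg: "f \<ominus>\<^bsub>D Q\<^esub> g \<in> carrier (D Q)" using f(1) gc by simp
      have "\<exists>x. x \<in> carrier X \<and> i x = (f \<ominus>\<^bsub>D Q\<^esub> g) j" if "j \<in> I" for j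
      proof -
        have "p ((f \<ominus>\<^bsub>D Q\<^esub> g) j) = \<zero>\<^bsub>Y\<^esub>" using fun_cong[OF diff, of j] that by (simp add: dmap_def D_simps)
        moreover have "(f \<ominus>\<^bsub>D Q\<^esub> g) j \<in> carrier Q" using fg that by (auto simp: D_simps)
        ultimately show ?thesis using e(10) by blast
      qed
      then obtain x where x: "\<And>j. j \<in> I \<Longrightarrow> x j \<in> carrier X \<and> i (x j) = (f \<ominus>\<^bsub>D Q\<^esub> g) j" by metis
      have xc: "(\<lambda>j\<in>I. x j) \<in> carrier (D X)" using x by (auto simp: D_simps)
      have ix: "dmap i (\<lambda>j\<in>I. x j) = f \<ominus>\<^bsub>D Q\<^esub> g"
        using x fg by (intro extensionalityI[of _ I]) (auto simp: dmap_def D_simps PiE_def)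
      have "g \<oplus>\<^bsub>D Q\<^esub> (f \<ominus>\<^bsub>D Q\<^esub> g) = f"
        using f(1) gc by (simp add: a_minus_def DQ.M.a_lcomm[of g f] DQ.M.r_neg)
      then have "DQ.cls f = DQ.cls (f \<ominus>\<^bsub>D Q\<^esub> g)"
        using cls_add_left[OF DQ.quotient_module_axioms g(1) fg] by simp
      then have "C = i' (DX.cls (\<lambda>j\<in>I. x j))" unfolding i'(2)[OF xc] ix using f(2) by (simp only:)
      then show "C \<in> i' ` carrier (TT X)"
        unfolding TT_def DX.quot_carrier using xc by (intro image_eqI[of _ _ "DX.cls (\<lambda>j\<in>I. x j)"] imageI)
    qed
  qed
  ultimately show ?thesis unfolding short_exact_def
    by (intro exI[of _ i'] exI[of _ p'] conjI TT_left_module e(1-3) i'(1) p'(1))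
qed

text \<open>Tensoring with the regular bimodule is the identity. Here \<open>D Reg\<close> agrees
  with the free module and the tensor of \<open>x\<close> and \<open>u\<close> is the product x u,
  so \<open>XU Reg\<close> is \<open>U\<close> itself and the quotient is the image of
  \<open>H\<close>.\<close>

lemma TT_Reg_iso:
  assumes M: "left_module A M" and H: "H \<in> mod_hom A Fr M" "H ` carrier Fr = carrier M"
    and ker: "a_kernel Fr M H = U"
  shows "\<exists>f g. f \<in> mod_hom A (TT Reg) M \<and> g \<in> mod_hom A M (TT Reg) \<and>
    (\<forall>x\<in>carrier (TT Reg). g (f x) = x) \<and> (\<forall>y\<in>carrier M. f (g y) = y)"
proof -
  note R = Reg_left_module
  interpret M: left_module A M by (rule M)
  interpret DR: quotient_module A "D Reg" "XU Reg" by (rule quotient[OF R])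
  have eq: "carrier (D Reg) = carrier Fr" "add (D Reg) = add Fr" "zero (D Reg) = zero Fr"
    "\<And>r x. r \<in> carrier A \<Longrightarrow> x \<in> carrier Fr \<Longrightarrow> r \<odot>\<^bsub>D Reg\<^esub> x = r \<odot>\<^bsub>Fr\<^esub> x"
    by (auto simp: D_simps Fr_simps fun_eq_iff Reg_smult Fr_at)
  have H': "H \<in> mod_hom A (D Reg) M"
    using H(1) eq by (auto simp: mod_hom_def)
  have XUU: "XU Reg = U"
  proof
    have "submodule U A (D Reg)" using submodule_cong[OF Fr.left_module_axioms eq] U by simp
    then show "XU Reg \<subseteq> U"
    proof (rule XU_least[OF R])
      fix x u assume x: "x \<in> carrier Reg" and u: "u \<in> U"
      have "tp Reg x u = x \<odot>\<^bsub>Fr\<^esub> u"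
        using x Fr_at[OF U_closed[OF u]] by (auto simp: tp_def Fr_simps(4) Reg_smult intro!: restrict_ext)
      then show "tp Reg x u \<in> U" using Fr.submoduleD(5)[OF U _ u] x by simp
    qed
    show "U \<subseteq> XU Reg"
    proof
      fix u assume u: "u \<in> U"
      have "tp Reg \<one>\<^bsub>A\<^esub> u = u"
        using Fr_at[OF U_closed[OF u]] U_closed[OF u]
        by (intro extensionalityI[of _ I]) (auto simp: tp_def Fr_simps(1) Reg_smult PiE_def)
      then show "u \<in> XU Reg" using tp_in_XU[OF R _ u, of "\<one>\<^bsub>A\<^esub>"] by simp
    qed
  qed
  have HU: "H x = \<zero>\<^bsub>M\<^esub>" if "x \<in> XU Reg" for x
    using that ker XUU by (auto simp: a_kernel_def')
  obtain f where f: "f \<in> mod_hom A (TT Reg) M" "\<And>x. x \<in> carrier (D Reg) \<Longrightarrow> f (DR.cls x) = H x"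
    unfolding TT_def using DR.quot_lift[OF H' M HU] by blast
  interpret TM: module_pair A "TT Reg" M by (intro module_pairI TT_left_module R M)
  have "inj_on f (carrier (TT Reg))"
  proof (rule TM.inj_if_kernel_trivial[OF f(1)])
    fix C assume "C \<in> carrier (TT Reg)" and z: "f C = \<zero>\<^bsub>M\<^esub>"
    then obtain x where x: "x \<in> carrier (D Reg)" "C = DR.cls x" by (auto simp: TT_def DR.quot_carrier)
    then have "x \<in> a_kernel Fr M H" using z f(2) eq(1) by (simp add: a_kernel_def')
    then have "DR.cls x = XU Reg" unfolding DR.cls_eq_zero_iff[OF x(1)] by (simp only: ker XUU)
    then show "C = \<zero>\<^bsub>TT Reg\<^esub>" unfolding x(2) TT_def DR.quot_zero .
  qed
  moreover have "f ` carrier (TT Reg) = carrier M"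
  proof -
    have "f ` carrier (TT Reg) = H ` carrier (D Reg)"
      using f(2) by (simp add: TT_def DR.quot_carrier image_image)
    then show ?thesis using H(2) eq(1) by simp
  qed
  ultimately have bij: "bij_betw f (carrier (TT Reg)) (carrier M)" by (simp add: bij_betw_def)
  show ?thesis
    using f(1) TM.inverse_hom[OF f(1) bij] bij
    by (intro exI[of _ f] exI[of _ "inv_into (carrier (TT Reg)) f"]) (auto simp: bij_betw_def f_inv_into_f)
qed

end

section \<open>The radical\<close>

definition maximal_submodule :: "('r, 'x) ring_scheme \<Rightarrow> ('r, 'm) module \<Rightarrow> 'm set \<Rightarrow> bool" where
  "maximal_submodule R M N \<longleftrightarrow> submodule N R M \<and> N \<noteq> carrier M \<and>
     (\<forall>V. submodule V R M \<and> N \<subseteq> V \<longrightarrow> V = N \<or> V = carrier M)"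

lemma jacobson_radical_eq:
  "jacobson_radical A = carrier A \<inter> \<Inter>{I. maximal_submodule A (regular_module A) I}"
  by (simp add: jacobson_radical_def maximal_submodule_def)

text \<open>If \<open>l\<close> is outside \<open>N\<close>, the annihilator of the class of
  \<open>l\<close> in the simple module L / N is a maximal left ideal, and the radical is contained
  in it.\<close>

lemma radical_annihilates:
  assumes L: "left_module A L" and N: "maximal_submodule A L N"
    and l: "l \<in> carrier L" and j: "j \<in> jacobson_radical A"
  shows "j \<odot>\<^bsub>L\<^esub> l \<in> N"
proof (cases "l \<in> N")
  interpret L: left_module A L by (rule L)
  have Ns: "submodule N A L" using N by (simp add: maximal_submodule_def)
  have jA: "j \<in> carrier A" using j by (simp add: jacobson_radical_def)
  {
    case True
    then show ?thesis using L.submoduleD(5)[OF Ns jA] by blast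
  next
    case False
    have R: "left_module A (regular_module A)" by (rule regular_left_module[OF L.R.ring_axioms])
    interpret RL: module_pair A "regular_module A" L by (intro module_pairI R L)
    have hom: "(\<lambda>a. a \<odot>\<^bsub>L\<^esub> l) \<in> mod_hom A (regular_module A) L"
      using l by (auto intro!: mod_homI simp: L.smult_closed L.smult_l_distr L.smult_assoc1)
    let ?I = "{a \<in> carrier (regular_module A). a \<odot>\<^bsub>L\<^esub> l \<in> N}"
    have I: "submodule ?I A (regular_module A)" by (rule RL.vimage_submodule[OF hom Ns])
    have "maximal_submodule A (regular_module A) ?I" unfolding maximal_submodule_def
    proof (intro conjI I allI impI)
      have "\<one>\<^bsub>A\<^esub> \<notin> ?I" using False l by (simp add: L.smult_one)
      then show "?I \<noteq> carrier (regular_module A)" using L.R.one_closed by auto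
      fix V assume V: "submodule V A (regular_module A) \<and> ?I \<subseteq> V"
      note VD = RL.M.submoduleD[OF conjunct1[OF V]]
      have "V = carrier (regular_module A)" if "V \<noteq> ?I"
      proof -
        obtain a where a: "a \<in> V" "a \<notin> ?I" using V \<open>V \<noteq> ?I\<close> by blast
        then have aA: "a \<in> carrier A" using VD(3) by simp
        then have al: "a \<odot>\<^bsub>L\<^esub> l \<in> carrier L" "a \<odot>\<^bsub>L\<^esub> l \<notin> N" using a l by (auto simp: L.smult_closed)
        have Nc: "N \<subseteq> carrier L" by (rule L.submoduleD(1)[OF Ns])
        have ins: "insert (a \<odot>\<^bsub>L\<^esub> l) N \<subseteq> carrier L" using Nc al by simp
        have "N \<subseteq> mod_span A L (insert (a \<odot>\<^bsub>L\<^esub> l) N)" "a \<odot>\<^bsub>L\<^esub> l \<in> mod_span A L (insert (a \<odot>\<^bsub>L\<^esub> l) N)"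
          using L.span_superset[of "insert (a \<odot>\<^bsub>L\<^esub> l) N"] by auto
        then have "mod_span A L (insert (a \<odot>\<^bsub>L\<^esub> l) N) = carrier L"
          using N L.span_submodule[OF ins] al(2) unfolding maximal_submodule_def by blast
        then have "l \<in> mod_span A L (insert (a \<odot>\<^bsub>L\<^esub> l) N)" using l by simp
        then obtain c y where cy: "c \<in> carrier A" "y \<in> mod_span A L N" "l = y \<oplus>\<^bsub>L\<^esub> c \<odot>\<^bsub>L\<^esub> (a \<odot>\<^bsub>L\<^esub> l)"
          by (rule span_insert[OF L Nc al(1)])
        have y: "y \<in> N" using cy(2) L.span_least[OF Ns order_refl] by blast
        then have yc: "y \<in> carrier L" using Nc by blast
        \<comment> \<open>With c a in \<open>V\<close> and 1 - c a in \<open>?I\<close>, which is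
          contained in \<open>V\<close>, the left ideal \<open>V\<close> contains one.\<close>
        have ca: "c \<otimes>\<^bsub>A\<^esub> a \<in> V" using VD(5)[OF cy(1) a(1)] by simp
        have caA: "c \<otimes>\<^bsub>A\<^esub> a \<in> carrier A" using cy(1) aA by simp
        have "(\<one>\<^bsub>A\<^esub> \<ominus>\<^bsub>A\<^esub> c \<otimes>\<^bsub>A\<^esub> a) \<odot>\<^bsub>L\<^esub> l = l \<ominus>\<^bsub>L\<^esub> c \<odot>\<^bsub>L\<^esub> (a \<odot>\<^bsub>L\<^esub> l)"
          using l caA cy(1) aA by (simp add: a_minus_def L.smult_l_distr L.smult_l_minus L.smult_one L.smult_assoc1)
        also have "\<dots> = (y \<oplus>\<^bsub>L\<^esub> c \<odot>\<^bsub>L\<^esub> (a \<odot>\<^bsub>L\<^esub> l)) \<ominus>\<^bsub>L\<^esub> c \<odot>\<^bsub>L\<^esub> (a \<odot>\<^bsub>L\<^esub> l)"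
          using arg_cong[OF cy(3), of "\<lambda>z. z \<ominus>\<^bsub>L\<^esub> c \<odot>\<^bsub>L\<^esub> (a \<odot>\<^bsub>L\<^esub> l)"] .
        also have "\<dots> = y"
          using yc al(1) cy(1) by (simp add: a_minus_def L.M.a_assoc L.M.r_neg L.smult_closed)
        finally have "\<one>\<^bsub>A\<^esub> \<ominus>\<^bsub>A\<^esub> c \<otimes>\<^bsub>A\<^esub> a \<in> ?I" using y caA by simp
        then have "\<one>\<^bsub>A\<^esub> \<ominus>\<^bsub>A\<^esub> c \<otimes>\<^bsub>A\<^esub> a \<in> V" using V by blast
        from VD(4)[OF this ca] have "\<one>\<^bsub>A\<^esub> \<in> V"
          using caA by (simp add: a_minus_def L.R.a_assoc L.R.l_neg)
        then have "r \<in> V" if "r \<in> carrier A" for r using VD(5)[of r "\<one>\<^bsub>A\<^esub>"] that by simp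
        then show ?thesis using VD(1) by auto
      qed
      then show "V = ?I \<or> V = carrier (regular_module A)" by blast
    qed
    then have "j \<in> ?I" using j unfolding jacobson_radical_eq by blast
    then show ?thesis by simp
  }
qed

text \<open>An intersection of left ideals is only a left ideal. Closure under right multiplication
  is \<open>radical_annihilates\<close> for the regular module: j x lies in every maximal left
  ideal.\<close>

lemma radical_ideal: assumes "ring A" shows "ideal (jacobson_radical A) A"
proof (rule idealI[OF assms])
  interpret ring A by fact
  interpret R: left_module A "regular_module A" by (rule regular_left_module[OF assms])
  have s: "submodule (jacobson_radical A) A (regular_module A)"
    unfolding R.submodule_iff jacobson_radical_eq
    by (auto simp: maximal_submodule_def R.submodule_iff)
  note D = R.submoduleD[OF s, simplified]
  show "subgroup (jacobson_radical A) (add_monoid A)"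
  proof (rule subgroup.intro)
    show "inv\<^bsub>add_monoid A\<^esub> x \<in> jacobson_radical A" if "x \<in> jacobson_radical A" for x
      using D(5)[of "\<ominus>\<^bsub>A\<^esub> \<one>\<^bsub>A\<^esub>" x] that D(3) by (simp add: l_minus a_inv_def[symmetric])
  qed (use D in auto)
  show "x \<otimes>\<^bsub>A\<^esub> a \<in> jacobson_radical A" if "a \<in> jacobson_radical A" "x \<in> carrier A" for a x
    using D(5) that by simp
  show "a \<otimes>\<^bsub>A\<^esub> x \<in> jacobson_radical A" if "a \<in> jacobson_radical A" "x \<in> carrier A" for a x
    using radical_annihilates[OF R.left_module_axioms _ _ that(1), of _ x] that D(3)
    by (auto simp: jacobson_radical_eq)
qed

section \<open>Right multiplication by the radical and Nakayama's lemma\<close>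

context fd_algebra
begin

definition "J = jacobson_radical A"

text \<open>\<open>RL X L\<close> is \<open>X L\<close>, a left submodule of \<open>X\<close> which need not be a subbimodule.\<close>

definition "RL X L = mod_span A (lmod X) {tens \<one>\<^bsub>A\<^esub> l \<odot>\<^bsub>X\<^esub> x | l x. l \<in> L \<and> x \<in> carrier X}"

lemma J_ideal: "ideal J A" unfolding J_def by (rule radical_ideal[OF A_ring])

lemma J_closed: "j \<in> J \<Longrightarrow> j \<in> carrier A"
  by (simp add: J_def jacobson_radical_def)

lemma right_left_comm:
  assumes "left_module Env X" "a \<in> carrier A" "b \<in> carrier A" "x \<in> carrier X"
  shows "tens a \<one>\<^bsub>A\<^esub> \<odot>\<^bsub>X\<^esub> (tens \<one>\<^bsub>A\<^esub> b \<odot>\<^bsub>X\<^esub> x) = tens \<one>\<^bsub>A\<^esub> b \<odot>\<^bsub>X\<^esub> (tens a \<one>\<^bsub>A\<^esub> \<odot>\<^bsub>X\<^esub> x)"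
  using trans[OF tens_split(1)[OF assms, symmetric] tens_split(2)[OF assms]] .

lemma right_right:
  assumes X: "left_module Env X" and "a \<in> carrier A" "b \<in> carrier A" "x \<in> carrier X"
  shows "tens \<one>\<^bsub>A\<^esub> b \<odot>\<^bsub>X\<^esub> (tens \<one>\<^bsub>A\<^esub> a \<odot>\<^bsub>X\<^esub> x) = tens \<one>\<^bsub>A\<^esub> (a \<otimes>\<^bsub>A\<^esub> b) \<odot>\<^bsub>X\<^esub> x"
proof -
  interpret X: left_module Env X by (rule X)
  show ?thesis using assms(2-) by (simp add: X.smult_assoc1[symmetric] tens_closed tens_mult)
qed

lemma right_closed:
  "left_module Env X \<Longrightarrow> b \<in> carrier A \<Longrightarrow> x \<in> carrier X \<Longrightarrow> tens \<one>\<^bsub>A\<^esub> b \<odot>\<^bsub>X\<^esub> x \<in> carrier X"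
  by (rule left_module.smult_closed) (auto intro!: tens_closed)

lemma left_closed:
  "left_module Env X \<Longrightarrow> a \<in> carrier A \<Longrightarrow> x \<in> carrier X \<Longrightarrow> tens a \<one>\<^bsub>A\<^esub> \<odot>\<^bsub>X\<^esub> x \<in> carrier X"
  by (rule left_module.smult_closed) (auto intro!: tens_closed)

lemma RL_submodule_left:
  assumes "left_module Env X" "L \<subseteq> carrier A" shows "submodule (RL X L) A (lmod X)"
  unfolding RL_def using assms right_closed[OF assms(1)]
  by (intro left_module.span_submodule[OF lmod_left_module]) auto

lemma RL_gen: "left_module Env X \<Longrightarrow> l \<in> L \<Longrightarrow> x \<in> carrier X \<Longrightarrow> tens \<one>\<^bsub>A\<^esub> l \<odot>\<^bsub>X\<^esub> x \<in> RL X L"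
  unfolding RL_def by (rule subsetD[OF left_module.span_superset[OF lmod_left_module]]) auto

lemma RL_least:
  assumes "left_module Env X" "submodule W A (lmod X)"
    "\<And>l x. l \<in> L \<Longrightarrow> x \<in> carrier X \<Longrightarrow> tens \<one>\<^bsub>A\<^esub> l \<odot>\<^bsub>X\<^esub> x \<in> W"
  shows "RL X L \<subseteq> W"
  unfolding RL_def using assms(3) by (intro left_module.span_least[OF lmod_left_module[OF assms(1)] assms(2)]) auto

text \<open>Right multiplication by a fixed element commutes with the left action, so preimages of
  left submodules under it are left submodules.\<close>

lemma right_preimage_submodule:
  assumes X: "left_module Env X" and W: "submodule W A (lmod X)" and L: "L \<subseteq> carrier A"
  shows "submodule {x \<in> carrier X. \<forall>l\<in>L. tens \<one>\<^bsub>A\<^esub> l \<odot>\<^bsub>X\<^esub> x \<in> W} A (lmod X)"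
proof -
  interpret X: left_module Env X by (rule X)
  interpret lX: left_module A "lmod X" by (rule lmod_left_module[OF X])
  note D = lX.submoduleD[OF W, simplified]
  have t: "tens \<one>\<^bsub>A\<^esub> l \<in> carrier Env" if "l \<in> L" for l using that L by (auto intro!: tens_closed)
  show ?thesis unfolding lX.submodule_iff
  proof (intro conjI ballI)
    fix a x assume a: "a \<in> carrier A" and x: "x \<in> {x \<in> carrier X. \<forall>l\<in>L. tens \<one>\<^bsub>A\<^esub> l \<odot>\<^bsub>X\<^esub> x \<in> W}"
    then have xc: "x \<in> carrier X" by simp
    have "tens \<one>\<^bsub>A\<^esub> l \<odot>\<^bsub>X\<^esub> (tens a \<one>\<^bsub>A\<^esub> \<odot>\<^bsub>X\<^esub> x) \<in> W" if l: "l \<in> L" for l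
    proof -
      have "l \<in> carrier A" using l L by blast
      then show ?thesis
        unfolding right_left_comm[OF X a \<open>l \<in> carrier A\<close> xc, symmetric] using x l D(5)[OF a] by simp
    qed
    then show "a \<odot>\<^bsub>lmod X\<^esub> x \<in> {x \<in> carrier X. \<forall>l\<in>L. tens \<one>\<^bsub>A\<^esub> l \<odot>\<^bsub>X\<^esub> x \<in> W}"
      using left_closed[OF X a xc] by simp
  qed (use D(2,4) t in \<open>auto simp: X.smult_r_null X.smult_r_distr\<close>)
qed

text \<open>Since \<open>J\<close> is a two-sided ideal, x j b is again a product with an element of
  \<open>J\<close>, which makes X J stable on the right.\<close>

lemma RL_J_submodule:
  assumes X: "left_module Env X" shows "submodule (RL X J) Env X"
proof -
  have JA: "J \<subseteq> carrier A" using J_closed by blast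
  have s: "submodule (RL X J) A (lmod X)" by (rule RL_submodule_left[OF X JA])
  interpret lX: left_module A "lmod X" by (rule lmod_left_module[OF X])
  note D = lX.submoduleD[OF s, simplified]
  have "RL X J \<subseteq> {x \<in> carrier X. \<forall>b\<in>carrier A. tens \<one>\<^bsub>A\<^esub> b \<odot>\<^bsub>X\<^esub> x \<in> RL X J}"
  proof (rule RL_least[OF X right_preimage_submodule[OF X s order_refl]])
    fix l x assume l: "l \<in> J" and x: "x \<in> carrier X"
    have lA: "l \<in> carrier A" by (rule J_closed[OF l])
    have "tens \<one>\<^bsub>A\<^esub> b \<odot>\<^bsub>X\<^esub> (tens \<one>\<^bsub>A\<^esub> l \<odot>\<^bsub>X\<^esub> x) \<in> RL X J" if b: "b \<in> carrier A" for b
      unfolding right_right[OF X lA b x] using ideal.I_r_closed[OF J_ideal l b] by (rule RL_gen[OF X _ x])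
    then show "tens \<one>\<^bsub>A\<^esub> l \<odot>\<^bsub>X\<^esub> x \<in> {x \<in> carrier X. \<forall>b\<in>carrier A. tens \<one>\<^bsub>A\<^esub> b \<odot>\<^bsub>X\<^esub> x \<in> RL X J}"
      using right_closed[OF X lA x] by simp
  qed
  then show ?thesis using D by (intro Env_submoduleI[OF X]) auto
qed

lemma regular_finite_length: "finite_length A (regular_module A)"
proof (rule finite_length[OF regular_left_module[OF A_ring]])
  interpret R: left_module A "regular_module A" by (rule regular_left_module[OF A_ring])
  have "x \<in> mod_span A (regular_module A) {\<one>\<^bsub>A\<^esub>}" if "x \<in> carrier A" for x
    using R.submoduleD(5)[OF R.span_submodule[of "{\<one>\<^bsub>A\<^esub>}"], of x "\<one>\<^bsub>A\<^esub>"] R.span_superset[of "{\<one>\<^bsub>A\<^esub>}"] that by simp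
  then show "fin_gen A (regular_module A)"
    unfolding fin_gen_def using R.span_carrier[of "{\<one>\<^bsub>A\<^esub>}"] by (intro exI[of _ "{\<one>\<^bsub>A\<^esub>}"]) auto
qed

text \<open>
  Nakayama's lemma on the right for the radical defined on the left: a left ideal \<open>L\<close> minimal with
  \<open>X L = X\<close> must vanish, because \<open>J L\<close> lies in any maximal submodule of \<open>L\<close>.
\<close>

lemma right_nakayama:
  assumes X: "left_module Env X" and XJ: "RL X J = carrier X"
  shows "carrier X = {\<zero>\<^bsub>X\<^esub>}"
proof -
  interpret X: left_module Env X by (rule X)
  interpret lX: left_module A "lmod X" by (rule lmod_left_module[OF X])
  interpret R: left_module A "regular_module A" by (rule regular_left_module[OF A_ring])
  have "x \<in> RL X (carrier A)" if "x \<in> carrier X" for x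
    using RL_gen[OF X A.A.one_closed that] X.smult_one[OF that] by (simp add: tens_one[symmetric])
  moreover have "RL X (carrier A) \<subseteq> carrier X"
    using lX.submoduleD(1)[OF RL_submodule_left[OF X order_refl]] by simp
  ultimately have "RL X (carrier (regular_module A)) = carrier X" by auto
  then obtain L where L: "submodule L A (regular_module A)" "RL X L = carrier X"
    "\<And>V. submodule V A (regular_module A) \<Longrightarrow> RL X V = carrier X \<Longrightarrow> V \<subseteq> L \<Longrightarrow> V = L"
    using finite_length_minimal[OF regular_finite_length R.carrier_submodule, of "\<lambda>L. RL X L = carrier X"]
    by blast
  note LD = R.submoduleD[OF L(1), simplified]
  have "L = {\<zero>\<^bsub>A\<^esub>}"
  proof (rule ccontr)
    assume nz: "L \<noteq> {\<zero>\<^bsub>A\<^esub>}"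
    have "{\<zero>\<^bsub>A\<^esub>} \<subset> L" using nz LD(2) by blast
    then obtain N where N: "submodule N A (regular_module A)" "N \<subset> L"
      "\<And>V. submodule V A (regular_module A) \<Longrightarrow> V \<subset> L \<Longrightarrow> N \<subseteq> V \<Longrightarrow> V = N"
      using finite_length_maximal[OF regular_finite_length R.zero_submodule, of "\<lambda>V. V \<subset> L"] by auto
    let ?L = "regular_module A\<lparr>carrier := L\<rparr>"
    have Lm: "left_module A ?L" by (rule R.submodule_left_module[OF L(1)])
    have Nmax: "maximal_submodule A ?L N"
      unfolding maximal_submodule_def submodule_of_submodule[OF R.left_module_axioms L(1)]
      using N by auto
    have NA: "N \<subseteq> carrier A" using R.submoduleD(1)[OF N(1)] by simp
    note s = RL_submodule_left[OF X NA]
    \<comment> \<open>As J L is contained in \<open>N\<close>, multiplying X J by \<open>L\<close>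
      lands in X N. The hypothesis X J = X turns this into X L inside X N, so \<open>N\<close>
      contradicts the minimality of \<open>L\<close>.\<close>
    have "RL X J \<subseteq> {x \<in> carrier X. \<forall>l\<in>L. tens \<one>\<^bsub>A\<^esub> l \<odot>\<^bsub>X\<^esub> x \<in> RL X N}"
    proof (rule RL_least[OF X right_preimage_submodule[OF X s LD(1)]])
      fix j x assume j: "j \<in> J" and x: "x \<in> carrier X"
      have jA: "j \<in> carrier A" by (rule J_closed[OF j])
      have "tens \<one>\<^bsub>A\<^esub> l \<odot>\<^bsub>X\<^esub> (tens \<one>\<^bsub>A\<^esub> j \<odot>\<^bsub>X\<^esub> x) \<in> RL X N" if l: "l \<in> L" for l
      proof -
        have "j \<otimes>\<^bsub>A\<^esub> l \<in> N" using radical_annihilates[OF Lm Nmax, of l j] l j by (simp add: J_def)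
        then show ?thesis unfolding right_right[OF X jA LD(3)[OF l] x] by (rule RL_gen[OF X _ x])
      qed
      then show "tens \<one>\<^bsub>A\<^esub> j \<odot>\<^bsub>X\<^esub> x \<in> {x \<in> carrier X. \<forall>l\<in>L. tens \<one>\<^bsub>A\<^esub> l \<odot>\<^bsub>X\<^esub> x \<in> RL X N}"
        using right_closed[OF X jA x] by simp
    qed
    then have all: "tens \<one>\<^bsub>A\<^esub> l \<odot>\<^bsub>X\<^esub> x \<in> RL X N" if "l \<in> L" "x \<in> carrier X" for l x
      using XJ that by auto
    have "RL X L \<subseteq> RL X N" by (rule RL_least[OF X s all])
    then have "RL X N = carrier X" using L(2) lX.submoduleD(1)[OF s] by auto
    then show False using L(3)[OF N(1)] N(2) by blast
  qed
  have "RL X L \<subseteq> {\<zero>\<^bsub>lmod X\<^esub>}"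
  proof (rule RL_least[OF X lX.zero_submodule])
    fix l x assume "l \<in> L" "x \<in> carrier X"
    then show "tens \<one>\<^bsub>A\<^esub> l \<odot>\<^bsub>X\<^esub> x \<in> {\<zero>\<^bsub>lmod X\<^esub>}"
      using \<open>L = {\<zero>\<^bsub>A\<^esub>}\<close> left_module.smult_l_null[OF rmod_left_module[OF X], of x] by simp
  qed
  then show ?thesis using L(2) by auto
qed

end

section \<open>Bimodules with projective top\<close>

context fd_algebra
begin

abbreviation "Eq \<equiv> quot_mod A J"
abbreviation "Top X \<equiv> quot_mod X (RL X J)"

lemma Eq_quotient: "quotient_module K A J"
  by (intro quotient_moduleI A_left_module ideal_submodule[OF alg J_ideal])

lemma Eq_fd_algebra: "fd_algebra K Eq"
proof -
  interpret Q: quotient_module K A J by (rule Eq_quotient)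
  have "fin_gen K Eq"
    by (rule fin_gen_image[OF A_left_module Q.quot_left_module Q.cls_hom _ fg]) (simp add: Q.quot_carrier)
  then show ?thesis by (intro fd_algebra.intro K quotient_algebra[OF alg J_ideal])
qed

lemma top_quotient: "left_module Env X \<Longrightarrow> quotient_module Env X (RL X J)"
  by (intro quotient_moduleI RL_J_submodule)

definition "J_annihilates Y \<longleftrightarrow> (\<forall>j\<in>J. \<forall>y\<in>carrier Y. tens \<one>\<^bsub>A\<^esub> j \<odot>\<^bsub>Y\<^esub> y = \<zero>\<^bsub>Y\<^esub>)"

lemma J_annihilatesD: "J_annihilates Y \<Longrightarrow> j \<in> J \<Longrightarrow> y \<in> carrier Y \<Longrightarrow> tens \<one>\<^bsub>A\<^esub> j \<odot>\<^bsub>Y\<^esub> y = \<zero>\<^bsub>Y\<^esub>"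
  by (simp add: J_annihilates_def)

lemma top_annihilated:
  assumes X: "left_module Env X" shows "J_annihilates (Top X)"
  unfolding J_annihilates_def
proof (intro ballI)
  fix j y assume j: "j \<in> J" and y: "y \<in> carrier (Top X)"
  interpret Q: quotient_module Env X "RL X J" by (rule top_quotient[OF X])
  obtain x where x: "x \<in> carrier X" "y = Q.cls x" using y by (auto simp: Q.quot_carrier)
  have "tens \<one>\<^bsub>A\<^esub> j \<odot>\<^bsub>X\<^esub> x \<in> RL X J" by (rule RL_gen[OF X j x(1)])
  then show "tens \<one>\<^bsub>A\<^esub> j \<odot>\<^bsub>Top X\<^esub> y = \<zero>\<^bsub>Top X\<^esub>"
    using x J_closed[OF j] right_closed[OF X J_closed[OF j] x(1)]
    by (simp add: Q.quot_smult tens_closed Q.quot_zero Q.cls_eq_zero_iff)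
qed

text \<open>The right action of A / J on a bimodule annihilated by \<open>J\<close>, through chosen
  representatives. \<open>RE_smult\<close> shows independence of the choice.\<close>

definition "Erep c = (SOME a. a \<in> carrier A \<and> c = J +>\<^bsub>A\<^esub> a)"
definition "RE Y = with_smult Y (\<lambda>c y. tens \<one>\<^bsub>A\<^esub> (Erep c) \<odot>\<^bsub>Y\<^esub> y)"

lemma RE_simps [simp]: "carrier (RE Y) = carrier Y" "add (RE Y) = add Y" "zero (RE Y) = zero Y"
  "smult (RE Y) = (\<lambda>c y. tens \<one>\<^bsub>A\<^esub> (Erep c) \<odot>\<^bsub>Y\<^esub> y)"
  by (simp_all add: RE_def)

lemma Erep:
  assumes "c \<in> carrier Eq" shows "Erep c \<in> carrier A" "J +>\<^bsub>A\<^esub> Erep c = c"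
proof -
  interpret Q: quotient_module K A J by (rule Eq_quotient)
  obtain a where "a \<in> carrier A" "c = J +>\<^bsub>A\<^esub> a" using assms by (rule Q.quot_carrierE)
  then have "a \<in> carrier A \<and> c = J +>\<^bsub>A\<^esub> a" by simp
  then have "Erep c \<in> carrier A \<and> c = J +>\<^bsub>A\<^esub> Erep c"
    unfolding Erep_def by (rule someI[of "\<lambda>a. a \<in> carrier A \<and> c = J +>\<^bsub>A\<^esub> a"])
  then show "Erep c \<in> carrier A" "J +>\<^bsub>A\<^esub> Erep c = c" by auto
qed

lemma RE_smult:
  assumes Y: "left_module Env Y" and ann: "J_annihilates Y"
    and a: "a \<in> carrier A" and y: "y \<in> carrier Y"
  shows "(J +>\<^bsub>A\<^esub> a) \<odot>\<^bsub>RE Y\<^esub> y = tens \<one>\<^bsub>A\<^esub> a \<odot>\<^bsub>Y\<^esub> y"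
proof -
  interpret Q: quotient_module K A J by (rule Eq_quotient)
  interpret Y: left_module "opp A" "rmod Y" by (rule rmod_left_module[OF Y])
  have c: "J +>\<^bsub>A\<^esub> a \<in> carrier Eq" using a by (simp add: Q.quot_carrier)
  let ?r = "Erep (J +>\<^bsub>A\<^esub> a)"
  have r: "?r \<in> carrier A" "Q.cls ?r = Q.cls a" using Erep[OF c] by auto
  have rc: "?r \<ominus>\<^bsub>A\<^esub> a \<in> J" using r a Q.cls_eq_iff by simp
  have "?r = (?r \<ominus>\<^bsub>A\<^esub> a) \<oplus>\<^bsub>A\<^esub> a" using r(1) a by (simp add: a_minus_def A.M.a_assoc A.M.l_neg)
  then have "tens \<one>\<^bsub>A\<^esub> ?r \<odot>\<^bsub>Y\<^esub> y = tens \<one>\<^bsub>A\<^esub> ((?r \<ominus>\<^bsub>A\<^esub> a) \<oplus>\<^bsub>A\<^esub> a) \<odot>\<^bsub>Y\<^esub> y" by simp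
  also have "\<dots> = tens \<one>\<^bsub>A\<^esub> (?r \<ominus>\<^bsub>A\<^esub> a) \<odot>\<^bsub>Y\<^esub> y \<oplus>\<^bsub>Y\<^esub> tens \<one>\<^bsub>A\<^esub> a \<odot>\<^bsub>Y\<^esub> y"
    using Y.smult_l_distr[of "?r \<ominus>\<^bsub>A\<^esub> a" a y] r(1) a y by simp
  also have "\<dots> = tens \<one>\<^bsub>A\<^esub> a \<odot>\<^bsub>Y\<^esub> y"
    using J_annihilatesD[OF ann rc y] Y.M.l_zero[of "tens \<one>\<^bsub>A\<^esub> a \<odot>\<^bsub>Y\<^esub> y"] right_closed[OF Y a y] by simp
  finally show ?thesis by simp
qed

lemma RE_left_module:
  assumes Y: "left_module Env Y" and ann: "J_annihilates Y"
  shows "left_module (opp Eq) (RE Y)"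
proof -
  interpret Q: quotient_module K A J by (rule Eq_quotient)
  interpret Eq: fd_algebra K Eq by (rule Eq_fd_algebra)
  interpret Y: left_module "opp A" "rmod Y" by (rule rmod_left_module[OF Y])
  note sm = RE_smult[OF Y ann]
  note yc = right_closed[OF Y]
  have one: "\<one>\<^bsub>Eq\<^esub> = Q.cls \<one>\<^bsub>A\<^esub>" by (simp add: quot_mod_simps)
  show ?thesis
  proof (rule left_moduleI[OF opp_ring[OF Eq.A_ring]], unfold opp_simps)
    show "abelian_group (RE Y)" by (rule abelian_group_cong[OF Y.M.abelian_group_axioms]) auto
    fix c d x y assume c: "c \<in> carrier Eq" and x: "x \<in> carrier (RE Y)"
    obtain a where a: "a \<in> carrier A" "c = Q.cls a" using c by (rule Q.quot_carrierE)
    have xY: "x \<in> carrier Y" using x by simp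
    show "c \<odot>\<^bsub>RE Y\<^esub> x \<in> carrier (RE Y)" unfolding a(2) sm[OF a(1) xY] using yc[OF a(1) xY] by simp
    {
      assume d: "d \<in> carrier Eq"
      obtain b where b: "b \<in> carrier A" "d = Q.cls b" using d by (rule Q.quot_carrierE)
      show "(c \<oplus>\<^bsub>Eq\<^esub> d) \<odot>\<^bsub>RE Y\<^esub> x = c \<odot>\<^bsub>RE Y\<^esub> x \<oplus>\<^bsub>RE Y\<^esub> d \<odot>\<^bsub>RE Y\<^esub> x"
        unfolding a(2) b(2) Q.quot_add[OF a(1) b(1)] sm[OF a(1) xY] sm[OF b(1) xY] sm[OF A.M.a_closed[OF a(1) b(1)] xY]
        using Y.smult_l_distr[of a b x] a b xY by simp
      show "(d \<otimes>\<^bsub>Eq\<^esub> c) \<odot>\<^bsub>RE Y\<^esub> x = c \<odot>\<^bsub>RE Y\<^esub> (d \<odot>\<^bsub>RE Y\<^esub> x)"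
        unfolding a(2) b(2) quotient_algebra_mult[OF J_ideal b(1) a(1)] sm[OF b(1) xY]
          sm[OF a(1) yc[OF b(1) xY]] sm[OF A.A.m_closed[OF b(1) a(1)] xY]
        using right_right[OF Y b(1) a(1) xY] by simp
    next
      assume y: "y \<in> carrier (RE Y)"
      then have yY: "y \<in> carrier Y" by simp
      have xyY: "x \<oplus>\<^bsub>Y\<^esub> y \<in> carrier Y" using Y.M.a_closed[of x y] xY yY by simp
      show "c \<odot>\<^bsub>RE Y\<^esub> (x \<oplus>\<^bsub>RE Y\<^esub> y) = c \<odot>\<^bsub>RE Y\<^esub> x \<oplus>\<^bsub>RE Y\<^esub> c \<odot>\<^bsub>RE Y\<^esub> y"
        unfolding a(2) RE_simps(2) sm[OF a(1) xY] sm[OF a(1) yY] sm[OF a(1) xyY]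
        using Y.smult_r_distr[of a x y] a xY yY by simp
    }
  next
    fix x assume "x \<in> carrier (RE Y)"
    then have xY: "x \<in> carrier Y" by simp
    show "\<one>\<^bsub>Eq\<^esub> \<odot>\<^bsub>RE Y\<^esub> x = x"
      unfolding one sm[OF A.A.one_closed xY] using Y.smult_one[of x] xY by simp
  qed
qed

text \<open>The commuting ring is \<open>A\<close> on the left, so the Hom bimodule consists of left
  linear maps. They are compatible with the scalars of the right structure because \<open>K\<close>
  acts identically from both sides on a bimodule, by \<open>tens_scalar\<close>.\<close>

lemma RE_hom_action:
  assumes Y: "left_module Env Y" and annY: "J_annihilates Y"
    and Z: "left_module Env Z" and annZ: "J_annihilates Z"
  shows "hom_action K (opp Eq) A (RE Y) (RE Z) (lmod Y) (lmod Z)"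
proof (intro hom_action.intro hom_action_axioms.intro)
  interpret Q: quotient_module K A J by (rule Eq_quotient)
  interpret Eq: fd_algebra K Eq by (rule Eq_fd_algebra)
  show "assoc_algebra K (opp Eq)" by (rule opp_algebra[OF Eq.alg])
  show "left_module (opp Eq) (RE Y)" "left_module (opp Eq) (RE Z)"
    by (rule RE_left_module[OF Y annY], rule RE_left_module[OF Z annZ])
  show "module_pair A (lmod Y) (lmod Z)" by (intro module_pairI lmod_left_module Y Z)
  show "s \<odot>\<^bsub>RE Y\<^esub> (r \<odot>\<^bsub>lmod Y\<^esub> v) = r \<odot>\<^bsub>lmod Y\<^esub> (s \<odot>\<^bsub>RE Y\<^esub> v)"
    if "s \<in> carrier (opp Eq)" "r \<in> carrier A" "v \<in> carrier (RE Y)" for s r v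
    using that Erep(1)[of s] right_left_comm[OF Y, of r "Erep s" v] by simp
  show "s \<odot>\<^bsub>RE Z\<^esub> (r \<odot>\<^bsub>lmod Z\<^esub> v) = r \<odot>\<^bsub>lmod Z\<^esub> (s \<odot>\<^bsub>RE Z\<^esub> v)"
    if "s \<in> carrier (opp Eq)" "r \<in> carrier A" "v \<in> carrier (RE Z)" for s r v
    using that Erep(1)[of s] right_left_comm[OF Z, of r "Erep s" v] by simp
  show "f ((c \<odot>\<^bsub>opp Eq\<^esub> \<one>\<^bsub>opp Eq\<^esub>) \<odot>\<^bsub>RE Y\<^esub> v) = (c \<odot>\<^bsub>opp Eq\<^esub> \<one>\<^bsub>opp Eq\<^esub>) \<odot>\<^bsub>RE Z\<^esub> f v"
    if f: "f \<in> mod_hom A (lmod Y) (lmod Z)" and c: "c \<in> carrier K" and "v \<in> carrier (RE Y)" for f c v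
  proof -
    have v: "v \<in> carrier Y" using that by simp
    have fv: "f v \<in> carrier Z" using mod_homD(1)[OF f] v by simp
    have c1: "c \<odot>\<^bsub>A\<^esub> \<one>\<^bsub>A\<^esub> \<in> carrier A" using c by simp
    have eq: "c \<odot>\<^bsub>opp Eq\<^esub> \<one>\<^bsub>opp Eq\<^esub> = Q.cls (c \<odot>\<^bsub>A\<^esub> \<one>\<^bsub>A\<^esub>)"
      using Q.quot_smult[OF c A.A.one_closed] by (simp add: quot_mod_simps)
    have "f (tens (c \<odot>\<^bsub>A\<^esub> \<one>\<^bsub>A\<^esub>) \<one>\<^bsub>A\<^esub> \<odot>\<^bsub>Y\<^esub> v) = tens (c \<odot>\<^bsub>A\<^esub> \<one>\<^bsub>A\<^esub>) \<one>\<^bsub>A\<^esub> \<odot>\<^bsub>Z\<^esub> f v"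
      using mod_homD(3)[OF f c1] v by simp
    then have "f (tens \<one>\<^bsub>A\<^esub> (c \<odot>\<^bsub>A\<^esub> \<one>\<^bsub>A\<^esub>) \<odot>\<^bsub>Y\<^esub> v) = tens \<one>\<^bsub>A\<^esub> (c \<odot>\<^bsub>A\<^esub> \<one>\<^bsub>A\<^esub>) \<odot>\<^bsub>Z\<^esub> f v"
      using tens_scalar[OF c] by simp
    then show ?thesis unfolding eq RE_smult[OF Y annY c1 v] RE_smult[OF Z annZ c1 fv] .
  qed
qed simp_all

lemma RE_hom:
  assumes p: "p \<in> mod_hom Env Y Z" shows "p \<in> mod_hom (opp Eq) (RE Y) (RE Z)"
  using mod_homD[OF p] Erep(1) tens_closed by (intro mod_homI) auto

text \<open>
  Separability of \<open>A / J\<close> turns a left-linear splitting of a map of tops into a bilinear one: the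
  regular bimodule of \<open>A / J\<close> is projective, so its natural map into the left-linear endomorphisms of
  \<open>Y\<close> lifts to the left-linear maps \<open>Y \<rightarrow> Z\<close>.
\<close>

lemma separable_split:
  assumes sep: "separable K Eq"
    and Y: "left_module Env Y" and annY: "J_annihilates Y"
    and Z: "left_module Env Z" and annZ: "J_annihilates Z"
    and p: "p \<in> mod_hom Env Z Y" "p ` carrier Z = carrier Y" and pr: "projective A (lmod Y)"
  shows "\<exists>s\<in>mod_hom Env Y Z. \<forall>y\<in>carrier Y. p (s y) = y"
proof -
  interpret Q: quotient_module K A J by (rule Eq_quotient)
  interpret Eq: fd_algebra K Eq by (rule Eq_fd_algebra)
  interpret HB: hom_action K "opp Eq" A "RE Y" "RE Z" "lmod Y" "lmod Z"
    by (rule RE_hom_action[OF Y annY Z annZ])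
  interpret HC: hom_action K "opp Eq" A "RE Y" "RE Y" "lmod Y" "lmod Y"
    by (rule RE_hom_action[OF Y annY Y annY])
  have ps: "p ` carrier (lmod Z) = carrier (lmod Y)" using p(2) by simp
  note post = hom_action_post[OF HB.hom_action_axioms HC.hom_action_axioms RE_hom[OF p(1)] lmod_hom[OF p(1)] ps pr]
  have RegP: "projective Eq.Env Eq.Reg" using sep by (simp add: separable_def)
  \<comment> \<open>Right multiplication by \<open>c\<close>, a left linear endomorphism of
    \<open>Y\<close>; its value at one is the identity to be lifted through
    \<open>p\<close>.\<close>
  define \<phi> where "\<phi> c = (\<lambda>y\<in>carrier (RE Y). c \<odot>\<^bsub>RE Y\<^esub> y)" for c
  have Yc: "c \<odot>\<^bsub>RE Y\<^esub> y \<in> carrier (RE Y)" if "c \<in> carrier Eq" "y \<in> carrier (RE Y)" for c y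
    using HB.V.smult_closed[of c y] that by (simp only: opp_simps)
  have \<phi>c: "\<phi> c \<in> carrier HC.HM" if c: "c \<in> carrier Eq.Reg" for c
  proof -
    have c': "c \<in> carrier Eq" using c by simp
    have "(\<lambda>y. c \<odot>\<^bsub>RE Y\<^esub> y) \<in> mod_hom A (lmod Y) (lmod Y)"
    proof (rule mod_homI)
      show "c \<odot>\<^bsub>RE Y\<^esub> y \<in> carrier (lmod Y)" if "y \<in> carrier (lmod Y)" for y
        using Yc[OF c'] that by (simp only: RE_simps lmod_simps)
      show "c \<odot>\<^bsub>RE Y\<^esub> (x \<oplus>\<^bsub>lmod Y\<^esub> y) = c \<odot>\<^bsub>RE Y\<^esub> x \<oplus>\<^bsub>lmod Y\<^esub> c \<odot>\<^bsub>RE Y\<^esub> y"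
        if "x \<in> carrier (lmod Y)" "y \<in> carrier (lmod Y)" for x y
        using HB.V.smult_r_distr[of c x y] that c' by (simp only: RE_simps(1,2) lmod_simps(1,2) opp_simps(1))
      show "c \<odot>\<^bsub>RE Y\<^esub> (r \<odot>\<^bsub>lmod Y\<^esub> y) = r \<odot>\<^bsub>lmod Y\<^esub> (c \<odot>\<^bsub>RE Y\<^esub> y)"
        if "r \<in> carrier A" "y \<in> carrier (lmod Y)" for r y
        using HB.V_comm[of c r y] that c' by (simp only: RE_simps(1) lmod_simps(1) opp_simps(1))
    qed
    from restrict_mod_hom[OF lmod_left_module[OF Y] this]
    show ?thesis unfolding \<phi>_def HC.HM_simps(1) by (simp only: RE_simps(1) lmod_simps(1))
  qed
  have "\<exists>\<psi>. (\<forall>q\<in>carrier Eq.Reg. \<psi> q \<in> carrier HB.HM) \<and>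
    (\<forall>q\<in>carrier Eq.Reg. \<forall>q'\<in>carrier Eq.Reg. \<psi> (q \<oplus>\<^bsub>Eq.Reg\<^esub> q') = \<psi> q \<oplus>\<^bsub>HB.HM\<^esub> \<psi> q') \<and>
    (\<forall>a\<in>carrier Eq. \<forall>b\<in>carrier Eq. \<forall>q\<in>carrier Eq.Reg. \<psi> (Eq.tens a b \<odot>\<^bsub>Eq.Reg\<^esub> q) = hom_act (RE Y) (RE Z) b a (\<psi> q)) \<and>
    (\<forall>q\<in>carrier Eq.Reg. (\<lambda>v\<in>carrier (RE Y). p (\<psi> q v)) = \<phi> q)"
  proof (rule Eq.env_hom_lifting[OF HB.env_action_right[OF Eq_fd_algebra refl]
        HC.env_action_right[OF Eq_fd_algebra refl] RegP post(1,2) _ post(4) \<phi>c])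
    show "(\<lambda>v\<in>carrier (RE Y). p (hom_act (RE Y) (RE Z) b a f v)) = hom_act (RE Y) (RE Y) b a (\<lambda>v\<in>carrier (RE Y). p (f v))"
      if "a \<in> carrier Eq" "b \<in> carrier Eq" "f \<in> carrier HB.HM" for a b f
      using post(3)[of b a f] that by (simp only: opp_simps(1))
    show "\<phi> (q \<oplus>\<^bsub>Eq.Reg\<^esub> q') = \<phi> q \<oplus>\<^bsub>HC.HM\<^esub> \<phi> q'" if "q \<in> carrier Eq.Reg" "q' \<in> carrier Eq.Reg" for q q'
    proof -
      have q: "q \<in> carrier (opp Eq)" "q' \<in> carrier (opp Eq)" using that by simp_all
      show ?thesis unfolding \<phi>_def HC.HM_simps(3)
      proof (rule restrict_ext)
        fix y assume y: "y \<in> carrier (RE Y)"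
        show "(q \<oplus>\<^bsub>Eq.Reg\<^esub> q') \<odot>\<^bsub>RE Y\<^esub> y = (\<lambda>y\<in>carrier (RE Y). q \<odot>\<^bsub>RE Y\<^esub> y) y \<oplus>\<^bsub>RE Y\<^esub> (\<lambda>y\<in>carrier (RE Y). q' \<odot>\<^bsub>RE Y\<^esub> y) y"
          using HB.V.smult_l_distr[OF q y] y by (simp only: Eq.Reg_simps opp_simps restrict_apply if_True)
      qed
    qed
    show "\<phi> (Eq.tens a b \<odot>\<^bsub>Eq.Reg\<^esub> q) = hom_act (RE Y) (RE Y) b a (\<phi> q)"
      if "a \<in> carrier Eq" "b \<in> carrier Eq" "q \<in> carrier Eq.Reg" for a b q
    proof -
      have q: "q \<in> carrier Eq" using that by simp
      show ?thesis unfolding \<phi>_def hom_act_def Eq.Reg_smult[OF that(1,2) q]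
      proof (rule restrict_ext)
        fix y assume y: "y \<in> carrier (RE Y)"
        have "(a \<otimes>\<^bsub>Eq\<^esub> q \<otimes>\<^bsub>Eq\<^esub> b) \<odot>\<^bsub>RE Y\<^esub> y = b \<odot>\<^bsub>RE Y\<^esub> (q \<odot>\<^bsub>RE Y\<^esub> (a \<odot>\<^bsub>RE Y\<^esub> y))"
          using HB.V.smult_assoc1[of b "q \<otimes>\<^bsub>opp Eq\<^esub> a" y] HB.V.smult_assoc1[of q a y] that(1,2) q y
          by (simp only: opp_simps Eq.A.A.m_closed)
        then show "(a \<otimes>\<^bsub>Eq\<^esub> q \<otimes>\<^bsub>Eq\<^esub> b) \<odot>\<^bsub>RE Y\<^esub> y = b \<odot>\<^bsub>RE Y\<^esub> (\<lambda>y\<in>carrier (RE Y). q \<odot>\<^bsub>RE Y\<^esub> y) (a \<odot>\<^bsub>RE Y\<^esub> y)"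
          using Yc[OF that(1) y] by (simp only: restrict_apply if_True)
      qed
    qed
  qed
  then obtain \<psi> where "\<forall>q\<in>carrier Eq.Reg. \<psi> q \<in> carrier HB.HM"
    "\<forall>q\<in>carrier Eq.Reg. \<forall>q'\<in>carrier Eq.Reg. \<psi> (q \<oplus>\<^bsub>Eq.Reg\<^esub> q') = \<psi> q \<oplus>\<^bsub>HB.HM\<^esub> \<psi> q'"
    "\<forall>a\<in>carrier Eq. \<forall>b\<in>carrier Eq. \<forall>q\<in>carrier Eq.Reg. \<psi> (Eq.tens a b \<odot>\<^bsub>Eq.Reg\<^esub> q) = hom_act (RE Y) (RE Z) b a (\<psi> q)"
    "\<forall>q\<in>carrier Eq.Reg. (\<lambda>v\<in>carrier (RE Y). p (\<psi> q v)) = \<phi> q"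
    by (elim exE conjE)
  note \<psi> = this[rule_format]
  define s where "s = \<psi> \<one>\<^bsub>Eq\<^esub>"
  have one: "\<one>\<^bsub>Eq\<^esub> \<in> carrier Eq.Reg" by simp
  have sHM: "s \<in> carrier HB.HM" unfolding s_def by (rule \<psi>(1)[OF one])
  note sD = HB.HM_D[OF sHM]
  have s_right: "s (c \<odot>\<^bsub>RE Y\<^esub> y) = c \<odot>\<^bsub>RE Z\<^esub> s y" if c: "c \<in> carrier Eq" and y: "y \<in> carrier (RE Y)" for c y
  proof -
    \<comment> \<open>In the regular bimodule left and right multiplication by \<open>c\<close>
      agree on one. Under \<open>\<psi>\<close> this says that s (y c) equals (s y) c, so the left
      linear map \<open>s\<close> is linear on the right as well.\<close>
    have "Eq.tens c \<one>\<^bsub>Eq\<^esub> \<odot>\<^bsub>Eq.Reg\<^esub> \<one>\<^bsub>Eq\<^esub> = c" "Eq.tens \<one>\<^bsub>Eq\<^esub> c \<odot>\<^bsub>Eq.Reg\<^esub> \<one>\<^bsub>Eq\<^esub> = c"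
      using c by (simp_all add: Eq.Reg_smult)
    then have "hom_act (RE Y) (RE Z) \<one>\<^bsub>Eq\<^esub> c s = hom_act (RE Y) (RE Z) c \<one>\<^bsub>Eq\<^esub> s"
      using \<psi>(3)[OF c Eq.A.A.one_closed one] \<psi>(3)[OF Eq.A.A.one_closed c one] unfolding s_def by simp
    from fun_cong[OF this, of y] y
    have eq: "\<one>\<^bsub>Eq\<^esub> \<odot>\<^bsub>RE Z\<^esub> s (c \<odot>\<^bsub>RE Y\<^esub> y) = c \<odot>\<^bsub>RE Z\<^esub> s (\<one>\<^bsub>Eq\<^esub> \<odot>\<^bsub>RE Y\<^esub> y)"
      by (simp only: hom_act_def restrict_apply if_True)
    have "\<one>\<^bsub>Eq\<^esub> \<odot>\<^bsub>RE Z\<^esub> s (c \<odot>\<^bsub>RE Y\<^esub> y) = s (c \<odot>\<^bsub>RE Y\<^esub> y)"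
      using HB.B.smult_one[OF sD(1)[OF Yc[OF c y]]] by (simp only: opp_simps)
    moreover have "\<one>\<^bsub>Eq\<^esub> \<odot>\<^bsub>RE Y\<^esub> y = y" using HB.V.smult_one[OF y] by (simp only: opp_simps)
    ultimately show ?thesis using eq by (simp only:)
  qed
  have "s \<in> mod_hom Env Y Z"
  proof (rule Env_homI[OF Y Z])
    show "s y \<in> carrier Z" if "y \<in> carrier Y" for y using sD(1) that by simp
    show "s (x \<oplus>\<^bsub>Y\<^esub> y) = s x \<oplus>\<^bsub>Z\<^esub> s y" if "x \<in> carrier Y" "y \<in> carrier Y" for x y using sD(2) that by simp
    show "s (tens a b \<odot>\<^bsub>Y\<^esub> y) = tens a b \<odot>\<^bsub>Z\<^esub> s y" if "a \<in> carrier A" "b \<in> carrier A" "y \<in> carrier Y" for a b y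
    proof -
      have sy: "s y \<in> carrier Z" using sD(1) that(3) by simp
      have yb: "tens \<one>\<^bsub>A\<^esub> b \<odot>\<^bsub>Y\<^esub> y \<in> carrier Y" by (rule right_closed[OF Y that(2,3)])
      have cb: "Q.cls b \<in> carrier Eq" using that(2) by (simp add: Q.quot_carrier)
      have "s (tens \<one>\<^bsub>A\<^esub> b \<odot>\<^bsub>Y\<^esub> y) = tens \<one>\<^bsub>A\<^esub> b \<odot>\<^bsub>Z\<^esub> s y"
        using s_right[OF cb, of y] that(3) unfolding RE_smult[OF Y annY that(2,3)] RE_smult[OF Z annZ that(2) sy] by simp
      moreover have "s (tens a \<one>\<^bsub>A\<^esub> \<odot>\<^bsub>Y\<^esub> (tens \<one>\<^bsub>A\<^esub> b \<odot>\<^bsub>Y\<^esub> y)) = tens a \<one>\<^bsub>A\<^esub> \<odot>\<^bsub>Z\<^esub> s (tens \<one>\<^bsub>A\<^esub> b \<odot>\<^bsub>Y\<^esub> y)"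
        using mod_homD(3)[OF sD(3) that(1), of "tens \<one>\<^bsub>A\<^esub> b \<odot>\<^bsub>Y\<^esub> y"] yb by simp
      ultimately show ?thesis
        unfolding tens_split(1)[OF Y that] tens_split(1)[OF Z that(1,2) sy] by simp
    qed
  qed
  moreover have "p (s y) = y" if "y \<in> carrier Y" for y
  proof -
    have y: "y \<in> carrier (RE Y)" using that by simp
    from fun_cong[OF \<psi>(4)[OF one], of y] have "p (s y) = \<one>\<^bsub>Eq\<^esub> \<odot>\<^bsub>RE Y\<^esub> y"
      using y by (simp only: s_def \<phi>_def restrict_apply if_True)
    also have "\<dots> = y" using HB.V.smult_one[OF y] by (simp only: opp_simps)
    finally show ?thesis .
  qed
  ultimately show ?thesis by blast
qed

lemma RL_map:
  assumes X: "left_module Env X" and Y: "left_module Env Y" and f: "f \<in> mod_hom Env X Y"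
    and L: "L \<subseteq> carrier A"
  shows "x \<in> RL X L \<Longrightarrow> f x \<in> RL Y L"
proof -
  interpret lXY: module_pair A "lmod X" "lmod Y" by (intro module_pairI lmod_left_module X Y)
  have "RL X L \<subseteq> {x \<in> carrier (lmod X). f x \<in> RL Y L}"
  proof (rule RL_least[OF X lXY.vimage_submodule[OF lmod_hom[OF f] RL_submodule_left[OF Y L]]])
    fix l x assume l: "l \<in> L" and x: "x \<in> carrier X"
    then have lA: "l \<in> carrier A" using L by blast
    have "f (tens \<one>\<^bsub>A\<^esub> l \<odot>\<^bsub>X\<^esub> x) = tens \<one>\<^bsub>A\<^esub> l \<odot>\<^bsub>Y\<^esub> f x" using mod_homD(3)[OF f] lA x tens_closed by simp
    then show "tens \<one>\<^bsub>A\<^esub> l \<odot>\<^bsub>X\<^esub> x \<in> {x \<in> carrier (lmod X). f x \<in> RL Y L}"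
      using right_closed[OF X lA x] RL_gen[OF Y l mod_homD(1)[OF f x]] by simp
  qed
  then show "x \<in> RL X L \<Longrightarrow> f x \<in> RL Y L" by auto
qed

lemma RL_map_surj:
  assumes X: "left_module Env X" and Y: "left_module Env Y" and f: "f \<in> mod_hom Env X Y"
    and surj: "f ` carrier X = carrier Y" and L: "L \<subseteq> carrier A"
  shows "RL Y L \<subseteq> f ` RL X L"
proof -
  interpret lXY: module_pair A "lmod X" "lmod Y" by (intro module_pairI lmod_left_module X Y)
  show ?thesis
  proof (rule RL_least[OF Y lXY.image_submodule[OF lmod_hom[OF f] RL_submodule_left[OF X L]]])
    fix l y assume l: "l \<in> L" and "y \<in> carrier Y"
    then obtain x where x: "x \<in> carrier X" "f x = y" using surj by (metis imageE)
    have lA: "l \<in> carrier A" using L l by blast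
    have "f (tens \<one>\<^bsub>A\<^esub> l \<odot>\<^bsub>X\<^esub> x) = tens \<one>\<^bsub>A\<^esub> l \<odot>\<^bsub>Y\<^esub> y" using mod_homD(3)[OF f] lA x tens_closed by simp
    then show "tens \<one>\<^bsub>A\<^esub> l \<odot>\<^bsub>Y\<^esub> y \<in> f ` RL X L" using RL_gen[OF X l x(1)] by (metis imageI)
  qed
qed

theorem bimodule_projective:
  assumes sep: "separable K Eq" and X: "left_module Env X" "fin_gen Env X"
    and right: "projective (opp A) (rmod X)" and top: "projective A (lmod (Top X))"
  shows "projective Env X"
proof -
  interpret Ev: fd_algebra K Env by (rule Env_fd_algebra)
  have JA: "J \<subseteq> carrier A" using J_closed by blast
  let ?P = "Ev.cover X" and ?p = "Ev.cover_map X"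
  have c: "is_proj_cover Env X ?P ?p" by (rule Ev.proj_cover[OF X])
  note C = proj_coverD[OF c]
  interpret PX: module_pair Env ?P X by (intro module_pairI C X)
  interpret QX: quotient_module Env X "RL X J" by (rule top_quotient[OF X(1)])
  interpret QP: quotient_module Env ?P "RL ?P J" by (rule top_quotient[OF C(2)])
  obtain p' where p': "p' \<in> mod_hom Env (Top ?P) (Top X)" "\<And>x. x \<in> carrier ?P \<Longrightarrow> p' (QP.cls x) = QX.cls (?p x)"
    using quot_map[OF C(2) X(1) QP.U QX.U C(3) RL_map[OF C(2) X(1) C(3) JA]] by blast
  have p's: "p' ` carrier (Top ?P) = carrier (Top X)"
    using p'(2) C(4) by (auto simp: QP.quot_carrier QX.quot_carrier image_image) (metis imageI image_image)
  obtain s where s: "s \<in> mod_hom Env (Top X) (Top ?P)" "\<And>y. y \<in> carrier (Top X) \<Longrightarrow> p' (s y) = y"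
    using separable_split[OF sep QX.quot_left_module top_annihilated[OF X(1)] QP.quot_left_module
        top_annihilated[OF C(2)] p'(1) p's top] by blast
  interpret SX: module_pair Env "Top X" "Top ?P" by (intro module_pairI QX.quot_left_module QP.quot_left_module)
  interpret PT: module_pair Env ?P "Top ?P" by (intro module_pairI QP.quot_left_module C(2))
  \<comment> \<open>The preimage in the cover of the image of the splitting. Once it is seen to be
    everything, the splitting is onto and the map of tops is injective.\<close>
  let ?U = "{x \<in> carrier ?P. QP.cls x \<in> s ` carrier (Top X)}"
  have "?U = carrier ?P"
  proof (rule proj_cover_kernel_superfluous[OF c X(1) PT.vimage_submodule[OF QP.cls_hom SX.image_submodule[OF s(1) SX.M.carrier_submodule]]])
    fix x assume x: "x \<in> carrier ?P"
    have px: "?p x \<in> carrier X" by (rule mod_homD(1)[OF C(3) x])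
    have z: "QX.cls (?p x) \<in> carrier (Top X)" using px by (simp add: QX.quot_carrier)
    obtain y where y: "y \<in> carrier ?P" "s (QX.cls (?p x)) = QP.cls y"
      using mod_homD(1)[OF s(1) z] by (rule QP.quot_carrierE)
    have py: "?p y \<in> carrier X" by (rule mod_homD(1)[OF C(3) y(1)])
    have "QX.cls (?p y) = QX.cls (?p x)" using p'(2)[OF y(1)] y(2) s(2)[OF z] by simp
    \<comment> \<open>The difference of the images lies in X J, which is the image of the
      corresponding submodule of the cover. So \<open>y\<close> can be corrected by some
      \<open>w\<close> there: the class in the top, hence membership in \<open>?U\<close>, is
      unchanged, and the image in \<open>X\<close> becomes that of \<open>x\<close>.\<close>
    then have "?p x \<ominus>\<^bsub>X\<^esub> ?p y \<in> RL X J" using QX.cls_eq_iff[OF px py] by simp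
    then have "?p x \<ominus>\<^bsub>X\<^esub> ?p y \<in> ?p ` RL ?P J" by (rule subsetD[OF RL_map_surj[OF C(2) X(1) C(3,4) JA]])
    then obtain w where "?p x \<ominus>\<^bsub>X\<^esub> ?p y = ?p w" and w1: "w \<in> RL ?P J" by (rule imageE)
    note w = w1 this(1)[symmetric]
    have wP: "w \<in> carrier ?P" by (rule PX.M.submoduleD(3)[OF QP.U w(1)])
    have "QP.cls (w \<oplus>\<^bsub>?P\<^esub> y) = s (QX.cls (?p x))"
      unfolding y(2) by (rule cls_add_left[OF QP.quotient_module_axioms w(1) y(1)])
    then have "QP.cls (w \<oplus>\<^bsub>?P\<^esub> y) \<in> s ` carrier (Top X)" using z by (rule image_eqI)
    moreover have "w \<oplus>\<^bsub>?P\<^esub> y \<in> carrier ?P" by (rule PX.M.M.a_closed[OF wP y(1)])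
    ultimately have "w \<oplus>\<^bsub>?P\<^esub> y \<in> ?U" by (intro CollectI conjI)
    moreover have "?p (w \<oplus>\<^bsub>?P\<^esub> y) = ?p x"
      using px py by (simp add: mod_homD(2)[OF C(3) wP y(1)] w(2) a_minus_def PX.N.M.a_assoc PX.N.M.l_neg)
    ultimately show "\<exists>u\<in>?U. ?p u = ?p x" by blast
  qed
  then have cls_s: "QP.cls x \<in> s ` carrier (Top X)" if "x \<in> carrier ?P" for x using that by blast
  let ?C = "?P\<lparr>carrier := a_kernel ?P X ?p\<rparr>"
  \<comment> \<open>Every class in the top of the cover is in the image of the splitting, so a class
    that \<open>p'\<close> sends to zero is zero.\<close>
  have ker: "x \<in> RL ?P J" if x: "x \<in> carrier ?P" and px: "?p x = \<zero>\<^bsub>X\<^esub>" for x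
  proof -
    obtain z where z: "z \<in> carrier (Top X)" "QP.cls x = s z" using cls_s[OF x] by blast
    have "z = p' (QP.cls x)" using s(2)[OF z(1)] z(2) by simp
    also have "\<dots> = \<zero>\<^bsub>Top X\<^esub>" using p'(2)[OF x] px by (simp add: QX.cls_zero QX.quot_zero)
    finally have "QP.cls x = \<zero>\<^bsub>Top ?P\<^esub>" using z(2) SX.hom_zero[OF s(1)] by simp
    then show ?thesis using QP.cls_eq_zero_iff[OF x] by (simp add: QP.quot_zero)
  qed
  have ex: "short_exact Env ?C ?P X (\<lambda>x. x) ?p" by (rule short_exact_kernel[OF C(2) X(1) C(3,4)])
  have Cm: "left_module Env ?C" by (rule short_exactD(1)[OF ex])
  obtain \<rho> where \<rho>: "\<rho> \<in> mod_hom (opp A) (rmod ?P) (rmod ?C)" "\<And>x. x \<in> carrier ?C \<Longrightarrow> \<rho> x = x"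
    using rmod_split[OF ex C(1) right] by blast
  interpret lP: left_module A "lmod ?P" by (rule lmod_left_module[OF C(2)])
  interpret lC: left_module A "lmod ?C" by (rule lmod_left_module[OF Cm])
  interpret rho: module_pair "opp A" "rmod ?P" "rmod ?C" by (intro module_pairI rmod_left_module C Cm)
  note sC = RL_submodule_left[OF Cm JA]
  note DC = lC.submoduleD[OF sC, simplified]
  note \<rho>D = mod_homD[OF \<rho>(1), simplified]
  \<comment> \<open>The right-linear retraction \<open>\<rho>\<close> turns \<open>ker p \<subseteq> P J\<close> into \<open>ker p = (ker p) J\<close>.\<close>
  let ?W = "{x \<in> carrier ?P. \<forall>a\<in>carrier A. \<rho> (tens a \<one>\<^bsub>A\<^esub> \<odot>\<^bsub>?P\<^esub> x) \<in> RL ?C J}"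
  \<comment> \<open>Membership in \<open>?W\<close> is tested after all left multiplications because
    \<open>\<rho>\<close> is only right linear; without this the set would not be a left submodule
    in general.\<close>
  have W: "submodule ?W A (lmod ?P)" unfolding lP.submodule_iff
  proof (intro conjI ballI)
    show "\<zero>\<^bsub>lmod ?P\<^esub> \<in> ?W"
      using lP.smult_r_null rho.hom_zero[OF \<rho>(1)] DC(2) PX.M.M.zero_closed by simp
    fix x y assume x: "x \<in> ?W" and y: "y \<in> ?W"
    then have xy: "x \<in> carrier ?P" "y \<in> carrier ?P" by auto
    have "\<rho> (tens a \<one>\<^bsub>A\<^esub> \<odot>\<^bsub>?P\<^esub> (x \<oplus>\<^bsub>?P\<^esub> y)) \<in> RL ?C J" if a: "a \<in> carrier A" for a
    proof -
      have "\<rho> (tens a \<one>\<^bsub>A\<^esub> \<odot>\<^bsub>?P\<^esub> (x \<oplus>\<^bsub>?P\<^esub> y)) = \<rho> (tens a \<one>\<^bsub>A\<^esub> \<odot>\<^bsub>?P\<^esub> x) \<oplus>\<^bsub>?P\<^esub> \<rho> (tens a \<one>\<^bsub>A\<^esub> \<odot>\<^bsub>?P\<^esub> y)"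
        using lP.smult_r_distr[OF a, of x y] xy \<rho>D(2) left_closed[OF C(2) a] by simp
      then show ?thesis using x y a DC(4) by simp
    qed
    then show "x \<oplus>\<^bsub>lmod ?P\<^esub> y \<in> ?W" using xy by simp
  next
    fix b x assume b: "b \<in> carrier A" and x: "x \<in> ?W"
    then have xc: "x \<in> carrier ?P" by simp
    have "\<rho> (tens a \<one>\<^bsub>A\<^esub> \<odot>\<^bsub>?P\<^esub> (tens b \<one>\<^bsub>A\<^esub> \<odot>\<^bsub>?P\<^esub> x)) \<in> RL ?C J" if a: "a \<in> carrier A" for a
    proof -
      have "\<rho> (tens (a \<otimes>\<^bsub>A\<^esub> b) \<one>\<^bsub>A\<^esub> \<odot>\<^bsub>?P\<^esub> x) \<in> RL ?C J" using x A.A.m_closed[OF a b] by blast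
      then show ?thesis using lP.smult_assoc1[OF a b, of x] xc by simp
    qed
    then show "b \<odot>\<^bsub>lmod ?P\<^esub> x \<in> ?W" using left_closed[OF C(2) b xc] by simp
  qed auto
  have "RL ?P J \<subseteq> ?W"
  proof (rule RL_least[OF C(2) W])
    fix j x assume j: "j \<in> J" and x: "x \<in> carrier ?P"
    have jA: "j \<in> carrier A" by (rule J_closed[OF j])
    have "\<rho> (tens a \<one>\<^bsub>A\<^esub> \<odot>\<^bsub>?P\<^esub> (tens \<one>\<^bsub>A\<^esub> j \<odot>\<^bsub>?P\<^esub> x)) \<in> RL ?C J" if a: "a \<in> carrier A" for a
    proof -
      have ax: "tens a \<one>\<^bsub>A\<^esub> \<odot>\<^bsub>?P\<^esub> x \<in> carrier ?P" by (rule left_closed[OF C(2) a x])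
      have "\<rho> (tens a \<one>\<^bsub>A\<^esub> \<odot>\<^bsub>?P\<^esub> (tens \<one>\<^bsub>A\<^esub> j \<odot>\<^bsub>?P\<^esub> x)) = tens \<one>\<^bsub>A\<^esub> j \<odot>\<^bsub>?C\<^esub> \<rho> (tens a \<one>\<^bsub>A\<^esub> \<odot>\<^bsub>?P\<^esub> x)"
        unfolding right_left_comm[OF C(2) a jA x] using \<rho>D(3)[OF jA ax] by simp
      moreover have "tens \<one>\<^bsub>A\<^esub> j \<odot>\<^bsub>?C\<^esub> \<rho> (tens a \<one>\<^bsub>A\<^esub> \<odot>\<^bsub>?P\<^esub> x) \<in> RL ?C J"
        by (rule RL_gen[OF Cm j]) (use \<rho>D(1)[OF ax] in simp)
      ultimately show ?thesis by simp
    qed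
    then show "tens \<one>\<^bsub>A\<^esub> j \<odot>\<^bsub>?P\<^esub> x \<in> ?W" using right_closed[OF C(2) jA x] by simp
  qed
  have CJ: "x \<in> RL ?C J" if x: "x \<in> carrier ?C" for x
  proof -
    have xP: "x \<in> carrier ?P" "?p x = \<zero>\<^bsub>X\<^esub>" using x by (auto simp: a_kernel_def')
    have "x \<in> ?W" using ker[OF xP] \<open>RL ?P J \<subseteq> ?W\<close> by blast
    then have "\<forall>a\<in>carrier A. \<rho> (tens a \<one>\<^bsub>A\<^esub> \<odot>\<^bsub>?P\<^esub> x) \<in> RL ?C J" by simp
    from bspec[OF this A.A.one_closed] have "\<rho> x \<in> RL ?C J"
      using PX.M.smult_one[OF xP(1)] by (simp add: tens_one[symmetric])
    then show ?thesis using \<rho>(2)[OF x] by simp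
  qed
  have "RL ?C J = carrier ?C" using CJ DC(1) by auto
  from right_nakayama[OF Cm this] have C0: "a_kernel ?P X ?p = {\<zero>\<^bsub>?P\<^esub>}" by simp
  have "inj_on ?p (carrier ?P)"
    by (rule PX.inj_if_kernel_trivial[OF C(3)]) (use C0 in \<open>auto simp: a_kernel_def'\<close>)
  then have bij: "bij_betw ?p (carrier ?P) (carrier X)" using C(4) by (simp add: bij_betw_def)
  show ?thesis
    by (rule projective_retract[OF X(1) C(1) PX.inverse_hom[OF C(3) bij] C(3)])
      (use bij in \<open>auto simp: bij_betw_def f_inv_into_f\<close>)
qed

end

section \<open>Syzygies of the regular bimodule\<close>

text \<open>Transport of structure along an injective map of carrier types.\<close>

lemma transport_module:
  fixes M :: "('r, 'm) module" and e :: "'m \<Rightarrow> 'n"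
  assumes M: "left_module R M" and inj: "inj_on e (carrier M)"
  shows "\<exists>M' :: ('r, 'n) module. left_module R M' \<and> e \<in> mod_hom R M M' \<and> e ` carrier M = carrier M'"
proof -
  interpret M: left_module R M by (rule M)
  define d where "d = inv_into (carrier M) e"
  have d: "d (e x) = x" if "x \<in> carrier M" for x using inj that by (simp add: d_def)
  define M' :: "('r, 'n) module" where "M' = \<lparr>carrier = e ` carrier M, mult = undefined, one = undefined, zero = e \<zero>\<^bsub>M\<^esub>,
    add = (\<lambda>x y. e (d x \<oplus>\<^bsub>M\<^esub> d y)), smult = (\<lambda>r x. e (r \<odot>\<^bsub>M\<^esub> d x))\<rparr>"
  have ag: "abelian_group M'"
  proof (rule abelian_groupI)
    fix x assume "x \<in> carrier M'"
    then obtain a where a: "a \<in> carrier M" "x = e a" by (auto simp: M'_def)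
    show "\<exists>y\<in>carrier M'. y \<oplus>\<^bsub>M'\<^esub> x = \<zero>\<^bsub>M'\<^esub>"
      using a by (intro bexI[of _ "e (\<ominus>\<^bsub>M\<^esub> a)"]) (auto simp: M'_def d M.M.l_neg)
  qed (auto simp: M'_def d M.M.a_assoc M.M.a_comm M.M.a_lcomm)
  have "left_module R M'"
    by (rule left_moduleI[OF M.R.ring_axioms ag])
      (auto simp: M'_def d M.smult_closed M.smult_l_distr M.smult_r_distr M.smult_assoc1 M.smult_one)
  moreover have "e \<in> mod_hom R M M'" by (rule mod_homI) (auto simp: M'_def d)
  ultimately show ?thesis by (intro exI[of _ M']) (simp add: M'_def)
qed

text \<open>\<open>gl_dim\<close> ranges over modules on one carrier type, while quotients live on a
  type of sets. The injection into the required type picks a preimage under a surjection from a free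
  module of finite rank.\<close>

lemma fin_gen_copy:
  fixes M :: "('r, 'm) module"
  assumes M: "left_module R M" and fg: "fin_gen R M"
  shows "\<exists>(M' :: ('r, nat \<Rightarrow> 'r) module) f g. left_module R M' \<and> fin_gen R M' \<and> f \<in> mod_hom R M M' \<and>
    g \<in> mod_hom R M' M \<and> (\<forall>x\<in>carrier M. g (f x) = x) \<and> (\<forall>y\<in>carrier M'. f (g y) = y)"
proof -
  obtain n \<pi> where \<pi>: "\<pi> \<in> mod_hom R (free_module R {..<n::nat}) M"
    "\<pi> ` carrier (free_module R {..<n}) = carrier M"
    by (rule fin_gen_free_cover[OF M fg])
  define e where "e = inv_into (carrier (free_module R {..<n})) \<pi>"
  have "inj_on e (carrier M)" unfolding e_def \<pi>(2)[symmetric] by (rule inj_on_inv_into) simp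
  from transport_module[OF M this] obtain M' where M': "left_module R M'" "e \<in> mod_hom R M M'"
    "e ` carrier M = carrier M'" by (elim exE conjE)
  interpret module_pair R M M' by (intro module_pairI M M'(1))
  have bij: "bij_betw e (carrier M) (carrier M')" using \<open>inj_on e (carrier M)\<close> M'(3) by (simp add: bij_betw_def)
  show ?thesis
    using M' fin_gen_image[OF M M'(1,2,3) fg] inverse_hom[OF M'(2) bij] bij
    by (intro exI[of _ M'] exI[of _ e] exI[of _ "inv_into (carrier M) e"]) (auto simp: bij_betw_def f_inv_into_f)
qed

context fd_algebra
begin

abbreviation "ecover X \<equiv> fst (proj_cover Env X)"
abbreviation "ecover_map X \<equiv> snd (proj_cover Env X)"

text \<open>The bimodule syzygy of order i + 1 of the regular bimodule. The shift by one is forced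
  by the types: the regular bimodule lives on \<open>'a\<close>, all its syzygies on another
  type.\<close>

definition "Z i = (syzygy Env ^^ i) (syzygy Env Reg)"

lemma Z_module: "left_module Env (Z i)" "fin_gen Env (Z i)"
proof -
  interpret Ev: fd_algebra K Env by (rule Env_fd_algebra)
  note S = Ev.syzygy_module[OF Reg_left_module Reg_fin_gen]
  show "left_module Env (Z i)" "fin_gen Env (Z i)"
    unfolding Z_def by (rule Ev.syzygy_funpow_module[OF S])+
qed

lemma ecover_projective: "left_module Env X \<Longrightarrow> fin_gen Env X \<Longrightarrow> projective Env (ecover X)"
  by (rule proj_coverD(1)[OF fd_algebra.proj_cover[OF Env_fd_algebra]])

lemma Z_exact:
  "short_exact Env (Z 0) (ecover Reg) Reg (\<lambda>x. x) (ecover_map Reg)"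
  "short_exact Env (Z (Suc i)) (ecover (Z i)) (Z i) (\<lambda>x. x) (ecover_map (Z i))"
proof -
  show "short_exact Env (Z 0) (ecover Reg) Reg (\<lambda>x. x) (ecover_map Reg)"
    using fd_algebra.syzygy_short_exact[OF Env_fd_algebra Reg_left_module Reg_fin_gen] by (simp add: Z_def)
  show "short_exact Env (Z (Suc i)) (ecover (Z i)) (Z i) (\<lambda>x. x) (ecover_map (Z i))"
    using fd_algebra.syzygy_short_exact[OF Env_fd_algebra Z_module[of i]] by (simp add: Z_def)
qed

text \<open>The regular bimodule is free on the right, and right projectivity passes from each term
  to the kernel of its cover by \<open>rmod_split\<close>.\<close>

lemma Z_right_projective: "projective (opp A) (rmod (Z i))"
proof (induction i)
  case 0
  show ?case
    by (rule rmod_split[OF Z_exact(1) ecover_projective[OF Reg_left_module Reg_fin_gen] rmod_Reg_projective])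
next
  case (Suc i)
  show ?case by (rule rmod_split[OF Z_exact(2) ecover_projective[OF Z_module] Suc.IH])
qed

end

context tensor_functor
begin

lemma TT_Z_exact:
  "\<exists>i' p'. short_exact A (TT (Z 0)) (TT (ecover Reg)) (TT Reg) i' p'"
  "\<exists>i' p'. short_exact A (TT (Z (Suc i))) (TT (ecover (Z i))) (TT (Z i)) i' p'"
proof -
  obtain \<rho> where "\<rho> \<in> mod_hom (opp A) (rmod (ecover Reg)) (rmod (Z 0))" "\<And>x. x \<in> carrier (Z 0) \<Longrightarrow> \<rho> x = x"
    by (rule rmod_split[OF Z_exact(1) ecover_projective[OF Reg_left_module Reg_fin_gen] rmod_Reg_projective])
      (rule that; assumption)
  then show "\<exists>i' p'. short_exact A (TT (Z 0)) (TT (ecover Reg)) (TT Reg) i' p'"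
    by (rule TT_exact[OF Z_exact(1)])
  obtain \<rho> where "\<rho> \<in> mod_hom (opp A) (rmod (ecover (Z i))) (rmod (Z (Suc i)))"
    "\<And>x. x \<in> carrier (Z (Suc i)) \<Longrightarrow> \<rho> x = x"
    by (rule rmod_split[OF Z_exact(2) ecover_projective[OF Z_module] Z_right_projective])
      (rule that; assumption)
  then show "\<exists>i' p'. short_exact A (TT (Z (Suc i))) (TT (ecover (Z i))) (TT (Z i)) i' p'"
    by (rule TT_exact[OF Z_exact(2)])
qed

lemma TT_ecover_projective:
  "projective A (TT (ecover Reg))" "projective A (TT (ecover (Z i)))"
  by (intro TT_projective ecover_projective Reg_left_module Reg_fin_gen Z_module)+

text \<open>Tensored with a module, the minimal bimodule resolution is still exact with projective
  terms; comparing it with the minimal resolution of \<open>M\<close> lets projectivity pass from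
  \<open>TT (Z i)\<close> to the syzygy of \<open>M\<close>.\<close>

lemma syzygy_retract_TT:
  fixes M :: "('a, nat \<Rightarrow> 'a) module"
  assumes M: "left_module A M" "fin_gen A M"
    and f: "f \<in> mod_hom A M (TT Reg)" and g: "g \<in> mod_hom A (TT Reg) M" and gf: "\<And>x. x \<in> carrier M \<Longrightarrow> g (f x) = x"
  shows "\<exists>W :: ('a, nat \<Rightarrow> 'a) module. stable_retract A ((syzygy A ^^ Suc i) M) (TT (Z i)) W"
proof -
  have cov: "projective A (cover M)" by (rule proj_coverD(1)[OF proj_cover[OF M]])
  have st0: "stable_retract A M (TT Reg) (cover M)"
    by (rule stable_retract_iso[OF M(1) TT_left_module[OF Reg_left_module] cov f g]) (rule gf)
  obtain i' p' where "short_exact A (TT (Z 0)) (TT (ecover Reg)) (TT Reg) i' p'"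
    using TT_Z_exact(1) by (elim exE)
  note st = stable_retract_kernel[OF syzygy_short_exact[OF M] this cov TT_ecover_projective(1) st0]
  obtain u v where uv: "\<And>i. short_exact A (TT (Z (Suc i))) (TT (ecover (Z i))) (TT (Z i)) (u i) (v i)"
    using TT_Z_exact(2) by metis
  show ?thesis unfolding funpow_Suc_right o_apply
    by (rule nth_syzygy_stable_retract(1)[where N = "\<lambda>i. TT (Z i)" and Q = "\<lambda>i. TT (ecover (Z i))"
          and u = u and v = v, OF syzygy_module[OF M] uv TT_ecover_projective(2) st])
qed

text \<open>The opposite comparison, through which projectivity passes from the syzygy of
  \<open>M\<close> to \<open>TT (Z i)\<close>. The complement is the tensored bimodule cover, which
  determines the type of \<open>W\<close>.\<close>

lemma TT_retract_syzygy:
  fixes M :: "('a, nat \<Rightarrow> 'a) module"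
  assumes M: "left_module A M" "fin_gen A M"
    and f: "f \<in> mod_hom A (TT Reg) M" and g: "g \<in> mod_hom A M (TT Reg)"
    and gf: "\<And>x. x \<in> carrier (TT Reg) \<Longrightarrow> g (f x) = x"
  shows "\<exists>W :: ('a, ('i \<Rightarrow> nat \<Rightarrow> ('a \<times> 'a \<Rightarrow> 'k) set) set) module. stable_retract A (TT (Z i)) ((syzygy A ^^ Suc i) M) W"
proof (induction i)
  case 0
  have st0: "stable_retract A (TT Reg) M (TT (ecover Reg))"
    by (rule stable_retract_iso[OF TT_left_module[OF Reg_left_module] M(1) TT_ecover_projective(1) f g]) (rule gf)
  obtain i' p' where "short_exact A (TT (Z 0)) (TT (ecover Reg)) (TT Reg) i' p'"
    using TT_Z_exact(1) by (elim exE)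
  from stable_retract_kernel[OF this syzygy_short_exact[OF M] TT_ecover_projective(1) proj_coverD(1)[OF proj_cover[OF M]] st0]
  show ?case unfolding funpow.simps o_apply id_apply by (rule exI)
next
  case (Suc i)
  note S = syzygy_funpow_module[OF M, of "Suc i"]
  obtain i' p' where "short_exact A (TT (Z (Suc i))) (TT (ecover (Z i))) (TT (Z i)) i' p'"
    using TT_Z_exact(2)[of i] by (elim exE)
  note st = stable_retract_kernel[OF this syzygy_short_exact[OF S] TT_ecover_projective(2) proj_coverD(1)[OF proj_cover[OF S]]]
  from Suc.IH obtain W :: "('a, ('i \<Rightarrow> nat \<Rightarrow> ('a \<times> 'a \<Rightarrow> 'k) set) set) module"
    where "stable_retract A (TT (Z i)) ((syzygy A ^^ Suc i) M) W" by (rule exE)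
  from st[OF this] show ?case unfolding funpow.simps(2)[of "Suc i"] o_apply by (rule exI)
qed

end

section \<open>Global dimension and the projectivity of bimodule syzygies\<close>

context fd_algebra
begin

text \<open>
  Tensoring the minimal resolution of the regular bimodule with a module resolves the module, so a
  projective syzygy of \<open>A\<close> bounds all projective dimensions.
\<close>

lemma gl_dim_le_if_projective:
  "projective Env Reg \<Longrightarrow> gl_dim A \<le> enat 0"
  "projective Env (Z i) \<Longrightarrow> gl_dim A \<le> enat (Suc i)"
proof -
  have *: "(projective Env Reg \<longrightarrow> projective A M) \<and> (projective Env (Z i) \<longrightarrow> projective A ((syzygy A ^^ Suc i) M))"
    if M: "left_module A M" "fin_gen A M" for M :: "('a, nat \<Rightarrow> 'a) module"
  proof -
    obtain n H where H: "H \<in> mod_hom A (free_module A {..<n::nat}) M"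
      "H ` carrier (free_module A {..<n}) = carrier M"
      by (rule fin_gen_free_cover[OF M])
    interpret F: module_pair A "free_module A {..<n}" M by (intro module_pairI A.free_left_module M)
    \<comment> \<open>\<open>M\<close> is presented as a free module of finite rank modulo the
      kernel of \<open>H\<close>; the tensor functor then computes the product with
      \<open>M\<close>.\<close>
    interpret tensor_functor K A "{..<n}" "a_kernel (free_module A {..<n}) M H"
      by (intro tensor_functor.intro fd_algebra_axioms tensor_functor_axioms.intro F.kernel_submodule H(1)) simp
    from TT_Reg_iso[OF M(1) H refl] obtain f g where fg: "f \<in> mod_hom A (TT Reg) M" "g \<in> mod_hom A M (TT Reg)"
      "\<forall>y\<in>carrier M. f (g y) = y" by (elim exE conjE)
    have "projective A M" if "projective Env Reg"
      by (rule projective_retract[OF M(1) TT_projective[OF that] fg(2,1) fg(3)[rule_format]])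
    moreover have "projective A ((syzygy A ^^ Suc i) M)" if "projective Env (Z i)"
    proof -
      from syzygy_retract_TT[OF M fg(2,1) fg(3)[rule_format]]
      obtain W :: "('a, nat \<Rightarrow> 'a) module" where "stable_retract A ((syzygy A ^^ Suc i) M) (TT (Z i)) W" by (rule exE)
      then show ?thesis by (rule stable_retract_projective) (rule TT_projective[OF that])
    qed
    ultimately show ?thesis by (intro conjI impI)
  qed
  show "projective Env Reg \<Longrightarrow> gl_dim A \<le> enat 0" unfolding gl_dim_le_iff using * by simp
  show "projective Env (Z i) \<Longrightarrow> gl_dim A \<le> enat (Suc i)" unfolding gl_dim_le_iff using * by (simp del: funpow.simps)
qed

text \<open>The radical inside the free module of rank one, so that the tensor functor attached to
  it is the product with A / J.\<close>

abbreviation "UJ \<equiv> {u \<in> carrier (free_module A {0::nat}). u 0 \<in> J}"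

lemma UJ_tensor: "tensor_functor K A {0::nat} UJ"
proof (intro tensor_functor.intro fd_algebra_axioms tensor_functor_axioms.intro)
  interpret Fr: left_module A "free_module A {0::nat}" by (rule A.free_left_module)
  show "submodule UJ A (free_module A {0::nat})"
    unfolding Fr.submodule_iff
    using ideal.I_l_closed[OF J_ideal] additive_subgroup.a_closed[OF ideal.axioms(1)[OF J_ideal]]
      additive_subgroup.zero_closed[OF ideal.axioms(1)[OF J_ideal]]
      Fr.M.zero_closed Fr.M.a_closed Fr.smult_closed
    by (auto simp: free_module_def direct_sum_simps)
qed simp

lemma lmod_Top:
  "carrier (quot_mod (lmod X) W) = carrier (quot_mod X W)" "add (quot_mod (lmod X) W) = add (quot_mod X W)"
  "zero (quot_mod (lmod X) W) = zero (quot_mod X W)"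
  "a \<odot>\<^bsub>quot_mod (lmod X) W\<^esub> C = tens a \<one>\<^bsub>A\<^esub> \<odot>\<^bsub>quot_mod X W\<^esub> C"
  by (simp_all add: quot_mod_simps A_RCOSETS_def' a_r_coset_def' set_add_defs set_mult_def fun_eq_iff)

text \<open>The product of \<open>X\<close> with A / J is X / X J: constant tuples and evaluation at
  the only index 0 respect the two systems of relations and exhibit the top as a retract.\<close>

lemma Top_projective:
  assumes X: "left_module Env X" and pr: "projective A (tensor_functor.TT K A {0::nat} UJ X)"
  shows "projective A (lmod (Top X))"
proof -
  interpret T: tensor_functor K A "{0::nat}" UJ by (rule UJ_tensor)
  have JA: "J \<subseteq> carrier A" using J_closed by blast
  interpret X: left_module A "lmod X" by (rule lmod_left_module[OF X])
  interpret QX: quotient_module A "lmod X" "RL X J"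
    by (intro quotient_moduleI X.left_module_axioms RL_submodule_left[OF X JA])
  interpret DX: quotient_module A "T.D X" "T.XU X" by (rule T.quotient[OF X])
  interpret XD: module_pair A "lmod X" "T.D X" by (intro module_pairI X.left_module_axioms T.D_left_module[OF X])
  interpret DX': module_pair A "T.D X" "lmod X" by (intro module_pairI X.left_module_axioms T.D_left_module[OF X])
  let ?s = "\<lambda>x. \<lambda>i\<in>{0::nat}. x"
  have s: "?s \<in> mod_hom A (lmod X) (T.D X)" by (rule mod_homI) (auto simp: T.D_simps intro!: restrict_ext)
  have e: "(\<lambda>f. f 0) \<in> mod_hom A (T.D X) (lmod X)" by (rule mod_homI) (auto simp: T.D_simps)
  have "RL X J \<subseteq> {x \<in> carrier (lmod X). ?s x \<in> T.XU X}"
  proof (rule RL_least[OF X XD.vimage_submodule[OF s DX.U]])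
    fix j x assume j: "j \<in> J" and x: "x \<in> carrier X"
    have "?s j \<in> UJ" using j J_closed[OF j] by (auto simp: T.Fr_simps)
    note in_XU = T.tp_in_XU[OF X x this]
    have "T.tp X x (?s j) = ?s (tens \<one>\<^bsub>A\<^esub> j \<odot>\<^bsub>X\<^esub> x)" unfolding T.tp_def by (rule restrict_ext) (simp only: restrict_apply if_True)
    with in_XU have 1: "?s (tens \<one>\<^bsub>A\<^esub> j \<odot>\<^bsub>X\<^esub> x) \<in> T.XU X" by (simp only:)
    have "tens \<one>\<^bsub>A\<^esub> j \<odot>\<^bsub>X\<^esub> x \<in> carrier (lmod X)" unfolding lmod_simps by (rule right_closed[OF X J_closed[OF j] x])
    from this 1 show "tens \<one>\<^bsub>A\<^esub> j \<odot>\<^bsub>X\<^esub> x \<in> {x \<in> carrier (lmod X). ?s x \<in> T.XU X}" by (intro CollectI conjI)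
  qed
  then have sU: "?s x \<in> T.XU X" if "x \<in> RL X J" for x using that by blast
  have "T.XU X \<subseteq> {f \<in> carrier (T.D X). f 0 \<in> RL X J}"
  proof (rule T.XU_least[OF X DX'.vimage_submodule[OF e QX.U]])
    fix x u assume x: "x \<in> carrier X" and u: "u \<in> UJ"
    have "u 0 \<in> J" using u by (elim CollectE conjE)
    then have "tens \<one>\<^bsub>A\<^esub> (u 0) \<odot>\<^bsub>X\<^esub> x \<in> RL X J" by (rule RL_gen[OF X _ x])
    then have "T.tp X x u 0 \<in> RL X J" by (simp only: T.tp_def restrict_apply singleton_iff simp_thms if_True)
    with T.tp_closed[OF X x T.U_closed[OF u]] show "T.tp X x u \<in> {f \<in> carrier (T.D X). f 0 \<in> RL X J}"
      by (intro CollectI conjI)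
  qed
  then have eU: "f 0 \<in> RL X J" if "f \<in> T.XU X" for f using that by blast
  obtain s' where s': "s' \<in> mod_hom A (quot_mod (lmod X) (RL X J)) (T.TT X)"
    "\<And>x. x \<in> carrier (lmod X) \<Longrightarrow> s' (QX.cls x) = DX.cls (?s x)"
    unfolding T.TT_def by (rule quot_map[OF X.left_module_axioms DX.left_module_axioms QX.U DX.U s sU]) (assumption, rule that[unfolded T.TT_def])
  obtain e' where e': "e' \<in> mod_hom A (T.TT X) (quot_mod (lmod X) (RL X J))"
    "\<And>f. f \<in> carrier (T.D X) \<Longrightarrow> e' (DX.cls f) = QX.cls (f 0)"
    unfolding T.TT_def by (rule quot_map[OF DX.left_module_axioms X.left_module_axioms DX.U QX.U e]) (rule eU, assumption, rule that[unfolded T.TT_def])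
  have "projective A (quot_mod (lmod X) (RL X J))"
  proof (rule projective_retract[OF QX.quot_left_module pr s'(1) e'(1)])
    fix C assume "C \<in> carrier (quot_mod (lmod X) (RL X J))"
    then obtain x where x: "x \<in> carrier (lmod X)" "C = QX.cls x" by (rule QX.quot_carrierE)
    show "e' (s' C) = C" unfolding x(2) s'(2)[OF x(1)] e'(2)[OF mod_homD(1)[OF s x(1)]] by simp
  qed
  then show ?thesis by (rule projective_cong) (simp_all only: lmod_simps lmod_Top)
qed

theorem projective_if_gl_dim_le:
  assumes sep: "separable K Eq"
  shows "gl_dim A \<le> enat 0 \<Longrightarrow> projective Env Reg"
    "gl_dim A \<le> enat (Suc i) \<Longrightarrow> projective Env (Z i)"
proof -
  interpret T: tensor_functor K A "{0::nat}" UJ by (rule UJ_tensor)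
  have Vfg: "fin_gen A T.TV"
    by (rule fin_gen_image[OF T.Fr.left_module_axioms T.V.quot_left_module T.V.cls_hom
          T.V.quot_carrier[symmetric] free_fin_gen[OF A_ring T.I]])
  \<comment> \<open>The bound on the global dimension is applied to a single module, A / J, moved to
    the carrier type over which \<open>gl_dim\<close> quantifies.\<close>
  from fin_gen_copy[OF T.V.quot_left_module Vfg]
  obtain M :: "('a, nat \<Rightarrow> 'a) module" and f g where M: "left_module A M" "fin_gen A M"
    and f: "f \<in> mod_hom A T.TV M" and g: "g \<in> mod_hom A M T.TV"
    and gf: "\<forall>x\<in>carrier T.TV. g (f x) = x" and fg: "\<forall>y\<in>carrier M. f (g y) = y"
    by (elim exE conjE)
  have "a_kernel T.Fr T.TV T.V.cls = UJ"
    unfolding a_kernel_def' T.V.quot_zero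
  proof (rule equalityI; rule subsetI)
    fix u assume "u \<in> {u \<in> carrier T.Fr. T.V.cls u = UJ}"
    then have "u \<in> carrier T.Fr \<and> T.V.cls u = UJ" by (rule CollectD)
    from conjunct1[OF this] conjunct2[OF this] show "u \<in> UJ" by (rule T.V.cls_eq_zero_iff[THEN iffD1])
  next
    fix u assume u: "u \<in> UJ"
    have c: "u \<in> carrier T.Fr" by (rule T.U_closed[OF u])
    from c T.V.cls_eq_zero_iff[OF c, THEN iffD2, OF u] show "u \<in> {u \<in> carrier T.Fr. T.V.cls u = UJ}"
      by (intro CollectI conjI)
  qed
  from T.TT_Reg_iso[OF T.V.quot_left_module T.V.cls_hom T.V.quot_carrier[symmetric] this]
  obtain F G where F: "F \<in> mod_hom A (T.TT Reg) T.TV" and G: "G \<in> mod_hom A T.TV (T.TT Reg)"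
    and GF: "\<forall>x\<in>carrier (T.TT Reg). G (F x) = x"
    by (elim exE conjE)
  note h = mod_hom_comp[OF F f] and h' = mod_hom_comp[OF g G]
  have h'h: "G (g (f (F x))) = x" if "x \<in> carrier (T.TT Reg)" for x
    by (rule trans[OF arg_cong[of _ _ G, OF gf[rule_format, OF mod_homD(1)[OF F that]]] GF[rule_format, OF that]])
  show "projective Env Reg" if "gl_dim A \<le> enat 0"
  proof -
    have "projective A ((syzygy A ^^ 0) M)" by (rule that[unfolded gl_dim_le_iff, rule_format, OF conjI[OF M]])
    then have "projective A M" by (simp only: funpow.simps(1) id_apply)
    have "projective A (T.TT Reg)"
      by (rule projective_retract[OF T.TT_left_module[OF Reg_left_module] \<open>projective A M\<close> h h']) (rule h'h)
    then show ?thesis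
      by (intro bimodule_projective sep Reg_left_module Reg_fin_gen rmod_Reg_projective Top_projective)
  qed
  show "projective Env (Z i)" if "gl_dim A \<le> enat (Suc i)"
  proof -
    have pr: "projective A ((syzygy A ^^ Suc i) M)" by (rule that[unfolded gl_dim_le_iff, rule_format, OF conjI[OF M]])
    from T.TT_retract_syzygy[OF M h h' h'h] obtain W :: "('a, (nat \<Rightarrow> nat \<Rightarrow> ('a \<times> 'a \<Rightarrow> 'k) set) set) module"
      where "stable_retract A (T.TT (Z i)) ((syzygy A ^^ Suc i) M) W" by (rule exE)
    then have "projective A (T.TT (Z i))" using pr by (rule stable_retract_projective)
    then show ?thesis
      by (intro bimodule_projective sep Z_module Z_right_projective Top_projective)
  qed
qed

text \<open>The \<open>n\<close>-th translate vanishes exactly if the bimodule syzygy of order n - 1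
  is projective, which is the bound n - 1 on the global dimension. That syzygy is \<open>Reg\<close>
  for n = 1 and \<open>Z i\<close> for n = i + 2.\<close>

lemma bimod_tau_trivial_iff:
  assumes sep: "separable K Eq" and n: "n \<ge> 1"
  shows "carrier (bimod_tau K A n) = {\<zero>\<^bsub>bimod_tau K A n\<^esub>} \<longleftrightarrow> gl_dim A < enat n"
proof -
  note H = fd_algebra.higher_ar_translate_module(3)[OF Env_fd_algebra Reg_left_module Reg_fin_gen n, folded bimod_tau_def Z_def]
  consider "n = 1" | i where "n = Suc (Suc i)" using n by (metis One_nat_def not0_implies_Suc not_one_le_zero)
  then show ?thesis
  proof cases
    case 1
    then have "carrier (bimod_tau K A n) = {\<zero>\<^bsub>bimod_tau K A n\<^esub>} \<longleftrightarrow> gl_dim A \<le> enat 0"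
      unfolding H using gl_dim_le_if_projective(1) projective_if_gl_dim_le(1)[OF sep] by auto
    then show ?thesis using 1 by (cases "gl_dim A") auto
  next
    case 2
    then have "carrier (bimod_tau K A n) = {\<zero>\<^bsub>bimod_tau K A n\<^esub>} \<longleftrightarrow> gl_dim A \<le> enat (Suc i)"
      unfolding H using gl_dim_le_if_projective(2) projective_if_gl_dim_le(2)[OF sep] by auto
    then show ?thesis using 2 by (cases "gl_dim A") auto
  qed
qed

text \<open>Every single translate is finite-dimensional over \<open>K\<close>, so only the number
  of nonzero summands matters.\<close>

lemma bimod_tau_sum_finite_iff:
  "vdim K (scalar_restr Env (direct_sum {1..} (bimod_tau K A))) < \<infinity> \<longleftrightarrow>
    finite {n \<in> {1..}. carrier (bimod_tau K A n) \<noteq> {\<zero>\<^bsub>bimod_tau K A n\<^esub>}}"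
proof -
  interpret Ev: fd_algebra K Env by (rule Env_fd_algebra)
  interpret field K by (rule K)
  note H = Ev.higher_ar_translate_module(1,2)[OF Reg_left_module Reg_fin_gen, folded bimod_tau_def]
  have V: "left_module K (scalar_restr Env (bimod_tau K A n))" if "n \<in> {1..}" for n
    using that by (intro Ev.scalar_module H) simp
  have fgV: "fin_gen K (scalar_restr Env (bimod_tau K A n))" if "n \<in> {1..}" for n
    using that by (intro H) simp
  have S: "left_module K (direct_sum {1..} (\<lambda>n. scalar_restr Env (bimod_tau K A n)))"
    by (rule module_family.left_module[OF module_familyI[OF ring_axioms V]])
  show ?thesis
    unfolding Ev.scalar_restr_direct_sum vdim_finite_iff[OF S]
    using direct_sum_fin_gen_iff[OF ring_axioms, of "{1..}" "\<lambda>n. scalar_restr Env (bimod_tau K A n)"] V fgV by simp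
qed

end

theorem proposition7p1:
  fixes K :: "'k ring" and \<Lambda> :: "('k, 'a) module"
  assumes "field K"
    and "assoc_algebra K \<Lambda>"
    and "vdim K \<Lambda> < \<infinity>"
    and "separable K (quot_mod \<Lambda> (jacobson_radical \<Lambda>))"
  shows "(vdim K (scalar_restr (enveloping K \<Lambda>) (direct_sum {1..} (bimod_tau K \<Lambda>))) < \<infinity>
            \<longleftrightarrow> gl_dim \<Lambda> < \<infinity>) \<and>
         (gl_dim \<Lambda> < \<infinity> \<longrightarrow>
            (\<forall>n\<ge>1. carrier (bimod_tau K \<Lambda> n) = {\<zero>\<^bsub>bimod_tau K \<Lambda> n\<^esub>} \<longleftrightarrow> gl_dim \<Lambda> < enat n))"
proof -
  have "fin_gen K \<Lambda>"
    using vdim_finite_iff[OF assoc_algebra_left_module[OF assms(2)]] assms(3) by simp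
  then interpret fd_algebra K \<Lambda> using assms(1,2) by (intro fd_algebra.intro)
  note tau = bimod_tau_trivial_iff[OF assms(4)[folded J_def]]
  \<comment> \<open>The nonzero translates are exactly those of index 1 up to the global dimension,
    an initial segment that is finite if and only if the global dimension is.\<close>
  have "{n \<in> {1..}. carrier (bimod_tau K \<Lambda> n) \<noteq> {\<zero>\<^bsub>bimod_tau K \<Lambda> n\<^esub>}} = {n \<in> {1..}. enat n \<le> gl_dim \<Lambda>}"
    using tau by (intro Collect_cong conj_cong refl) (simp add: not_less[symmetric])
  moreover have "finite {n \<in> {1..}. enat n \<le> gl_dim \<Lambda>} \<longleftrightarrow> gl_dim \<Lambda> < \<infinity>"
  proof (cases "gl_dim \<Lambda>")
    case (enat d)
    then have "{n \<in> {1..}. enat n \<le> gl_dim \<Lambda>} \<subseteq> {..d}" by auto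
    then show ?thesis using enat finite_subset by auto
  next
    case infinity
    then show ?thesis using infinite_Ici by (simp add: atLeast_def)
  qed
  ultimately show ?thesis unfolding bimod_tau_sum_finite_iff using tau by simp
qed

end
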